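(* Let $L,H>0$, $D=\mathbb T_L\times(0,H)$, and $1<p<\infty$. Consider the shear flow in $D$ with stream function $$\bar\psi(x_1,x_2)=a\sin(mx_2+\alpha)+bx_2+c,\qquad a,b,c,m,\alpha\in\mathbb R,$$ and let $\bar\omega:=-\Delta\bar\psi$. If $m^2\le\Lambda_1$, then the shear flow is stable in the following sense: for any $\varepsilon>0$ there exists $\delta>0$ such that for any sufficiently smooth Euler flow in $D$ with vorticity $\omega(t,\mathbf x)$, $$\|\omega(0,\cdot)-\bar\omega\|_{L^p(D)}<\delta\quad\Longrightarrow\quad\|\omega(t,\cdot)-\bar\omega\|_{L^p(D)}<\varepsilon\quad\forall\,t\in\mathbb R.$$
   Context: $\mathbb T_L=\mathbb R/L\mathbb Z$, $D=\mathbb T_L\times(0,H)$ is a periodic channel with coordinates $\mathbf x=(x_1,x_2)$, $\bar D=\mathbb T_L\times[0,H]$. Euler flow: a solution, defined for all $t\in\mathbb R$, of $\partial_t\mathbf v+(\mathbf v\cdot\nabla)\mathbf v=-\nabla P$, $\nabla\cdot\mathbf v=0$ in $D$, with $v_2=0$ on $\{x_2=0\}\cup\{x_2=H\}$, where $\mathbf v=(v_1,v_2)$ and $P$ are functions on $\mathbb R\times D$ (so periodic in $x_1$). "Sufficiently smooth" means a classical solution, e.g. $\mathbf v\in C^2(\mathbb R\times\bar D)$, $P\in C^1(\mathbb R\times\bar D)$. Its vorticity is $\omega=\partial_{x_1}v_2-\partial_{x_2}v_1$. The flow with stream function $\psi$ has velocity $\nabla^\perp\psi=(\partial_{x_2}\psi,-\partial_{x_1}\psi)$.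 $\Lambda_1$ is the first (smallest) eigenvalue of the problem $$-\Delta u=\Lambda u\ \text{ in } D,\qquad u|_{x_2=0}=u|_{x_2=H}=\text{constant},\qquad \int_Du\,d\mathbf x=0$$ (the constant is not prescribed but is the same on both boundary components). Explicitly, $\Lambda_1=\min\{\frac{4\pi^2}{H^2},\frac{4\pi^2}{L^2}+\frac{\pi^2}{H^2}\}$. *)

theory Defs
  imports "HOL-Analysis.Analysis"
begin

text \<open>
  Functions on the periodic channel are represented by functions on
  \<^typ>\<open>real \<times> real\<close> that are \<open>L\<close>-periodic in the first coordinate. Only their values
  on the closed strip \<open>\<real> \<times> [0,H]\<close> matter; integrals over the channel are taken over
  one period.
\<close>

definition strip :: "real \<Rightarrow> (real \<times> real) set" where
  "strip H = UNIV \<times> {0<..<H}"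

definition closed_strip :: "real \<Rightarrow> (real \<times> real) set" where
  "closed_strip H = UNIV \<times> {0..H}"

definition period_cell :: "real \<Rightarrow> real \<Rightarrow> (real \<times> real) set" where
  "period_cell L H = {0..<L} \<times> {0<..<H}"

definition channel_periodic :: "real \<Rightarrow> real \<Rightarrow> (real \<times> real \<Rightarrow> 'a) \<Rightarrow> bool" where
  "channel_periodic L H f \<longleftrightarrow>
     (\<forall>x1 x2. 0 \<le> x2 \<and> x2 \<le> H \<longrightarrow> f (x1 + L, x2) = f (x1, x2))"

text \<open>
  Smoothness up to the boundary. The derivative within a convex set with nonempty interior
  is unique, and on such a set this agrees with requiring the interior derivatives to extend
  continuously to the boundary.
\<close>

definition C1_on ::
  "'a::real_normed_vector set \<Rightarrow> ('a \<Rightarrow> 'b::real_normed_vector) \<Rightarrow> bool" where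
  "C1_on S f \<longleftrightarrow> (\<exists>f' :: 'a \<Rightarrow> 'a \<Rightarrow>\<^sub>L 'b.
     (\<forall>x\<in>S. (f has_derivative blinfun_apply (f' x)) (at x within S)) \<and> continuous_on S f')"

definition C2_on ::
  "'a::real_normed_vector set \<Rightarrow> ('a \<Rightarrow> 'b::real_normed_vector) \<Rightarrow> bool" where
  "C2_on S f \<longleftrightarrow> (\<exists>f' :: 'a \<Rightarrow> 'a \<Rightarrow>\<^sub>L 'b.
     (\<forall>x\<in>S. (f has_derivative blinfun_apply (f' x)) (at x within S)) \<and> C1_on S f')"

text \<open>Classical two-sided partial derivatives; they are only used in the open strip.\<close>

definition pd1 :: "(real \<times> real \<Rightarrow> real) \<Rightarrow> real \<times> real \<Rightarrow> real" where
  "pd1 f x = deriv (\<lambda>s. f (s, snd x)) (fst x)"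

definition pd2 :: "(real \<times> real \<Rightarrow> real) \<Rightarrow> real \<times> real \<Rightarrow> real" where
  "pd2 f x = deriv (\<lambda>s. f (fst x, s)) (snd x)"

definition laplacian :: "(real \<times> real \<Rightarrow> real) \<Rightarrow> real \<times> real \<Rightarrow> real" where
  "laplacian f x = pd1 (pd1 f) x + pd2 (pd2 f) x"

definition vorticity :: "(real \<times> real \<Rightarrow> real \<times> real) \<Rightarrow> real \<times> real \<Rightarrow> real" where
  "vorticity v x = pd1 (\<lambda>y. snd (v y)) x - pd2 (\<lambda>y. fst (v y)) x"

definition euler_flow ::
  "real \<Rightarrow> real \<Rightarrow> (real \<Rightarrow> real \<times> real \<Rightarrow> real \<times> real) \<Rightarrow> (real \<Rightarrow> real \<times> real \<Rightarrow> real) \<Rightarrow> bool"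
where
  "euler_flow L H v P \<longleftrightarrow>
     C2_on (UNIV \<times> closed_strip H) (\<lambda>(t, x). v t x) \<and>
     C1_on (UNIV \<times> closed_strip H) (\<lambda>(t, x). P t x) \<and>
     (\<forall>t. channel_periodic L H (v t) \<and> channel_periodic L H (P t)) \<and>
     (\<forall>t. \<forall>x\<in>strip H.
        deriv (\<lambda>s. fst (v s x)) t
          + fst (v t x) * pd1 (\<lambda>y. fst (v t y)) x
          + snd (v t x) * pd2 (\<lambda>y. fst (v t y)) x = - pd1 (P t) x \<and>
        deriv (\<lambda>s. snd (v s x)) t
          + fst (v t x) * pd1 (\<lambda>y. snd (v t y)) x
          + snd (v t x) * pd2 (\<lambda>y. snd (v t y)) x = - pd2 (P t) x \<and>
        pd1 (\<lambda>y. fst (v t y)) x + pd2 (\<lambda>y. snd (v t y)) x = 0) \<and>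
     (\<forall>t x1. snd (v t (x1, 0)) = 0 \<and> snd (v t (x1, H)) = 0)"

text \<open>
  For \<open>1 < p < \<infinity>\<close>. It is applied only to functions that are continuous and bounded on the
  period cell, so the Bochner integral is a genuine one.
\<close>

definition Lp_norm :: "real \<Rightarrow> real \<Rightarrow> real \<Rightarrow> (real \<times> real \<Rightarrow> real) \<Rightarrow> real" where
  "Lp_norm L H p f =
     (set_lebesgue_integral lborel (period_cell L H) (\<lambda>x. \<bar>f x\<bar> powr p)) powr (1 / p)"

text \<open>The boundary constant \<open>c\<close> is free but common to both boundary components.\<close>

definition channel_eigenvalue :: "real \<Rightarrow> real \<Rightarrow> real \<Rightarrow> bool" where
  "channel_eigenvalue L H \<Lambda> \<longleftrightarrow> (\<exists>u :: real \<times> real \<Rightarrow> real.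
     C2_on (closed_strip H) u \<and> channel_periodic L H u \<and>
     (\<exists>x\<in>closed_strip H. u x \<noteq> 0) \<and>
     (\<forall>x\<in>strip H. - laplacian u x = \<Lambda> * u x) \<and>
     (\<exists>c. \<forall>x1. u (x1, 0) = c \<and> u (x1, H) = c) \<and>
     set_lebesgue_integral lborel (period_cell L H) u = 0)"

text \<open>
  For \<open>L, H > 0\<close> the set of eigenvalues is nonempty and bounded below and its infimum is
  attained, so this is the smallest eigenvalue.
\<close>

definition first_eigenvalue :: "real \<Rightarrow> real \<Rightarrow> real" where
  "first_eigenvalue L H = Inf {\<Lambda>. channel_eigenvalue L H \<Lambda>}"

definition shear_stream ::
  "real \<Rightarrow> real \<Rightarrow> real \<Rightarrow> real \<Rightarrow> real \<Rightarrow> real \<times> real \<Rightarrow> real" where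
  "shear_stream a b c m \<alpha> x = a * sin (m * snd x + \<alpha>) + b * snd x + c"

end

theory Submission
  imports Defs
begin

text \<open>
  Write \<open>\<omega>bar = A sin (m y + \<alpha>)\<close> with \<open>A = a m\<^sup>2\<close>. Energy, momentum, impulse and all Casimirs
  \<open>\<integral> F(\<omega>)\<close> are conserved. Truncating the vorticity to \<open>[-\<bar>A\<bar>, \<bar>A\<bar>]\<close> gives a bounded \<open>\<theta>\<close> whose
  \<open>L\<^sup>p\<close> distance to \<open>\<omega>\<close> is conserved and never exceeds the initial distance of \<open>\<omega>\<close> to \<open>\<omega>bar\<close>, so it
  suffices to control \<open>\<eta> = \<theta> - \<omega>bar\<close> in \<open>L\<^sup>2\<close>; no flow map is needed. With \<open>\<phi>\<close> the zero-flux stream function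
  of the perturbation, energy and the quadratic Casimir give \<open>\<integral> \<eta>\<^sup>2 \<le> m\<^sup>2 \<integral> \<bar>\<nabla>\<phi>\<bar>\<^sup>2 + O(\<delta>)\<close>, while
  \<open>\<integral> \<bar>\<nabla>\<phi>\<bar>\<^sup>2 = \<integral> \<phi> \<eta> + O(\<delta>)\<close>. Since \<open>m\<^sup>2 \<le> \<Lambda>\<^sub>1\<close>, a spectral gap above the lowest modes forces \<open>\<eta>\<close> to be
  close to a combination of \<open>cos (2\<pi>y/H)\<close>, \<open>sin (2\<pi>y/H)\<close> and \<open>sin (\<pi>y/H)\<close> times \<open>cos\<close> or \<open>sin\<close> of \<open>2\<pi>x/L\<close>.
  If \<open>m\<^sup>2 < (2\<pi>/H)\<^sup>2\<close> only the last two occur and the second moment of \<open>\<theta>\<close> excludes them. If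
  \<open>m\<^sup>2 = (2\<pi>/H)\<^sup>2\<close>, the impulse fixes the coefficient of \<open>sin (2\<pi>y/H)\<close>, and the second and third moments of \<open>\<theta>\<close>
  leave three separated values \<open>0, \<plusminus>\<beta>\<close> for the coefficient of \<open>cos (2\<pi>y/H)\<close>, between which it cannot
  jump because it is continuous in time.
\<close>

subsection \<open>Orthogonal systems and cosine polynomials\<close>

text \<open>Since \<open>p\<close> may be below 2, a small initial perturbation in
  \<open>L^p\<close> says nothing about the quadratic Casimir of the vorticity itself. The second
  and third moments are therefore those of the truncation. The remainder is small only in
  \<open>L^p\<close> and is felt through its pairing with the stream function; in two dimensions the
  Dirichlet energy bounds every even power norm of that function, which suffices for any
  \<open>p > 1\<close>. A further obstacle is that the vorticity does not determine the mean
  current: the flux through a vertical section is the same everywhere and at all times, so a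
  constant added to the reference velocity removes it. In the one-dimensional gap inequalities the 4
  is the ratio of the second eigenvalue to the first, and \<open>6 / l\<close> is
  \<open>4 - 1 = 3\<close> times \<open>2 / l\<close>, the reciprocal of the squared norm of a mode.
  In the critical case the cubic moment is decisive because
  \<open>sin(pi y/H)^2 = (1 - cos(2 pi y/H)) / 2\<close> couples the cosine mode with the mixed
  modes.\<close>

lemma integral_diff_mult_continuous:
  fixes f g u :: "'a::euclidean_space \<Rightarrow> real"
  assumes "continuous_on (cbox a b) f" "continuous_on (cbox a b) g" "continuous_on (cbox a b) u"
  shows "integral (cbox a b) (\<lambda>x. (f x - k * g x) * u x) =
    integral (cbox a b) (\<lambda>x. f x * u x) - k * integral (cbox a b) (\<lambda>x. g x * u x)"
proof -
  have "integral (cbox a b) (\<lambda>x. (f x - k * g x) * u x) =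
      integral (cbox a b) (\<lambda>x. f x * u x - k * (g x * u x))"
    by (simp add: algebra_simps)
  also have "\<dots> = integral (cbox a b) (\<lambda>x. f x * u x) - integral (cbox a b) (\<lambda>x. k * (g x * u x))"
    by (intro integral_diff integrable_continuous continuous_intros assms)
  finally show ?thesis by simp
qed

text \<open>Pythagoras with arbitrary coefficients \<open>k\<close>; the last sum measures their
  distance from the Fourier coefficients. Keeping \<open>k\<close> free lets one identity serve both
  Bessel, where \<open>k\<close> is optimal, and its converse, where \<open>k\<close> comes from a
  uniform approximation.\<close>

lemma orthogonal_expansion_defect:
  fixes f :: "'a::euclidean_space \<Rightarrow> real" and e :: "'i \<Rightarrow> 'a \<Rightarrow> real"
  assumes "finite S" and "continuous_on (cbox a b) f"
    and "\<And>i. i \<in> S \<Longrightarrow> continuous_on (cbox a b) (e i)"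
    and "\<And>i j. i \<in> S \<Longrightarrow> j \<in> S \<Longrightarrow> i \<noteq> j \<Longrightarrow> integral (cbox a b) (\<lambda>x. e i x * e j x) = 0"
    and "\<And>i. i \<in> S \<Longrightarrow> integral (cbox a b) (\<lambda>x. e i x * e i x) = h i"
    and "\<And>i. i \<in> S \<Longrightarrow> h i > 0"
  shows "integral (cbox a b) (\<lambda>x. (f x - (\<Sum>i\<in>S. k i * e i x))\<^sup>2) =
    integral (cbox a b) (\<lambda>x. (f x)\<^sup>2)
      - (\<Sum>i\<in>S. (integral (cbox a b) (\<lambda>x. f x * e i x))\<^sup>2 / h i)
      + (\<Sum>i\<in>S. h i * (k i - integral (cbox a b) (\<lambda>x. f x * e i x) / h i)\<^sup>2)"
  using assms
proof (induction S arbitrary: f rule: finite_induct)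
  case empty
  then show ?case by simp
next
  case (insert i S)
  let ?I = "integral (cbox a b)"
  define g where "g x = f x - k i * e i x" for x
  have ci: "continuous_on (cbox a b) (e i)" and cf: "continuous_on (cbox a b) f"
    using insert.prems by auto
  have cg: "continuous_on (cbox a b) g"
    unfolding g_def by (intro continuous_intros ci cf)
  have IH: "?I (\<lambda>x. (g x - (\<Sum>i\<in>S. k i * e i x))\<^sup>2) =
    ?I (\<lambda>x. (g x)\<^sup>2) - (\<Sum>i\<in>S. (?I (\<lambda>x. g x * e i x))\<^sup>2 / h i)
      + (\<Sum>i\<in>S. h i * (k i - ?I (\<lambda>x. g x * e i x) / h i)\<^sup>2)"
    using insert.prems by (intro insert.IH cg) auto
  \<comment> \<open>Orthogonality to \<open>e i\<close> leaves the remaining coefficients unchanged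
    when \<open>k i * e i\<close> is removed, so the induction hypothesis for \<open>g\<close>
    speaks about \<open>f\<close>.\<close>
  have gj: "?I (\<lambda>x. g x * e j x) = ?I (\<lambda>x. f x * e j x)" if "j \<in> S" for j
    unfolding g_def using insert.prems that insert.hyps
    by (subst integral_diff_mult_continuous) auto
  have hi: "?I (\<lambda>x. e i x * e i x) = h i" "h i > 0"
    using insert.prems by auto
  have "?I (\<lambda>x. (g x)\<^sup>2) = ?I (\<lambda>x. (f x - k i * e i x) * g x)"
    by (simp add: g_def power2_eq_square)
  also have "\<dots> = ?I (\<lambda>x. g x * f x) - k i * ?I (\<lambda>x. g x * e i x)"
    by (subst integral_diff_mult_continuous) (use cf ci cg in \<open>auto simp: mult.commute\<close>)
  also have "?I (\<lambda>x. g x * f x) = ?I (\<lambda>x. f x * f x) - k i * ?I (\<lambda>x. f x * e i x)"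
    unfolding g_def
    by (subst integral_diff_mult_continuous) (use cf ci in \<open>auto simp: mult.commute\<close>)
  also have "?I (\<lambda>x. g x * e i x) = ?I (\<lambda>x. f x * e i x) - k i * h i"
    unfolding g_def
    by (subst integral_diff_mult_continuous) (use cf ci hi in \<open>auto simp: mult.commute\<close>)
  also have "?I (\<lambda>x. f x * f x) - k i * ?I (\<lambda>x. f x * e i x)
      - k i * (?I (\<lambda>x. f x * e i x) - k i * h i) = ?I (\<lambda>x. (f x)\<^sup>2)
     - (?I (\<lambda>x. f x * e i x))\<^sup>2 / h i + h i * (k i - ?I (\<lambda>x. f x * e i x) / h i)\<^sup>2"
    using hi(2) by (simp add: field_simps power2_eq_square)
  finally have g2: "?I (\<lambda>x. (g x)\<^sup>2) = \<dots>" .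
  have "?I (\<lambda>x. (f x - (\<Sum>i\<in>insert i S. k i * e i x))\<^sup>2) = ?I (\<lambda>x. (g x - (\<Sum>i\<in>S. k i * e i x))\<^sup>2)"
    using insert.hyps by (simp add: g_def algebra_simps)
  then show ?case
    using insert.hyps by (simp add: IH gj g2)
qed

lemma bessel_inequality:
  fixes f :: "'a::euclidean_space \<Rightarrow> real" and e :: "'i \<Rightarrow> 'a \<Rightarrow> real"
  assumes "finite S" and "continuous_on (cbox a b) f"
    and "\<And>i. i \<in> S \<Longrightarrow> continuous_on (cbox a b) (e i)"
    and "\<And>i j. i \<in> S \<Longrightarrow> j \<in> S \<Longrightarrow> i \<noteq> j \<Longrightarrow> integral (cbox a b) (\<lambda>x. e i x * e j x) = 0"
    and "\<And>i. i \<in> S \<Longrightarrow> integral (cbox a b) (\<lambda>x. e i x * e i x) = h i"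
    and "\<And>i. i \<in> S \<Longrightarrow> h i > 0"
  shows "(\<Sum>i\<in>S. (integral (cbox a b) (\<lambda>x. f x * e i x))\<^sup>2 / h i)
     \<le> integral (cbox a b) (\<lambda>x. (f x)\<^sup>2)"
proof -
  let ?k = "\<lambda>i. integral (cbox a b) (\<lambda>x. f x * e i x) / h i"
  have "0 \<le> integral (cbox a b) (\<lambda>x. (f x - (\<Sum>i\<in>S. ?k i * e i x))\<^sup>2)"
    by (intro integral_nonneg integrable_continuous continuous_intros assms) auto
  also have "\<dots> = integral (cbox a b) (\<lambda>x. (f x)\<^sup>2)
      - (\<Sum>i\<in>S. (integral (cbox a b) (\<lambda>x. f x * e i x))\<^sup>2 / h i)"
    by (subst orthogonal_expansion_defect[OF assms]) auto
  finally show ?thesis by simp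
qed

text \<open>Stands in for Parseval: in mean square the Fourier coefficients do at least as well as
  the coefficients of any uniform approximation, so convergence of Fourier series never has to be
  discussed.\<close>

lemma reverse_bessel:
  fixes f :: "'a::euclidean_space \<Rightarrow> real" and e :: "'i \<Rightarrow> 'a \<Rightarrow> real"
  assumes "finite S" and "continuous_on (cbox a b) f"
    and "\<And>i. i \<in> S \<Longrightarrow> continuous_on (cbox a b) (e i)"
    and "\<And>i j. i \<in> S \<Longrightarrow> j \<in> S \<Longrightarrow> i \<noteq> j \<Longrightarrow> integral (cbox a b) (\<lambda>x. e i x * e j x) = 0"
    and "\<And>i. i \<in> S \<Longrightarrow> integral (cbox a b) (\<lambda>x. e i x * e i x) = h i"
    and "\<And>i. i \<in> S \<Longrightarrow> h i > 0"
    and "\<And>x. x \<in> cbox a b \<Longrightarrow> \<bar>f x - (\<Sum>i\<in>S. k i * e i x)\<bar> \<le> \<epsilon>"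
  shows "integral (cbox a b) (\<lambda>x. (f x)\<^sup>2)
     \<le> (\<Sum>i\<in>S. (integral (cbox a b) (\<lambda>x. f x * e i x))\<^sup>2 / h i) + \<epsilon>\<^sup>2 * measure lborel (cbox a b)"
proof -
  have "integral (cbox a b) (\<lambda>x. (f x - (\<Sum>i\<in>S. k i * e i x))\<^sup>2) \<le> integral (cbox a b) (\<lambda>x. \<epsilon>\<^sup>2)"
  proof (intro integral_le integrable_continuous continuous_intros assms)
    show "(f x - (\<Sum>i\<in>S. k i * e i x))\<^sup>2 \<le> \<epsilon>\<^sup>2" if "x \<in> cbox a b" for x
      using assms(7)[OF that] by (metis abs_ge_zero power2_abs power_mono)
  qed
  moreover have "0 \<le> (\<Sum>i\<in>S. h i * (k i - integral (cbox a b) (\<lambda>x. f x * e i x) / h i)\<^sup>2)"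
    by (intro sum_nonneg mult_nonneg_nonneg zero_le_power2) (use assms(6) less_imp_le in auto)
  ultimately show ?thesis
    by (subst (asm) orthogonal_expansion_defect[OF assms(1-6)]) (auto simp: mult.commute)
qed

section \<open>Density of cosine polynomials on an interval\<close>

definition cos_polynomial :: "(real \<Rightarrow> real) \<Rightarrow> bool" where
  "cos_polynomial g \<longleftrightarrow> (\<exists>N c. \<forall>\<theta>. g \<theta> = (\<Sum>n\<le>N. c n * cos (real n * \<theta>)))"

lemma cos_polynomial_cos: "cos_polynomial (\<lambda>\<theta>. k * cos (real n * \<theta>))"
  unfolding cos_polynomial_def
proof (intro exI allI)
  show "k * cos (real n * \<theta>) = (\<Sum>i\<le>n. (if i = n then k else 0) * cos (real i * \<theta>))" for \<theta>
    by (simp add: if_distrib if_distribR cong: if_cong)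
qed

lemma cos_polynomial_add:
  assumes "cos_polynomial f" "cos_polynomial g"
  shows "cos_polynomial (\<lambda>\<theta>. f \<theta> + g \<theta>)"
proof -
  obtain N c where f: "\<And>\<theta>. f \<theta> = (\<Sum>n\<le>N. c n * cos (real n * \<theta>))"
    using assms(1) unfolding cos_polynomial_def by blast
  obtain M d where g: "\<And>\<theta>. g \<theta> = (\<Sum>n\<le>M. d n * cos (real n * \<theta>))"
    using assms(2) unfolding cos_polynomial_def by blast
  have pad: "(\<Sum>n\<le>max N M. (if n \<le> K then c n else 0) * cos (real n * \<theta>))
     = (\<Sum>n\<le>K. c n * cos (real n * \<theta>))" if "K \<le> max N M" for K \<theta> and c :: "nat \<Rightarrow> real"
    using that by (intro sum.mono_neutral_cong_right) auto
  show ?thesis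
    unfolding cos_polynomial_def
  proof (intro exI allI)
    show "f \<theta> + g \<theta> = (\<Sum>n\<le>max N M. ((if n \<le> N then c n else 0) + (if n \<le> M then d n else 0))
        * cos (real n * \<theta>))" for \<theta>
      unfolding distrib_right sum.distrib by (simp add: pad f g)
  qed
qed

lemma cos_polynomial_sum:
  assumes "finite S" "\<And>i. i \<in> S \<Longrightarrow> cos_polynomial (f i)"
  shows "cos_polynomial (\<lambda>\<theta>. \<Sum>i\<in>S. f i \<theta>)"
  using assms
proof (induction S rule: finite_induct)
  case empty
  then show ?case using cos_polynomial_cos[of 0 0] by simp
next
  case (insert i S)
  then show ?case by (simp add: cos_polynomial_add)
qed

lemma cos_polynomial_times_cos:
  assumes "cos_polynomial g"
  shows "cos_polynomial (\<lambda>\<theta>. k * (cos \<theta> * g \<theta>))"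
proof -
  obtain N c where g: "\<And>\<theta>. g \<theta> = (\<Sum>n\<le>N. c n * cos (real n * \<theta>))"
    using assms unfolding cos_polynomial_def by blast
  have *: "cos_polynomial (\<lambda>\<theta>. k * (cos \<theta> * (c n * cos (real n * \<theta>))))" for n
  \<comment> \<open>The product formula produces the frequencies \<open>n + 1\<close> and
    \<open>n - 1\<close>, so \<open>n = 0\<close> is treated apart.\<close>
  proof (cases n)
    case 0
    then show ?thesis
      using cos_polynomial_cos[of "k * c n" 1] by (simp add: mult_ac)
  next
    case (Suc m)
    have "k * (cos \<theta> * (c n * cos (real n * \<theta>)))
        = (k * c n / 2) * cos (real (n + 1) * \<theta>) + (k * c n / 2) * cos (real m * \<theta>)" for \<theta>
    proof -
      have "cos \<theta> * cos (real n * \<theta>) = (cos (real (n + 1) * \<theta>) + cos (real m * \<theta>)) / 2"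
        using cos_times_cos[of "real n * \<theta>" \<theta>] Suc by (simp add: algebra_simps)
      then have "k * c n * (cos \<theta> * cos (real n * \<theta>))
          = k * c n * ((cos (real (n + 1) * \<theta>) + cos (real m * \<theta>)) / 2)"
        by simp
      then show ?thesis
        by (simp add: algebra_simps add_divide_distrib)
    qed
    then show ?thesis
      by (simp only:) (intro cos_polynomial_add cos_polynomial_cos)
  qed
  have "k * (cos \<theta> * g \<theta>) = (\<Sum>n\<le>N. k * (cos \<theta> * (c n * cos (real n * \<theta>))))" for \<theta>
    by (simp add: g sum_distrib_left)
  then show ?thesis
    by (simp only:) (intro cos_polynomial_sum *, auto)
qed

lemma cos_polynomial_power: "cos_polynomial (\<lambda>\<theta>. k * cos \<theta> ^ n)"
proof (induction n arbitrary: k)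
  case 0
  then show ?case using cos_polynomial_cos[of k 0] by simp
next
  case (Suc n)
  then show ?case using cos_polynomial_times_cos[OF Suc[of 1], of k] by simp
qed

text \<open>Weierstrass in the variable \<open>cos (pi / l * y)\<close>: through
  \<open>arccos\<close> a continuous function on \<open>{0..l}\<close> becomes one on
  \<open>{-1..1}\<close>, and a polynomial in a cosine is again a finite cosine sum. The values of
  \<open>f\<close> at the end points are arbitrary.\<close>

lemma cos_polynomial_dense:
  fixes f :: "real \<Rightarrow> real"
  assumes l: "l > 0" and f: "continuous_on {0..l} f" and e: "\<epsilon> > 0"
  obtains N c where "\<And>y. y \<in> {0..l} \<Longrightarrow> \<bar>f y - (\<Sum>n\<le>N. c n * cos (real n * (pi / l * y)))\<bar> \<le> \<epsilon>"
proof -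
  have sub: "l / pi * arccos x \<in> {0..l}" if "x \<in> {-1..1}" for x
    using arccos_lbound[of x] arccos_ubound[of x] that l by (auto simp: field_simps)
  have c: "continuous_on {-1..1} (\<lambda>x. f (l / pi * arccos x))"
    by (rule continuous_on_compose2[OF f]) (use sub in \<open>auto intro!: continuous_intros continuous_on_arccos\<close>)
  obtain g where g: "real_polynomial_function g"
      "\<And>x. x \<in> {-1..1} \<Longrightarrow> \<bar>f (l / pi * arccos x) - g x\<bar> < \<epsilon>"
    using Stone_Weierstrass_real_polynomial_function[OF compact_Icc c e] by metis
  obtain a n where a: "g = (\<lambda>x. \<Sum>i\<le>n. a i * x ^ i)"
    using g(1) real_polynomial_function_iff_sum by metis
  have "cos_polynomial (\<lambda>\<theta>. g (cos \<theta>))"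
    unfolding a by (intro cos_polynomial_sum cos_polynomial_power) auto
  then obtain N c where N: "\<And>\<theta>. g (cos \<theta>) = (\<Sum>n\<le>N. c n * cos (real n * \<theta>))"
    unfolding cos_polynomial_def by blast
  show thesis
  proof (rule that)
    fix y assume y: "y \<in> {0..l}"
    then have "arccos (cos (pi / l * y)) = pi / l * y"
      using l by (intro arccos_cos) (auto simp: field_simps)
    then have "l / pi * arccos (cos (pi / l * y)) = y"
      using l by (simp add: field_simps)
    then have "\<bar>f y - g (cos (pi / l * y))\<bar> < \<epsilon>"
      using g(2)[of "cos (pi / l * y)"] by simp
    then show "\<bar>f y - (\<Sum>n\<le>N. c n * cos (real n * (pi / l * y)))\<bar> \<le> \<epsilon>"
      by (simp add: N)
  qed
qed

subsection \<open>Spectral gaps on an interval\<close>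

lemma integral_by_parts_within:
  fixes F G F' G' :: "real \<Rightarrow> real"
  assumes "a \<le> b"
    and F: "\<And>x. x \<in> {a..b} \<Longrightarrow> (F has_real_derivative F' x) (at x within {a..b})"
    and G: "\<And>x. x \<in> {a..b} \<Longrightarrow> (G has_real_derivative G' x) (at x within {a..b})"
    and F': "continuous_on {a..b} F'" and G': "continuous_on {a..b} G'"
  shows "integral {a..b} (\<lambda>x. F x * G' x) = F b * G b - F a * G a - integral {a..b} (\<lambda>x. F' x * G x)"
proof -
  have cF: "continuous_on {a..b} F" and cG: "continuous_on {a..b} G"
    by (rule DERIV_continuous_on[OF F] DERIV_continuous_on[OF G], assumption)+
  have "((\<lambda>x. F' x * G x + F x * G' x) has_integral F b * G b - F a * G a) {a..b}"
  proof (rule fundamental_theorem_of_calculus[OF \<open>a \<le> b\<close>])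
    show "((\<lambda>x. F x * G x) has_vector_derivative F' x * G x + F x * G' x) (at x within {a..b})"
      if "x \<in> {a..b}" for x
      unfolding has_real_derivative_iff_has_vector_derivative[symmetric]
      by (rule derivative_eq_intros F G that refl)+ (simp add: algebra_simps)
  qed
  then have "F b * G b - F a * G a = integral {a..b} (\<lambda>x. F' x * G x + F x * G' x)"
    by (simp add: integral_unique)
  also have "\<dots> = integral {a..b} (\<lambda>x. F' x * G x) + integral {a..b} (\<lambda>x. F x * G' x)"
    by (intro integral_add integrable_continuous_real continuous_intros cF cG F' G')
  finally show ?thesis by simp
qed

lemma integral_deriv_within:
  fixes F F' :: "real \<Rightarrow> real"
  assumes "a \<le> b"
    and "\<And>x. x \<in> {a..b} \<Longrightarrow> (F has_real_derivative F' x) (at x within {a..b})"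
  shows "integral {a..b} F' = F b - F a"
  using fundamental_theorem_of_calculus[OF assms(1), of F F'] assms(2)
  by (simp add: has_real_derivative_iff_has_vector_derivative integral_unique)

lemma integral_cos_mode:
  assumes "l > 0"
  shows "integral {0..l} (\<lambda>y. cos (of_int k * (pi / l * y))) = (if k = 0 then l else 0)"
proof (cases "k = 0")
  case False
  have "integral {0..l} (\<lambda>y. cos (of_int k * (pi / l * y)))
     = sin (of_int k * (pi / l * l)) / (of_int k * pi / l) - sin (of_int k * (pi / l * 0)) / (of_int k * pi / l)"
    using assms False
    by (intro integral_deriv_within) (auto intro!: derivative_eq_intros simp: field_simps)
  also have "\<dots> = 0"
    using assms by (simp add: sin_zero_iff_int2)
  finally show ?thesis using False by simp
qed (use assms in simp)

lemma cos_mode_orthogonal: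
  assumes "l > 0" "n \<noteq> 0"
  shows "integral {0..l} (\<lambda>y. cos (real n * (pi / l * y)) * cos (real j * (pi / l * y)))
      = (if n = j then l / 2 else 0)"
proof -
  have "cos (real n * (pi / l * y)) * cos (real j * (pi / l * y))
     = (1/2) * (cos (of_int (int n - int j) * (pi / l * y)) + cos (of_int (int n + int j) * (pi / l * y)))" for y
    unfolding of_int_diff of_int_add of_int_of_nat_eq left_diff_distrib distrib_right
    by (simp add: cos_times_cos)
  then have "integral {0..l} (\<lambda>y. cos (real n * (pi / l * y)) * cos (real j * (pi / l * y)))
     = integral {0..l} (\<lambda>y. (1/2) * (cos (of_int (int n - int j) * (pi / l * y)) + cos (of_int (int n + int j) * (pi / l * y))))"
    by (simp only:)
  also have "\<dots> = (1/2) * (integral {0..l} (\<lambda>y. cos (of_int (int n - int j) * (pi / l * y)))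
      + integral {0..l} (\<lambda>y. cos (of_int (int n + int j) * (pi / l * y))))"
    unfolding integral_mult_right
    using assms by (subst integral_add) (auto intro!: integrable_continuous_real continuous_intros)
  finally show ?thesis
    unfolding integral_cos_mode[OF assms(1)] using assms by auto
qed

lemma sin_mode_orthogonal:
  assumes "l > 0" "n \<noteq> 0"
  shows "integral {0..l} (\<lambda>y. sin (real n * (pi / l * y)) * sin (real j * (pi / l * y)))
      = (if n = j then l / 2 else 0)"
proof -
  have "sin (real n * (pi / l * y)) * sin (real j * (pi / l * y))
     = (1/2) * (cos (of_int (int n - int j) * (pi / l * y)) - cos (of_int (int n + int j) * (pi / l * y)))" for y
    unfolding of_int_diff of_int_add of_int_of_nat_eq left_diff_distrib distrib_right
    by (simp add: sin_times_sin)
  then have "integral {0..l} (\<lambda>y. sin (real n * (pi / l * y)) * sin (real j * (pi / l * y)))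
     = integral {0..l} (\<lambda>y. (1/2) * (cos (of_int (int n - int j) * (pi / l * y)) - cos (of_int (int n + int j) * (pi / l * y))))"
    by (simp only:)
  also have "\<dots> = (1/2) * (integral {0..l} (\<lambda>y. cos (of_int (int n - int j) * (pi / l * y)))
      - integral {0..l} (\<lambda>y. cos (of_int (int n + int j) * (pi / l * y))))"
    unfolding integral_mult_right
    using assms by (subst integral_diff) (auto intro!: integrable_continuous_real continuous_intros)
  finally show ?thesis
    unfolding integral_cos_mode[OF assms(1)] using assms by auto
qed

text \<open>Differentiation carries the system \<open>e\<close> to the system \<open>g\<close> and
  multiplies the \<open>n\<close>-th coefficient by \<open>n * w\<close> up to sign. Modes with
  \<open>n \<ge> 2\<close> gain at least the factor 4. The first gains only 1, and the missing
  \<open>3 * w\<^sup>2\<close> times its squared coefficient over \<open>l / 2\<close> is the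
  subtracted term.\<close>

lemma spectral_gap_of_modes:
  fixes F F' :: "real \<Rightarrow> real" and e g :: "nat \<Rightarrow> real \<Rightarrow> real"
  assumes l: "l > 0" and w: "w > 0"
    and F: "continuous_on {0..l} F" and F': "continuous_on {0..l} F'"
    and e: "\<And>n. continuous_on {0..l} (e n)" and g: "\<And>n. continuous_on {0..l} (g n)"
    and eo: "\<And>n j. n \<noteq> 0 \<Longrightarrow> integral {0..l} (\<lambda>y. e n y * e j y) = (if n = j then l / 2 else 0)"
    and go: "\<And>n j. n \<noteq> 0 \<Longrightarrow> integral {0..l} (\<lambda>y. g n y * g j y) = (if n = j then l / 2 else 0)"
    and coeff: "\<And>n. n \<noteq> 0 \<Longrightarrow>
      (integral {0..l} (\<lambda>y. F' y * g n y))\<^sup>2 = (real n * w)\<^sup>2 * (integral {0..l} (\<lambda>y. F y * e n y))\<^sup>2"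
    and dense: "\<And>\<epsilon>. \<epsilon> > 0 \<Longrightarrow> \<exists>N a. \<forall>y\<in>{0..l}. \<bar>F y - (\<Sum>n\<in>{1..N}. a n * e n y)\<bar> \<le> \<epsilon>"
  shows "w\<^sup>2 * (4 * integral {0..l} (\<lambda>y. (F y)\<^sup>2) - 6 / l * (integral {0..l} (\<lambda>y. F y * e 1 y))\<^sup>2)
      \<le> integral {0..l} (\<lambda>y. (F' y)\<^sup>2)"
proof -
  let ?c = "\<lambda>n. integral {0..l} (\<lambda>y. F y * e n y)"
  let ?d = "\<lambda>n. integral {0..l} (\<lambda>y. F' y * g n y)"
  have bess: "(\<Sum>n\<in>{1..N}. (?d n)\<^sup>2 / (l/2)) \<le> integral {0..l} (\<lambda>y. (F' y)\<^sup>2)" for N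
    by (rule bessel_inequality[where a = 0 and b = l and h = "\<lambda>_. l/2", unfolded cbox_interval])
       (use F' g go l in auto)
  have "4 * w\<^sup>2 * integral {0..l} (\<lambda>y. (F y)\<^sup>2)
     \<le> 6 * w\<^sup>2 / l * (?c 1)\<^sup>2 + integral {0..l} (\<lambda>y. (F' y)\<^sup>2)"
  proof (rule field_le_epsilon)
    fix r :: real assume r: "r > 0"
    \<comment> \<open>Chosen so that the approximation error, multiplied by
      \<open>4 * w\<^sup>2\<close>, costs exactly \<open>r\<close>.\<close>
    define \<epsilon> where "\<epsilon> = sqrt (r / (4 * w\<^sup>2 * l))"
    have eps: "\<epsilon> > 0" "4 * w\<^sup>2 * (\<epsilon>\<^sup>2 * l) = r"
      using r l w by (auto simp: \<epsilon>_def)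
    obtain N a where N: "\<forall>y\<in>{0..l}. \<bar>F y - (\<Sum>n\<in>{1..N}. a n * e n y)\<bar> \<le> \<epsilon>"
      using dense[OF eps(1)] by blast
    have "integral {0..l} (\<lambda>y. (F y)\<^sup>2)
        \<le> (\<Sum>n\<in>{1..N}. (?c n)\<^sup>2 / (l/2)) + \<epsilon>\<^sup>2 * measure lborel {0..l}"
      by (rule reverse_bessel[where a = 0 and b = l and h = "\<lambda>_. l/2" and k = a, unfolded cbox_interval])
         (use F e eo l N in auto)
    then have "4 * w\<^sup>2 * integral {0..l} (\<lambda>y. (F y)\<^sup>2)
        \<le> 4 * w\<^sup>2 * ((\<Sum>n\<in>{1..N}. (?c n)\<^sup>2 / (l/2)) + \<epsilon>\<^sup>2 * l)"
      using l w by (intro mult_left_mono) auto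
    also have "\<dots> = (\<Sum>n\<in>{1..N}. 4 * w\<^sup>2 * ((?c n)\<^sup>2 / (l/2))) + r"
      using eps by (simp add: distrib_left sum_distrib_left)
    also have "(\<Sum>n\<in>{1..N}. 4 * w\<^sup>2 * ((?c n)\<^sup>2 / (l/2)))
      \<le> (\<Sum>n\<in>{1..N}. (if n = 1 then 6 * w\<^sup>2 / l * (?c 1)\<^sup>2 else 0) + (?d n)\<^sup>2 / (l/2))"
    proof (rule sum_mono)
      fix n assume n: "n \<in> {1..N}"
      have d: "(?d n)\<^sup>2 = (real n)\<^sup>2 * (w\<^sup>2 * (?c n)\<^sup>2)"
        using coeff[of n] n by (simp add: power_mult_distrib)
      show "4 * w\<^sup>2 * ((?c n)\<^sup>2 / (l/2))
         \<le> (if n = 1 then 6 * w\<^sup>2 / l * (?c 1)\<^sup>2 else 0) + (?d n)\<^sup>2 / (l/2)"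
      proof (cases "n = 1")
        case True
        then show ?thesis using d l by (simp add: field_simps)
      next
        case False
        then have "2 \<le> real n" using n by auto
        then have "(2::real)\<^sup>2 \<le> (real n)\<^sup>2" by (intro power_mono) auto
        then have "4 * (w\<^sup>2 * (?c n)\<^sup>2) \<le> (real n)\<^sup>2 * (w\<^sup>2 * (?c n)\<^sup>2)"
          by (intro mult_right_mono) auto
        then show ?thesis using d l False by (simp add: field_simps)
      qed
    qed
    also have "\<dots> = (if 1 \<le> N then 6 * w\<^sup>2 / l * (?c 1)\<^sup>2 else 0) + (\<Sum>n\<in>{1..N}. (?d n)\<^sup>2 / (l/2))"
      unfolding sum.distrib by (subst sum.delta) auto
    also have "\<dots> \<le> 6 * w\<^sup>2 / l * (?c 1)\<^sup>2 + integral {0..l} (\<lambda>y. (F' y)\<^sup>2)"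
      using bess[of N] l by (intro add_mono) auto
    finally show "4 * w\<^sup>2 * integral {0..l} (\<lambda>y. (F y)\<^sup>2)
       \<le> 6 * w\<^sup>2 / l * (?c 1)\<^sup>2 + integral {0..l} (\<lambda>y. (F' y)\<^sup>2) + r"
      by simp
  qed
  then show ?thesis by (simp add: algebra_simps)
qed

text \<open>The mean is split off first because the constant mode disappears under differentiation;
  its squared norm \<open>l\<close> instead of \<open>l / 2\<close> explains the coefficient
  \<open>4 / l\<close>.\<close>

lemma spectral_gap_Neumann:
  fixes f f' :: "real \<Rightarrow> real"
  assumes l: "l > 0" and f': "continuous_on {0..l} f'"
    and d: "\<And>y. y \<in> {0..l} \<Longrightarrow> (f has_real_derivative f' y) (at y within {0..l})"
  shows "(pi / l)\<^sup>2 * (4 * integral {0..l} (\<lambda>y. (f y)\<^sup>2) - 4 / l * (integral {0..l} f)\<^sup>2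
      - 6 / l * (integral {0..l} (\<lambda>y. f y * cos (pi / l * y)))\<^sup>2) \<le> integral {0..l} (\<lambda>y. (f' y)\<^sup>2)"
proof -
  define M where "M = integral {0..l} f / l"
  define F where "F y = f y - M" for y
  have f: "continuous_on {0..l} f" by (rule DERIV_continuous_on[OF d])
  have F: "continuous_on {0..l} F" unfolding F_def by (intro continuous_intros f)
  have I0: "integral {0..l} (\<lambda>y. cos (real n * (pi / l * y))) = 0" if "n \<noteq> 0" for n
    using integral_cos_mode[OF l, of "int n"] that by simp
  have IM: "integral {0..l} F = 0"
    unfolding F_def using l
    by (subst integral_diff) (auto intro!: integrable_continuous_real f simp: M_def)
  have "(pi / l)\<^sup>2 * (4 * integral {0..l} (\<lambda>y. (F y)\<^sup>2)
      - 6 / l * (integral {0..l} (\<lambda>y. F y * cos (real 1 * (pi / l * y))))\<^sup>2) \<le> integral {0..l} (\<lambda>y. (f' y)\<^sup>2)"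
  proof (rule spectral_gap_of_modes[where e = "\<lambda>n y. cos (real n * (pi / l * y))"
        and g = "\<lambda>n y. sin (real n * (pi / l * y))"])
    fix n :: nat assume n: "n \<noteq> 0"
    have "integral {0..l} (\<lambda>y. sin (real n * (pi / l * y)) * f' y)
      = sin (real n * (pi / l * l)) * F l - sin (real n * (pi / l * 0)) * F 0
       - integral {0..l} (\<lambda>y. (cos (real n * (pi / l * y)) * (real n * (pi / l))) * F y)"
      using l by (intro integral_by_parts_within)
        (auto intro!: derivative_eq_intros d continuous_intros f' simp: F_def)
    also have "\<dots> = - (real n * (pi / l)) * integral {0..l} (\<lambda>y. F y * cos (real n * (pi / l * y)))"
      using l by (simp add: mult_ac flip: integral_mult_right)
    finally show "(integral {0..l} (\<lambda>y. f' y * sin (real n * (pi / l * y))))\<^sup>2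
      = (real n * (pi / l))\<^sup>2 * (integral {0..l} (\<lambda>y. F y * cos (real n * (pi / l * y))))\<^sup>2"
      by (simp only: mult.commute[of "f' _"] power_mult_distrib power2_minus)
  next
    fix \<epsilon> :: real assume e: "\<epsilon> > 0"
    then obtain N c where N: "\<And>y. y \<in> {0..l} \<Longrightarrow>
        \<bar>F y - (\<Sum>n\<le>N. c n * cos (real n * (pi / l * y)))\<bar> \<le> \<epsilon> / 2"
      using cos_polynomial_dense[OF l F, of "\<epsilon>/2"] half_gt_zero[OF e] by blast
    have split: "(\<Sum>n\<le>N. c n * cos (real n * (pi / l * y)))
        = c 0 + (\<Sum>n\<in>{1..N}. c n * cos (real n * (pi / l * y)))" for y
      by (simp add: sum.atMost_shift sum.atLeast1_atMost_eq)
    \<comment> \<open>As \<open>F\<close> has mean zero, the mean \<open>c 0\<close> of the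
      approximating sum is at most \<open>\<epsilon> / 2\<close>, so dropping it at most doubles the
      error.\<close>
    have "c 0 * l = integral {0..l} (\<lambda>y. \<Sum>n\<le>N. c n * cos (real n * (pi / l * y)))"
    proof -
      have "integral {0..l} (\<lambda>y. \<Sum>n\<le>N. c n * cos (real n * (pi / l * y)))
        = (\<Sum>n\<le>N. c n * integral {0..l} (\<lambda>y. cos (real n * (pi / l * y))))"
        using l by (subst integral_sum) (auto intro!: integrable_continuous_real continuous_intros)
      also have "\<dots> = (\<Sum>n\<le>N. if n = 0 then c 0 * l else 0)"
        using I0 l by (intro sum.cong) auto
      finally show ?thesis by simp
    qed
    also have "\<bar>\<dots>\<bar> = \<bar>integral {0..l} (\<lambda>y. F y - (\<Sum>n\<le>N. c n * cos (real n * (pi / l * y))))\<bar>"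
    proof -
      have "integral {0..l} (\<lambda>y. F y - (\<Sum>n\<le>N. c n * cos (real n * (pi / l * y))))
        = integral {0..l} F - integral {0..l} (\<lambda>y. \<Sum>n\<le>N. c n * cos (real n * (pi / l * y)))"
        using l by (intro integral_diff integrable_continuous_real F) (auto intro!: continuous_intros)
      then show ?thesis using IM by simp
    qed
    also have "\<dots> \<le> \<epsilon> / 2 * (l - 0)"
      unfolding real_norm_def[symmetric]
      using N l by (intro integral_bound) (auto intro!: continuous_intros F)
    finally have c0: "\<bar>c 0\<bar> \<le> \<epsilon> / 2"
      using l by (simp add: abs_mult)
    show "\<exists>N a. \<forall>y\<in>{0..l}. \<bar>F y - (\<Sum>n\<in>{1..N}. a n * cos (real n * (pi / l * y)))\<bar> \<le> \<epsilon>"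
    proof (intro exI ballI)
      fix y assume "y \<in> {0..l}"
      from N[OF this] c0 show "\<bar>F y - (\<Sum>n\<in>{1..N}. c n * cos (real n * (pi / l * y)))\<bar> \<le> \<epsilon>"
        unfolding split by linarith
    qed
  qed (rule cos_mode_orthogonal[OF l] sin_mode_orthogonal[OF l], assumption
      | (use l F f' in \<open>(auto intro!: continuous_intros)[1]\<close>))+
  moreover have "integral {0..l} (\<lambda>y. F y * cos (real 1 * (pi / l * y)))
      = integral {0..l} (\<lambda>y. f y * cos (pi / l * y))"
  proof -
    have "integral {0..l} (\<lambda>y. F y * cos (real 1 * (pi / l * y)))
      = integral {0..l} (\<lambda>y. f y * cos (pi / l * y) - M * cos (pi / l * y))"
      by (simp add: F_def algebra_simps)
    also have "\<dots> = integral {0..l} (\<lambda>y. f y * cos (pi / l * y)) - integral {0..l} (\<lambda>y. M * cos (pi / l * y))"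
      by (intro integral_diff integrable_continuous_real continuous_intros f)
    finally show ?thesis using I0[of 1] by simp
  qed
  moreover have "integral {0..l} (\<lambda>y. (F y)\<^sup>2) = integral {0..l} (\<lambda>y. (f y)\<^sup>2) - (integral {0..l} f)\<^sup>2 / l"
  proof -
    have "integral {0..l} (\<lambda>y. (F y)\<^sup>2) = integral {0..l} (\<lambda>y. (f y)\<^sup>2 - M * (f y + F y))"
      by (simp add: F_def power2_eq_square algebra_simps)
    also have "\<dots> = integral {0..l} (\<lambda>y. (f y)\<^sup>2) - M * (integral {0..l} f + integral {0..l} F)"
      by (subst integral_diff; (subst integral_mult_right)?; (subst integral_add)?)
         (auto intro!: integrable_continuous_real continuous_intros f F)
    finally show ?thesis using IM by (simp add: M_def power2_eq_square)
  qed
  ultimately show ?thesis by (simp add: algebra_simps)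
qed

text \<open>Density of sine sums is obtained by integration: \<open>f'\<close> is approximated by
  cosines, and the zero of \<open>f\<close> at \<open>l\<close> shows that the constant coefficient,
  the only one whose primitive is not a sine, is small.\<close>

lemma spectral_gap_Dirichlet:
  fixes f f' :: "real \<Rightarrow> real"
  assumes l: "l > 0" and f': "continuous_on {0..l} f'"
    and d: "\<And>y. y \<in> {0..l} \<Longrightarrow> (f has_real_derivative f' y) (at y within {0..l})"
    and f0: "f 0 = 0" "f l = 0"
  shows "(pi / l)\<^sup>2 * (4 * integral {0..l} (\<lambda>y. (f y)\<^sup>2)
      - 6 / l * (integral {0..l} (\<lambda>y. f y * sin (pi / l * y)))\<^sup>2) \<le> integral {0..l} (\<lambda>y. (f' y)\<^sup>2)"
proof -
  have f: "continuous_on {0..l} f" by (rule DERIV_continuous_on[OF d])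
  have I0: "integral {0..l} (\<lambda>y. cos (real n * (pi / l * y))) = 0" if "n \<noteq> 0" for n
    using integral_cos_mode[OF l, of "int n"] that by simp
  have If': "integral {0..l} f' = 0"
    using integral_deriv_within[of 0 l f f'] d l f0 by simp
  have "(pi / l)\<^sup>2 * (4 * integral {0..l} (\<lambda>y. (f y)\<^sup>2)
      - 6 / l * (integral {0..l} (\<lambda>y. f y * sin (real 1 * (pi / l * y))))\<^sup>2) \<le> integral {0..l} (\<lambda>y. (f' y)\<^sup>2)"
  proof (rule spectral_gap_of_modes[where e = "\<lambda>n y. sin (real n * (pi / l * y))"
        and g = "\<lambda>n y. cos (real n * (pi / l * y))"])
    fix n :: nat assume n: "n \<noteq> 0"
    have "integral {0..l} (\<lambda>y. cos (real n * (pi / l * y)) * f' y)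
      = cos (real n * (pi / l * l)) * f l - cos (real n * (pi / l * 0)) * f 0
       - integral {0..l} (\<lambda>y. (- sin (real n * (pi / l * y)) * (real n * (pi / l))) * f y)"
      using l by (intro integral_by_parts_within)
        (auto intro!: derivative_eq_intros d continuous_intros f')
    also have "\<dots> = (real n * (pi / l)) * integral {0..l} (\<lambda>y. f y * sin (real n * (pi / l * y)))"
      using l f0 by (simp add: mult_ac flip: integral_mult_right)
    finally show "(integral {0..l} (\<lambda>y. f' y * cos (real n * (pi / l * y))))\<^sup>2
      = (real n * (pi / l))\<^sup>2 * (integral {0..l} (\<lambda>y. f y * sin (real n * (pi / l * y))))\<^sup>2"
      by (simp only: mult.commute[of "f' _"] power_mult_distrib power2_minus)
  next
    fix \<epsilon> :: real assume e: "\<epsilon> > 0"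
    \<comment> \<open>Two errors of size \<open>r * l\<close> occur, one from integrating the
      approximation of \<open>f'\<close> and one from its constant coefficient.\<close>
    define r where "r = \<epsilon> / (2 * l)"
    have r: "r > 0" using e l by (simp add: r_def)
    obtain N c where N: "\<And>y. y \<in> {0..l} \<Longrightarrow>
        \<bar>f' y - (\<Sum>n\<le>N. c n * cos (real n * (pi / l * y)))\<bar> \<le> r"
      using cos_polynomial_dense[OF l f' r] by blast
    define a where "a n = c n / (real n * (pi / l))" for n
    have split: "(\<Sum>n\<le>N. c n * h n) = c 0 * h 0 + (\<Sum>n\<in>{1..N}. c n * h n)" for h :: "nat \<Rightarrow> real"
      by (simp add: sum.atMost_shift sum.atLeast1_atMost_eq)
    have prim: "integral {0..y} (\<lambda>s. f' s - (\<Sum>n\<le>N. c n * cos (real n * (pi / l * s))))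
        = f y - (c 0 * y + (\<Sum>n\<in>{1..N}. a n * sin (real n * (pi / l * y))))" if y: "y \<in> {0..l}" for y
    proof -
      have "integral {0..y} (\<lambda>s. f' s - (\<Sum>n\<le>N. c n * cos (real n * (pi / l * s))))
        = (f y - (c 0 * y + (\<Sum>n\<in>{1..N}. a n * sin (real n * (pi / l * y)))))
        - (f 0 - (c 0 * 0 + (\<Sum>n\<in>{1..N}. a n * sin (real n * (pi / l * 0)))))"
      proof (rule integral_deriv_within)
        fix x assume x: "x \<in> {0..y}"
        have *: "(f has_real_derivative f' x) (at x within {0..y})"
          by (rule DERIV_subset[OF d]) (use x y in auto)
        show "((\<lambda>y. f y - (c 0 * y + (\<Sum>n\<in>{1..N}. a n * sin (real n * (pi / l * y))))) has_real_derivative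
          f' x - (\<Sum>n\<le>N. c n * cos (real n * (pi / l * x)))) (at x within {0..y})"
          unfolding split using l
          by (auto intro!: derivative_eq_intros * sum.cong simp: a_def)
      qed (use y in auto)
      then show ?thesis using f0 by simp
    qed
    have bd: "\<bar>integral {0..y} (\<lambda>s. f' s - (\<Sum>n\<le>N. c n * cos (real n * (pi / l * s))))\<bar> \<le> r * l"
      if y: "y \<in> {0..l}" for y
    proof -
      have "norm (integral {0..y} (\<lambda>s. f' s - (\<Sum>n\<le>N. c n * cos (real n * (pi / l * s))))) \<le> r * (y - 0)"
        using y N l by (intro integral_bound) (auto intro!: continuous_intros continuous_on_subset[OF f'])
      also have "\<dots> \<le> r * l" using y r by (intro mult_left_mono) auto
      finally show ?thesis by simp
    qed
    have sl: "sin (real n * (pi / l * l)) = 0" for n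
      using l by simp
    have "\<bar>c 0 * l\<bar> \<le> r * l"
      using bd[of l] prim[of l] f0 l by (simp add: sl)
    then have c0: "\<bar>c 0\<bar> \<le> r" using l by (simp add: abs_mult)
    show "\<exists>N a. \<forall>y\<in>{0..l}. \<bar>f y - (\<Sum>n\<in>{1..N}. a n * sin (real n * (pi / l * y)))\<bar> \<le> \<epsilon>"
    proof (intro exI ballI)
      fix y assume y: "y \<in> {0..l}"
      have "\<bar>c 0 * y\<bar> \<le> r * l" using y c0 by (auto simp: abs_mult intro!: mult_mono)
      moreover have "r * l + r * l = \<epsilon>" using l by (simp add: r_def)
      ultimately show "\<bar>f y - (\<Sum>n\<in>{1..N}. a n * sin (real n * (pi / l * y)))\<bar> \<le> \<epsilon>"
        using bd[OF y] prim[OF y] by linarith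
    qed
  qed (rule cos_mode_orthogonal[OF l] sin_mode_orthogonal[OF l], assumption
      | (use l f f' in \<open>(auto intro!: continuous_intros)[1]\<close>))+
  then show ?thesis by simp
qed

lemma integral_reflect_fold:
  fixes h :: "real \<Rightarrow> real"
  assumes T: "T > 0" and h: "continuous_on {0..T} h"
  shows "integral {0..T} h = integral {0..T/2} (\<lambda>s. h s + h (T - s))"
proof -
  have h1: "continuous_on {0..T/2} h" "continuous_on {T/2..T} h"
    using T by (auto intro: continuous_on_subset[OF h])
  have h2: "continuous_on {0..T/2} (\<lambda>s. h (T - s))"
    by (rule continuous_on_compose2[OF h]) (use T in \<open>auto intro!: continuous_intros\<close>)
  have "(h has_integral integral {T/2..T} h) (cbox (T/2) T)"
    using integrable_integral[OF integrable_continuous_real[OF h1(2)]] by simp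
  from has_integral_affinity[OF this, of "-1" T]
  have "((\<lambda>s. h (T - s)) has_integral integral {T/2..T} h) ((\<lambda>x. T - x) ` {T/2..T})"
    by (simp add: algebra_simps)
  also have "(\<lambda>x. T - x) ` {T/2..T} = {0..T/2}"
    using T by (auto simp: image_iff intro!: bexI[of _ "T - _"])
  finally have "integral {0..T/2} (\<lambda>s. h (T - s)) = integral {T/2..T} h"
    by (rule integral_unique)
  moreover have "integral {0..T/2} h + integral {T/2..T} h = integral {0..T} h"
    using T by (intro Henstock_Kurzweil_Integration.integral_combine integrable_continuous_real h) auto
  moreover have "integral {0..T/2} (\<lambda>s. h s + h (T - s))
      = integral {0..T/2} h + integral {0..T/2} (\<lambda>s. h (T - s))"
    by (intro integral_add integrable_continuous_real h1 h2)
  ultimately show ?thesis by simp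
qed

text \<open>The even part about \<open>T/2\<close> is free at both ends of \<open>[0,T/2]\<close>, the odd part vanishes there.\<close>

lemma spectral_gap_periodic:
  fixes f f' :: "real \<Rightarrow> real"
  assumes T: "T > 0" and f': "continuous_on {0..T} f'"
    and d: "\<And>y. y \<in> {0..T} \<Longrightarrow> (f has_real_derivative f' y) (at y within {0..T})"
    and per: "f 0 = f T"
  shows "(2 * pi / T)\<^sup>2 * (4 * integral {0..T} (\<lambda>y. (f y)\<^sup>2) - 4 / T * (integral {0..T} f)\<^sup>2
      - 6 / T * ((integral {0..T} (\<lambda>y. f y * cos (2 * pi / T * y)))\<^sup>2
               + (integral {0..T} (\<lambda>y. f y * sin (2 * pi / T * y)))\<^sup>2))
    \<le> integral {0..T} (\<lambda>y. (f' y)\<^sup>2)"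
proof -
  define l where "l = T / 2"
  have l: "l > 0" and Tl: "T = 2 * l" using T by (auto simp: l_def)
  have pl: "2 * pi / T = pi / l" using T by (simp add: l_def)
  define g where "g s = f s + f (T - s)" for s
  define g' where "g' s = f' s - f' (T - s)" for s
  define h where "h s = f s - f (T - s)" for s
  define h' where "h' s = f' s + f' (T - s)" for s
  have f: "continuous_on {0..T} f" by (rule DERIV_continuous_on[OF d])
  have f'1: "continuous_on {0..l} f'" and f1: "continuous_on {0..l} f"
    using l Tl by (auto intro: continuous_on_subset[OF f'] continuous_on_subset[OF f])
  have f'2: "continuous_on {0..l} (\<lambda>s. f' (T - s))"
    by (rule continuous_on_compose2[OF f']) (use l Tl in \<open>auto intro!: continuous_intros\<close>)
  have f2: "continuous_on {0..l} (\<lambda>s. f (T - s))"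
    by (rule continuous_on_compose2[OF f]) (use l Tl in \<open>auto intro!: continuous_intros\<close>)
  have d1: "(f has_real_derivative f' y) (at y within {0..l})" if "y \<in> {0..l}" for y
    by (rule DERIV_subset[OF d]) (use that l Tl in auto)
  have d2: "((\<lambda>s. f (T - s)) has_real_derivative - f' (T - y)) (at y within {0..l})" if "y \<in> {0..l}" for y
  proof -
    have sub: "(\<lambda>s. T - s) ` {0..l} \<subseteq> {0..T}" using l Tl by auto
    have "(f has_real_derivative f' (T - y)) (at (T - y) within (\<lambda>s. T - s) ` {0..l})"
      by (rule DERIV_subset[OF d sub]) (use that l Tl in auto)
    moreover have "((\<lambda>s. T - s) has_real_derivative -1) (at y within {0..l})"
      by (auto intro!: derivative_eq_intros)
    ultimately have "(f \<circ> (\<lambda>s. T - s) has_real_derivative f' (T - y) * -1) (at y within {0..l})"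
      by (rule DERIV_image_chain)
    then show ?thesis by (simp add: o_def)
  qed
  have cg': "continuous_on {0..l} g'" and ch': "continuous_on {0..l} h'"
    unfolding g'_def h'_def by (intro continuous_intros f'1 f'2)+
  have cg: "continuous_on {0..l} g" and ch: "continuous_on {0..l} h"
    unfolding g_def h_def by (intro continuous_intros f1 f2)+
  have dg: "(g has_real_derivative g' y) (at y within {0..l})" if "y \<in> {0..l}" for y
    unfolding g_def g'_def using DERIV_add[OF d1[OF that] d2[OF that]] by simp
  have dh: "(h has_real_derivative h' y) (at y within {0..l})" if "y \<in> {0..l}" for y
    unfolding h_def h'_def using DERIV_diff[OF d1[OF that] d2[OF that]] by simp
  have N: "(pi / l)\<^sup>2 * (4 * integral {0..l} (\<lambda>y. (g y)\<^sup>2) - 4 / l * (integral {0..l} g)\<^sup>2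
      - 6 / l * (integral {0..l} (\<lambda>y. g y * cos (pi / l * y)))\<^sup>2) \<le> integral {0..l} (\<lambda>y. (g' y)\<^sup>2)"
    by (rule spectral_gap_Neumann[OF l cg' dg])
  have D: "(pi / l)\<^sup>2 * (4 * integral {0..l} (\<lambda>y. (h y)\<^sup>2)
      - 6 / l * (integral {0..l} (\<lambda>y. h y * sin (pi / l * y)))\<^sup>2) \<le> integral {0..l} (\<lambda>y. (h' y)\<^sup>2)"
    by (rule spectral_gap_Dirichlet[OF l ch' dh]) (use per Tl in \<open>auto simp: h_def\<close>)
  \<comment> \<open>Parallelogram identity for the even and odd parts about \<open>T / 2\<close>. It
    is used for \<open>f\<close> and for \<open>f'\<close>; differentiation exchanges the two
    parities.\<close>
  have sq: "2 * integral {0..T} (\<lambda>y. (u y)\<^sup>2)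
     = integral {0..l} (\<lambda>y. (u y + u (T - y))\<^sup>2) + integral {0..l} (\<lambda>y. (u y - u (T - y))\<^sup>2)"
    if u: "continuous_on {0..T} u" "continuous_on {0..l} u" "continuous_on {0..l} (\<lambda>s. u (T - s))" for u :: "real \<Rightarrow> real"
  proof -
    have "integral {0..l} (\<lambda>y. (u y + u (T - y))\<^sup>2) + integral {0..l} (\<lambda>y. (u y - u (T - y))\<^sup>2)
      = integral {0..l} (\<lambda>y. (u y + u (T - y))\<^sup>2 + (u y - u (T - y))\<^sup>2)"
      by (subst integral_add) (auto intro!: integrable_continuous_real continuous_intros u)
    also have "\<dots> = integral {0..l} (\<lambda>y. 2 * ((u y)\<^sup>2 + (u (T - y))\<^sup>2))"
      by (simp add: power2_eq_square algebra_simps)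
    also have "\<dots> = 2 * integral {0..T} (\<lambda>y. (u y)\<^sup>2)"
      unfolding integral_mult_right l_def
      by (subst integral_reflect_fold[OF T]) (intro continuous_intros u, rule refl)
    finally show ?thesis by simp
  qed
  have i0: "integral {0..T} f = integral {0..l} g"
    using integral_reflect_fold[OF T f] by (simp add: g_def[abs_def] l_def)
  have refl: "cos (pi / l * (T - s)) = cos (pi / l * s)" "sin (pi / l * (T - s)) = - sin (pi / l * s)" for s
  proof -
    have "pi / l * (T - s) = 2 * pi - pi / l * s" using l by (simp add: Tl field_simps)
    then show "cos (pi / l * (T - s)) = cos (pi / l * s)" "sin (pi / l * (T - s)) = - sin (pi / l * s)"
      by (simp_all add: cos_diff sin_diff)
  qed
  have i1: "integral {0..T} (\<lambda>y. f y * cos (pi / l * y)) = integral {0..l} (\<lambda>y. g y * cos (pi / l * y))"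
  proof -
    have "continuous_on {0..T} (\<lambda>y. f y * cos (pi / l * y))"
      using l by (auto intro!: continuous_intros f)
    from integral_reflect_fold[OF T this] show ?thesis
      unfolding refl l_def[symmetric] g_def by (simp only: distrib_right left_diff_distrib mult_minus_right add_uminus_conv_diff)
  qed
  have i2: "integral {0..T} (\<lambda>y. f y * sin (pi / l * y)) = integral {0..l} (\<lambda>y. h y * sin (pi / l * y))"
  proof -
    have "continuous_on {0..T} (\<lambda>y. f y * sin (pi / l * y))"
      using l by (auto intro!: continuous_intros f)
    from integral_reflect_fold[OF T this] show ?thesis
      unfolding refl l_def[symmetric] h_def by (simp only: distrib_right left_diff_distrib mult_minus_right add_uminus_conv_diff)
  qed
  \<comment> \<open>Doubling matches the constants on the half interval:
    \<open>8 / T = 4 / l\<close> and \<open>12 / T = 6 / l\<close>.\<close>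
  have "2 * ((pi / l)\<^sup>2 * (4 * integral {0..T} (\<lambda>y. (f y)\<^sup>2) - 4 / T * (integral {0..T} f)\<^sup>2
      - 6 / T * ((integral {0..T} (\<lambda>y. f y * cos (pi / l * y)))\<^sup>2
               + (integral {0..T} (\<lambda>y. f y * sin (pi / l * y)))\<^sup>2)))
    = (pi / l)\<^sup>2 * (4 * (2 * integral {0..T} (\<lambda>y. (f y)\<^sup>2)) - 4 / l * (integral {0..T} f)\<^sup>2
      - 6 / l * ((integral {0..T} (\<lambda>y. f y * cos (pi / l * y)))\<^sup>2
               + (integral {0..T} (\<lambda>y. f y * sin (pi / l * y)))\<^sup>2))"
    using l by (simp add: Tl field_simps)
  also have "\<dots> \<le> 2 * integral {0..T} (\<lambda>y. (f' y)\<^sup>2)"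
    using N D unfolding sq[OF f f1 f2] sq[OF f' f'1 f'2] i0 i1 i2 g_def[symmetric] h_def[symmetric] g'_def h'_def
    by (simp add: algebra_simps)
  finally show ?thesis unfolding pl by simp
qed

subsection \<open>Spectral gap for stream functions on the channel\<close>

lemma cos_sin_full_period:
  fixes T :: real
  assumes T: "T > 0"
  shows "integral {0..T} (\<lambda>x. cos (2 * pi / T * x)) = 0"
    and "integral {0..T} (\<lambda>x. sin (2 * pi / T * x)) = 0"
    and "integral {0..T} (\<lambda>x. cos (2 * pi / T * x) * cos (2 * pi / T * x)) = T / 2"
    and "integral {0..T} (\<lambda>x. sin (2 * pi / T * x) * sin (2 * pi / T * x)) = T / 2"
    and "integral {0..T} (\<lambda>x. cos (2 * pi / T * x) * sin (2 * pi / T * x)) = 0"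
proof -
  have eq: "2 * pi / T * x = real 2 * (pi / T * x)" for x by simp
  have T1: "2 * pi / T * T = 2 * pi" using T by simp
  show "integral {0..T} (\<lambda>x. cos (2 * pi / T * x)) = 0"
  proof -
    have "2 * pi / T * x = of_int 2 * (pi / T * x)" for x by simp
    then show ?thesis by (simp only: integral_cos_mode[OF T]) simp
  qed
  have "integral {0..T} (\<lambda>x. sin (2 * pi / T * x))
     = - cos (2 * pi / T * T) / (2 * pi / T) - (- cos (2 * pi / T * 0) / (2 * pi / T))"
    using T by (intro integral_deriv_within) (auto intro!: derivative_eq_intros)
  then show "integral {0..T} (\<lambda>x. sin (2 * pi / T * x)) = 0" unfolding T1 by simp
  show "integral {0..T} (\<lambda>x. cos (2 * pi / T * x) * cos (2 * pi / T * x)) = T / 2"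
    unfolding eq using cos_mode_orthogonal[OF T, of 2 2] by simp
  show "integral {0..T} (\<lambda>x. sin (2 * pi / T * x) * sin (2 * pi / T * x)) = T / 2"
    unfolding eq using sin_mode_orthogonal[OF T, of 2 2] by simp
  have "integral {0..T} (\<lambda>x. cos (2 * pi / T * x) * sin (2 * pi / T * x))
     = (sin (2 * pi / T * T))\<^sup>2 / (2 * (2 * pi / T)) - (sin (2 * pi / T * 0))\<^sup>2 / (2 * (2 * pi / T))"
    using T by (intro integral_deriv_within) (auto intro!: derivative_eq_intros)
  then show "integral {0..T} (\<lambda>x. cos (2 * pi / T * x) * sin (2 * pi / T * x)) = 0"
    unfolding T1 by simp
qed

text \<open>Two orthogonal functions, indexed by \<open>bool\<close>, at the optimal coefficients:
  the squared norm left over after the first harmonic.\<close>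

lemma first_harmonic_defect:
  fixes F :: "real \<Rightarrow> real"
  assumes T: "T > 0" and F: "continuous_on {0..T} F"
  defines "c \<equiv> integral {0..T} (\<lambda>x. F x * cos (2 * pi / T * x))"
    and "s \<equiv> integral {0..T} (\<lambda>x. F x * sin (2 * pi / T * x))"
  shows "integral {0..T} (\<lambda>x. (F x - 2 / T * (c * cos (2 * pi / T * x) + s * sin (2 * pi / T * x)))\<^sup>2)
     = integral {0..T} (\<lambda>x. (F x)\<^sup>2) - 2 / T * (c\<^sup>2 + s\<^sup>2)"
proof -
  define e where "e b x = (if b then cos (2 * pi / T * x) else sin (2 * pi / T * x))" for b x
  define k where "k b = 2 / T * (if b then c else s)" for b
  note per = cos_sin_full_period[OF T]
  have "integral {0..T} (\<lambda>x. (F x - (\<Sum>i\<in>UNIV. k i * e i x))\<^sup>2)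
     = integral {0..T} (\<lambda>x. (F x)\<^sup>2)
      - (\<Sum>i\<in>UNIV. (integral {0..T} (\<lambda>x. F x * e i x))\<^sup>2 / (T/2))
      + (\<Sum>i\<in>UNIV. T/2 * (k i - integral {0..T} (\<lambda>x. F x * e i x) / (T/2))\<^sup>2)"
  proof (rule orthogonal_expansion_defect[where a = 0 and b = T and h = "\<lambda>_. T/2", unfolded cbox_interval])
    show "continuous_on {0..T} (e i)" for i
      using T by (cases i) (auto simp: e_def[abs_def] intro!: continuous_intros)
    show "integral {0..T} (\<lambda>x. e i x * e j x) = 0" if "i \<noteq> j" for i j
      using that per(5) by (cases i; cases j) (simp_all add: e_def mult.commute)
    show "integral {0..T} (\<lambda>x. e i x * e i x) = T / 2" for i
      using per(3,4) by (cases i) (simp_all add: e_def)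
  qed (use T F in auto)
  then show ?thesis
    by (simp add: UNIV_bool e_def k_def c_def s_def algebra_simps add_divide_distrib)
qed

lemma sin_bessel:
  fixes F :: "real \<Rightarrow> real"
  assumes T: "T > 0" and F: "continuous_on {0..T} F"
  shows "2 / T * (integral {0..T} (\<lambda>x. F x * sin (pi / T * x)))\<^sup>2 \<le> integral {0..T} (\<lambda>x. (F x)\<^sup>2)"
proof -
  have "(\<Sum>i\<in>{1}. (integral {0..T} (\<lambda>x. F x * sin (real i * (pi / T * x))))\<^sup>2 / (T/2))
     \<le> integral {0..T} (\<lambda>x. (F x)\<^sup>2)"
    by (rule bessel_inequality[where a = 0 and b = T and h = "\<lambda>_. T/2", unfolded cbox_interval])
       (use T F sin_mode_orthogonal[OF T, of 1 1] in \<open>auto intro!: continuous_intros\<close>)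
  then show ?thesis by (simp add: mult.commute)
qed

section \<open>The periodic channel and integrals over its closed period cell\<close>

locale channel =
  fixes L H :: real
  assumes L_pos: "L > 0" and H_pos: "H > 0"
begin

abbreviation cell :: "(real \<times> real) set" where
  "cell \<equiv> cbox (0, 0) (L, H)"

abbreviation cint :: "(real \<times> real \<Rightarrow> real) \<Rightarrow> real" where
  "cint \<equiv> integral cell"

lemma mem_cell: "(x, y) \<in> cell \<longleftrightarrow> x \<in> {0..L} \<and> y \<in> {0..H}"
  by (auto simp: cbox_Pair_eq)

lemma continuous_on_slice1:
  fixes F :: "real \<times> real \<Rightarrow> real"
  assumes "continuous_on cell F" "y \<in> {0..H}"
  shows "continuous_on {0..L} (\<lambda>x. F (x, y))"
  by (rule continuous_on_compose2[OF assms(1)]) (use assms in \<open>auto simp: mem_cell intro!: continuous_intros\<close>)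

lemma continuous_on_slice2:
  fixes F :: "real \<times> real \<Rightarrow> real"
  assumes "continuous_on cell F" "x \<in> {0..L}"
  shows "continuous_on {0..H} (\<lambda>y. F (x, y))"
  by (rule continuous_on_compose2[OF assms(1)]) (use assms in \<open>auto simp: mem_cell intro!: continuous_intros\<close>)

lemma cint_iterated:
  fixes F :: "real \<times> real \<Rightarrow> real"
  assumes "continuous_on cell F"
  shows "cint F = integral {0..L} (\<lambda>x. integral {0..H} (\<lambda>y. F (x, y)))"
  using integral_prod_continuous[OF assms] by simp

lemma cint_iterated_swap:
  fixes F :: "real \<times> real \<Rightarrow> real"
  assumes "continuous_on cell F"
  shows "cint F = integral {0..H} (\<lambda>y. integral {0..L} (\<lambda>x. F (x, y)))"
proof -
  have "continuous_on cell (\<lambda>(x, y). F (x, y))" using assms by simp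
  from integral_swap_continuous[OF this] show ?thesis
    using cint_iterated[OF assms] by simp
qed

lemma continuous_on_integral2:
  fixes F :: "real \<times> real \<Rightarrow> real"
  assumes "continuous_on cell F"
  shows "continuous_on {0..L} (\<lambda>x. integral {0..H} (\<lambda>y. F (x, y)))"
  by (rule integral_continuous_on_param[where a = 0 and b = H and f = "\<lambda>x y. F (x, y)", unfolded cbox_interval])
     (use assms in \<open>simp add: cbox_Pair_eq\<close>)

lemma continuous_on_integral1:
  fixes F :: "real \<times> real \<Rightarrow> real"
  assumes "continuous_on cell F"
  shows "continuous_on {0..H} (\<lambda>y. integral {0..L} (\<lambda>x. F (x, y)))"
proof (rule integral_continuous_on_param[where a = 0 and b = L and f = "\<lambda>y x. F (x, y)", unfolded cbox_interval])
  show "continuous_on ({0..H} \<times> {0..L}) (\<lambda>(y, x). F (x, y))"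
    unfolding case_prod_beta
    by (rule continuous_on_compose2[OF assms]) (auto simp: mem_cell intro!: continuous_intros)
qed

lemma cint_add:
  "continuous_on cell F \<Longrightarrow> continuous_on cell G \<Longrightarrow> cint (\<lambda>z. F z + G z) = cint F + cint G"
  by (intro integral_add integrable_continuous)

lemma cint_diff:
  "continuous_on cell F \<Longrightarrow> continuous_on cell G \<Longrightarrow> cint (\<lambda>z. F z - G z) = cint F - cint G"
  by (intro integral_diff integrable_continuous)

lemma cint_mono:
  "continuous_on cell F \<Longrightarrow> continuous_on cell G \<Longrightarrow> (\<And>z. z \<in> cell \<Longrightarrow> F z \<le> G z) \<Longrightarrow> cint F \<le> cint G"
  by (intro integral_le integrable_continuous)

lemma cint_nonneg:
  "continuous_on cell F \<Longrightarrow> (\<And>z. z \<in> cell \<Longrightarrow> 0 \<le> F z) \<Longrightarrow> 0 \<le> cint F"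
  by (intro integral_nonneg integrable_continuous)

lemma cint_const: "cint (\<lambda>_. c) = c * (L * H)"
  using L_pos H_pos by (simp add: content_Pair)

lemma cint_cong: "(\<And>z. z \<in> cell \<Longrightarrow> F z = G z) \<Longrightarrow> cint F = cint G"
  by (rule integral_cong)

lemma cint_abs_le:
  assumes "continuous_on cell F"
  shows "\<bar>cint F\<bar> \<le> cint (\<lambda>z. \<bar>F z\<bar>)"
proof -
  have "cint F \<le> cint (\<lambda>z. \<bar>F z\<bar>)"
    by (intro cint_mono continuous_intros assms) auto
  moreover have "cint (\<lambda>z. - F z) \<le> cint (\<lambda>z. \<bar>F z\<bar>)"
    by (intro cint_mono continuous_intros assms) auto
  ultimately show ?thesis by simp
qed

text \<open>Stream functions of zero flux, with the partial derivatives carried along.\<close>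

definition stream ::
  "(real \<times> real \<Rightarrow> real) \<Rightarrow> (real \<times> real \<Rightarrow> real) \<Rightarrow> (real \<times> real \<Rightarrow> real) \<Rightarrow> bool" where
  "stream f fx fy \<longleftrightarrow> continuous_on cell f \<and> continuous_on cell fx \<and> continuous_on cell fy \<and>
     (\<forall>x\<in>{0..L}. \<forall>y\<in>{0..H}.
        ((\<lambda>s. f (s, y)) has_real_derivative fx (x, y)) (at x within {0..L}) \<and>
        ((\<lambda>s. f (x, s)) has_real_derivative fy (x, y)) (at y within {0..H})) \<and>
     (\<forall>x\<in>{0..L}. f (x, 0) = 0 \<and> f (x, H) = 0) \<and> (\<forall>y\<in>{0..H}. f (0, y) = f (L, y))"

text \<open>For the negative Laplacian \<open>e1\<close> and \<open>e2\<close> have eigenvalue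
  \<open>(2 * pi / H)\<^sup>2\<close>, while \<open>e3\<close> and \<open>e4\<close> have
  \<open>(2 * pi / L)\<^sup>2 + (pi / H)\<^sup>2\<close>. On both walls \<open>e1\<close> equals 1
  and the others vanish.\<close>

abbreviation e1 :: "real \<times> real \<Rightarrow> real" where "e1 z \<equiv> cos (2 * pi / H * snd z)"
abbreviation e2 :: "real \<times> real \<Rightarrow> real" where "e2 z \<equiv> sin (2 * pi / H * snd z)"
abbreviation e3 :: "real \<times> real \<Rightarrow> real" where "e3 z \<equiv> sin (pi / H * snd z) * cos (2 * pi / L * fst z)"
abbreviation e4 :: "real \<times> real \<Rightarrow> real" where "e4 z \<equiv> sin (pi / H * snd z) * sin (2 * pi / L * fst z)"

text \<open>Splitting \<open>f\<close> into its average over \<open>x\<close> and the rest decouples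
  the problem. The average vanishes at both walls, hence is periodic in \<open>y\<close>, which
  produces \<open>e1\<close> and \<open>e2\<close>. The rest vanishes at the walls and has mean zero
  in \<open>x\<close>, so the Dirichlet gap in \<open>y\<close> and the periodic gap in
  \<open>x\<close> add up. \<open>F0\<close> and \<open>G0\<close> are the squared norms of the two
  pieces (the first without its mean), \<open>F1\<close> and \<open>G1\<close> those of their
  projections to the lowest modes.\<close>

lemma stream_spectral_gap:
  assumes st: "stream f fx fy"
  defines "F1 \<equiv> 2 / (L * H) * ((cint (\<lambda>z. f z * e1 z))\<^sup>2 + (cint (\<lambda>z. f z * e2 z))\<^sup>2)"
    and "G1 \<equiv> 4 / (L * H) * ((cint (\<lambda>z. f z * e3 z))\<^sup>2 + (cint (\<lambda>z. f z * e4 z))\<^sup>2)"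
  shows "\<exists>F0 G0. F0 + G0 = cint (\<lambda>z. (f z)\<^sup>2) - (cint f)\<^sup>2 / (L * H) \<and> F1 \<le> F0 \<and> G1 \<le> G0 \<and> 0 \<le> F0 \<and> 0 \<le> G0 \<and>
    (2 * pi / H)\<^sup>2 * F0 + 3 * (2 * pi / H)\<^sup>2 * (F0 - F1) + ((pi / H)\<^sup>2 + (2 * pi / L)\<^sup>2) * G0
      + min (3 * (pi / H)\<^sup>2) (3 * (2 * pi / L)\<^sup>2) * (G0 - G1)
    \<le> cint (\<lambda>z. (fx z)\<^sup>2) + cint (\<lambda>z. (fy z)\<^sup>2)"
proof -
  let ?\<nu> = "2 * pi / H" and ?k = "2 * pi / L" and ?r = "pi / H"
  have cf: "continuous_on cell f" and cfx: "continuous_on cell fx" and cfy: "continuous_on cell fy"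
    and dx: "\<And>x y. x \<in> {0..L} \<Longrightarrow> y \<in> {0..H} \<Longrightarrow> ((\<lambda>s. f (s, y)) has_real_derivative fx (x, y)) (at x within {0..L})"
    and dy: "\<And>x y. x \<in> {0..L} \<Longrightarrow> y \<in> {0..H} \<Longrightarrow> ((\<lambda>s. f (x, s)) has_real_derivative fy (x, y)) (at y within {0..H})"
    and bd: "\<And>x. x \<in> {0..L} \<Longrightarrow> f (x, 0) = 0" "\<And>x. x \<in> {0..L} \<Longrightarrow> f (x, H) = 0"
    and per: "\<And>y. y \<in> {0..H} \<Longrightarrow> f (0, y) = f (L, y)"
    using st unfolding stream_def by blast+
  note perL = cos_sin_full_period[OF L_pos] and perH = cos_sin_full_period[OF H_pos]
  define a where "a y = integral {0..L} (\<lambda>x. f (x, y))" for y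
  define a' where "a' y = integral {0..L} (\<lambda>x. fy (x, y))" for y
  have ca: "continuous_on {0..H} a" and ca': "continuous_on {0..H} a'"
    unfolding a_def a'_def by (intro continuous_on_integral1 cf cfy)+
  have da: "(a has_real_derivative a' y) (at y within {0..H})" if "y \<in> {0..H}" for y
    unfolding a_def a'_def
  proof (rule leibniz_rule_field_derivative[where a = 0 and b = L, unfolded cbox_interval])
    show "continuous_on ({0..H} \<times> {0..L}) (\<lambda>(y, x). fy (x, y))"
      unfolding case_prod_beta
      by (rule continuous_on_compose2[OF cfy]) (auto simp: mem_cell intro!: continuous_intros)
  qed (use dy that in \<open>auto intro!: integrable_continuous_real continuous_on_slice1 cf\<close>)
  have cy: "continuous_on cell (\<lambda>z. u (snd z))" if "continuous_on {0..H} u" for u :: "real \<Rightarrow> real"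
    by (rule continuous_on_compose2[OF that]) (auto simp: mem_cell intro!: continuous_intros)
  have cx: "continuous_on cell (\<lambda>z. u (fst z))" if "continuous_on {0..L} u" for u :: "real \<Rightarrow> real"
    by (rule continuous_on_compose2[OF that]) (auto simp: mem_cell intro!: continuous_intros)
  have trig: "continuous_on X (\<lambda>x. cos (?k * h x))" "continuous_on X (\<lambda>x. sin (?k * h x))"
     "continuous_on X (\<lambda>x. cos (?\<nu> * h x))" "continuous_on X (\<lambda>x. sin (?\<nu> * h x))"
     "continuous_on X (\<lambda>x. sin (?r * h x))" if "continuous_on X h"
     for X and h :: "'x::t2_space \<Rightarrow> real"
    using that L_pos H_pos by (auto intro!: continuous_intros)

  have cosH: "continuous_on {0..H} (\<lambda>y. cos (?\<nu> * y))" and sinH: "continuous_on {0..H} (\<lambda>y. sin (?\<nu> * y))"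
    by (intro trig continuous_on_id)+
  have Ia: "?\<nu>\<^sup>2 * (4 * integral {0..H} (\<lambda>y. (a y)\<^sup>2) - 4 / H * (integral {0..H} a)\<^sup>2
      - 6 / H * ((integral {0..H} (\<lambda>y. a y * cos (?\<nu> * y)))\<^sup>2
               + (integral {0..H} (\<lambda>y. a y * sin (?\<nu> * y)))\<^sup>2))
    \<le> integral {0..H} (\<lambda>y. (a' y)\<^sup>2)"
  proof (rule spectral_gap_periodic[OF H_pos ca' da])
    show "a 0 = a H" using bd unfolding a_def by (metis (no_types, lifting) integral_cong)
  qed
  have M: "integral {0..H} a = cint f"
    unfolding a_def by (rule cint_iterated_swap[OF cf, symmetric])
  have a_e: "integral {0..H} (\<lambda>y. a y * u y) = cint (\<lambda>z. f z * u (snd z))"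
    if "continuous_on {0..H} u" for u
    unfolding a_def
    by (subst cint_iterated_swap) (auto intro!: continuous_intros cf cy that)

  define A where "A = integral {0..H} (\<lambda>y. (a y)\<^sup>2)"
  \<comment> \<open>The average over \<open>x\<close> is \<open>a / L\<close>, whose squared norm on
    the cell is \<open>A / L\<close>; the other term removes its mean.\<close>
  define F0 where "F0 = (A - (cint f)\<^sup>2 / H) / L"
  define E12 where "E12 = (cint (\<lambda>z. f z * e1 z))\<^sup>2 + (cint (\<lambda>z. f z * e2 z))\<^sup>2"
  have F1: "F1 = 2 / (L * H) * E12" by (simp add: F1_def E12_def)
  have Ia': "?\<nu>\<^sup>2 * (F0 + 3 * (F0 - F1)) \<le> integral {0..H} (\<lambda>y. (a' y)\<^sup>2) / L"
  proof -
    have "?\<nu>\<^sup>2 * (F0 + 3 * (F0 - F1)) = ?\<nu>\<^sup>2 * (4 * A - 4 / H * (cint f)\<^sup>2 - 6 / H * E12) / L"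
      using L_pos H_pos by (simp add: F0_def F1 field_simps)
    also have "\<dots> \<le> integral {0..H} (\<lambda>y. (a' y)\<^sup>2) / L"
      using Ia L_pos unfolding M A_def E12_def a_e[OF cosH] a_e[OF sinH]
      by (intro divide_right_mono) simp_all
    finally show ?thesis .
  qed
  have FF: "F1 \<le> F0"
  proof -
    \<comment> \<open>\<open>F1 \<le> F0\<close> expresses that the centred average keeps a
      nonnegative squared norm when its first harmonic is removed.\<close>
    define b where "b y = a y - cint f / H" for y
    have cb: "continuous_on {0..H} b" unfolding b_def by (intro continuous_intros ca)
    have b_e: "integral {0..H} (\<lambda>y. b y * u y) = cint (\<lambda>z. f z * u (snd z))"
      if "continuous_on {0..H} u" "integral {0..H} u = 0" for u
    proof -
      have "integral {0..H} (\<lambda>y. b y * u y) = integral {0..H} (\<lambda>y. a y * u y - cint f / H * u y)"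
        by (simp add: b_def algebra_simps)
      also have "\<dots> = integral {0..H} (\<lambda>y. a y * u y) - integral {0..H} (\<lambda>y. cint f / H * u y)"
        by (intro integral_diff integrable_continuous_real continuous_intros ca that)
      finally show ?thesis using that by (simp add: a_e)
    qed
    have "integral {0..H} (\<lambda>y. (b y)\<^sup>2) = integral {0..H} (\<lambda>y. (a y)\<^sup>2 - (cint f / H * (2 * a y) - (cint f / H)\<^sup>2))"
      by (simp add: b_def power2_diff algebra_simps)
    also have "\<dots> = A - integral {0..H} (\<lambda>y. cint f / H * (2 * a y) - (cint f / H)\<^sup>2)"
      unfolding A_def by (intro integral_diff integrable_continuous_real continuous_intros ca)
    also have "integral {0..H} (\<lambda>y. cint f / H * (2 * a y) - (cint f / H)\<^sup>2)
      = integral {0..H} (\<lambda>y. cint f / H * (2 * a y)) - integral {0..H} (\<lambda>y. (cint f / H)\<^sup>2)"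
      by (intro integral_diff integrable_continuous_real continuous_intros ca)
    also have "\<dots> = (cint f)\<^sup>2 / H"
      using H_pos M by (simp add: field_simps power2_eq_square)
    finally have b2: "integral {0..H} (\<lambda>y. (b y)\<^sup>2) = A - (cint f)\<^sup>2 / H" .
    have "integral {0..H} (\<lambda>y. (b y)\<^sup>2) - 2 / H * E12 = integral {0..H} (\<lambda>y. (b y - 2 / H *
        (cint (\<lambda>z. f z * e1 z) * cos (?\<nu> * y) + cint (\<lambda>z. f z * e2 z) * sin (?\<nu> * y)))\<^sup>2)"
      unfolding E12_def b_e[OF cosH perH(1), symmetric] b_e[OF sinH perH(2), symmetric]
      by (rule first_harmonic_defect[OF H_pos cb, symmetric])
    also have "\<dots> \<ge> 0"
      by (intro integral_nonneg integrable_continuous_real continuous_intros cb cosH sinH) auto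
    finally have "0 \<le> integral {0..H} (\<lambda>y. (b y)\<^sup>2) - 2 / H * E12" .
    then have "2 / H * E12 / L \<le> F0"
      unfolding b2 F0_def using L_pos by (intro divide_right_mono) auto
    then show ?thesis by (simp add: F1 mult.commute)
  qed

  define g where "g z = f z - a (snd z) / L" for z
  have cg: "continuous_on cell g" unfolding g_def using L_pos by (auto intro!: continuous_intros cf cy ca)
  define G0 where "G0 = cint (\<lambda>z. (f z)\<^sup>2) - A / L"
  have slice_g: "integral {0..L} (\<lambda>x. (g (x, y))\<^sup>2) = integral {0..L} (\<lambda>x. (f (x, y))\<^sup>2) - (a y)\<^sup>2 / L"
    if y: "y \<in> {0..H}" for y
  proof -
    have "integral {0..L} (\<lambda>x. (g (x, y))\<^sup>2)
      = integral {0..L} (\<lambda>x. (f (x, y))\<^sup>2 - (a y / L * (2 * f (x, y)) - (a y / L)\<^sup>2))"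
      by (simp add: g_def power2_diff algebra_simps)
    also have "\<dots> = integral {0..L} (\<lambda>x. (f (x, y))\<^sup>2) - integral {0..L} (\<lambda>x. a y / L * (2 * f (x, y)) - (a y / L)\<^sup>2)"
      by (intro integral_diff integrable_continuous_real continuous_intros continuous_on_slice1 cf y)
    also have "integral {0..L} (\<lambda>x. a y / L * (2 * f (x, y)) - (a y / L)\<^sup>2)
      = integral {0..L} (\<lambda>x. a y / L * (2 * f (x, y))) - integral {0..L} (\<lambda>x. (a y / L)\<^sup>2)"
      by (intro integral_diff integrable_continuous_real continuous_intros continuous_on_slice1 cf y)
    also have "\<dots> = (a y)\<^sup>2 / L"
      using L_pos by (simp add: a_def[symmetric] field_simps power2_eq_square)
    finally show ?thesis .
  qed
  have slice_gy: "integral {0..L} (\<lambda>x. (fy (x, y) - a' y / L)\<^sup>2) = integral {0..L} (\<lambda>x. (fy (x, y))\<^sup>2) - (a' y)\<^sup>2 / L"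
    if y: "y \<in> {0..H}" for y
  proof -
    have "integral {0..L} (\<lambda>x. (fy (x, y) - a' y / L)\<^sup>2)
      = integral {0..L} (\<lambda>x. (fy (x, y))\<^sup>2 - (a' y / L * (2 * fy (x, y)) - (a' y / L)\<^sup>2))"
      by (simp add: power2_diff algebra_simps)
    also have "\<dots> = integral {0..L} (\<lambda>x. (fy (x, y))\<^sup>2) - integral {0..L} (\<lambda>x. a' y / L * (2 * fy (x, y)) - (a' y / L)\<^sup>2)"
      by (intro integral_diff integrable_continuous_real continuous_intros continuous_on_slice1 cfy y)
    also have "integral {0..L} (\<lambda>x. a' y / L * (2 * fy (x, y)) - (a' y / L)\<^sup>2)
      = integral {0..L} (\<lambda>x. a' y / L * (2 * fy (x, y))) - integral {0..L} (\<lambda>x. (a' y / L)\<^sup>2)"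
      by (intro integral_diff integrable_continuous_real continuous_intros continuous_on_slice1 cfy y)
    also have "\<dots> = (a' y)\<^sup>2 / L"
      using L_pos by (simp add: a'_def[symmetric] field_simps power2_eq_square)
    finally show ?thesis .
  qed
  have minus_y: "integral {0..H} (\<lambda>y. integral {0..L} (\<lambda>x. (u (x, y))\<^sup>2) - w y)
     = cint (\<lambda>z. (u z)\<^sup>2) - integral {0..H} w"
    if "continuous_on cell u" "continuous_on {0..H} w" for u w
    using that
    by (subst integral_diff; (subst cint_iterated_swap)?)
       (auto intro!: integrable_continuous_real continuous_on_integral1[of "\<lambda>z. (u z)\<^sup>2"] continuous_intros)
  have G0: "cint (\<lambda>z. (g z)\<^sup>2) = G0"
  proof -
    have "cint (\<lambda>z. (g z)\<^sup>2) = integral {0..H} (\<lambda>y. integral {0..L} (\<lambda>x. (f (x, y))\<^sup>2) - (a y)\<^sup>2 / L)"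
      by (subst cint_iterated_swap) (auto intro!: continuous_intros cg integral_cong simp: slice_g)
    also have "\<dots> = G0" unfolding G0_def A_def
      using L_pos by (subst minus_y) (auto intro!: continuous_intros cf ca)
    finally show ?thesis .
  qed
  have Gy: "cint (\<lambda>z. (fy z - a' (snd z) / L)\<^sup>2) = cint (\<lambda>z. (fy z)\<^sup>2) - integral {0..H} (\<lambda>y. (a' y)\<^sup>2) / L"
  proof -
    have "cint (\<lambda>z. (fy z - a' (snd z) / L)\<^sup>2) = integral {0..H} (\<lambda>y. integral {0..L} (\<lambda>x. (fy (x, y))\<^sup>2) - (a' y)\<^sup>2 / L)"
      using L_pos
      by (subst cint_iterated_swap) (auto intro!: continuous_intros cfy cy ca' integral_cong simp: slice_gy)
    also have "\<dots> = cint (\<lambda>z. (fy z)\<^sup>2) - integral {0..H} (\<lambda>y. (a' y)\<^sup>2) / L"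
      using L_pos by (subst minus_y) (auto intro!: continuous_intros cfy ca')
    finally show ?thesis .
  qed

  define g1 where "g1 x = integral {0..H} (\<lambda>y. g (x, y) * sin (?r * y))" for x
  have cg1: "continuous_on {0..L} g1" unfolding g1_def
    by (rule continuous_on_integral2[of "\<lambda>z. g z * sin (?r * snd z)", unfolded fst_conv snd_conv])
       (intro continuous_intros cg trig)
  define K1 where "K1 = integral {0..L} (\<lambda>x. (g1 x)\<^sup>2)"
  have minus_x: "integral {0..L} (\<lambda>x. \<beta> * integral {0..H} (\<lambda>y. (u (x, y))\<^sup>2) - \<gamma> * (w x)\<^sup>2)
     = \<beta> * cint (\<lambda>z. (u z)\<^sup>2) - \<gamma> * integral {0..L} (\<lambda>x. (w x)\<^sup>2)"
    if "continuous_on cell u" "continuous_on {0..L} w" for u w and \<beta> \<gamma> :: real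
    using that
    by (subst integral_diff; (subst cint_iterated)?)
       (auto intro!: integrable_continuous_real continuous_on_integral2[of "\<lambda>z. (u z)\<^sup>2"] continuous_intros)
  have Ib: "?r\<^sup>2 * (4 * G0 - 6 / H * K1) \<le> cint (\<lambda>z. (fy z)\<^sup>2) - integral {0..H} (\<lambda>y. (a' y)\<^sup>2) / L"
  proof -
    \<comment> \<open>The right-hand side carries \<open>1 *\<close> and
      \<open>- 0 * 0\<^sup>2\<close> to match the shape that \<open>minus_x\<close>
      integrates.\<close>
    have pt: "?r\<^sup>2 * 4 * integral {0..H} (\<lambda>y. (g (x, y))\<^sup>2) - ?r\<^sup>2 * (6 / H) * (g1 x)\<^sup>2
       \<le> 1 * integral {0..H} (\<lambda>y. (fy (x, y) - a' y / L)\<^sup>2) - 0 * 0\<^sup>2" if x: "x \<in> {0..L}" for x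
    proof -
      have "?r\<^sup>2 * (4 * integral {0..H} (\<lambda>y. (g (x, y))\<^sup>2) - 6 / H * (integral {0..H} (\<lambda>y. g (x, y) * sin (?r * y)))\<^sup>2)
          \<le> integral {0..H} (\<lambda>y. (fy (x, y) - a' y / L)\<^sup>2)"
      proof (rule spectral_gap_Dirichlet[OF H_pos])
        show "continuous_on {0..H} (\<lambda>y. fy (x, y) - a' y / L)"
          using L_pos by (auto intro!: continuous_intros ca' continuous_on_slice2[OF cfy x])
        show "((\<lambda>y. g (x, y)) has_real_derivative fy (x, y) - a' y / L) (at y within {0..H})"
          if "y \<in> {0..H}" for y
          unfolding g_def using L_pos by (auto intro!: derivative_eq_intros dy da x that)
        have "a 0 = 0" "a H = 0"
          using integral_cong[of "{0..L}" "\<lambda>x. f (x, 0)" "\<lambda>_. 0"]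
            integral_cong[of "{0..L}" "\<lambda>x. f (x, H)" "\<lambda>_. 0"] bd
          unfolding a_def by simp_all
        then show "g (x, 0) = 0" "g (x, H) = 0" using bd[OF x] by (simp_all add: g_def)
      qed
      then show ?thesis by (simp add: g1_def algebra_simps)
    qed
    have cgy: "continuous_on cell (\<lambda>z. fy z - a' (snd z) / L)"
      using L_pos by (auto intro!: continuous_intros cfy cy ca')
    have "?r\<^sup>2 * 4 * cint (\<lambda>z. (g z)\<^sup>2) - ?r\<^sup>2 * (6 / H) * K1
       = integral {0..L} (\<lambda>x. ?r\<^sup>2 * 4 * integral {0..H} (\<lambda>y. (g (x, y))\<^sup>2) - ?r\<^sup>2 * (6 / H) * (g1 x)\<^sup>2)"
      unfolding K1_def by (rule minus_x[OF cg cg1, symmetric])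
    also have "\<dots> \<le> integral {0..L} (\<lambda>x. 1 * integral {0..H} (\<lambda>y. (fy (x, y) - a' y / L)\<^sup>2) - 0 * 0\<^sup>2)"
    proof -
      have 1: "continuous_on {0..L} (\<lambda>x. integral {0..H} (\<lambda>y. (g (x, y))\<^sup>2))"
        by (rule continuous_on_integral2[of "\<lambda>z. (g z)\<^sup>2"]) (intro continuous_intros cg)
      have 2: "continuous_on {0..L} (\<lambda>x. integral {0..H} (\<lambda>y. (fy (x, y) - a' y / L)\<^sup>2))"
        by (rule continuous_on_integral2[of "\<lambda>z. (fy z - a' (snd z) / L)\<^sup>2", unfolded snd_conv])
           (intro continuous_on_power cgy)
      show ?thesis
        using H_pos by (intro integral_le integrable_continuous_real pt) (auto intro!: continuous_intros 1 2 cg1)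
    qed
    also have "\<dots> = 1 * cint (\<lambda>z. (fy z - a' (snd z) / L)\<^sup>2) - 0 * integral {0..L} (\<lambda>x. 0\<^sup>2)"
      using minus_x[OF cgy, of "\<lambda>_. 0" 1 0] by simp
    finally show ?thesis unfolding Gy G0 by (simp add: algebra_simps)
  qed
  have D1: "2 / H * K1 \<le> G0"
  proof -
    have "2 / H * K1 = integral {0..L} (\<lambda>x. 2 / H * (g1 x)\<^sup>2)" by (simp add: K1_def)
    also have "\<dots> \<le> integral {0..L} (\<lambda>x. integral {0..H} (\<lambda>y. (g (x, y))\<^sup>2))"
    proof (intro integral_le integrable_continuous_real continuous_on_integral2[of "\<lambda>z. (g z)\<^sup>2"] continuous_intros cg cg1)
      show "2 / H * (g1 x)\<^sup>2 \<le> integral {0..H} (\<lambda>y. (g (x, y))\<^sup>2)" if "x \<in> {0..L}" for x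
        unfolding g1_def by (rule sin_bessel[OF H_pos continuous_on_slice2[OF cg that]])
    qed
    also have "\<dots> = G0" unfolding G0[symmetric]
      by (rule cint_iterated[symmetric]) (intro continuous_intros cg)
    finally show ?thesis .
  qed

  define c where "c y = integral {0..L} (\<lambda>x. f (x, y) * cos (?k * x))" for y
  define s where "s y = integral {0..L} (\<lambda>x. f (x, y) * sin (?k * x))" for y
  have cc: "continuous_on {0..H} c" unfolding c_def
    by (rule continuous_on_integral1[of "\<lambda>z. f z * cos (?k * fst z)", unfolded fst_conv snd_conv])
       (intro continuous_intros cf trig)
  have cs: "continuous_on {0..H} s" unfolding s_def
    by (rule continuous_on_integral1[of "\<lambda>z. f z * sin (?k * fst z)", unfolded fst_conv snd_conv])
       (intro continuous_intros cf trig)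
  define K2 where "K2 = integral {0..H} (\<lambda>y. (c y)\<^sup>2 + (s y)\<^sup>2)"
  have Ic: "?k\<^sup>2 * (4 * G0 - 6 / L * K2) \<le> cint (\<lambda>z. (fx z)\<^sup>2)"
  proof -
    have pt: "?k\<^sup>2 * (4 * (integral {0..L} (\<lambda>x. (f (x, y))\<^sup>2) - ((a y)\<^sup>2 / L + 3 / (2 * L) * ((c y)\<^sup>2 + (s y)\<^sup>2))))
       \<le> integral {0..L} (\<lambda>x. (fx (x, y))\<^sup>2)" if y: "y \<in> {0..H}" for y
    proof -
      have "?k\<^sup>2 * (4 * integral {0..L} (\<lambda>x. (f (x, y))\<^sup>2) - 4 / L * (integral {0..L} (\<lambda>x. f (x, y)))\<^sup>2
      - 6 / L * ((integral {0..L} (\<lambda>x. f (x, y) * cos (?k * x)))\<^sup>2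
               + (integral {0..L} (\<lambda>x. f (x, y) * sin (?k * x)))\<^sup>2))
        \<le> integral {0..L} (\<lambda>x. (fx (x, y))\<^sup>2)"
        by (rule spectral_gap_periodic[OF L_pos]) (use dx per y cfx in \<open>auto intro!: continuous_on_slice1\<close>)
      then show ?thesis by (simp add: a_def c_def s_def algebra_simps)
    qed
    have "?k\<^sup>2 * (4 * G0 - 6 / L * K2)
      = ?k\<^sup>2 * (4 * integral {0..H} (\<lambda>y. integral {0..L} (\<lambda>x. (f (x, y))\<^sup>2) - ((a y)\<^sup>2 / L + 3 / (2 * L) * ((c y)\<^sup>2 + (s y)\<^sup>2))))"
    proof -
      have cA: "continuous_on {0..H} (\<lambda>y. (a y)\<^sup>2 / L)"
        using L_pos by (auto intro!: continuous_intros ca)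
      have cK: "continuous_on {0..H} (\<lambda>y. 3 / (2 * L) * ((c y)\<^sup>2 + (s y)\<^sup>2))"
        by (intro continuous_intros cc cs)
      have "integral {0..H} (\<lambda>y. integral {0..L} (\<lambda>x. (f (x, y))\<^sup>2) - ((a y)\<^sup>2 / L + 3 / (2 * L) * ((c y)\<^sup>2 + (s y)\<^sup>2)))
        = cint (\<lambda>z. (f z)\<^sup>2) - integral {0..H} (\<lambda>y. (a y)\<^sup>2 / L + 3 / (2 * L) * ((c y)\<^sup>2 + (s y)\<^sup>2))"
        by (rule minus_y) (intro cf continuous_on_add cA cK)+
      also have "integral {0..H} (\<lambda>y. (a y)\<^sup>2 / L + 3 / (2 * L) * ((c y)\<^sup>2 + (s y)\<^sup>2))
        = integral {0..H} (\<lambda>y. (a y)\<^sup>2 / L) + integral {0..H} (\<lambda>y. 3 / (2 * L) * ((c y)\<^sup>2 + (s y)\<^sup>2))"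
        by (intro integral_add integrable_continuous_real cA cK)
      also have "\<dots> = A / L + 3 / (2 * L) * K2" by (simp only: A_def K2_def integral_divide integral_mult_right)
      finally have E: "integral {0..H} (\<lambda>y. integral {0..L} (\<lambda>x. (f (x, y))\<^sup>2) - ((a y)\<^sup>2 / L + 3 / (2 * L) * ((c y)\<^sup>2 + (s y)\<^sup>2)))
        = cint (\<lambda>z. (f z)\<^sup>2) - (A / L + 3 / (2 * L) * K2)" .
      show ?thesis unfolding E G0_def by (simp add: algebra_simps)
    qed
    also have "\<dots> = integral {0..H} (\<lambda>y. ?k\<^sup>2 * (4 * (integral {0..L} (\<lambda>x. (f (x, y))\<^sup>2) - ((a y)\<^sup>2 / L + 3 / (2 * L) * ((c y)\<^sup>2 + (s y)\<^sup>2)))))"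
      by (simp only: integral_mult_right)
    also have "\<dots> \<le> integral {0..H} (\<lambda>y. integral {0..L} (\<lambda>x. (fx (x, y))\<^sup>2))"
      using L_pos by (intro integral_le integrable_continuous_real pt)
        (auto intro!: continuous_intros continuous_on_integral1[of "\<lambda>z. (f z)\<^sup>2"] continuous_on_integral1[of "\<lambda>z. (fx z)\<^sup>2"] cf cfx ca cc cs)
    also have "\<dots> = cint (\<lambda>z. (fx z)\<^sup>2)"
      by (rule cint_iterated_swap[symmetric]) (intro continuous_intros cfx)
    finally show ?thesis .
  qed

  define C where "C = cint (\<lambda>z. f z * e3 z)"
  define S where "S = cint (\<lambda>z. f z * e4 z)"
  have G1: "G1 = 4 / (L * H) * (C\<^sup>2 + S\<^sup>2)" by (simp add: G1_def C_def S_def)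
  have gc: "integral {0..L} (\<lambda>x. g (x, y) * cos (?k * x)) = c y" "integral {0..L} (\<lambda>x. g (x, y) * sin (?k * x)) = s y"
    if y: "y \<in> {0..H}" for y
  proof -
    have "integral {0..L} (\<lambda>x. g (x, y) * u x) = integral {0..L} (\<lambda>x. f (x, y) * u x)"
      if u: "continuous_on {0..L} u" "integral {0..L} u = 0" for u
    proof -
      have "integral {0..L} (\<lambda>x. g (x, y) * u x) = integral {0..L} (\<lambda>x. f (x, y) * u x - a y / L * u x)"
        by (simp add: g_def algebra_simps)
      also have "\<dots> = integral {0..L} (\<lambda>x. f (x, y) * u x) - integral {0..L} (\<lambda>x. a y / L * u x)"
        by (intro integral_diff integrable_continuous_real continuous_intros continuous_on_slice1[OF cf y] u)
      finally show ?thesis using u by simp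
    qed
    then show "integral {0..L} (\<lambda>x. g (x, y) * cos (?k * x)) = c y" "integral {0..L} (\<lambda>x. g (x, y) * sin (?k * x)) = s y"
      using perL(1,2) trig(1,2)[of "{0..L}" "\<lambda>x. x"] by (simp_all add: c_def s_def)
  qed
  have g1c: "integral {0..L} (\<lambda>x. g1 x * u x) = integral {0..H} (\<lambda>y. integral {0..L} (\<lambda>x. g (x, y) * u x) * sin (?r * y))"
    if u: "continuous_on {0..L} u" for u
  proof -
    have cgu: "continuous_on cell (\<lambda>z. g z * u (fst z) * sin (?r * snd z))"
      by (intro continuous_intros cg cx[OF u] trig)
    have "integral {0..L} (\<lambda>x. g1 x * u x) = integral {0..L} (\<lambda>x. integral {0..H} (\<lambda>y. g (x, y) * u x * sin (?r * y)))"
      unfolding g1_def by (simp add: mult_ac flip: integral_mult_left)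
    also have "\<dots> = integral {0..H} (\<lambda>y. integral {0..L} (\<lambda>x. g (x, y) * u x * sin (?r * y)))"
      using cint_iterated[OF cgu] cint_iterated_swap[OF cgu] by simp
    finally show ?thesis by simp
  qed
  have cu: "continuous_on {0..L} (\<lambda>x. cos (?k * x))" "continuous_on {0..L} (\<lambda>x. sin (?k * x))"
    by (intro trig continuous_on_id)+
  have C: "integral {0..L} (\<lambda>x. g1 x * cos (?k * x)) = C"
  proof -
    have "integral {0..L} (\<lambda>x. g1 x * cos (?k * x)) = integral {0..H} (\<lambda>y. c y * sin (?r * y))"
      unfolding g1c[OF cu(1)] by (rule integral_cong) (simp only: gc)
    also have "\<dots> = integral {0..H} (\<lambda>y. integral {0..L} (\<lambda>x. f (x, y) * cos (?k * x) * sin (?r * y)))"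
      unfolding c_def by (simp only: integral_mult_left)
    also have "\<dots> = integral {0..H} (\<lambda>y. integral {0..L} (\<lambda>x. f (x, y) * e3 (x, y)))"
      by (simp only: fst_conv snd_conv mult_ac)
    also have "\<dots> = C"
      unfolding C_def by (rule cint_iterated_swap[symmetric]) (intro continuous_intros cf trig)
    finally show ?thesis .
  qed
  have S: "integral {0..L} (\<lambda>x. g1 x * sin (?k * x)) = S"
  proof -
    have "integral {0..L} (\<lambda>x. g1 x * sin (?k * x)) = integral {0..H} (\<lambda>y. s y * sin (?r * y))"
      unfolding g1c[OF cu(2)] by (rule integral_cong) (simp only: gc)
    also have "\<dots> = integral {0..H} (\<lambda>y. integral {0..L} (\<lambda>x. f (x, y) * sin (?k * x) * sin (?r * y)))"
      unfolding s_def by (simp only: integral_mult_left)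
    also have "\<dots> = integral {0..H} (\<lambda>y. integral {0..L} (\<lambda>x. f (x, y) * e4 (x, y)))"
      by (simp only: fst_conv snd_conv mult_ac)
    also have "\<dots> = S"
      unfolding S_def by (rule cint_iterated_swap[symmetric]) (intro continuous_intros cf trig)
    finally show ?thesis .
  qed
  \<comment> \<open>\<open>q\<close> is \<open>g\<close> without its first harmonic in
    \<open>x\<close>. The projections in \<open>x\<close> and in \<open>y\<close> commute: the sine
    coefficient of \<open>q\<close> is \<open>g1\<close> without its first harmonic.\<close>
  define q where "q z = g z - 2 / L * (c (snd z) * cos (?k * fst z) + s (snd z) * sin (?k * fst z))" for z
  have cq: "continuous_on cell q" unfolding q_def
    by (intro continuous_intros cg cy cc cs trig)
  have q2: "cint (\<lambda>z. (q z)\<^sup>2) = G0 - 2 / L * K2"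
  proof -
    have cgx: "continuous_on {0..H} (\<lambda>y. integral {0..L} (\<lambda>x. (g (x, y))\<^sup>2))"
      by (rule continuous_on_integral1[of "\<lambda>z. (g z)\<^sup>2"]) (intro continuous_intros cg)
    have "cint (\<lambda>z. (q z)\<^sup>2) = integral {0..H} (\<lambda>y. integral {0..L} (\<lambda>x. (q (x, y))\<^sup>2))"
      by (rule cint_iterated_swap) (intro continuous_intros cq)
    also have "\<dots> = integral {0..H} (\<lambda>y. integral {0..L} (\<lambda>x. (g (x, y))\<^sup>2) - 2 / L * ((c y)\<^sup>2 + (s y)\<^sup>2))"
    proof (rule integral_cong)
      fix y assume y: "y \<in> {0..H}"
      show "integral {0..L} (\<lambda>x. (q (x, y))\<^sup>2) = integral {0..L} (\<lambda>x. (g (x, y))\<^sup>2) - 2 / L * ((c y)\<^sup>2 + (s y)\<^sup>2)"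
        using first_harmonic_defect[OF L_pos continuous_on_slice1[OF cg y]]
          unfolding gc[OF y] q_def fst_conv snd_conv .
    qed
    also have "\<dots> = integral {0..H} (\<lambda>y. integral {0..L} (\<lambda>x. (g (x, y))\<^sup>2)) - integral {0..H} (\<lambda>y. 2 / L * ((c y)\<^sup>2 + (s y)\<^sup>2))"
      by (intro integral_diff integrable_continuous_real cgx continuous_intros cc cs)
    also have "integral {0..H} (\<lambda>y. integral {0..L} (\<lambda>x. (g (x, y))\<^sup>2)) = G0"
      unfolding G0[symmetric] by (rule cint_iterated_swap[symmetric]) (intro continuous_intros cg)
    finally show ?thesis by (simp only: K2_def integral_mult_right)
  qed
  have D2: "2 / L * K2 \<le> G0"
    using cint_nonneg[of "\<lambda>z. (q z)\<^sup>2"] cq q2 by (simp add: continuous_intros)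
  define q1 where "q1 x = g1 x - 2 / L * (C * cos (?k * x) + S * sin (?k * x))" for x
  have cq1: "continuous_on {0..L} q1" unfolding q1_def by (intro continuous_intros cg1 cu)
  have q1: "integral {0..H} (\<lambda>y. q (x, y) * sin (?r * y)) = q1 x" if x: "x \<in> {0..L}" for x
  proof -
    have ic: "integral {0..H} (\<lambda>y. c y * sin (?r * y)) = C" "integral {0..H} (\<lambda>y. s y * sin (?r * y)) = S"
      unfolding C[symmetric] S[symmetric] g1c[OF cu(1)] g1c[OF cu(2)]
      by (rule integral_cong, simp only: gc)+
    have ct: "continuous_on {0..H} (\<lambda>y. sin (?r * y))" by (intro trig continuous_on_id)
    have "integral {0..H} (\<lambda>y. q (x, y) * sin (?r * y))
      = integral {0..H} (\<lambda>y. g (x, y) * sin (?r * y) - (2 / L * cos (?k * x) * (c y * sin (?r * y)) + 2 / L * sin (?k * x) * (s y * sin (?r * y))))"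
      by (simp add: q_def algebra_simps)
    also have "\<dots> = g1 x - integral {0..H} (\<lambda>y. 2 / L * cos (?k * x) * (c y * sin (?r * y)) + 2 / L * sin (?k * x) * (s y * sin (?r * y)))"
      unfolding g1_def
      by (intro integral_diff integrable_continuous_real continuous_intros continuous_on_slice2[OF cg x] ct cc cs)
    also have "integral {0..H} (\<lambda>y. 2 / L * cos (?k * x) * (c y * sin (?r * y)) + 2 / L * sin (?k * x) * (s y * sin (?r * y)))
      = integral {0..H} (\<lambda>y. 2 / L * cos (?k * x) * (c y * sin (?r * y))) + integral {0..H} (\<lambda>y. 2 / L * sin (?k * x) * (s y * sin (?r * y)))"
      by (intro integral_add integrable_continuous_real continuous_intros ct cc cs)
    also have "\<dots> = 2 / L * cos (?k * x) * C + 2 / L * sin (?k * x) * S"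
      unfolding integral_mult_right ic ..
    finally show ?thesis by (simp add: q1_def algebra_simps)
  qed
  have q12: "integral {0..L} (\<lambda>x. (q1 x)\<^sup>2) = K1 - 2 / L * (C\<^sup>2 + S\<^sup>2)"
    using first_harmonic_defect[OF L_pos cg1] unfolding q1_def C S K1_def .
  have "2 / H * integral {0..L} (\<lambda>x. (q1 x)\<^sup>2) \<le> cint (\<lambda>z. (q z)\<^sup>2)"
  proof -
    have "2 / H * integral {0..L} (\<lambda>x. (q1 x)\<^sup>2) = integral {0..L} (\<lambda>x. 2 / H * (q1 x)\<^sup>2)" by simp
    also have "\<dots> \<le> integral {0..L} (\<lambda>x. integral {0..H} (\<lambda>y. (q (x, y))\<^sup>2))"
    proof (intro integral_le integrable_continuous_real continuous_on_integral2[of "\<lambda>z. (q z)\<^sup>2"] continuous_intros cq cq1)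
      show "2 / H * (q1 x)\<^sup>2 \<le> integral {0..H} (\<lambda>y. (q (x, y))\<^sup>2)" if "x \<in> {0..L}" for x
        using sin_bessel[OF H_pos continuous_on_slice2[OF cq that]] unfolding q1[OF that] .
    qed
    also have "\<dots> = cint (\<lambda>z. (q z)\<^sup>2)"
      by (rule cint_iterated[symmetric]) (intro continuous_intros cq)
    finally show ?thesis .
  qed
  \<comment> \<open>In other words, \<open>G0 - G1\<close> is at most the part missed by the sine
    projection in \<open>y\<close> plus the part missed by the harmonic projection in
    \<open>x\<close>. Three times these parts, weighted by the squared frequencies, are the
    surpluses contained in \<open>Ib\<close> and \<open>Ic\<close>.\<close>
  then have D12: "2 / H * K1 + 2 / L * K2 - G0 \<le> G1"
    unfolding q2 q12 G1 by (simp add: algebra_simps)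
  have GG: "G1 \<le> G0"
  proof -
    have "0 \<le> integral {0..L} (\<lambda>x. (q1 x)\<^sup>2)"
      by (intro integral_nonneg integrable_continuous_real continuous_intros cq1) auto
    then have "2 / H * (2 / L * (C\<^sup>2 + S\<^sup>2)) \<le> 2 / H * K1"
      unfolding q12 using H_pos by (intro mult_left_mono) auto
    then show ?thesis using D1 by (simp add: G1 mult.commute)
  qed
  have pos: "0 \<le> F1" "0 \<le> G1" using L_pos H_pos by (auto simp: F1_def G1_def)
  have "min (3 * ?r\<^sup>2) (3 * ?k\<^sup>2) * (G0 - G1)
     \<le> min (3 * ?r\<^sup>2) (3 * ?k\<^sup>2) * (G0 - 2 / H * K1) + min (3 * ?r\<^sup>2) (3 * ?k\<^sup>2) * (G0 - 2 / L * K2)"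
    unfolding distrib_left[symmetric] using D12 by (intro mult_left_mono) auto
  also have "\<dots> \<le> 3 * ?r\<^sup>2 * (G0 - 2 / H * K1) + 3 * ?k\<^sup>2 * (G0 - 2 / L * K2)"
    using D1 D2 by (intro add_mono mult_right_mono) auto
  finally have "?\<nu>\<^sup>2 * F0 + 3 * ?\<nu>\<^sup>2 * (F0 - F1) + (?r\<^sup>2 + ?k\<^sup>2) * G0 + min (3 * ?r\<^sup>2) (3 * ?k\<^sup>2) * (G0 - G1)
    \<le> cint (\<lambda>z. (fx z)\<^sup>2) + cint (\<lambda>z. (fy z)\<^sup>2)"
    using Ia' Ib Ic by (simp add: algebra_simps)
  moreover have "F0 + G0 = cint (\<lambda>z. (f z)\<^sup>2) - (cint f)\<^sup>2 / (L * H)"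
    using L_pos H_pos by (simp add: F0_def G0_def field_simps)
  ultimately show ?thesis
    using FF GG pos by (intro exI[of _ F0] exI[of _ G0]) auto
qed

end

subsection \<open>Sobolev bounds for stream functions\<close>

text \<open>Young's inequality with an even integer replacing the conjugate exponent
  \<open>1 + 1 / (p - 1)\<close>, so that stream functions have to be estimated in integer powers
  only. The summand 1 covers \<open>a \<le> 1\<close>.\<close>

lemma mult_le_powr_plus_even_power:
  fixes a s p :: real
  assumes "0 \<le> a" "0 \<le> s" "1 < p" and n: "1 + 1 / (p - 1) \<le> real (2 * n)"
  shows "a * s \<le> s powr p + 1 + a ^ (2 * n)"
proof (cases "a \<le> s powr (p - 1)")
  case True
  then have "a * s \<le> s powr (p - 1) * s"
    using assms by (intro mult_right_mono) auto
  also have "\<dots> = s powr p"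
    using assms powr_mult_base[of s "p - 1"] by (simp add: mult.commute)
  finally show ?thesis using assms by (simp add: add_increasing2)
next
  case False
  then have a: "0 < a" using powr_ge_zero[of s "p - 1"] by linarith
  have "s = (s powr (p - 1)) powr (1 / (p - 1))"
    using assms by (simp add: powr_powr)
  also have "\<dots> \<le> a powr (1 / (p - 1))"
    using False assms by (intro powr_mono2) auto
  finally have "a * s \<le> a * a powr (1 / (p - 1))"
    using a by (intro mult_left_mono) auto
  also have "\<dots> = a powr (1 + 1 / (p - 1))"
    using a by (simp add: powr_mult_base)
  also have "\<dots> \<le> 1 + a ^ (2 * n)"
  proof (cases "a \<le> 1")
    case True
    have "a powr (1 + 1 / (p - 1)) \<le> 1 powr (1 + 1 / (p - 1))"
      using a True assms by (intro powr_mono2) auto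
    then show ?thesis by (simp add: add_increasing2)
  next
    case False
    then have "a powr (1 + 1 / (p - 1)) \<le> a powr real (2 * n)"
      using n by (intro powr_mono) auto
    also have "\<dots> = a ^ (2 * n)" using a by (rule powr_realpow)
    finally show ?thesis by simp
  qed
  finally show ?thesis using powr_ge_zero[of s p] by linarith
qed

context channel
begin

lemma box_cell_nonempty: "box (0, 0) (L, H) \<noteq> {}"
  using L_pos H_pos by (auto simp: box_ne_empty Basis_prod_def)

lemma cint_sq_nonneg:
  assumes "continuous_on cell u"
  shows "0 \<le> cint (\<lambda>z. (u z)\<^sup>2)"
  using assms by (intro cint_nonneg continuous_intros) auto

lemma cint_cauchy_schwarz:
  assumes u: "continuous_on cell u" and v: "continuous_on cell v"
  shows "(cint (\<lambda>z. u z * v z))\<^sup>2 \<le> cint (\<lambda>z. (u z)\<^sup>2) * cint (\<lambda>z. (v z)\<^sup>2)"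
proof (cases "cint (\<lambda>z. (v z)\<^sup>2) = 0")
  case True
  have "\<forall>z\<in>cell. (v z)\<^sup>2 = 0"
    using integral_cbox_eq_0_iff[of "(0,0)" "(L,H)" "\<lambda>z. (v z)\<^sup>2"] True v box_cell_nonempty
    by (auto simp: continuous_intros)
  then have "cint (\<lambda>z. u z * v z) = cint (\<lambda>_. 0)" by (intro cint_cong) auto
  then show ?thesis using True by simp
next
  case False
  then have pos: "0 < cint (\<lambda>z. (v z)\<^sup>2)" using cint_sq_nonneg[OF v] by linarith
  have "(\<Sum>i\<in>{()}. (cint (\<lambda>z. u z * v z))\<^sup>2 / cint (\<lambda>z. (v z)\<^sup>2)) \<le> cint (\<lambda>z. (u z)\<^sup>2)"
    using pos by (intro bessel_inequality u v) (auto simp: power2_eq_square)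
  then show ?thesis using pos by (simp add: field_simps)
qed

text \<open>Gagliardo--Nirenberg argument applied to \<open>w = f\<^sup>n\<^sup>+\<^sup>1\<close>: \<open>w\<^sup>2\<close> is bounded by
  a function of \<open>x\<close> times a function of \<open>y\<close>.\<close>

lemma stream_power_step:
  assumes st: "stream f fx fy"
  shows "cint (\<lambda>z. f z ^ (2 * Suc n))
     \<le> 2 * (1 + H / L) * (real (Suc n))\<^sup>2 * (cint (\<lambda>z. (fx z)\<^sup>2) + cint (\<lambda>z. (fy z)\<^sup>2)) * cint (\<lambda>z. f z ^ (2 * n))"
proof -
  have cf: "continuous_on cell f" and cfx: "continuous_on cell fx" and cfy: "continuous_on cell fy"
    and dx: "\<And>x y. x \<in> {0..L} \<Longrightarrow> y \<in> {0..H} \<Longrightarrow> ((\<lambda>s. f (s, y)) has_real_derivative fx (x, y)) (at x within {0..L})"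
    and dy: "\<And>x y. x \<in> {0..L} \<Longrightarrow> y \<in> {0..H} \<Longrightarrow> ((\<lambda>s. f (x, s)) has_real_derivative fy (x, y)) (at y within {0..H})"
    and bd: "\<And>x. x \<in> {0..L} \<Longrightarrow> f (x, 0) = 0"
    using st unfolding stream_def by blast+
  define w where "w z = f z ^ Suc n" for z
  define wx where "wx z = real (Suc n) * f z ^ n * fx z" for z
  define wy where "wy z = real (Suc n) * f z ^ n * fy z" for z
  have cw: "continuous_on cell w" and cwx: "continuous_on cell wx" and cwy: "continuous_on cell wy"
    unfolding w_def[abs_def] wx_def wy_def by (intro continuous_intros cf cfx cfy)+
  have wdx: "((\<lambda>s. w (s, y)) has_real_derivative wx (x, y)) (at x within {0..L})"
    if "x \<in> {0..L}" "y \<in> {0..H}" for x y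
    unfolding w_def wx_def by (rule DERIV_power[OF dx[OF that], of "Suc n", THEN DERIV_cong]) simp
  have wdy: "((\<lambda>s. w (x, s)) has_real_derivative wy (x, y)) (at y within {0..H})"
    if "x \<in> {0..L}" "y \<in> {0..H}" for x y
    unfolding w_def wy_def by (rule DERIV_power[OF dy[OF that], of "Suc n", THEN DERIV_cong]) simp
  have osc: "\<bar>u t - u s\<bar> \<le> integral {0..b} (\<lambda>r. \<bar>u' r\<bar>)"
    if u: "\<And>r. r \<in> {0..b} \<Longrightarrow> (u has_real_derivative u' r) (at r within {0..b})"
      and cu: "continuous_on {0..b} u'" and st: "0 \<le> s" "s \<le> t" "t \<le> b" for u u' :: "real \<Rightarrow> real" and b s t
  proof -
    have cu': "continuous_on {s..t} u'" by (rule continuous_on_subset[OF cu]) (use st in auto)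
    have "u t - u s = integral {s..t} u'"
      by (rule integral_deriv_within[symmetric]) (use st in \<open>auto intro: DERIV_subset[OF u]\<close>)
    also have "\<bar>\<dots>\<bar> \<le> integral {s..t} (\<lambda>r. \<bar>u' r\<bar>)"
      using integral_norm_bound_integral[of u' "{s..t}" "\<lambda>r. \<bar>u' r\<bar>"] cu'
      by (simp add: integrable_continuous_real continuous_intros)
    also have "\<dots> \<le> integral {0..b} (\<lambda>r. \<bar>u' r\<bar>)"
      using st cu cu' by (intro integral_subset_le integrable_continuous_real continuous_intros) auto
    finally show ?thesis .
  qed
  have osc': "\<bar>u t - u s\<bar> \<le> integral {0..b} (\<lambda>r. \<bar>u' r\<bar>)"
    if "\<And>r. r \<in> {0..b} \<Longrightarrow> (u has_real_derivative u' r) (at r within {0..b})"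
      "continuous_on {0..b} u'" "s \<in> {0..b}" "t \<in> {0..b}" for u u' :: "real \<Rightarrow> real" and b s t
    using osc[OF that(1,2), of s t] osc[OF that(1,2), of t s] that(3,4)
    by (cases "s \<le> t") (auto simp: abs_minus_commute)
  define A where "A x = integral {0..H} (\<lambda>y. \<bar>wy (x, y)\<bar>)" for x
  define R where "R y = integral {0..L} (\<lambda>x. \<bar>wx (x, y)\<bar>)" for y
  define W where "W y = integral {0..L} (\<lambda>x. \<bar>w (x, y)\<bar>)" for y
  have cA: "continuous_on {0..L} A" unfolding A_def
    by (rule continuous_on_integral2[of "\<lambda>z. \<bar>wy z\<bar>"]) (intro continuous_intros cwy)
  have cR: "continuous_on {0..H} R" unfolding R_def
    by (rule continuous_on_integral1[of "\<lambda>z. \<bar>wx z\<bar>"]) (intro continuous_intros cwx)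
  have cW: "continuous_on {0..H} W" unfolding W_def
    by (rule continuous_on_integral1[of "\<lambda>z. \<bar>w z\<bar>"]) (intro continuous_intros cw)
  have wA: "\<bar>w (x, y)\<bar> \<le> A x" if "x \<in> {0..L}" "y \<in> {0..H}" for x y
    using osc'[of H "\<lambda>s. w (x, s)" "\<lambda>s. wy (x, s)" 0 y] wdy continuous_on_slice2[OF cwy] that H_pos bd
    by (simp add: A_def w_def)
  \<comment> \<open>No wall bounds the \<open>x\<close> direction, so \<open>w\<close> is compared
    with its mean over a period rather than with a zero.\<close>
  have wR: "\<bar>w (x, y)\<bar> \<le> W y / L + R y" if xy: "x \<in> {0..L}" "y \<in> {0..H}" for x y
  proof -
    have "\<bar>w (x, y)\<bar> * L = integral {0..L} (\<lambda>s. \<bar>w (x, y)\<bar>)" using L_pos by simp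
    also have "\<dots> \<le> integral {0..L} (\<lambda>s. \<bar>w (s, y)\<bar> + R y)"
    proof (intro integral_le integrable_continuous_real continuous_intros continuous_on_slice1 cw xy)
      fix s assume s: "s \<in> {0..L}"
      have "\<bar>w (x, y) - w (s, y)\<bar> \<le> R y"
        unfolding R_def
        by (rule osc'[of L "\<lambda>s. w (s, y)" "\<lambda>s. wx (s, y)"]) (use wdx continuous_on_slice1[OF cwx] xy s in auto)
      then show "\<bar>w (x, y)\<bar> \<le> \<bar>w (s, y)\<bar> + R y" by linarith
    qed
    also have "\<dots> = W y + L * R y"
      unfolding W_def using L_pos
      by (subst integral_add)
         (auto intro!: integrable_continuous_real continuous_intros continuous_on_slice1 cw xy)
    finally show ?thesis using L_pos by (simp add: field_simps)
  qed
  define S where "S = cint (\<lambda>z. \<bar>wx z\<bar> + \<bar>wy z\<bar>)"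
  have iA: "integral {0..L} A = cint (\<lambda>z. \<bar>wy z\<bar>)" unfolding A_def
    by (rule cint_iterated[symmetric]) (intro continuous_intros cwy)
  have iR: "integral {0..H} R = cint (\<lambda>z. \<bar>wx z\<bar>)" unfolding R_def
    by (rule cint_iterated_swap[symmetric]) (intro continuous_intros cwx)
  have iW: "integral {0..H} W = cint (\<lambda>z. \<bar>w z\<bar>)" unfolding W_def
    by (rule cint_iterated_swap[symmetric]) (intro continuous_intros cw)
  have A0: "0 \<le> integral {0..L} A" unfolding iA by (intro cint_nonneg continuous_intros cwy) auto
  have AS: "integral {0..L} A \<le> S" unfolding iA S_def by (intro cint_mono continuous_intros cwx cwy) auto
  have RS: "integral {0..H} R \<le> S" unfolding iR S_def by (intro cint_mono continuous_intros cwx cwy) auto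
  \<comment> \<open>The mean over \<open>x\<close> is controlled by the vertical derivative through
    \<open>wA\<close>; this is the origin of the term \<open>H / L\<close>.\<close>
  have WA: "integral {0..H} W \<le> H * integral {0..L} A"
  proof -
    have cw': "continuous_on cell (\<lambda>z. \<bar>w z\<bar>)" by (intro continuous_intros cw)
    have "cint (\<lambda>z. \<bar>w z\<bar>) = integral {0..L} (\<lambda>x. integral {0..H} (\<lambda>y. \<bar>w (x, y)\<bar>))"
      by (rule cint_iterated[OF cw'])
    also have "\<dots> \<le> integral {0..L} (\<lambda>x. H * A x)"
    proof (intro integral_le integrable_continuous_real continuous_intros cA continuous_on_integral2[OF cw'])
      fix x assume x: "x \<in> {0..L}"
      have "integral {0..H} (\<lambda>y. \<bar>w (x, y)\<bar>) \<le> integral {0..H} (\<lambda>y. A x)"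
        by (intro integral_le integrable_continuous_real continuous_intros continuous_on_slice2[OF cw'] x wA)
      then show "integral {0..H} (\<lambda>y. \<bar>w (x, y)\<bar>) \<le> H * A x" using H_pos by simp
    qed
    finally show ?thesis unfolding iW by simp
  qed
  have "cint (\<lambda>z. f z ^ (2 * Suc n)) = cint (\<lambda>z. (w z)\<^sup>2)"
    by (simp only: w_def power_mult[symmetric] mult.commute[of 2])
  also have "\<dots> = integral {0..L} (\<lambda>x. integral {0..H} (\<lambda>y. (w (x, y))\<^sup>2))"
    by (rule cint_iterated) (intro continuous_intros cw)
  also have "\<dots> \<le> integral {0..L} (\<lambda>x. A x * integral {0..H} (\<lambda>y. W y / L + R y))"
  proof (intro integral_le integrable_continuous_real continuous_intros cA continuous_on_integral2[of "\<lambda>z. (w z)\<^sup>2"] cw)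
    fix x assume x: "x \<in> {0..L}"
    have "integral {0..H} (\<lambda>y. (w (x, y))\<^sup>2) \<le> integral {0..H} (\<lambda>y. A x * (W y / L + R y))"
    proof (intro integral_le integrable_continuous_real)
      show "continuous_on {0..H} (\<lambda>y. (w (x, y))\<^sup>2)"
        by (intro continuous_intros continuous_on_slice2[OF cw] x)
      show "continuous_on {0..H} (\<lambda>y. A x * (W y / L + R y))"
        using L_pos by (auto intro!: continuous_intros cW cR)
      fix y assume y: "y \<in> {0..H}"
      have "(w (x, y))\<^sup>2 = \<bar>w (x, y)\<bar> * \<bar>w (x, y)\<bar>" by (simp add: power2_eq_square)
      also have "\<dots> \<le> A x * (W y / L + R y)"
        using wA[OF x y] wR[OF x y] by (intro mult_mono) auto
      finally show "(w (x, y))\<^sup>2 \<le> A x * (W y / L + R y)" .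
    qed
    then show "integral {0..H} (\<lambda>y. (w (x, y))\<^sup>2) \<le> A x * integral {0..H} (\<lambda>y. W y / L + R y)" by simp
  qed
  also have "\<dots> = integral {0..L} A * (integral {0..H} W / L + integral {0..H} R)"
    using L_pos
    by (subst integral_add) (auto intro!: integrable_continuous_real continuous_intros cW cR)
  also have "\<dots> \<le> S * (H / L * S + S)"
  proof -
    have "integral {0..H} W \<le> H * S" using WA AS H_pos by (meson mult_left_mono less_imp_le order_trans)
    then have "integral {0..H} W / L \<le> H * S / L" using L_pos by (intro divide_right_mono) auto
    moreover have "0 \<le> S" using A0 AS by simp
    moreover have "0 \<le> integral {0..H} W" unfolding iW by (intro cint_nonneg continuous_intros cw) auto
    moreover have "0 \<le> integral {0..H} R" unfolding iR by (intro cint_nonneg continuous_intros cwx) auto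
    ultimately show ?thesis using AS RS A0 L_pos by (intro mult_mono add_mono add_nonneg_nonneg) auto
  qed
  also have "\<dots> = (1 + H / L) * S\<^sup>2" by (simp add: power2_eq_square algebra_simps)
  also have "\<dots> \<le> (1 + H / L) * ((real (Suc n))\<^sup>2 * (cint (\<lambda>z. f z ^ (2 * n)) *
      (2 * (cint (\<lambda>z. (fx z)\<^sup>2) + cint (\<lambda>z. (fy z)\<^sup>2)))))"
  proof (intro mult_left_mono)
    \<comment> \<open>The chain rule leaves \<open>\<bar>f\<bar> ^ n\<close> in front of the
      gradient; Cauchy-Schwarz separates it from the Dirichlet energy.\<close>
    have "S = cint (\<lambda>z. real (Suc n) * (\<bar>f z\<bar> ^ n * (\<bar>fx z\<bar> + \<bar>fy z\<bar>)))"
      unfolding S_def by (rule cint_cong) (simp only: wx_def wy_def abs_mult power_abs distrib_left abs_of_nat mult.assoc)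
    also have "\<dots> = real (Suc n) * cint (\<lambda>z. \<bar>f z\<bar> ^ n * (\<bar>fx z\<bar> + \<bar>fy z\<bar>))" by simp
    finally have "S\<^sup>2 = (real (Suc n))\<^sup>2 * (cint (\<lambda>z. \<bar>f z\<bar> ^ n * (\<bar>fx z\<bar> + \<bar>fy z\<bar>)))\<^sup>2"
      by (simp add: power_mult_distrib)
    also have "\<dots> \<le> (real (Suc n))\<^sup>2 * (cint (\<lambda>z. (\<bar>f z\<bar> ^ n)\<^sup>2) * cint (\<lambda>z. (\<bar>fx z\<bar> + \<bar>fy z\<bar>)\<^sup>2))"
      by (intro mult_left_mono cint_cauchy_schwarz continuous_intros cf cfx cfy) auto
    also have "cint (\<lambda>z. (\<bar>f z\<bar> ^ n)\<^sup>2) = cint (\<lambda>z. f z ^ (2 * n))"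
      by (simp add: power_mult[symmetric] power_even_abs mult.commute[of n])
    also have "cint (\<lambda>z. (\<bar>fx z\<bar> + \<bar>fy z\<bar>)\<^sup>2) \<le> cint (\<lambda>z. 2 * ((fx z)\<^sup>2 + (fy z)\<^sup>2))"
    proof (intro cint_mono continuous_intros cfx cfy)
      show "(\<bar>fx z\<bar> + \<bar>fy z\<bar>)\<^sup>2 \<le> 2 * ((fx z)\<^sup>2 + (fy z)\<^sup>2)" for z
        using sum_squares_bound[of "\<bar>fx z\<bar>" "\<bar>fy z\<bar>"] by (simp add: power2_sum)
    qed
    also have "\<dots> = 2 * (cint (\<lambda>z. (fx z)\<^sup>2) + cint (\<lambda>z. (fy z)\<^sup>2))"
      unfolding integral_mult_right by (subst cint_add) (auto intro!: continuous_intros cfx cfy)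
    finally show "S\<^sup>2 \<le> (real (Suc n))\<^sup>2 * (cint (\<lambda>z. f z ^ (2 * n)) *
      (2 * (cint (\<lambda>z. (fx z)\<^sup>2) + cint (\<lambda>z. (fy z)\<^sup>2))))"
      using cint_nonneg[of "\<lambda>z. f z ^ (2 * n)"] cf
      by (simp add: mult_left_mono continuous_intros)
  qed (use L_pos H_pos in auto)
  finally show ?thesis by (simp only: mult_ac)
qed

text \<open>Each power step trades two powers of \<open>f\<close> for one factor of the Dirichlet
  energy, and the recursion ends with the area of the cell. A uniform bound for \<open>f\<close>
  cannot be had from the energy in two dimensions.\<close>

lemma stream_even_power_bound:
  "\<exists>C\<ge>0. \<forall>f fx fy. stream f fx fy \<longrightarrow>
     cint (\<lambda>z. f z ^ (2 * n)) \<le> C * (cint (\<lambda>z. (fx z)\<^sup>2) + cint (\<lambda>z. (fy z)\<^sup>2)) ^ n"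
proof (induction n)
  case 0
  show ?case using L_pos H_pos by (intro exI[of _ "L * H"]) (auto simp: content_Pair)
next
  case (Suc n)
  then obtain C where C: "C \<ge> 0" "\<And>f fx fy. stream f fx fy \<Longrightarrow>
     cint (\<lambda>z. f z ^ (2 * n)) \<le> C * (cint (\<lambda>z. (fx z)\<^sup>2) + cint (\<lambda>z. (fy z)\<^sup>2)) ^ n" by blast
  let ?K = "2 * (1 + H / L) * (real (Suc n))\<^sup>2"
  have K: "?K \<ge> 0" using L_pos H_pos by simp
  show ?case
  proof (intro exI[of _ "?K * C"] conjI allI impI)
    fix f fx fy assume st: "stream f fx fy"
    let ?X = "cint (\<lambda>z. (fx z)\<^sup>2) + cint (\<lambda>z. (fy z)\<^sup>2)"
    have X: "?X \<ge> 0" using st unfolding stream_def by (intro add_nonneg_nonneg cint_sq_nonneg) auto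
    have "cint (\<lambda>z. f z ^ (2 * Suc n)) \<le> ?K * ?X * cint (\<lambda>z. f z ^ (2 * n))"
      by (rule stream_power_step[OF st])
    also have "\<dots> \<le> ?K * ?X * (C * ?X ^ n)"
      by (rule mult_left_mono[OF C(2)[OF st] mult_nonneg_nonneg[OF K X]])
    finally show "cint (\<lambda>z. f z ^ (2 * Suc n)) \<le> ?K * C * ?X ^ Suc n"
      by (simp only: power_Suc mult_ac)
  qed (use K C in simp)
qed

text \<open>Normalising \<open>f\<close> by \<open>X\<close> and \<open>\<rho>\<close> by
  \<open>d\<close> turns the additive Young inequality into a product bound. \<open>X\<close> is a
  positive upper bound for the root of the energy, so that a vanishing energy needs no separate
  case.\<close>

lemma stream_duality_bound:
  assumes p: "1 < p"
  shows "\<exists>C>0. \<forall>f fx fy \<rho> X d. stream f fx fy \<longrightarrow> continuous_on cell \<rho> \<longrightarrow> X > 0 \<longrightarrow> d > 0 \<longrightarrow>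
     cint (\<lambda>z. (fx z)\<^sup>2) + cint (\<lambda>z. (fy z)\<^sup>2) \<le> X\<^sup>2 \<longrightarrow> cint (\<lambda>z. \<bar>\<rho> z\<bar> powr p) \<le> d powr p \<longrightarrow>
     cint (\<lambda>z. \<bar>f z * \<rho> z\<bar>) \<le> C * X * d"
proof -
  obtain n :: nat where n: "1 + 1 / (p - 1) \<le> real n" using real_arch_simple by blast
  then have n: "1 + 1 / (p - 1) \<le> real (2 * n)" by linarith
  obtain C where C: "C \<ge> 0" "\<And>f fx fy. stream f fx fy \<Longrightarrow>
     cint (\<lambda>z. f z ^ (2 * n)) \<le> C * (cint (\<lambda>z. (fx z)\<^sup>2) + cint (\<lambda>z. (fy z)\<^sup>2)) ^ n"
    using stream_even_power_bound by blast
  show ?thesis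
  proof (intro exI[of _ "1 + L * H + C"] conjI allI impI)
    fix f fx fy \<rho> and X d :: real
    assume st: "stream f fx fy" and r: "continuous_on cell \<rho>" and X: "X > 0" and d: "d > 0"
      and XX: "cint (\<lambda>z. (fx z)\<^sup>2) + cint (\<lambda>z. (fy z)\<^sup>2) \<le> X\<^sup>2"
      and rd: "cint (\<lambda>z. \<bar>\<rho> z\<bar> powr p) \<le> d powr p"
    have cf: "continuous_on cell f" and cfx: "continuous_on cell fx" and cfy: "continuous_on cell fy"
      using st by (auto simp: stream_def)
    have cp: "continuous_on cell (\<lambda>z. \<bar>\<rho> z\<bar> powr p)"
      by (rule continuous_on_powr') (use p r in \<open>auto intro!: continuous_intros\<close>)
    have "cint (\<lambda>z. \<bar>f z * \<rho> z\<bar>) = cint (\<lambda>z. X * d * ((\<bar>f z\<bar> / X) * (\<bar>\<rho> z\<bar> / d)))"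
      using X d by (intro cint_cong) (simp add: abs_mult)
    also have "\<dots> = X * d * cint (\<lambda>z. (\<bar>f z\<bar> / X) * (\<bar>\<rho> z\<bar> / d))"
      by (rule integral_mult_right)
    also have "\<dots> \<le> X * d * cint (\<lambda>z. \<bar>\<rho> z\<bar> powr p * (1 / d powr p) + 1 + f z ^ (2 * n) * (1 / X ^ (2 * n)))"
    proof (intro mult_left_mono cint_mono)
      show "continuous_on cell (\<lambda>z. (\<bar>f z\<bar> / X) * (\<bar>\<rho> z\<bar> / d))"
        using X d by (auto intro!: continuous_intros cf r)
      show "continuous_on cell (\<lambda>z. \<bar>\<rho> z\<bar> powr p * (1 / d powr p) + 1 + f z ^ (2 * n) * (1 / X ^ (2 * n)))"
        by (intro continuous_on_add continuous_on_mult cp continuous_on_const continuous_on_power cf)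
      show "(\<bar>f z\<bar> / X) * (\<bar>\<rho> z\<bar> / d) \<le> \<bar>\<rho> z\<bar> powr p * (1 / d powr p) + 1 + f z ^ (2 * n) * (1 / X ^ (2 * n))" for z
        using mult_le_powr_plus_even_power[of "\<bar>f z\<bar> / X" "\<bar>\<rho> z\<bar> / d" p n] X d p n
        by (simp add: powr_divide power_divide power_even_abs)
    qed (use X d in auto)
    also have "cint (\<lambda>z. \<bar>\<rho> z\<bar> powr p * (1 / d powr p) + 1 + f z ^ (2 * n) * (1 / X ^ (2 * n)))
       = cint (\<lambda>z. \<bar>\<rho> z\<bar> powr p) * (1 / d powr p) + L * H + cint (\<lambda>z. f z ^ (2 * n)) * (1 / X ^ (2 * n))"
      unfolding integral_mult_left[symmetric] using cint_const[of 1]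
      by (subst cint_add, (intro continuous_intros cp cf)+)+ simp
    also have "\<dots> \<le> d powr p * (1 / d powr p) + L * H + C * X ^ (2 * n) * (1 / X ^ (2 * n))"
    proof -
      have "0 \<le> cint (\<lambda>z. (fx z)\<^sup>2) + cint (\<lambda>z. (fy z)\<^sup>2)"
        by (intro add_nonneg_nonneg cint_sq_nonneg cfx cfy)
      then have "(cint (\<lambda>z. (fx z)\<^sup>2) + cint (\<lambda>z. (fy z)\<^sup>2)) ^ n \<le> X ^ (2 * n)"
        using XX unfolding power_mult by (intro power_mono)
      then have "cint (\<lambda>z. f z ^ (2 * n)) \<le> C * X ^ (2 * n)"
        using C(2)[OF st] C(1) by (meson mult_left_mono order_trans)
      then show ?thesis using rd X d by (intro add_mono order_refl mult_right_mono) auto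
    qed
    also have "\<dots> = 1 + L * H + C" using X d by simp
    finally show "cint (\<lambda>z. \<bar>f z * \<rho> z\<bar>) \<le> (1 + L * H + C) * X * d"
      using X d by (simp add: mult_ac)
  qed (use C L_pos H_pos in \<open>simp add: add_pos_nonneg\<close>)
qed

end

subsection \<open>Fields on space-time and conservation laws\<close>

lemma real_derivative_unique_Icc:
  fixes f :: "real \<Rightarrow> real"
  assumes "a < b" "x \<in> {a..b}"
    and "(f has_real_derivative D) (at x within {a..b})"
    and "(f has_real_derivative E) (at x within {a..b})"
  shows "D = E"
  using vector_derivative_unique_within_closed_interval[of a b x f D E] assms
  by (simp add: has_real_derivative_iff_has_vector_derivative)

text \<open>Differentiating \<open>f(u,v) = f(a,v) + \<integral>\<^sub>a\<^sup>u \<partial>\<^sub>u f\<close> first in \<open>v\<close> and then in \<open>u\<close>.\<close>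

lemma mixed_partials_commute:
  fixes f :: "real \<Rightarrow> real \<Rightarrow> real"
  assumes ab: "a < b" and cd: "c < d"
    and fu: "\<And>u v. u \<in> {a..b} \<Longrightarrow> v \<in> {c..d} \<Longrightarrow> ((\<lambda>s. f s v) has_real_derivative fu u v) (at u within {a..b})"
    and fv: "\<And>u v. u \<in> {a..b} \<Longrightarrow> v \<in> {c..d} \<Longrightarrow> ((\<lambda>s. f u s) has_real_derivative fv u v) (at v within {c..d})"
    and fuv: "\<And>u v. u \<in> {a..b} \<Longrightarrow> v \<in> {c..d} \<Longrightarrow> ((\<lambda>s. fu u s) has_real_derivative fuv u v) (at v within {c..d})"
    and fvu: "\<And>u v. u \<in> {a..b} \<Longrightarrow> v \<in> {c..d} \<Longrightarrow> ((\<lambda>s. fv s v) has_real_derivative fvu u v) (at u within {a..b})"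
    and cu: "continuous_on ({c..d} \<times> {a..b}) (\<lambda>(v, u). fu u v)"
    and cuv: "continuous_on ({c..d} \<times> {a..b}) (\<lambda>(v, u). fuv u v)"
    and uv: "u \<in> {a..b}" "v \<in> {c..d}"
  shows "fuv u v = fvu u v"
proof -
  have slice: "continuous_on {a..b} (\<lambda>u. g u v)"
    if "continuous_on ({c..d} \<times> {a..b}) (\<lambda>(v, u). g u v)" "v \<in> {c..d}" for g :: "real \<Rightarrow> real \<Rightarrow> real" and v
  proof -
    have "continuous_on {a..b} (\<lambda>u. case (v, u) of (v, u) \<Rightarrow> g u v)"
      by (rule continuous_on_compose2[OF that(1)]) (intro continuous_intros, use that(2) in auto)
    then show ?thesis by simp
  qed
  have fv_eq: "fv u v = fv a v + integral {a..u} (\<lambda>s. fuv s v)" if u: "u \<in> {a..b}" for u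
  proof -
    have F: "f u v' = f a v' + integral {a..u} (\<lambda>s. fu s v')" if "v' \<in> {c..d}" for v'
    proof -
      have "integral {a..u} (\<lambda>s. fu s v') = f u v' - f a v'"
        by (rule integral_deriv_within) (use u that in \<open>auto intro!: DERIV_subset[OF fu]\<close>)
      then show ?thesis by simp
    qed
    have "((\<lambda>v'. f a v' + integral {a..u} (\<lambda>s. fu s v')) has_real_derivative
        fv a v + integral {a..u} (\<lambda>s. fuv s v)) (at v within {c..d})"
    proof (rule DERIV_add[OF fv])
      show "((\<lambda>v'. integral {a..u} (\<lambda>s. fu s v')) has_real_derivative integral {a..u} (\<lambda>s. fuv s v)) (at v within {c..d})"
      proof (rule leibniz_rule_field_derivative[where a = a and b = u, unfolded cbox_interval])
        show "continuous_on ({c..d} \<times> {a..u}) (\<lambda>(v, s). fuv s v)"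
          by (rule continuous_on_subset[OF cuv]) (use u in auto)
        show "(\<lambda>s. fu s v') integrable_on {a..u}" if "v' \<in> {c..d}" for v'
          by (intro integrable_continuous_real continuous_on_subset[OF slice[OF cu that]]) (use u in auto)
      qed (use u uv in \<open>auto intro!: fuv\<close>)
    qed (use ab uv in auto)
    then have "((\<lambda>v'. f u v') has_real_derivative fv a v + integral {a..u} (\<lambda>s. fuv s v)) (at v within {c..d})"
    proof (rule has_field_derivative_transform_within[of _ _ _ _ 1])
      show "f a v' + integral {a..u} (\<lambda>s. fu s v') = f u v'" if "v' \<in> {c..d}" for v'
        by (rule F[OF that, symmetric])
    qed (use uv in auto)
    then show ?thesis
      using real_derivative_unique_Icc[OF cd uv(2) fv[OF u uv(2)]] by blast
  qed
  have "((\<lambda>s. fv a v + integral {a..s} (\<lambda>r. fuv r v)) has_real_derivative 0 + fuv u v) (at u within {a..b})"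
    by (intro DERIV_add DERIV_const integral_has_real_derivative slice[OF cuv] uv)
  then have "((\<lambda>s. fv s v) has_real_derivative 0 + fuv u v) (at u within {a..b})"
  proof (rule has_field_derivative_transform_within[where d = 1])
    show "fv a v + integral {a..s} (\<lambda>r. fuv r v) = fv s v" if "s \<in> {a..b}" for s
      by (rule fv_eq[OF that, symmetric])
  qed (use uv in auto)
  then show ?thesis using real_derivative_unique_Icc[OF ab uv(1) _ fvu[OF uv]] by fastforce
qed

abbreviation spacetime :: "real \<Rightarrow> (real \<times> real \<times> real) set" where
  "spacetime H \<equiv> UNIV \<times> closed_strip H"

type_synonym field = "real \<times> real \<times> real \<Rightarrow> real"

text \<open>The partial derivatives are carried as explicit functions, so conservation laws become
  algebraic identities between them. In \<open>y\<close> the derivative is taken within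
  \<open>{0..H}\<close> to include the walls.\<close>

definition C1_field :: "real \<Rightarrow> field \<Rightarrow> field \<Rightarrow> field \<Rightarrow> field \<Rightarrow> bool" where
  "C1_field H f ft fx fy \<longleftrightarrow>
     continuous_on (spacetime H) f \<and> continuous_on (spacetime H) ft \<and>
     continuous_on (spacetime H) fx \<and> continuous_on (spacetime H) fy \<and>
     (\<forall>t x. \<forall>y\<in>{0..H}.
        ((\<lambda>s. f (s, x, y)) has_real_derivative ft (t, x, y)) (at t) \<and>
        ((\<lambda>s. f (t, s, y)) has_real_derivative fx (t, x, y)) (at x) \<and>
        ((\<lambda>s. f (t, x, s)) has_real_derivative fy (t, x, y)) (at y within {0..H}))"

lemma C1_fieldD:
  assumes "C1_field H f ft fx fy"
  shows "continuous_on (spacetime H) f" "continuous_on (spacetime H) ft"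
    "continuous_on (spacetime H) fx" "continuous_on (spacetime H) fy"
    "\<And>t x y. y \<in> {0..H} \<Longrightarrow> ((\<lambda>s. f (s, x, y)) has_real_derivative ft (t, x, y)) (at t)"
    "\<And>t x y. y \<in> {0..H} \<Longrightarrow> ((\<lambda>s. f (t, s, y)) has_real_derivative fx (t, x, y)) (at x)"
    "\<And>t x y. y \<in> {0..H} \<Longrightarrow> ((\<lambda>s. f (t, x, s)) has_real_derivative fy (t, x, y)) (at y within {0..H})"
  using assms by (simp_all add: C1_field_def)

lemma C1_field_add:
  assumes "C1_field H f ft fx fy" "C1_field H g gt gx gy"
  shows "C1_field H (\<lambda>p. f p + g p) (\<lambda>p. ft p + gt p) (\<lambda>p. fx p + gx p) (\<lambda>p. fy p + gy p)"
  unfolding C1_field_def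
  by (intro conjI allI ballI continuous_intros DERIV_add C1_fieldD(1-4)[OF assms(1)] C1_fieldD(1-4)[OF assms(2)];
      (rule C1_fieldD(5-7)[OF assms(1)] C1_fieldD(5-7)[OF assms(2)], assumption))

lemma C1_field_diff:
  assumes "C1_field H f ft fx fy" "C1_field H g gt gx gy"
  shows "C1_field H (\<lambda>p. f p - g p) (\<lambda>p. ft p - gt p) (\<lambda>p. fx p - gx p) (\<lambda>p. fy p - gy p)"
  unfolding C1_field_def
  by (intro conjI allI ballI continuous_intros DERIV_diff C1_fieldD(1-4)[OF assms(1)] C1_fieldD(1-4)[OF assms(2)];
      (rule C1_fieldD(5-7)[OF assms(1)] C1_fieldD(5-7)[OF assms(2)], assumption))

lemma C1_field_mult:
  assumes f: "C1_field H f ft fx fy" and g: "C1_field H g gt gx gy"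
  shows "C1_field H (\<lambda>p. f p * g p) (\<lambda>p. ft p * g p + f p * gt p)
     (\<lambda>p. fx p * g p + f p * gx p) (\<lambda>p. fy p * g p + f p * gy p)"
proof -
  note f' = C1_fieldD[OF f] and g' = C1_fieldD[OF g]
  show ?thesis
    unfolding C1_field_def
  proof (intro conjI allI ballI)
    fix t x y :: real assume y: "y \<in> {0..H}"
    show "((\<lambda>s. f (s, x, y) * g (s, x, y)) has_real_derivative
        ft (t, x, y) * g (t, x, y) + f (t, x, y) * gt (t, x, y)) (at t)"
      by (rule DERIV_cong[OF DERIV_mult'[OF f'(5)[OF y] g'(5)[OF y]]]) simp
    show "((\<lambda>s. f (t, s, y) * g (t, s, y)) has_real_derivative
        fx (t, x, y) * g (t, x, y) + f (t, x, y) * gx (t, x, y)) (at x)"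
      by (rule DERIV_cong[OF DERIV_mult'[OF f'(6)[OF y] g'(6)[OF y]]]) simp
    show "((\<lambda>s. f (t, x, s) * g (t, x, s)) has_real_derivative
        fy (t, x, y) * g (t, x, y) + f (t, x, y) * gy (t, x, y)) (at y within {0..H})"
      by (rule DERIV_cong[OF DERIV_mult'[OF f'(7)[OF y] g'(7)[OF y]]]) simp
  qed (intro continuous_intros f'(1-4) g'(1-4))+
qed

lemma C1_field_power:
  assumes f: "C1_field H f ft fx fy"
  shows "C1_field H (\<lambda>p. f p ^ n) (\<lambda>p. real n * f p ^ (n - 1) * ft p)
     (\<lambda>p. real n * f p ^ (n - 1) * fx p) (\<lambda>p. real n * f p ^ (n - 1) * fy p)"
proof -
  note f' = C1_fieldD[OF f]
  show ?thesis
    unfolding C1_field_def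
  proof (intro conjI allI ballI)
    fix t x y :: real assume y: "y \<in> {0..H}"
    show "((\<lambda>s. f (s, x, y) ^ n) has_real_derivative
        real n * f (t, x, y) ^ (n - 1) * ft (t, x, y)) (at t)"
      by (rule DERIV_cong[OF DERIV_power[OF f'(5)[OF y]]]) simp
    show "((\<lambda>s. f (t, s, y) ^ n) has_real_derivative
        real n * f (t, x, y) ^ (n - 1) * fx (t, x, y)) (at x)"
      by (rule DERIV_cong[OF DERIV_power[OF f'(6)[OF y]]]) simp
    show "((\<lambda>s. f (t, x, s) ^ n) has_real_derivative
        real n * f (t, x, y) ^ (n - 1) * fy (t, x, y)) (at y within {0..H})"
      by (rule DERIV_cong[OF DERIV_power[OF f'(7)[OF y]]]) simp
  qed (intro continuous_intros f'(1-4))+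
qed

lemma C1_field_const: "C1_field H (\<lambda>_. c) (\<lambda>_. 0) (\<lambda>_. 0) (\<lambda>_. 0)"
  unfolding C1_field_def by (auto intro!: continuous_intros)

lemma C1_field_height: "C1_field H (\<lambda>p. snd (snd p)) (\<lambda>_. 0) (\<lambda>_. 0) (\<lambda>_. 1)"
  unfolding C1_field_def by (auto intro!: continuous_intros derivative_eq_intros)

section \<open>From Frechet derivatives to fields of partial derivatives\<close>

lemma has_real_derivative_along_curve:
  fixes F :: "'a::real_normed_vector \<Rightarrow> 'b::real_normed_vector" and l :: "'b \<Rightarrow> real"
  assumes F: "(F has_derivative blinfun_apply D) (at (c s) within S)"
    and c: "(c has_vector_derivative e) (at s within T)" and T: "\<And>r. r \<in> T \<Longrightarrow> c r \<in> S"
    and l: "bounded_linear l"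
  shows "((\<lambda>r. l (F (c r))) has_real_derivative l (blinfun_apply D e)) (at s within T)"
proof -
  have c': "(c has_derivative (\<lambda>h. h *\<^sub>R e)) (at s within T)"
    using c by (simp add: has_vector_derivative_def)
  have "(F has_derivative blinfun_apply D) (at (c s) within c ` T)"
    by (rule has_derivative_subset[OF F]) (use T in auto)
  from has_derivative_in_compose[OF c' this]
  have "((\<lambda>r. F (c r)) has_derivative (\<lambda>h. blinfun_apply D (h *\<^sub>R e))) (at s within T)"
    by (simp add: o_def)
  then have "((\<lambda>r. l (F (c r))) has_derivative (\<lambda>h. l (blinfun_apply D (h *\<^sub>R e)))) (at s within T)"
    by (rule bounded_linear.has_derivative[OF l])
  then show ?thesis
    unfolding has_field_derivative_def
    by (rule has_derivative_eq_rhs)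
       (auto simp: blinfun.scaleR_right linear_cmul[OF bounded_linear.linear[OF l]] mult.commute)
qed

lemma C1_field_of_derivative:
  fixes F :: "real \<times> real \<times> real \<Rightarrow> 'b::real_normed_vector" and l :: "'b \<Rightarrow> real"
  assumes F: "\<And>p. p \<in> spacetime H \<Longrightarrow> (F has_derivative blinfun_apply (F' p)) (at p within spacetime H)"
    and F': "continuous_on (spacetime H) F'" and l: "bounded_linear l"
  shows "C1_field H (\<lambda>p. l (F p)) (\<lambda>p. l (blinfun_apply (F' p) (1, 0, 0)))
     (\<lambda>p. l (blinfun_apply (F' p) (0, 1, 0))) (\<lambda>p. l (blinfun_apply (F' p) (0, 0, 1)))"
  unfolding C1_field_def
proof (intro conjI allI ballI)
  have "continuous_on (spacetime H) F"
    by (rule has_derivative_continuous_on) (rule F)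
  then show "continuous_on (spacetime H) (\<lambda>p. l (F p))"
    by (rule bounded_linear.continuous_on[OF l])
  show "continuous_on (spacetime H) (\<lambda>p. l (blinfun_apply (F' p) e))" for e
    by (intro bounded_linear.continuous_on[OF l] continuous_intros F')
  then show "continuous_on (spacetime H) (\<lambda>p. l (blinfun_apply (F' p) e))"
    "continuous_on (spacetime H) (\<lambda>p. l (blinfun_apply (F' p) e))" for e by blast+
  fix t x y :: real assume y: "y \<in> {0..H}"
  show "((\<lambda>s. l (F (s, x, y))) has_real_derivative l (blinfun_apply (F' (t, x, y)) (1, 0, 0))) (at t)"
    by (rule has_real_derivative_along_curve[OF F _ _ l, where c = "\<lambda>s. (s, x, y)"])
       ((rule has_vector_derivative_Pair has_vector_derivative_id has_vector_derivative_const)+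
        | (use y in \<open>simp add: closed_strip_def\<close>))+
  show "((\<lambda>s. l (F (t, s, y))) has_real_derivative l (blinfun_apply (F' (t, x, y)) (0, 1, 0))) (at x)"
    by (rule has_real_derivative_along_curve[OF F _ _ l, where c = "\<lambda>s. (t, s, y)"])
       ((rule has_vector_derivative_Pair has_vector_derivative_id has_vector_derivative_const)+
        | (use y in \<open>simp add: closed_strip_def\<close>))+
  show "((\<lambda>s. l (F (t, x, s))) has_real_derivative l (blinfun_apply (F' (t, x, y)) (0, 0, 1))) (at y within {0..H})"
    by (rule has_real_derivative_along_curve[OF F _ _ l, where c = "\<lambda>s. (t, x, s)"])
       ((rule has_vector_derivative_Pair has_vector_derivative_id has_vector_derivative_const)+
        | (use y in \<open>simp add: closed_strip_def\<close>))+
qed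

lemma C1_field_of_C1_on:
  fixes F :: "real \<times> real \<times> real \<Rightarrow> 'b::real_normed_vector" and l :: "'b \<Rightarrow> real"
  assumes "C1_on (spacetime H) F" and "bounded_linear l"
  shows "\<exists>ft fx fy. C1_field H (\<lambda>p. l (F p)) ft fx fy"
proof -
  obtain F' where "\<forall>p\<in>spacetime H. (F has_derivative blinfun_apply (F' p)) (at p within spacetime H)"
      "continuous_on (spacetime H) F'"
    using assms(1) unfolding C1_on_def by blast
  then have "C1_field H (\<lambda>p. l (F p)) (\<lambda>p. l (blinfun_apply (F' p) (1, 0, 0)))
     (\<lambda>p. l (blinfun_apply (F' p) (0, 1, 0))) (\<lambda>p. l (blinfun_apply (F' p) (0, 0, 1)))"
    by (intro C1_field_of_derivative assms(2)) auto
  then show ?thesis by blast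
qed

text \<open>The derivative \<open>F'\<close> takes values in linear maps; evaluation in a coordinate
  direction followed by \<open>l\<close> is again bounded linear, so the first-order result applied
  to \<open>F'\<close> yields the second partial derivatives.\<close>

lemma C1_field_of_C2_on:
  fixes F :: "real \<times> real \<times> real \<Rightarrow> 'b::real_normed_vector" and l :: "'b \<Rightarrow> real"
  assumes F: "C2_on (spacetime H) F" and l: "bounded_linear l"
  shows "\<exists>ft fx fy. C1_field H (\<lambda>p. l (F p)) ft fx fy \<and> (\<exists>a b c. C1_field H ft a b c) \<and>
     (\<exists>a b c. C1_field H fx a b c) \<and> (\<exists>a b c. C1_field H fy a b c)"
proof -
  obtain F' where F': "\<And>p. p \<in> spacetime H \<Longrightarrow> (F has_derivative blinfun_apply (F' p)) (at p within spacetime H)"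
     "C1_on (spacetime H) F'"
    using F unfolding C2_on_def by blast
  have cF': "continuous_on (spacetime H) F'"
  proof -
    obtain F'' where "\<And>p. p \<in> spacetime H \<Longrightarrow> (F' has_derivative blinfun_apply (F'' p)) (at p within spacetime H)"
      using F'(2) unfolding C1_on_def by blast
    then show ?thesis by (rule has_derivative_continuous_on)
  qed
  have bl: "bounded_linear (\<lambda>B. l (blinfun_apply B e))" for e :: "real \<times> real \<times> real"
    by (rule bounded_linear_compose[OF l blinfun.bounded_linear_left])
  show ?thesis
    using C1_field_of_derivative[OF F'(1) cF' l] C1_field_of_C1_on[OF F'(2) bl] by blast
qed

section \<open>Integrated conservation laws in divergence form\<close>

context channel
begin

lemma cell_subset_strip: "cell \<subseteq> closed_strip H"
  by (auto simp: closed_strip_def cbox_Pair_eq)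

lemma continuous_on_cell:
  assumes "continuous_on (spacetime H) f"
  shows "continuous_on cell (\<lambda>z. f (t, z))"
  by (rule continuous_on_compose2[OF assms]) (use cell_subset_strip in \<open>auto intro!: continuous_intros\<close>)

lemma cint_deriv_x:
  assumes "C1_field H h ht hx hy" and per: "\<And>y. y \<in> {0..H} \<Longrightarrow> h (t, L, y) = h (t, 0, y)"
  shows "cint (\<lambda>z. hx (t, z)) = 0"
proof -
  note h = C1_fieldD[OF assms(1)]
  have "cint (\<lambda>z. hx (t, z)) = integral {0..H} (\<lambda>y. integral {0..L} (\<lambda>x. hx (t, x, y)))"
    by (rule cint_iterated_swap) (rule continuous_on_cell[OF h(3)])
  also have "\<dots> = integral {0..H} (\<lambda>y. 0)"
  proof (rule integral_cong)
    fix y assume y: "y \<in> {0..H}"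
    have "integral {0..L} (\<lambda>x. hx (t, x, y)) = h (t, L, y) - h (t, 0, y)"
      using L_pos y by (intro integral_deriv_within) (auto intro!: has_field_derivative_at_within[OF h(6)[OF y]])
    then show "integral {0..L} (\<lambda>x. hx (t, x, y)) = 0" using per[OF y] by simp
  qed
  finally show ?thesis by simp
qed

lemma cint_deriv_y:
  assumes "C1_field H h ht hx hy" and bd: "\<And>x. x \<in> {0..L} \<Longrightarrow> h (t, x, H) = h (t, x, 0)"
  shows "cint (\<lambda>z. hy (t, z)) = 0"
proof -
  note h = C1_fieldD[OF assms(1)]
  have "cint (\<lambda>z. hy (t, z)) = integral {0..L} (\<lambda>x. integral {0..H} (\<lambda>y. hy (t, x, y)))"
    by (rule cint_iterated) (rule continuous_on_cell[OF h(4)])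
  also have "\<dots> = integral {0..L} (\<lambda>x. 0)"
  proof (rule integral_cong)
    fix x assume x: "x \<in> {0..L}"
    have "integral {0..H} (\<lambda>y. hy (t, x, y)) = h (t, x, H) - h (t, x, 0)"
      using H_pos by (intro integral_deriv_within) (auto intro: h(7))
    then show "integral {0..H} (\<lambda>y. hy (t, x, y)) = 0" using bd[OF x] by simp
  qed
  finally show ?thesis by simp
qed

text \<open>After differentiation under the integral, the horizontal flux \<open>h\<close> cancels
  by periodicity and the vertical flux \<open>k\<close> because its values at the two walls agree.
  What remains for each invariant is to find its flux.\<close>

lemma conservation_law:
  assumes g: "C1_field H g gt gx gy" and h: "C1_field H h ht hx hy" and k: "C1_field H k kt kx ky"
    and eq: "\<And>t x y. y \<in> {0..H} \<Longrightarrow> gt (t, x, y) + hx (t, x, y) + ky (t, x, y) = 0"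
    and per: "\<And>t y. y \<in> {0..H} \<Longrightarrow> h (t, L, y) = h (t, 0, y)"
    and bd: "\<And>t x. x \<in> {0..L} \<Longrightarrow> k (t, x, H) = k (t, x, 0)"
  shows "cint (\<lambda>z. g (t, z)) = cint (\<lambda>z. g (0, z))"
proof -
  note gg = C1_fieldD[OF g] and hh = C1_fieldD[OF h] and kk = C1_fieldD[OF k]
  have "((\<lambda>t. cint (\<lambda>z. g (t, z))) has_real_derivative cint (\<lambda>z. gt (t, z))) (at t within UNIV)" for t
  proof (rule leibniz_rule_field_derivative)
    show "continuous_on (UNIV \<times> cell) (\<lambda>(t, z). gt (t, z))"
      using continuous_on_subset[OF gg(2)] cell_subset_strip by (simp add: Sigma_mono)
  next
    fix t z assume "z \<in> cell"
    then show "((\<lambda>t. g (t, z)) has_real_derivative gt (t, z)) (at t within UNIV)"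
      using gg(5)[of "snd z" "fst z" t] by (cases z) (auto simp: mem_cell)
  next
    show "(\<lambda>z. g (t, z)) integrable_on cell" for t
      by (intro integrable_continuous continuous_on_cell gg(1))
  qed auto
  moreover have "cint (\<lambda>z. gt (t, z)) = 0" for t
  proof -
    have "cint (\<lambda>z. gt (t, z)) = cint (\<lambda>z. - 1 * (hx (t, z) + ky (t, z)))"
    proof (rule cint_cong)
      fix z assume "z \<in> cell"
      then show "gt (t, z) = - 1 * (hx (t, z) + ky (t, z))"
        using eq[of "snd z" t "fst z"] by (cases z) (auto simp: mem_cell)
    qed
    also have "\<dots> = - 1 * (cint (\<lambda>z. hx (t, z)) + cint (\<lambda>z. ky (t, z)))"
      unfolding integral_mult_right by (subst cint_add) (rule continuous_on_cell hh kk refl)+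
    also have "\<dots> = 0"
      using cint_deriv_x[OF h per, of t] cint_deriv_y[OF k bd, of t] by simp
    finally show ?thesis .
  qed
  ultimately have "\<forall>t. ((\<lambda>t. cint (\<lambda>z. g (t, z))) has_real_derivative 0) (at t)" by simp
  then show ?thesis by (rule DERIV_isconst_all)
qed

end

subsection \<open>Conserved quantities of the Euler equations\<close>

text \<open>Exchanges the derivative functions while \<open>f\<close> stays. In this way the
  pressure gradient is replaced by an expression in the velocity that is itself
  differentiable.\<close>

lemma C1_field_cong:
  assumes "C1_field H f ft fx fy"
    and "\<And>p. p \<in> spacetime H \<Longrightarrow> ft p = gt p" "\<And>p. p \<in> spacetime H \<Longrightarrow> fx p = gx p"
      "\<And>p. p \<in> spacetime H \<Longrightarrow> fy p = gy p"
  shows "C1_field H f gt gx gy"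
proof -
  have "continuous_on (spacetime H) gt" "continuous_on (spacetime H) gx" "continuous_on (spacetime H) gy"
    using C1_fieldD(2-4)[OF assms(1)] assms(2-4) by (auto cong: continuous_on_cong_simp)
  moreover have "ft (t, x, y) = gt (t, x, y)" "fx (t, x, y) = gx (t, x, y)" "fy (t, x, y) = gy (t, x, y)"
    if "y \<in> {0..H}" for t x y
    using assms(2-4) that by (auto simp: closed_strip_def)
  ultimately show ?thesis
    using assms(1) unfolding C1_field_def by auto
qed

lemma continuous_on_field_slice:
  assumes "continuous_on (spacetime H) f" and "continuous_on X a" "continuous_on X b" "continuous_on X c"
    and "\<And>s. s \<in> X \<Longrightarrow> c s \<in> {0..H}"
  shows "continuous_on X (\<lambda>s. f (a s, b s, c s))"
  by (rule continuous_on_compose2[OF assms(1)])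
     (use assms(5) in \<open>auto intro!: continuous_on_Pair assms(2-4) simp: closed_strip_def\<close>)

text \<open>The equations of motion are postulated in the open strip; this carries them to the
  walls, where the boundary integrals live.\<close>

lemma field_zero_of_interior:
  fixes f :: field
  assumes H: "0 < H" and f: "continuous_on (spacetime H) f"
    and 0: "\<And>y. y \<in> {0<..<H} \<Longrightarrow> f (t, x, y) = 0" and y: "y \<in> {0..H}"
  shows "f (t, x, y) = 0"
proof -
  have cl: "closure {0<..<H} = {0..H}" using H by simp
  have "continuous_on (closure {0<..<H}) (\<lambda>y. f (t, x, y))"
    unfolding cl by (rule continuous_on_field_slice[OF f]) (auto intro!: continuous_intros)
  then show ?thesis
    using continuous_constant_on_closure[of "{0<..<H}" "\<lambda>y. f (t, x, y)" 0 y] 0 y cl by blast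
qed

section \<open>Mixed derivatives and periodicity of fields\<close>

lemma C1_field_mixed_tx:
  assumes f: "C1_field H f ft fx fy" and ft: "C1_field H ft a b c" and fx: "C1_field H fx a' b' c'"
    and y: "y \<in> {0..H}"
  shows "b (t, x, y) = a' (t, x, y)"
proof (rule mixed_partials_commute[where f = "\<lambda>t x. f (t, x, y)" and fu = "\<lambda>t x. ft (t, x, y)"
      and fv = "\<lambda>t x. fx (t, x, y)" and fuv = "\<lambda>t x. b (t, x, y)" and fvu = "\<lambda>t x. a' (t, x, y)"
      and a = "t - 1" and b = "t + 1" and c = "x - 1" and d = "x + 1"])
  show "continuous_on ({x - 1..x + 1} \<times> {t - 1..t + 1}) (\<lambda>(v, u). ft (u, v, y))"
    unfolding case_prod_beta
    by (rule continuous_on_field_slice[OF C1_fieldD(1)[OF ft]]) (use y in \<open>auto intro!: continuous_intros\<close>)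
  show "continuous_on ({x - 1..x + 1} \<times> {t - 1..t + 1}) (\<lambda>(v, u). b (u, v, y))"
    unfolding case_prod_beta
    by (rule continuous_on_field_slice[OF C1_fieldD(3)[OF ft]]) (use y in \<open>auto intro!: continuous_intros\<close>)
qed (auto intro!: has_field_derivative_at_within[OF C1_fieldD(5)[OF f y]]
      has_field_derivative_at_within[OF C1_fieldD(6)[OF f y]]
      has_field_derivative_at_within[OF C1_fieldD(6)[OF ft y]]
      has_field_derivative_at_within[OF C1_fieldD(5)[OF fx y]])

lemma C1_field_mixed_ty:
  assumes H: "0 < H" and f: "C1_field H f ft fx fy" and ft: "C1_field H ft a b c" and fy: "C1_field H fy a' b' c'"
    and y: "y \<in> {0..H}"
  shows "c (t, x, y) = a' (t, x, y)"
proof (rule mixed_partials_commute[where f = "\<lambda>t y. f (t, x, y)" and fu = "\<lambda>t y. ft (t, x, y)"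
      and fv = "\<lambda>t y. fy (t, x, y)" and fuv = "\<lambda>t y. c (t, x, y)" and fvu = "\<lambda>t y. a' (t, x, y)"
      and a = "t - 1" and b = "t + 1" and c = "0" and d = "H"])
  show "continuous_on ({0..H} \<times> {t - 1..t + 1}) (\<lambda>(v, u). ft (u, x, v))"
    unfolding case_prod_beta
    by (rule continuous_on_field_slice[OF C1_fieldD(1)[OF ft]]) (auto intro!: continuous_intros)
  show "continuous_on ({0..H} \<times> {t - 1..t + 1}) (\<lambda>(v, u). c (u, x, v))"
    unfolding case_prod_beta
    by (rule continuous_on_field_slice[OF C1_fieldD(4)[OF ft]]) (auto intro!: continuous_intros)
qed (use H y in \<open>auto simp del: atLeastAtMost_iff intro!: has_field_derivative_at_within[OF C1_fieldD(5)[OF f]]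
      C1_fieldD(7)[OF f] C1_fieldD(7)[OF ft] has_field_derivative_at_within[OF C1_fieldD(5)[OF fy]]\<close>, simp)

lemma C1_field_mixed_xy:
  assumes H: "0 < H" and f: "C1_field H f ft fx fy" and fx: "C1_field H fx a b c" and fy: "C1_field H fy a' b' c'"
    and y: "y \<in> {0..H}"
  shows "c (t, x, y) = b' (t, x, y)"
proof (rule mixed_partials_commute[where f = "\<lambda>x y. f (t, x, y)" and fu = "\<lambda>x y. fx (t, x, y)"
      and fv = "\<lambda>x y. fy (t, x, y)" and fuv = "\<lambda>x y. c (t, x, y)" and fvu = "\<lambda>x y. b' (t, x, y)"
      and a = "x - 1" and b = "x + 1" and c = "0" and d = "H"])
  show "continuous_on ({0..H} \<times> {x - 1..x + 1}) (\<lambda>(v, u). fx (t, u, v))"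
    unfolding case_prod_beta
    by (rule continuous_on_field_slice[OF C1_fieldD(1)[OF fx]]) (auto intro!: continuous_intros)
  show "continuous_on ({0..H} \<times> {x - 1..x + 1}) (\<lambda>(v, u). c (t, u, v))"
    unfolding case_prod_beta
    by (rule continuous_on_field_slice[OF C1_fieldD(4)[OF fx]]) (auto intro!: continuous_intros)
qed (use H y in \<open>auto simp del: atLeastAtMost_iff intro!: has_field_derivative_at_within[OF C1_fieldD(6)[OF f]]
      C1_fieldD(7)[OF f] C1_fieldD(7)[OF fx] has_field_derivative_at_within[OF C1_fieldD(6)[OF fy]]\<close>, simp)

lemma C1_field_periodic:
  assumes H: "0 < H" and f: "C1_field H f ft fx fy"
    and per: "\<And>x y. y \<in> {0..H} \<Longrightarrow> f (t, x + L, y) = f (t, x, y)" and y: "y \<in> {0..H}"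
  shows "fx (t, x + L, y) = fx (t, x, y)" "fy (t, x + L, y) = fy (t, x, y)"
proof -
  have "((\<lambda>s. f (t, s + L, y)) has_real_derivative fx (t, x + L, y)) (at x)"
    by (rule DERIV_shift[THEN iffD1]) (rule C1_fieldD(6)[OF f y])
  then have "((\<lambda>s. f (t, s, y)) has_real_derivative fx (t, x + L, y)) (at x)"
    by (simp add: per[OF y])
  then show "fx (t, x + L, y) = fx (t, x, y)"
    using C1_fieldD(6)[OF f y] DERIV_unique by blast
  have "((\<lambda>s. f (t, x, s)) has_real_derivative fy (t, x + L, y)) (at y within {0..H})"
    using C1_fieldD(7)[OF f y, of t "x + L"]
    by (rule has_field_derivative_transform_within[where d = 1]) (use per y in auto)
  then show "fy (t, x + L, y) = fy (t, x, y)"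
    using real_derivative_unique_Icc[OF H y _ C1_fieldD(7)[OF f y]] by blast
qed

lemma C1_field_pd:
  assumes f: "C1_field H f ft fx fy" and y: "y \<in> {0<..<H}"
  shows "pd1 (\<lambda>z. f (t, z)) (x, y) = fx (t, x, y)" "pd2 (\<lambda>z. f (t, z)) (x, y) = fy (t, x, y)"
    "deriv (\<lambda>s. f (s, x, y)) t = ft (t, x, y)"
proof -
  have y': "y \<in> {0..H}" using y by auto
  show "pd1 (\<lambda>z. f (t, z)) (x, y) = fx (t, x, y)"
    unfolding pd1_def using C1_fieldD(6)[OF f y'] by (simp add: DERIV_imp_deriv)
  show "pd2 (\<lambda>z. f (t, z)) (x, y) = fy (t, x, y)"
    unfolding pd2_def using C1_fieldD(7)[OF f y', of t x] y
    by (simp add: DERIV_imp_deriv at_within_Icc_at)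
  show "deriv (\<lambda>s. f (s, x, y)) t = ft (t, x, y)"
    using C1_fieldD(5)[OF f y'] by (simp add: DERIV_imp_deriv)
qed

text \<open>The flow as the conservation laws see it: equations valid up to the walls, and the
  vorticity as a field of its own with its transport equation, so that second derivatives of the
  velocity no longer appear.\<close>

locale euler_fields = channel +
  fixes v1 v1t v1x v1y v2 v2t v2x v2y q qt qx qy w wt wx wy :: field
  assumes v1: "C1_field H v1 v1t v1x v1y" and v2: "C1_field H v2 v2t v2x v2y"
    and q: "C1_field H q qt qx qy" and w: "C1_field H w wt wx wy"
    and w_eq: "\<And>t x y. y \<in> {0..H} \<Longrightarrow> w (t, x, y) = v2x (t, x, y) - v1y (t, x, y)"
    and momentum1: "\<And>t x y. y \<in> {0..H} \<Longrightarrow>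
      v1t (t, x, y) + v1 (t, x, y) * v1x (t, x, y) + v2 (t, x, y) * v1y (t, x, y) + qx (t, x, y) = 0"
    and momentum2: "\<And>t x y. y \<in> {0..H} \<Longrightarrow>
      v2t (t, x, y) + v1 (t, x, y) * v2x (t, x, y) + v2 (t, x, y) * v2y (t, x, y) + qy (t, x, y) = 0"
    and div0: "\<And>t x y. y \<in> {0..H} \<Longrightarrow> v1x (t, x, y) + v2y (t, x, y) = 0"
    and transport: "\<And>t x y. y \<in> {0..H} \<Longrightarrow>
      wt (t, x, y) + v1 (t, x, y) * wx (t, x, y) + v2 (t, x, y) * wy (t, x, y) = 0"
    and periodic: "\<And>t y. y \<in> {0..H} \<Longrightarrow> v1 (t, L, y) = v1 (t, 0, y)"
      "\<And>t y. y \<in> {0..H} \<Longrightarrow> v2 (t, L, y) = v2 (t, 0, y)"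
      "\<And>t y. y \<in> {0..H} \<Longrightarrow> q (t, L, y) = q (t, 0, y)"
      "\<And>t y. y \<in> {0..H} \<Longrightarrow> w (t, L, y) = w (t, 0, y)"
    and impermeable: "\<And>t x. v2 (t, x, 0) = 0" "\<And>t x. v2 (t, x, H) = 0"
begin

text \<open>A power of the vorticity is transported by a divergence-free velocity, so its flux is
  velocity times \<open>w ^ n\<close>, whose vertical part vanishes at the walls. Other functions of
  the vorticity are reached later by polynomial approximation.\<close>

lemma vorticity_power_conserved: "cint (\<lambda>z. w (t, z) ^ n) = cint (\<lambda>z. w (0, z) ^ n)"
proof (rule conservation_law)
  show "C1_field H (\<lambda>p. w p ^ n) (\<lambda>p. real n * w p ^ (n - 1) * wt p)
     (\<lambda>p. real n * w p ^ (n - 1) * wx p) (\<lambda>p. real n * w p ^ (n - 1) * wy p)"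
    by (rule C1_field_power[OF w])
  from C1_field_mult[OF v1 this] C1_field_mult[OF v2 this]
  show "C1_field H (\<lambda>p. v1 p * w p ^ n) (\<lambda>p. v1t p * w p ^ n + v1 p * (real n * w p ^ (n - 1) * wt p))
     (\<lambda>p. v1x p * w p ^ n + v1 p * (real n * w p ^ (n - 1) * wx p))
     (\<lambda>p. v1y p * w p ^ n + v1 p * (real n * w p ^ (n - 1) * wy p))"
   "C1_field H (\<lambda>p. v2 p * w p ^ n) (\<lambda>p. v2t p * w p ^ n + v2 p * (real n * w p ^ (n - 1) * wt p))
     (\<lambda>p. v2x p * w p ^ n + v2 p * (real n * w p ^ (n - 1) * wx p))
     (\<lambda>p. v2y p * w p ^ n + v2 p * (real n * w p ^ (n - 1) * wy p))" .
  fix t x y :: real assume y: "y \<in> {0..H}"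
  let ?p = "(t, x, y)"
  have "real n * w ?p ^ (n - 1) * wt ?p + (v1x ?p * w ?p ^ n + v1 ?p * (real n * w ?p ^ (n - 1) * wx ?p))
      + (v2y ?p * w ?p ^ n + v2 ?p * (real n * w ?p ^ (n - 1) * wy ?p))
    = real n * w ?p ^ (n - 1) * (wt ?p + v1 ?p * wx ?p + v2 ?p * wy ?p) + w ?p ^ n * (v1x ?p + v2y ?p)"
    by (simp add: algebra_simps)
  then show "real n * w ?p ^ (n - 1) * wt ?p + (v1x ?p * w ?p ^ n + v1 ?p * (real n * w ?p ^ (n - 1) * wx ?p))
      + (v2y ?p * w ?p ^ n + v2 ?p * (real n * w ?p ^ (n - 1) * wy ?p)) = 0"
    using transport[OF y] div0[OF y] by simp
qed (simp_all add: periodic impermeable)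

lemma momentum_conserved: "cint (\<lambda>z. v1 (t, z)) = cint (\<lambda>z. v1 (0, z))"
proof (rule conservation_law[OF v1 C1_field_add[OF C1_field_mult[OF v1 v1] q] C1_field_mult[OF v1 v2]])
  fix t x y :: real assume y: "y \<in> {0..H}"
  let ?p = "(t, x, y)"
  have "v1t ?p + (v1x ?p * v1 ?p + v1 ?p * v1x ?p + qx ?p) + (v1y ?p * v2 ?p + v1 ?p * v2y ?p)
    = (v1t ?p + v1 ?p * v1x ?p + v2 ?p * v1y ?p + qx ?p) + v1 ?p * (v1x ?p + v2y ?p)"
    by (simp add: algebra_simps)
  then show "v1t ?p + (v1x ?p * v1 ?p + v1 ?p * v1x ?p + qx ?p) + (v1y ?p * v2 ?p + v1 ?p * v2y ?p) = 0"
    using momentum1[OF y] div0[OF y] by simp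
qed (simp_all add: periodic impermeable)

text \<open>The weight \<open>y\<close> leaves the source \<open>v2 * w\<close>, and
  incompressibility makes it a divergence: it is the \<open>x\<close> derivative of
  \<open>(v2\<^sup>2 - v1\<^sup>2) / 2\<close> minus the \<open>y\<close> derivative of
  \<open>v1 * v2\<close>. These two terms correct the fluxes \<open>y * v1 * w\<close> and
  \<open>y * v2 * w\<close>.\<close>

lemma impulse_conserved: "cint (\<lambda>z. snd z * w (t, z)) = cint (\<lambda>z. snd z * w (0, z))"
proof -
  note kin = C1_field_mult[OF C1_field_diff[OF C1_field_mult[OF v2 v2] C1_field_mult[OF v1 v1]] C1_field_const[of H "1/2"]]
  have "cint (\<lambda>z. snd (snd (t, z)) * w (t, z)) = cint (\<lambda>z. snd (snd (0 :: real, z)) * w (0, z))"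
  proof (rule conservation_law[OF C1_field_mult[OF C1_field_height w]
        C1_field_diff[OF C1_field_mult[OF C1_field_height C1_field_mult[OF v1 w]] kin]
        C1_field_add[OF C1_field_mult[OF C1_field_height C1_field_mult[OF v2 w]] C1_field_mult[OF v1 v2]]])
    fix t x y :: real assume y: "y \<in> {0..H}"
    let ?p = "(t, x, y)"
    have "y * (wt ?p + v1 ?p * wx ?p + v2 ?p * wy ?p) + (v1 ?p + y * w ?p) * (v1x ?p + v2y ?p)
        + v2 ?p * (w ?p - v2x ?p + v1y ?p) = 0"
      using transport[OF y] div0[OF y] w_eq[OF y] by simp
    then show "0 * w ?p + snd (snd ?p) * wt ?p
       + (0 * (v1 ?p * w ?p) + snd (snd ?p) * (v1x ?p * w ?p + v1 ?p * wx ?p)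
         - ((v2x ?p * v2 ?p + v2 ?p * v2x ?p - (v1x ?p * v1 ?p + v1 ?p * v1x ?p)) * (1 / 2)
            + (v2 ?p * v2 ?p - v1 ?p * v1 ?p) * 0))
       + (1 * (v2 ?p * w ?p) + snd (snd ?p) * (v2y ?p * w ?p + v2 ?p * wy ?p)
         + (v1y ?p * v2 ?p + v1 ?p * v2y ?p)) = 0"
      by (simp add: algebra_simps)
  qed (simp_all add: periodic impermeable)
  then show ?thesis by simp
qed

text \<open>The flux is the velocity times the Bernoulli quantity
  \<open>v1\<^sup>2 + v2\<^sup>2 + 2 * q\<close>.\<close>

lemma energy_conserved:
  "cint (\<lambda>z. (v1 (t, z))\<^sup>2 + (v2 (t, z))\<^sup>2) = cint (\<lambda>z. (v1 (0, z))\<^sup>2 + (v2 (0, z))\<^sup>2)"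
proof -
  note kin = C1_field_add[OF C1_field_mult[OF v1 v1] C1_field_mult[OF v2 v2]]
  note pr = C1_field_add[OF kin C1_field_mult[OF C1_field_const[of H 2] q]]
  have "cint (\<lambda>z. v1 (t, z) * v1 (t, z) + v2 (t, z) * v2 (t, z))
     = cint (\<lambda>z. v1 (0, z) * v1 (0, z) + v2 (0, z) * v2 (0, z))"
  proof (rule conservation_law[OF kin C1_field_mult[OF v1 pr] C1_field_mult[OF v2 pr]])
    fix t x y :: real assume y: "y \<in> {0..H}"
    let ?p = "(t, x, y)"
    have "2 * v1 ?p * (v1t ?p + v1 ?p * v1x ?p + v2 ?p * v1y ?p + qx ?p)
       + 2 * v2 ?p * (v2t ?p + v1 ?p * v2x ?p + v2 ?p * v2y ?p + qy ?p)
       + (v1 ?p * v1 ?p + v2 ?p * v2 ?p + 2 * q ?p) * (v1x ?p + v2y ?p) = 0"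
      using momentum1[OF y] momentum2[OF y] div0[OF y] by simp
    then show "v1t ?p * v1 ?p + v1 ?p * v1t ?p + (v2t ?p * v2 ?p + v2 ?p * v2t ?p)
       + (v1x ?p * (v1 ?p * v1 ?p + v2 ?p * v2 ?p + 2 * q ?p)
         + v1 ?p * (v1x ?p * v1 ?p + v1 ?p * v1x ?p + (v2x ?p * v2 ?p + v2 ?p * v2x ?p) + (0 * q ?p + 2 * qx ?p)))
       + (v2y ?p * (v1 ?p * v1 ?p + v2 ?p * v2 ?p + 2 * q ?p)
         + v2 ?p * (v1y ?p * v1 ?p + v1 ?p * v1y ?p + (v2y ?p * v2 ?p + v2 ?p * v2y ?p) + (0 * q ?p + 2 * qy ?p))) = 0"
      by (simp add: algebra_simps)
  qed (simp_all add: periodic impermeable)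
  then show ?thesis by (simp add: power2_eq_square)
qed

end

text \<open>Vorticity transport is the curl of the momentum equations. The pressure is only assumed
  C^1, but its gradient equals minus the material acceleration, which is C^1 because the velocity is
  C^2; hence the mixed derivatives of the pressure exist and commute.\<close>

lemma (in channel) euler_flow_fields:
  assumes E: "euler_flow L H v P"
  shows "\<exists>v1 v1t v1x v1y v2 v2t v2x v2y q qt qx qy w wt wx wy.
    euler_fields L H v1 v1t v1x v1y v2 v2t v2x v2y q qt qx qy w wt wx wy \<and>
    (\<forall>t x y. y \<in> {0<..<H} \<longrightarrow> vorticity (v t) (x, y) = w (t, x, y))"
proof -
  have vC2: "C2_on (spacetime H) (\<lambda>(t, x). v t x)" and PC1: "C1_on (spacetime H) (\<lambda>(t, x). P t x)"
    and per: "\<And>t. channel_periodic L H (v t)" "\<And>t. channel_periodic L H (P t)"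
    and bc: "\<And>t x. snd (v t (x, 0)) = 0" "\<And>t x. snd (v t (x, H)) = 0"
    using E unfolding euler_flow_def by auto
  have eqs: "deriv (\<lambda>s. fst (v s (x, y))) t + fst (v t (x, y)) * pd1 (\<lambda>y. fst (v t y)) (x, y)
          + snd (v t (x, y)) * pd2 (\<lambda>y. fst (v t y)) (x, y) = - pd1 (P t) (x, y)"
      "deriv (\<lambda>s. snd (v s (x, y))) t + fst (v t (x, y)) * pd1 (\<lambda>y. snd (v t y)) (x, y)
          + snd (v t (x, y)) * pd2 (\<lambda>y. snd (v t y)) (x, y) = - pd2 (P t) (x, y)"
      "pd1 (\<lambda>y. fst (v t y)) (x, y) + pd2 (\<lambda>y. snd (v t y)) (x, y) = 0"
    if "y \<in> {0<..<H}" for t x y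
    using E that unfolding euler_flow_def strip_def by auto
  define v1 where "v1 p = fst (v (fst p) (snd p))" for p
  define v2 where "v2 p = snd (v (fst p) (snd p))" for p
  define q where "q p = P (fst p) (snd p)" for p
  obtain v1t v1x v1y v1tt v1tx v1ty v1xt v1xx v1xy v1yt v1yx v1yy where
      V1: "C1_field H v1 v1t v1x v1y" "C1_field H v1t v1tt v1tx v1ty"
        "C1_field H v1x v1xt v1xx v1xy" "C1_field H v1y v1yt v1yx v1yy"
    using C1_field_of_C2_on[OF vC2 bounded_linear_fst] by (auto simp: v1_def[abs_def] case_prod_beta)
  obtain v2t v2x v2y v2tt v2tx v2ty v2xt v2xx v2xy v2yt v2yx v2yy where
      V2: "C1_field H v2 v2t v2x v2y" "C1_field H v2t v2tt v2tx v2ty"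
        "C1_field H v2x v2xt v2xx v2xy" "C1_field H v2y v2yt v2yx v2yy"
    using C1_field_of_C2_on[OF vC2 bounded_linear_snd] by (auto simp: v2_def[abs_def] case_prod_beta)
  obtain qt qx qy where Q: "C1_field H q qt qx qy"
    using C1_field_of_C1_on[OF PC1 bounded_linear_ident] by (auto simp: q_def[abs_def] case_prod_beta)
  have pd: "pd1 (\<lambda>z. fst (v t z)) (x, y) = v1x (t, x, y)" "pd2 (\<lambda>z. fst (v t z)) (x, y) = v1y (t, x, y)"
      "deriv (\<lambda>s. fst (v s (x, y))) t = v1t (t, x, y)"
      "pd1 (\<lambda>z. snd (v t z)) (x, y) = v2x (t, x, y)" "pd2 (\<lambda>z. snd (v t z)) (x, y) = v2y (t, x, y)"
      "deriv (\<lambda>s. snd (v s (x, y))) t = v2t (t, x, y)"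
      "pd1 (P t) (x, y) = qx (t, x, y)" "pd2 (P t) (x, y) = qy (t, x, y)"
    if "y \<in> {0<..<H}" for t x y
    using C1_field_pd[OF V1(1) that] C1_field_pd[OF V2(1) that] C1_field_pd[OF Q that]
    by (simp_all add: v1_def v2_def q_def)
  define M1 where "M1 p = v1t p + v1 p * v1x p + v2 p * v1y p" for p
  define M2 where "M2 p = v2t p + v1 p * v2x p + v2 p * v2y p" for p
  note CM1 = C1_field_add[OF C1_field_add[OF V1(2) C1_field_mult[OF V1(1) V1(3)]] C1_field_mult[OF V2(1) V1(4)], folded M1_def]
  note CM2 = C1_field_add[OF C1_field_add[OF V2(2) C1_field_mult[OF V1(1) V2(3)]] C1_field_mult[OF V2(1) V2(4)], folded M2_def]
  have mom1: "M1 (t, x, y) + qx (t, x, y) = 0" if "y \<in> {0..H}" for t x y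
  proof (rule field_zero_of_interior[OF H_pos, of "\<lambda>p. M1 p + qx p", OF _ _ that])
    show "continuous_on (spacetime H) (\<lambda>p. M1 p + qx p)"
      by (intro continuous_on_add C1_fieldD(1)[OF CM1] C1_fieldD(3)[OF Q])
    show "M1 (t, x, y) + qx (t, x, y) = 0" if "y \<in> {0<..<H}" for y
      using eqs(1)[OF that, of x t] by (simp add: pd[OF that] M1_def v1_def v2_def)
  qed
  have mom2: "M2 (t, x, y) + qy (t, x, y) = 0" if "y \<in> {0..H}" for t x y
  proof (rule field_zero_of_interior[OF H_pos, of "\<lambda>p. M2 p + qy p", OF _ _ that])
    show "continuous_on (spacetime H) (\<lambda>p. M2 p + qy p)"
      by (intro continuous_on_add C1_fieldD(1)[OF CM2] C1_fieldD(4)[OF Q])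
    show "M2 (t, x, y) + qy (t, x, y) = 0" if "y \<in> {0<..<H}" for y
      using eqs(2)[OF that, of x t] by (simp add: pd[OF that] M2_def v1_def v2_def)
  qed
  have dv: "v1x (t, x, y) + v2y (t, x, y) = 0" if "y \<in> {0..H}" for t x y
  proof (rule field_zero_of_interior[OF H_pos, of "\<lambda>p. v1x p + v2y p", OF _ _ that])
    show "continuous_on (spacetime H) (\<lambda>p. v1x p + v2y p)"
      by (intro continuous_on_add C1_fieldD(1)[OF V1(3)] C1_fieldD(1)[OF V2(4)])
    show "v1x (t, x, y) + v2y (t, x, y) = 0" if "y \<in> {0<..<H}" for y
      using eqs(3)[OF that, of t x] by (simp add: pd[OF that])
  qed
  \<comment> \<open>The form \<open>0 - M1\<close> lets \<open>C1_field_diff\<close> with a constant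
    field supply the derivatives of the gradient.\<close>
  have Q': "C1_field H q qt (\<lambda>p. 0 - M1 p) (\<lambda>p. 0 - M2 p)"
  proof (rule C1_field_cong[OF Q])
    show "qx p = 0 - M1 p" "qy p = 0 - M2 p" if "p \<in> spacetime H" for p
      using mom1[of "snd (snd p)" "fst p" "fst (snd p)"] mom2[of "snd (snd p)" "fst p" "fst (snd p)"] that
      by (cases p; auto simp: closed_strip_def)+
  qed simp
  define w where "w p = v2x p - v1y p" for p
  have W: "C1_field H w (\<lambda>p. v2xt p - v1yt p) (\<lambda>p. v2xx p - v1yx p) (\<lambda>p. v2xy p - v1yy p)"
    unfolding w_def[abs_def] by (rule C1_field_diff[OF V2(3) V1(4)])
  have tr: "(v2xt p - v1yt p) + v1 p * (v2xx p - v1yx p) + v2 p * (v2xy p - v1yy p) = 0"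
    if p: "p = (t, x, y)" and y: "y \<in> {0..H}" for p t x y
  proof -
    note mixed = C1_field_mixed_tx[OF V2(1-3) y, of t x] C1_field_mixed_ty[OF H_pos V1(1,2,4) y, of t x]
      C1_field_mixed_xy[OF H_pos V1(1,3,4) y, of t x] C1_field_mixed_xy[OF H_pos V2(1,3,4) y, of t x]
    \<comment> \<open>Equality of the mixed derivatives of the pressure. Expanded, it is the
      transport equation plus vorticity times divergence.\<close>
    have "0 - (v1ty p + (v1y p * v1x p + v1 p * v1xy p) + (v2y p * v1y p + v2 p * v1yy p))
        = 0 - (v2tx p + (v1x p * v2x p + v1 p * v2xx p) + (v2x p * v2y p + v2 p * v2yx p))"
      using C1_field_mixed_xy[OF H_pos Q' C1_field_diff[OF C1_field_const[of H 0] CM1] C1_field_diff[OF C1_field_const[of H 0] CM2] y, of t x]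
      unfolding p by simp
    then have "(v2xt p - v1yt p) + v1 p * (v2xx p - v1yx p) + v2 p * (v2xy p - v1yy p)
        + (v2x p - v1y p) * (v1x p + v2y p) = 0"
      using mixed unfolding p by (simp add: algebra_simps)
    then show ?thesis using dv[OF y, of t x] unfolding p by simp
  qed
  have perv: "v1 (t, x + L, y) = v1 (t, x, y)" "v2 (t, x + L, y) = v2 (t, x, y)" "q (t, x + L, y) = q (t, x, y)"
    if "y \<in> {0..H}" for t x y
    using per that unfolding channel_periodic_def by (auto simp: v1_def v2_def q_def)
  have perw: "w (t, x + L, y) = w (t, x, y)" if "y \<in> {0..H}" for t x y
    unfolding w_def
    using C1_field_periodic(1)[OF H_pos V2(1) perv(2) that] C1_field_periodic(2)[OF H_pos V1(1) perv(1) that] by simp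
  have "euler_fields L H v1 v1t v1x v1y v2 v2t v2x v2y q qt qx qy w
      (\<lambda>p. v2xt p - v1yt p) (\<lambda>p. v2xx p - v1yx p) (\<lambda>p. v2xy p - v1yy p)"
  proof (unfold_locales)
    fix t x y :: real assume y: "y \<in> {0..H}"
    show "w (t, x, y) = v2x (t, x, y) - v1y (t, x, y)" by (simp add: w_def)
    show "v1t (t, x, y) + v1 (t, x, y) * v1x (t, x, y) + v2 (t, x, y) * v1y (t, x, y) + qx (t, x, y) = 0"
      using mom1[OF y] by (simp add: M1_def)
    show "v2t (t, x, y) + v1 (t, x, y) * v2x (t, x, y) + v2 (t, x, y) * v2y (t, x, y) + qy (t, x, y) = 0"
      using mom2[OF y] by (simp add: M2_def)
    show "v1x (t, x, y) + v2y (t, x, y) = 0" by (rule dv[OF y])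
    show "(v2xt (t, x, y) - v1yt (t, x, y)) + v1 (t, x, y) * (v2xx (t, x, y) - v1yx (t, x, y))
        + v2 (t, x, y) * (v2xy (t, x, y) - v1yy (t, x, y)) = 0"
      by (rule tr[OF refl y])
    show "v1 (t, L, y) = v1 (t, 0, y)" "v2 (t, L, y) = v2 (t, 0, y)" "q (t, L, y) = q (t, 0, y)"
        "w (t, L, y) = w (t, 0, y)"
      using perv[OF y, of t 0] perw[OF y, of t 0] by simp_all
  next
    show "v2 (t, x, 0) = 0" "v2 (t, x, H) = 0" for t x using bc by (simp_all add: v2_def)
  qed (fact V1 V2 Q W)+
  moreover have "\<forall>t x y. y \<in> {0<..<H} \<longrightarrow> vorticity (v t) (x, y) = w (t, x, y)"
    by (simp add: vorticity_def pd w_def)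
  ultimately show ?thesis by blast
qed

subsection \<open>Upper bounds for the first eigenvalue\<close>

lemma C1_on_linear:
  assumes "C1_on S G" and l: "bounded_linear l"
  shows "C1_on S (\<lambda>p. l (G p))"
proof -
  obtain G' where G': "\<And>x. x \<in> S \<Longrightarrow> (G has_derivative blinfun_apply (G' x)) (at x within S)" "continuous_on S G'"
    using assms(1) unfolding C1_on_def by blast
  show ?thesis
    unfolding C1_on_def
  proof (intro exI[of _ "\<lambda>x. Blinfun l o\<^sub>L G' x"] conjI ballI)
    show "((\<lambda>p. l (G p)) has_derivative blinfun_apply (Blinfun l o\<^sub>L G' x)) (at x within S)" if "x \<in> S" for x
      using bounded_linear.has_derivative[OF l G'(1)[OF that]]
      by (simp add: blinfun_apply_blinfun_compose[abs_def] bounded_linear_Blinfun_apply[OF l])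
    show "continuous_on S (\<lambda>x. Blinfun l o\<^sub>L G' x)"
      by (intro continuous_intros G'(2))
  qed
qed

lemma C1_on_add:
  assumes "C1_on S F" "C1_on S G"
  shows "C1_on S (\<lambda>p. F p + G p)"
proof -
  obtain F' where F': "\<And>x. x \<in> S \<Longrightarrow> (F has_derivative blinfun_apply (F' x)) (at x within S)" "continuous_on S F'"
    using assms(1) unfolding C1_on_def by blast
  obtain G' where G': "\<And>x. x \<in> S \<Longrightarrow> (G has_derivative blinfun_apply (G' x)) (at x within S)" "continuous_on S G'"
    using assms(2) unfolding C1_on_def by blast
  show ?thesis
    unfolding C1_on_def
  proof (intro exI[of _ "\<lambda>x. F' x + G' x"] conjI ballI)
    show "((\<lambda>p. F p + G p) has_derivative blinfun_apply (F' x + G' x)) (at x within S)" if "x \<in> S" for x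
      using has_derivative_add[OF F'(1)[OF that] G'(1)[OF that]]
      by (simp add: plus_blinfun.rep_eq)
    show "continuous_on S (\<lambda>x. F' x + G' x)"
      by (intro continuous_intros F'(2) G'(2))
  qed
qed

lemma C1_on_snd:
  assumes "C1_on X G"
  shows "C1_on (UNIV \<times> X) (\<lambda>p. G (snd p))"
proof -
  obtain G' where G': "\<And>x. x \<in> X \<Longrightarrow> (G has_derivative blinfun_apply (G' x)) (at x within X)" "continuous_on X G'"
    using assms unfolding C1_on_def by blast
  show ?thesis
    unfolding C1_on_def
  proof (intro exI[of _ "\<lambda>p. G' (snd p) o\<^sub>L Blinfun snd"] conjI ballI)
    fix p :: "'c \<times> 'a" assume p: "p \<in> UNIV \<times> X"
    have "(G has_derivative blinfun_apply (G' (snd p))) (at (snd p) within snd ` (UNIV \<times> X))"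
      using G'(1)[of "snd p"] p by (auto simp: snd_image_times)
    then have "((\<lambda>p. G (snd p)) has_derivative (\<lambda>h. blinfun_apply (G' (snd p)) (snd h))) (at p within UNIV \<times> X)"
      using has_derivative_in_compose[OF has_derivative_snd[OF has_derivative_ident]] by fast
    then show "((\<lambda>p. G (snd p)) has_derivative blinfun_apply (G' (snd p) o\<^sub>L Blinfun snd)) (at p within UNIV \<times> X)"
      by (simp add: blinfun_apply_blinfun_compose[abs_def] bounded_linear_Blinfun_apply[OF bounded_linear_snd])
  next
    show "continuous_on (UNIV \<times> X) (\<lambda>p. G' (snd p) o\<^sub>L Blinfun snd)"
      by (intro continuous_intros continuous_on_compose2[OF G'(2)]) auto
  qed
qed

text \<open>Regards a function on the channel as a time-independent field, so that the space-time
  calculus applies to eigenfunctions.\<close>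

lemma C2_on_snd:
  assumes "C2_on X G"
  shows "C2_on (UNIV \<times> X) (\<lambda>p. G (snd p))"
proof -
  obtain G' where G': "\<And>x. x \<in> X \<Longrightarrow> (G has_derivative blinfun_apply (G' x)) (at x within X)" "C1_on X G'"
    using assms unfolding C2_on_def by blast
  show ?thesis
    unfolding C2_on_def
  proof (intro exI[of _ "\<lambda>p. G' (snd p) o\<^sub>L Blinfun snd"] conjI ballI)
    fix p :: "'c \<times> 'a" assume p: "p \<in> UNIV \<times> X"
    have "(G has_derivative blinfun_apply (G' (snd p))) (at (snd p) within snd ` (UNIV \<times> X))"
      using G'(1)[of "snd p"] p by (auto simp: snd_image_times)
    then have "((\<lambda>p. G (snd p)) has_derivative (\<lambda>h. blinfun_apply (G' (snd p)) (snd h))) (at p within UNIV \<times> X)"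
      using has_derivative_in_compose[OF has_derivative_snd[OF has_derivative_ident]] by fast
    then show "((\<lambda>p. G (snd p)) has_derivative blinfun_apply (G' (snd p) o\<^sub>L Blinfun snd)) (at p within UNIV \<times> X)"
      by (simp add: blinfun_apply_blinfun_compose[abs_def] bounded_linear_Blinfun_apply[OF bounded_linear_snd])
  next
    show "C1_on (UNIV \<times> X) (\<lambda>p. G' (snd p) o\<^sub>L Blinfun snd)"
      by (rule C1_on_linear[OF C1_on_snd[OF G'(2)] bounded_bilinear.bounded_linear_left[OF bounded_bilinear_blinfun_compose]])
  qed
qed

lemma C1_on_of_gradient:
  fixes f :: "real \<times> real \<Rightarrow> real"
  assumes "\<And>z. (f has_derivative (\<lambda>h. fst h * p z + snd h * r z)) (at z)"
    and "continuous_on S p" "continuous_on S r"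
  shows "C1_on S f"
  unfolding C1_on_def
proof (intro exI[of _ "\<lambda>z. p z *\<^sub>R Blinfun fst + r z *\<^sub>R Blinfun snd"] conjI ballI)
  show "(f has_derivative blinfun_apply (p z *\<^sub>R Blinfun fst + r z *\<^sub>R Blinfun snd)) (at z within S)" for z
    using has_derivative_at_withinI[OF assms(1)]
    by (simp add: plus_blinfun.rep_eq scaleR_blinfun.rep_eq bounded_linear_Blinfun_apply[OF bounded_linear_fst]
        bounded_linear_Blinfun_apply[OF bounded_linear_snd] mult.commute)
qed (intro continuous_intros assms)

lemma C2_on_of_gradient:
  fixes f :: "real \<times> real \<Rightarrow> real"
  assumes "\<And>z. (f has_derivative (\<lambda>h. fst h * p z + snd h * r z)) (at z)"
    and "C1_on S p" "C1_on S r"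
  shows "C2_on S f"
  unfolding C2_on_def
proof (intro exI[of _ "\<lambda>z. p z *\<^sub>R Blinfun fst + r z *\<^sub>R Blinfun snd"] conjI ballI)
  show "(f has_derivative blinfun_apply (p z *\<^sub>R Blinfun fst + r z *\<^sub>R Blinfun snd)) (at z within S)" for z
    using has_derivative_at_withinI[OF assms(1)]
    by (simp add: plus_blinfun.rep_eq scaleR_blinfun.rep_eq bounded_linear_Blinfun_apply[OF bounded_linear_fst]
        bounded_linear_Blinfun_apply[OF bounded_linear_snd] mult.commute)
qed (intro C1_on_add C1_on_linear[OF assms(2) bounded_linear_scaleR_left] C1_on_linear[OF assms(3) bounded_linear_scaleR_left])

lemma laplacian_field:
  assumes f: "C1_field H f ft fx fy" and fx: "C1_field H fx fxt fxx fxy" and fy: "C1_field H fy fyt fyx fyy"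
    and y: "y \<in> {0<..<H}"
  shows "laplacian (\<lambda>z. f (t, z)) (x, y) = fxx (t, x, y) + fyy (t, x, y)"
proof -
  have 1: "pd1 (pd1 (\<lambda>z. f (t, z))) (x, y) = pd1 (\<lambda>z. fx (t, z)) (x, y)"
    unfolding pd1_def[of "pd1 _"] pd1_def[of "\<lambda>z. fx (t, z)"]
    by (simp add: C1_field_pd(1)[OF f y])
  \<comment> \<open>Moving in \<open>y\<close> may leave the strip, hence the neighbourhood; moving
    in \<open>x\<close> keeps the height.\<close>
  have "\<forall>\<^sub>F s in nhds y. s \<in> {0<..<H}"
    using y by (intro eventually_nhds_in_open) auto
  then have "\<forall>\<^sub>F s in nhds y. pd2 (\<lambda>z. f (t, z)) (x, s) = fy (t, x, s)"
    by eventually_elim (rule C1_field_pd(2)[OF f])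
  then have 2: "pd2 (pd2 (\<lambda>z. f (t, z))) (x, y) = pd2 (\<lambda>z. fy (t, z)) (x, y)"
    unfolding pd2_def[of "pd2 _"] pd2_def[of "\<lambda>z. fy (t, z)"]
    by (intro deriv_cong_ev) simp_all
  show ?thesis
    unfolding laplacian_def 1 2 C1_field_pd(1)[OF fx y] C1_field_pd(2)[OF fy y] ..
qed

section \<open>Green's identity for eigenfunctions and two explicit eigenvalues\<close>

context channel
begin

text \<open>The half-open cell and the closed one differ by a null set. Agreement is asked for off
  the walls only, because the two-sided derivatives in the vorticity carry no information on
  them.\<close>

lemma set_integral_period_cell:
  assumes g: "continuous_on cell g" and fg: "\<And>z. z \<in> period_cell L H \<Longrightarrow> f z = g z"
  shows "set_lebesgue_integral lborel (period_cell L H) f = cint g"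
proof -
  have sub: "period_cell L H \<subseteq> cell" by (auto simp: period_cell_def cbox_Pair_eq)
  have meas: "period_cell L H \<in> sets lborel"
    unfolding period_cell_def sets_lborel borel_prod[symmetric] by (intro pair_measureI) auto
  have box: "box (0, 0) (L, H) \<subseteq> period_cell L H"
    by (auto simp: period_cell_def mem_box Basis_prod_def)
  have "set_lebesgue_integral lborel (period_cell L H) f = set_lebesgue_integral lborel (period_cell L H) g"
    using fg by (intro set_lebesgue_integral_cong meas) auto
  also have "\<dots> = integral (period_cell L H) g"
  proof (rule set_borel_integral_eq_integral(2))
    have "set_integrable lborel cell g"
      unfolding set_integrable_def by (rule borel_integrable_compact[OF compact_cbox g])
    then show "set_integrable lborel (period_cell L H) g"
      by (rule set_integrable_subset[OF _ meas sub])
  qed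
  also have "\<dots> = cint g"
  proof (rule integral_spike_set)
    have "cell - period_cell L H \<subseteq> cell - box (0, 0) (L, H)" using box by blast
    then have "negligible (cell - period_cell L H)"
      using negligible_frontier_interval negligible_subset by blast
    then show "negligible {z \<in> cell - period_cell L H. g z \<noteq> 0}"
      by (rule negligible_subset) auto
    show "negligible {z \<in> period_cell L H - cell. g z \<noteq> 0}"
      using sub by (auto simp: Diff_eq_empty_iff[THEN iffD2])
  qed
  finally show ?thesis .
qed

text \<open>Green's identity equates \<open>\<Lambda>\<close> times the squared norm with the
  Dirichlet energy. The result bounds the set of eigenvalues below, so that its infimum lies below
  every explicit eigenvalue.\<close>

lemma channel_eigenvalue_nonneg:
  assumes "channel_eigenvalue L H \<Lambda>"
  shows "0 \<le> \<Lambda>"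
proof -
  obtain u c where uC2: "C2_on (closed_strip H) u" and per: "channel_periodic L H u"
    and nz: "\<exists>x\<in>closed_strip H. u x \<noteq> 0"
    and eig: "\<And>x. x \<in> strip H \<Longrightarrow> - laplacian u x = \<Lambda> * u x"
    and bc: "\<And>x. u (x, 0) = c \<and> u (x, H) = c"
    and mean: "set_lebesgue_integral lborel (period_cell L H) u = 0"
    using assms unfolding channel_eigenvalue_def by blast
  define f where "f p = u (snd p)" for p :: "real \<times> real \<times> real"
  have "C2_on (spacetime H) f" unfolding f_def by (rule C2_on_snd[OF uC2])
  from C1_field_of_C2_on[OF this bounded_linear_ident]
  obtain ft fx fy fxt fxx fxy fyt fyx fyy where f: "C1_field H f ft fx fy"
    and fx: "C1_field H fx fxt fxx fxy" and fy: "C1_field H fy fyt fyx fyy"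
    by blast
  have perf: "f (0, x + L, y) = f (0, x, y)" if "y \<in> {0..H}" for x y
    using per that by (auto simp: channel_periodic_def f_def)
  have perfx: "fx (0, x + L, y) = fx (0, x, y)" if "y \<in> {0..H}" for x y
    by (rule C1_field_periodic(1)[OF H_pos f perf that])
  have eq: "fxx (0, x, y) + fyy (0, x, y) + \<Lambda> * f (0, x, y) = 0" if "y \<in> {0..H}" for x y
  proof (rule field_zero_of_interior[OF H_pos, of "\<lambda>p. fxx p + fyy p + \<Lambda> * f p", OF _ _ that])
    show "continuous_on (spacetime H) (\<lambda>p. fxx p + fyy p + \<Lambda> * f p)"
      by (intro continuous_intros C1_fieldD(1)[OF f] C1_fieldD(3)[OF fx] C1_fieldD(4)[OF fy])
    show "fxx (0, x, y) + fyy (0, x, y) + \<Lambda> * f (0, x, y) = 0" if "y \<in> {0<..<H}" for y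
      using laplacian_field[OF f fx fy that, of 0 x] eig[of "(x, y)"] that by (simp add: f_def strip_def)
  qed
  have cf: "continuous_on cell (\<lambda>z. f (0, z))" and cfx: "continuous_on cell (\<lambda>z. fx (0, z))"
    and cfy: "continuous_on cell (\<lambda>z. fy (0, z))" and cfxx: "continuous_on cell (\<lambda>z. fxx (0, z))"
    and cfyy: "continuous_on cell (\<lambda>z. fyy (0, z))"
    by (intro continuous_on_cell C1_fieldD(1)[OF f] C1_fieldD(1)[OF fx] C1_fieldD(1)[OF fy]
        C1_fieldD(3)[OF fx] C1_fieldD(4)[OF fy])+
  have m0: "cint (\<lambda>z. f (0, z)) = 0"
    using set_integral_period_cell[of "\<lambda>z. f (0, z)" u] cf mean by (simp add: f_def)
  have xx0: "cint (\<lambda>z. fxx (0, z)) = 0"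
    by (rule cint_deriv_x[OF fx]) (use perfx[of _ 0] in simp)
  \<comment> \<open>Zero mean and periodicity make the total normal derivative on the walls vanish.
    This disposes of the contribution of the unknown wall value \<open>c\<close>.\<close>
  have yy0: "cint (\<lambda>z. fyy (0, z)) = 0"
  proof -
    have "cint (\<lambda>z. fyy (0, z)) = cint (\<lambda>z. - \<Lambda> * f (0, z) - fxx (0, z))"
    proof (rule cint_cong)
      fix z assume "z \<in> cell"
      then show "fyy (0, z) = - \<Lambda> * f (0, z) - fxx (0, z)"
        using eq[of "snd z" "fst z"] by (cases z) (auto simp: mem_cell)
    qed
    also have "\<dots> = - \<Lambda> * cint (\<lambda>z. f (0, z)) - cint (\<lambda>z. fxx (0, z))"
      unfolding integral_mult_right[symmetric] by (intro cint_diff continuous_intros cf cfxx)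
    finally show ?thesis using m0 xx0 by simp
  qed
  have A: "cint (\<lambda>z. fx (0, z) * fx (0, z) + f (0, z) * fxx (0, z)) = 0"
    by (rule cint_deriv_x[OF C1_field_mult[OF f fx]]) (use perf[of _ 0] perfx[of _ 0] in simp)
  \<comment> \<open>The flux \<open>(f - c) * fy\<close> vanishes at both walls; the subtracted 0 is
    the derivative of the constant field.\<close>
  have B: "cint (\<lambda>z. (fy (0, z) - 0) * fy (0, z) + (f (0, z) - c) * fyy (0, z)) = 0"
    by (rule cint_deriv_y[OF C1_field_mult[OF C1_field_diff[OF f C1_field_const] fy]]) (simp add: f_def bc)
  have "cint (\<lambda>z. (fx (0, z))\<^sup>2) + cint (\<lambda>z. (fy (0, z))\<^sup>2)
     = cint (\<lambda>z. \<Lambda> * (f (0, z))\<^sup>2 + ((fx (0, z) * fx (0, z) + f (0, z) * fxx (0, z))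
        + ((fy (0, z) - 0) * fy (0, z) + (f (0, z) - c) * fyy (0, z))) + c * fyy (0, z))"
  proof (subst cint_add[symmetric])
    show "cint (\<lambda>z. (fx (0, z))\<^sup>2 + (fy (0, z))\<^sup>2)
     = cint (\<lambda>z. \<Lambda> * (f (0, z))\<^sup>2 + ((fx (0, z) * fx (0, z) + f (0, z) * fxx (0, z))
        + ((fy (0, z) - 0) * fy (0, z) + (f (0, z) - c) * fyy (0, z))) + c * fyy (0, z))"
    proof (rule cint_cong)
      fix z assume z: "z \<in> cell"
      have "fxx (0, z) + fyy (0, z) + \<Lambda> * f (0, z) = 0"
        using eq z by (cases z) (auto simp: mem_cell)
      then have "f (0, z) * (fxx (0, z) + fyy (0, z) + \<Lambda> * f (0, z)) = 0" by simp
      then show "(fx (0, z))\<^sup>2 + (fy (0, z))\<^sup>2 = \<Lambda> * (f (0, z))\<^sup>2 + ((fx (0, z) * fx (0, z) + f (0, z) * fxx (0, z))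
        + ((fy (0, z) - 0) * fy (0, z) + (f (0, z) - c) * fyy (0, z))) + c * fyy (0, z)"
        by (simp add: power2_eq_square algebra_simps)
    qed
  qed (intro continuous_intros cfx cfy)+
  also have "\<dots> = \<Lambda> * cint (\<lambda>z. (f (0, z))\<^sup>2) + (0 + 0) + c * 0"
  proof -
    have cE: "continuous_on cell (\<lambda>z. fx (0, z) * fx (0, z) + f (0, z) * fxx (0, z))"
      and cG: "continuous_on cell (\<lambda>z. (fy (0, z) - 0) * fy (0, z) + (f (0, z) - c) * fyy (0, z))"
      and cF: "continuous_on cell (\<lambda>z. \<Lambda> * (f (0, z))\<^sup>2)" and cc: "continuous_on cell (\<lambda>z. c * fyy (0, z))"
      by (intro continuous_intros cf cfx cfy cfxx cfyy)+
    show ?thesis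
      unfolding cint_add[OF continuous_on_add[OF cF continuous_on_add[OF cE cG]] cc]
        cint_add[OF cF continuous_on_add[OF cE cG]] cint_add[OF cE cG] A B integral_mult_right yy0 ..
  qed
  finally have en: "\<Lambda> * cint (\<lambda>z. (f (0, z))\<^sup>2) = cint (\<lambda>z. (fx (0, z))\<^sup>2) + cint (\<lambda>z. (fy (0, z))\<^sup>2)" by simp
  have "cint (\<lambda>z. (f (0, z))\<^sup>2) \<noteq> 0"
  proof
    assume "cint (\<lambda>z. (f (0, z))\<^sup>2) = 0"
    then have z: "\<forall>z\<in>cell. f (0, z) = 0"
      using integral_cbox_eq_0_iff[of "(0,0)" "(L,H)" "\<lambda>z. (f (0, z))\<^sup>2"] box_cell_nonempty
      by (auto simp: continuous_intros cf)
    obtain x y where xy: "y \<in> {0..H}" "u (x, y) \<noteq> 0" using nz by (auto simp: closed_strip_def)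
    have shift: "f (0, x + real n * L, y) = f (0, x, y)" for x n
    proof (induction n)
      case (Suc n)
      then show ?case using perf[OF xy(1), of "x + real n * L"] by (simp add: algebra_simps)
    qed simp
    \<comment> \<open>Translation by \<open>k\<close> periods moves the point where \<open>u\<close>
      is nonzero into the cell, on which \<open>f\<close> has been shown to vanish.\<close>
    define k where "k = \<lfloor>x / L\<rfloor>"
    have "of_int k \<le> x / L" "x / L \<le> of_int k + 1"
      unfolding k_def by linarith+
    then have k: "0 \<le> x - of_int k * L" "x - of_int k * L \<le> L"
      using L_pos by (simp_all add: pos_le_divide_eq pos_divide_le_eq distrib_right)
    have "f (0, x - of_int k * L, y) = f (0, x, y)"
    proof (cases "0 \<le> k")
      case True
      then show ?thesis using shift[of "x - of_int k * L" "nat k"] by simp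
    next
      case False
      then show ?thesis using shift[of x "nat (- k)"] by simp
    qed
    moreover have "f (0, x - of_int k * L, y) = 0" using z k xy by (auto simp: mem_cell)
    ultimately show False using xy by (simp add: f_def)
  qed
  then have "0 < cint (\<lambda>z. (f (0, z))\<^sup>2)" using cint_sq_nonneg[OF cf] by simp
  moreover have "0 \<le> \<Lambda> * cint (\<lambda>z. (f (0, z))\<^sup>2)"
    unfolding en by (intro add_nonneg_nonneg cint_sq_nonneg cfx cfy)
  ultimately show ?thesis by (simp add: zero_le_mult_iff)
qed

text \<open>The eigenfunction is \<open>e1\<close>, with the common wall value 1.\<close>

lemma channel_eigenvalue_shear: "channel_eigenvalue L H ((2 * pi / H)\<^sup>2)"
proof -
  let ?n = "2 * pi / H"
  have T1: "?n * H = 2 * pi" using H_pos by simp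
  have ce: "continuous_on S e1" for S using H_pos by (auto intro!: continuous_intros)
  have p2: "pd2 e1 = (\<lambda>z. - ?n * sin (?n * snd z))" and p1: "pd1 e1 = (\<lambda>z. 0)"
    using L_pos H_pos by (auto simp: pd1_def pd2_def fun_eq_iff intro!: DERIV_imp_deriv derivative_eq_intros)
  have p22: "pd2 (\<lambda>z. - ?n * sin (?n * snd z)) = (\<lambda>z. - (?n\<^sup>2) * e1 z)" and p11: "pd1 (\<lambda>z. 0) = (\<lambda>z. 0)"
    using L_pos H_pos by (auto simp: pd1_def pd2_def fun_eq_iff power2_eq_square intro!: DERIV_imp_deriv derivative_eq_intros)
  show ?thesis
    unfolding channel_eigenvalue_def
  proof (intro exI[of _ e1] conjI)
    show "C2_on (closed_strip H) e1"
    proof (rule C2_on_of_gradient[where p = "\<lambda>_. 0" and r = "\<lambda>z. - ?n * sin (?n * snd z)"])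
      show "(e1 has_derivative (\<lambda>h. fst h * 0 + snd h * (- ?n * sin (?n * snd z)))) (at z)" for z
        using H_pos by (auto intro!: derivative_eq_intros simp: fun_eq_iff)
      show "C1_on (closed_strip H) (\<lambda>_::real \<times> real. 0 :: real)"
        by (rule C1_on_of_gradient[where p = "\<lambda>_. 0" and r = "\<lambda>_. 0"]) (auto intro!: continuous_intros)
      show "C1_on (closed_strip H) (\<lambda>z::real \<times> real. - ?n * sin (?n * snd z))"
      proof (rule C1_on_of_gradient[where p = "\<lambda>_. 0" and r = "\<lambda>z. - ?n * (?n * cos (?n * snd z))"])
        show "((\<lambda>z::real \<times> real. - ?n * sin (?n * snd z)) has_derivative
            (\<lambda>h. fst h * 0 + snd h * (- ?n * (?n * cos (?n * snd z))))) (at z)" for z :: "real \<times> real"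
          using H_pos by (auto intro!: derivative_eq_intros simp: fun_eq_iff)
      qed (use H_pos in \<open>auto intro!: continuous_intros\<close>)
    qed
    show "channel_periodic L H e1" by (simp add: channel_periodic_def)
    show "\<exists>x\<in>closed_strip H. e1 x \<noteq> 0"
      using H_pos by (intro bexI[of _ "(0, 0)"]) (auto simp: closed_strip_def)
    show "\<forall>x\<in>strip H. - laplacian e1 x = ?n\<^sup>2 * e1 x"
      unfolding laplacian_def p1 p2 p11 p22 by simp
    show "\<exists>c. \<forall>x1. e1 (x1, 0) = c \<and> e1 (x1, H) = c"
      using T1 by (intro exI[of _ 1]) (simp add: cos_two_pi del: times_divide_eq_left)
    have "cint e1 = integral {0..L} (\<lambda>x. integral {0..H} (\<lambda>y. cos (?n * y)))"
      by (subst cint_iterated[OF ce]) simp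
    also have "\<dots> = 0" unfolding cos_sin_full_period(1)[OF H_pos] by simp
    finally show "set_lebesgue_integral lborel (period_cell L H) e1 = 0"
      using set_integral_period_cell[OF ce refl] by simp
  qed
qed

text \<open>The eigenfunction is \<open>e3\<close>, with wall value 0; its mean vanishes because its
  integral over \<open>x\<close> does at every height.\<close>

lemma channel_eigenvalue_mixed: "channel_eigenvalue L H ((2 * pi / L)\<^sup>2 + (pi / H)\<^sup>2)"
proof -
  let ?k = "2 * pi / L" and ?r = "pi / H"
  have T1: "?k * L = 2 * pi" "?r * H = pi" "?r * (H / 2) = pi / 2" using L_pos H_pos by simp_all
  have tr: "continuous_on S (\<lambda>z::real \<times> real. sin (?r * snd z))" "continuous_on S (\<lambda>z::real \<times> real. cos (?r * snd z))"
    "continuous_on S (\<lambda>z::real \<times> real. sin (?k * fst z))" "continuous_on S (\<lambda>z::real \<times> real. cos (?k * fst z))" for S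
    using L_pos H_pos by (auto intro!: continuous_intros)
  have ce: "continuous_on S e3" for S by (intro continuous_intros tr)
  have p1: "pd1 e3 = (\<lambda>z. sin (?r * snd z) * (- ?k * sin (?k * fst z)))"
    and p2: "pd2 e3 = (\<lambda>z. (?r * cos (?r * snd z)) * cos (?k * fst z))"
    using L_pos H_pos by (auto simp: pd1_def pd2_def fun_eq_iff intro!: DERIV_imp_deriv derivative_eq_intros)
  have p11: "pd1 (\<lambda>z. sin (?r * snd z) * (- ?k * sin (?k * fst z))) = (\<lambda>z. - (?k\<^sup>2) * e3 z)"
    and p22: "pd2 (\<lambda>z. (?r * cos (?r * snd z)) * cos (?k * fst z)) = (\<lambda>z. - (?r\<^sup>2) * e3 z)"
    using L_pos H_pos by (auto simp: pd1_def pd2_def fun_eq_iff power2_eq_square intro!: DERIV_imp_deriv derivative_eq_intros)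
  show ?thesis
    unfolding channel_eigenvalue_def
  proof (intro exI[of _ e3] conjI)
    show "C2_on (closed_strip H) e3"
    proof (rule C2_on_of_gradient[where p = "\<lambda>z. sin (?r * snd z) * (- ?k * sin (?k * fst z))"
          and r = "\<lambda>z. (?r * cos (?r * snd z)) * cos (?k * fst z)"])
      show "(e3 has_derivative (\<lambda>h. fst h * (sin (?r * snd z) * (- ?k * sin (?k * fst z)))
          + snd h * ((?r * cos (?r * snd z)) * cos (?k * fst z)))) (at z)" for z
        using H_pos L_pos by (auto intro!: derivative_eq_intros simp: fun_eq_iff field_simps)
      show "C1_on (closed_strip H) (\<lambda>z. sin (?r * snd z) * (- ?k * sin (?k * fst z)))"
      proof (rule C1_on_of_gradient[where p = "\<lambda>z. sin (?r * snd z) * (- ?k * (?k * cos (?k * fst z)))"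
            and r = "\<lambda>z. (?r * cos (?r * snd z)) * (- ?k * sin (?k * fst z))"])
        show "((\<lambda>z. sin (?r * snd z) * (- ?k * sin (?k * fst z))) has_derivative
           (\<lambda>h. fst h * (sin (?r * snd z) * (- ?k * (?k * cos (?k * fst z))))
             + snd h * ((?r * cos (?r * snd z)) * (- ?k * sin (?k * fst z))))) (at z)" for z
          using H_pos L_pos by (auto intro!: derivative_eq_intros simp: fun_eq_iff field_simps)
      qed (intro continuous_on_mult continuous_on_const tr)+
      show "C1_on (closed_strip H) (\<lambda>z. (?r * cos (?r * snd z)) * cos (?k * fst z))"
      proof (rule C1_on_of_gradient[where p = "\<lambda>z. (?r * cos (?r * snd z)) * (- ?k * sin (?k * fst z))"
            and r = "\<lambda>z. (- ?r * (?r * sin (?r * snd z))) * cos (?k * fst z)"])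
        show "((\<lambda>z. (?r * cos (?r * snd z)) * cos (?k * fst z)) has_derivative
           (\<lambda>h. fst h * ((?r * cos (?r * snd z)) * (- ?k * sin (?k * fst z)))
             + snd h * ((- ?r * (?r * sin (?r * snd z))) * cos (?k * fst z)))) (at z)" for z
          using H_pos L_pos by (auto intro!: derivative_eq_intros simp: fun_eq_iff field_simps)
      qed (intro continuous_on_mult continuous_on_const tr)+
    qed
    have "cos (?k * (x + L)) = cos (?k * x)" for x
      using T1(1) by (simp add: distrib_left del: times_divide_eq_left)
    then show "channel_periodic L H e3" by (simp add: channel_periodic_def)
    show "\<exists>x\<in>closed_strip H. e3 x \<noteq> 0"
      using H_pos T1(3) by (intro bexI[of _ "(0, H / 2)"]) (auto simp: closed_strip_def)
    show "\<forall>x\<in>strip H. - laplacian e3 x = (?k\<^sup>2 + ?r\<^sup>2) * e3 x"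
      unfolding laplacian_def p1 p2 p11 p22 by (simp add: algebra_simps)
    show "\<exists>c. \<forall>x1. e3 (x1, 0) = c \<and> e3 (x1, H) = c"
      using T1(2) by (intro exI[of _ 0]) (simp del: times_divide_eq_left)
    have "cint e3 = integral {0..H} (\<lambda>y. sin (?r * y) * integral {0..L} (\<lambda>x. cos (?k * x)))"
      by (subst cint_iterated_swap[OF ce]) simp
    also have "\<dots> = 0" unfolding cos_sin_full_period(1)[OF L_pos] by simp
    finally show "set_lebesgue_integral lborel (period_cell L H) e3 = 0"
      using set_integral_period_cell[OF ce refl] by simp
  qed
qed

text \<open>The hypothesis on \<open>m\<close> enters the stability argument through these two
  bounds.\<close>

lemma first_eigenvalue_le:
  "first_eigenvalue L H \<le> (2 * pi / H)\<^sup>2"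
  "first_eigenvalue L H \<le> (2 * pi / L)\<^sup>2 + (pi / H)\<^sup>2"
proof -
  have "bdd_below {\<Lambda>. channel_eigenvalue L H \<Lambda>}"
    by (rule bdd_belowI[of _ 0]) (simp add: channel_eigenvalue_nonneg)
  then show "first_eigenvalue L H \<le> (2 * pi / H)\<^sup>2"
    "first_eigenvalue L H \<le> (2 * pi / L)\<^sup>2 + (pi / H)\<^sup>2"
    unfolding first_eigenvalue_def
    by (auto intro!: cInf_lower channel_eigenvalue_shear channel_eigenvalue_mixed)
qed

subsection \<open>The stream function of the perturbation\<close>

lemma streamD:
  assumes "stream f fx fy"
  shows "continuous_on cell f" "continuous_on cell fx" "continuous_on cell fy"
    "\<And>x y. x \<in> {0..L} \<Longrightarrow> y \<in> {0..H} \<Longrightarrow> ((\<lambda>s. f (s, y)) has_real_derivative fx (x, y)) (at x within {0..L})"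
    "\<And>x y. x \<in> {0..L} \<Longrightarrow> y \<in> {0..H} \<Longrightarrow> ((\<lambda>s. f (x, s)) has_real_derivative fy (x, y)) (at y within {0..H})"
    "\<And>x. x \<in> {0..L} \<Longrightarrow> f (x, 0) = 0" "\<And>x. x \<in> {0..L} \<Longrightarrow> f (x, H) = 0"
    "\<And>y. y \<in> {0..H} \<Longrightarrow> f (0, y) = f (L, y)"
  using assms by (simp_all add: stream_def)

lemma stream_by_parts_x:
  assumes st: "stream f fx fy" and cg: "continuous_on cell g" and cgx: "continuous_on cell gx"
    and g: "\<And>x y. x \<in> {0..L} \<Longrightarrow> y \<in> {0..H} \<Longrightarrow> ((\<lambda>s. g (s, y)) has_real_derivative gx (x, y)) (at x within {0..L})"
    and per: "\<And>y. y \<in> {0..H} \<Longrightarrow> g (L, y) = g (0, y)"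
  shows "cint (\<lambda>z. f z * gx z) = - cint (\<lambda>z. fx z * g z)"
proof -
  note f = streamD[OF st]
  have "cint (\<lambda>z. f z * gx z) = integral {0..H} (\<lambda>y. integral {0..L} (\<lambda>x. f (x, y) * gx (x, y)))"
    by (rule cint_iterated_swap) (intro continuous_intros f cgx)
  also have "\<dots> = integral {0..H} (\<lambda>y. - integral {0..L} (\<lambda>x. fx (x, y) * g (x, y)))"
  proof (rule integral_cong)
    fix y assume y: "y \<in> {0..H}"
    have "integral {0..L} (\<lambda>x. f (x, y) * gx (x, y)) = f (L, y) * g (L, y) - f (0, y) * g (0, y)
       - integral {0..L} (\<lambda>x. fx (x, y) * g (x, y))"
      using L_pos by (intro integral_by_parts_within f(4) g y continuous_on_slice1 f(2) cgx) auto
    then show "integral {0..L} (\<lambda>x. f (x, y) * gx (x, y)) = - integral {0..L} (\<lambda>x. fx (x, y) * g (x, y))"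
      by (simp add: per[OF y] f(8)[OF y])
  qed
  also have "\<dots> = - cint (\<lambda>z. fx z * g z)"
    by (subst cint_iterated_swap) (auto intro!: continuous_intros f cg)
  finally show ?thesis .
qed

lemma stream_by_parts_y:
  assumes st: "stream f fx fy" and cg: "continuous_on cell g" and cgy: "continuous_on cell gy"
    and g: "\<And>x y. x \<in> {0..L} \<Longrightarrow> y \<in> {0..H} \<Longrightarrow> ((\<lambda>s. g (x, s)) has_real_derivative gy (x, y)) (at y within {0..H})"
  shows "cint (\<lambda>z. f z * gy z) = - cint (\<lambda>z. fy z * g z)"
proof -
  note f = streamD[OF st]
  have "cint (\<lambda>z. f z * gy z) = integral {0..L} (\<lambda>x. integral {0..H} (\<lambda>y. f (x, y) * gy (x, y)))"
    by (rule cint_iterated) (intro continuous_intros f cgy)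
  also have "\<dots> = integral {0..L} (\<lambda>x. - integral {0..H} (\<lambda>y. fy (x, y) * g (x, y)))"
  proof (rule integral_cong)
    fix x assume x: "x \<in> {0..L}"
    have "integral {0..H} (\<lambda>y. f (x, y) * gy (x, y)) = f (x, H) * g (x, H) - f (x, 0) * g (x, 0)
       - integral {0..H} (\<lambda>y. fy (x, y) * g (x, y))"
      using H_pos by (intro integral_by_parts_within f(5) g x continuous_on_slice2 f(3) cgy) auto
    then show "integral {0..H} (\<lambda>y. f (x, y) * gy (x, y)) = - integral {0..H} (\<lambda>y. fy (x, y) * g (x, y))"
      by (simp add: f(6,7)[OF x])
  qed
  also have "\<dots> = - cint (\<lambda>z. fy z * g z)"
    by (subst cint_iterated) (auto intro!: continuous_intros f cg)
  finally show ?thesis .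
qed

lemma continuous_on_cell_bounded:
  assumes "continuous_on cell (g :: real \<times> real \<Rightarrow> real)"
  obtains M where "0 < M" "\<And>z. z \<in> cell \<Longrightarrow> \<bar>g z\<bar> \<le> M"
proof -
  have "bounded (g ` cell)"
    by (rule compact_imp_bounded[OF compact_continuous_image[OF assms compact_cbox]])
  then obtain M where "0 < M" "\<forall>x\<in>g ` cell. norm x \<le> M" unfolding bounded_pos by blast
  then show ?thesis by (intro that[of M]) auto
qed

text \<open>Meant for stream functions defined by a vertical integral. Bounded partial derivatives
  give a Lipschitz estimate along a horizontal and then a vertical segment inside the cell.\<close>

lemma continuous_on_of_partials:
  assumes "continuous_on cell fx" "continuous_on cell fy"
    and dx: "\<And>x y. x \<in> {0..L} \<Longrightarrow> y \<in> {0..H} \<Longrightarrow> ((\<lambda>s. f (s, y)) has_real_derivative fx (x, y)) (at x within {0..L})"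
    and dy: "\<And>x y. x \<in> {0..L} \<Longrightarrow> y \<in> {0..H} \<Longrightarrow> ((\<lambda>s. f (x, s)) has_real_derivative fy (x, y)) (at y within {0..H})"
  shows "continuous_on cell f"
proof -
  obtain M where M: "0 < M" "\<And>z. z \<in> cell \<Longrightarrow> \<bar>fx z\<bar> \<le> M"
    by (rule continuous_on_cell_bounded[OF assms(1)]) blast
  obtain N where N: "0 < N" "\<And>z. z \<in> cell \<Longrightarrow> \<bar>fy z\<bar> \<le> N"
    by (rule continuous_on_cell_bounded[OF assms(2)]) blast
  have "(M + N)-lipschitz_on cell f"
  proof (rule lipschitz_onI)
    fix z z' assume zz: "z \<in> cell" "z' \<in> cell"
    obtain x y x' y' where z: "z = (x, y)" "z' = (x', y')" by (cases z; cases z')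
    have xy: "x \<in> {0..L}" "x' \<in> {0..L}" "y \<in> {0..H}" "y' \<in> {0..H}" using zz by (auto simp: z mem_cell)
    have "norm (f (x, y) - f (x', y)) \<le> M * norm (x - x')"
      by (rule field_differentiable_bound[where S = "{0..L}" and f = "\<lambda>s. f (s, y)"])
         (use dx M xy in \<open>auto simp: mem_cell\<close>)
    moreover have "norm (f (x', y) - f (x', y')) \<le> N * norm (y - y')"
      by (rule field_differentiable_bound[where S = "{0..H}" and f = "\<lambda>s. f (x', s)"])
         (use dy N xy in \<open>auto simp: mem_cell\<close>)
    moreover have "M * norm (x - x') \<le> M * dist z z'" "N * norm (y - y') \<le> N * dist z z'"
      using M(1) N(1) dist_fst_le[of z z'] dist_snd_le[of z z']
      by (auto simp: z dist_norm intro!: mult_left_mono)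
    ultimately show "dist (f z) (f z') \<le> (M + N) * dist z z'"
      by (simp add: z dist_real_def distrib_right)
  qed (use M N in simp)
  then show ?thesis by (rule lipschitz_on_continuous_on)
qed

end

section \<open>Flux, perturbation energy and Casimirs of a flow\<close>

context euler_fields
begin

text \<open>Incompressibility and impermeable walls make the flux independent of \<open>x\<close>,
  conservation of momentum makes it independent of \<open>t\<close>. Hence one constant shift of the
  reference velocity serves all times.\<close>

lemma flux: "integral {0..H} (\<lambda>y. v1 (t, x, y)) = cint (\<lambda>z. v1 (0, z)) / L"
proof -
  note f = C1_fieldD[OF v1] and g = C1_fieldD[OF v2]
  have slice: "continuous_on {0..H} (\<lambda>y. k (t, x, y))" if "continuous_on (spacetime H) k" for k :: field and x
    by (rule continuous_on_field_slice[OF that]) (auto intro!: continuous_intros)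
  have "((\<lambda>x. integral {0..H} (\<lambda>y. v1 (t, x, y))) has_real_derivative integral {0..H} (\<lambda>y. v1x (t, x, y))) (at x within UNIV)" for x
  proof (rule leibniz_rule_field_derivative[where a = 0 and b = H, unfolded cbox_interval])
    show "continuous_on (UNIV \<times> {0..H}) (\<lambda>(x, y). v1x (t, x, y))"
      unfolding case_prod_beta
      by (rule continuous_on_field_slice[OF f(3)]) (auto intro!: continuous_intros)
  qed (auto intro!: f integrable_continuous_real slice)
  moreover have "integral {0..H} (\<lambda>y. v1x (t, x, y)) = 0" for x
  proof -
    have "integral {0..H} (\<lambda>y. v1x (t, x, y)) = integral {0..H} (\<lambda>y. - v2y (t, x, y))"
      by (rule integral_cong) (use div0 in \<open>simp add: eq_neg_iff_add_eq_0\<close>)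
    also have "\<dots> = 0"
      using integral_deriv_within[of 0 H "\<lambda>y. v2 (t, x, y)" "\<lambda>y. v2y (t, x, y)"] g(7) H_pos impermeable
      by simp
    finally show ?thesis .
  qed
  ultimately have "\<forall>x. ((\<lambda>x. integral {0..H} (\<lambda>y. v1 (t, x, y))) has_real_derivative 0) (at x)" by simp
  then have const: "integral {0..H} (\<lambda>y. v1 (t, x', y)) = integral {0..H} (\<lambda>y. v1 (t, x, y))" for x'
    by (rule DERIV_isconst_all)
  have "cint (\<lambda>z. v1 (t, z)) = integral {0..L} (\<lambda>x'. integral {0..H} (\<lambda>y. v1 (t, x', y)))"
    by (rule cint_iterated) (rule continuous_on_cell[OF f(1)])
  also have "\<dots> = integral {0..L} (\<lambda>x'. integral {0..H} (\<lambda>y. v1 (t, x, y)))"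
    by (rule integral_cong) (rule const)
  also have "\<dots> = L * integral {0..H} (\<lambda>y. v1 (t, x, y))"
    using L_pos by simp
  finally show ?thesis using momentum_conserved[of t] L_pos by (simp add: field_simps)
qed

text \<open>A Galilean shift makes the flux of the perturbation vanish, so that its stream function is
  zero on both walls. In the energy identity \<open>a sin (m y + \<alpha>)\<close> may be replaced by its difference
  with the affine interpolant of its boundary values, since circulation and impulse are conserved.\<close>

lemma perturbation_stream:
  fixes a m \<alpha> :: real
  defines "wb \<equiv> \<lambda>z::real \<times> real. a * m\<^sup>2 * sin (m * snd z + \<alpha>)"
  shows "\<exists>f fx fy. (\<forall>t. stream (f t) (fx t) (fy t)) \<and>
    (\<forall>t. cint (\<lambda>z. (fx t z)\<^sup>2) + cint (\<lambda>z. (fy t z)\<^sup>2) = cint (\<lambda>z. f t z * (w (t, z) - wb z))) \<and>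
    (\<forall>t. m\<^sup>2 * (cint (\<lambda>z. (fx t z)\<^sup>2) + cint (\<lambda>z. (fy t z)\<^sup>2)) + 2 * cint (\<lambda>z. wb z * w (t, z)) =
         m\<^sup>2 * (cint (\<lambda>z. (fx 0 z)\<^sup>2) + cint (\<lambda>z. (fy 0 z)\<^sup>2)) + 2 * cint (\<lambda>z. wb z * w (0, z)))"
proof -
  note F1 = C1_fieldD[OF v1] and F2 = C1_fieldD[OF v2] and W = C1_fieldD[OF w]
  define S where "S y = a * sin (m * y + \<alpha>)" for y
  \<comment> \<open>\<open>V\<close> integrates over the height to
    \<open>S H - S 0 + \<kappa> * H\<close>, so this value gives \<open>v1 - V\<close> zero flux. A
    constant velocity does not change the vorticity \<open>wb\<close>.\<close>
  define \<kappa> where "\<kappa> = (cint (\<lambda>z. v1 (0, z)) / L - (S H - S 0)) / H"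
  define V where "V y = a * m * cos (m * y + \<alpha>) + \<kappa>" for y
  have dS: "(S has_real_derivative V y - \<kappa>) (at y within X)" for y X
    unfolding S_def V_def by (auto intro!: derivative_eq_intros)
  have dV: "(V has_real_derivative - (a * m\<^sup>2 * sin (m * y + \<alpha>))) (at y within X)" for y X
    unfolding V_def by (auto intro!: derivative_eq_intros simp: power2_eq_square)
  have cV: "continuous_on X V" for X unfolding V_def by (intro continuous_intros)
  have cS: "continuous_on X S" for X unfolding S_def by (intro continuous_intros)
  have cVz: "continuous_on cell (\<lambda>z. V (snd z))" and cSz: "continuous_on cell (\<lambda>z. S (snd z))"
    unfolding V_def S_def by (intro continuous_intros)+
  have cwb: "continuous_on cell wb" unfolding wb_def by (intro continuous_intros)
  define u where "u t z = v1 (t, z) - V (snd z)" for t and z :: "real \<times> real"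
  define uy where "uy t z = v1y (t, z) + wb z" for t z
  define f where "f t z = integral {0..snd z} (\<lambda>s. u t (fst z, s))" for t and z :: "real \<times> real"
  have c1: "continuous_on cell (\<lambda>z. v1 (t, z))" and c1y: "continuous_on cell (\<lambda>z. v1y (t, z))"
    and c2: "continuous_on cell (\<lambda>z. v2 (t, z))" and c2x: "continuous_on cell (\<lambda>z. v2x (t, z))"
    and cw: "continuous_on cell (\<lambda>z. w (t, z))" for t
    by (intro continuous_on_cell F1 F2 W)+
  have cu: "continuous_on cell (u t)" and cuy: "continuous_on cell (uy t)" for t
    unfolding u_def uy_def by (intro continuous_intros c1 c1y cVz cwb)+
  have duy: "((\<lambda>s. u t (x, s)) has_real_derivative uy t (x, y)) (at y within {0..H})"
    if "y \<in> {0..H}" for t x y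
    unfolding u_def uy_def wb_def using DERIV_diff[OF F1(7)[OF that] dV] by simp
  \<comment> \<open>Integrating \<open>u\<close> upwards from the lower wall makes \<open>u\<close>
    the \<open>y\<close> derivative; incompressibility and \<open>v2 = 0\<close> on that wall give
    \<open>- v2\<close> as the \<open>x\<close> derivative. Zero flux yields the value 0 on the
    upper wall.\<close>
  have st: "stream (f t) (\<lambda>z. - v2 (t, z)) (u t)" for t
  proof -
    have slice: "continuous_on {0..y} (\<lambda>s. u t (x, s))" if "y \<le> H" "x \<in> {0..L}" for x y
      by (rule continuous_on_subset[OF continuous_on_slice2[OF cu that(2)]]) (use that in auto)
    have dy: "((\<lambda>s. f t (x, s)) has_real_derivative u t (x, y)) (at y within {0..H})"
      if "x \<in> {0..L}" "y \<in> {0..H}" for x y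
      unfolding f_def fst_conv snd_conv
      by (rule integral_has_real_derivative[OF continuous_on_slice2[OF cu that(1)] that(2)])
    have dx: "((\<lambda>s. f t (s, y)) has_real_derivative - v2 (t, x, y)) (at x within {0..L})"
      if "x \<in> {0..L}" "y \<in> {0..H}" for x y
    proof -
      have "((\<lambda>x. integral {0..y} (\<lambda>s. u t (x, s))) has_real_derivative integral {0..y} (\<lambda>s. v1x (t, x, s))) (at x within {0..L})"
      proof (rule leibniz_rule_field_derivative[where a = 0 and b = y, unfolded cbox_interval])
        fix x s assume s: "s \<in> {0..y}"
        then have *: "((\<lambda>x. v1 (t, x, s)) has_real_derivative v1x (t, x, s)) (at x)"
          using that by (intro F1(6)) auto
        show "((\<lambda>x. u t (x, s)) has_real_derivative v1x (t, x, s)) (at x within {0..L})"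
          unfolding u_def snd_conv
          by (rule DERIV_cong[OF DERIV_diff[OF has_field_derivative_at_within[OF *] DERIV_const]]) simp
      next
        show "(\<lambda>s. u t (x, s)) integrable_on {0..y}" if "x \<in> {0..L}" for x
          using slice that \<open>y \<in> {0..H}\<close> by (intro integrable_continuous_real) auto
        show "continuous_on ({0..L} \<times> {0..y}) (\<lambda>(x, s). v1x (t, x, s))"
          unfolding case_prod_beta
          by (rule continuous_on_field_slice[OF F1(3)]) (use that in \<open>auto intro!: continuous_intros\<close>)
      qed (use that in auto)
      moreover have "integral {0..y} (\<lambda>s. v1x (t, x, s)) = integral {0..y} (\<lambda>s. - v2y (t, x, s))"
        by (rule integral_cong) (use div0 that in \<open>simp add: eq_neg_iff_add_eq_0\<close>)
      moreover have "integral {0..y} (\<lambda>s. v2y (t, x, s)) = v2 (t, x, y) - v2 (t, x, 0)"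
        by (rule integral_deriv_within) (use that in \<open>auto intro!: DERIV_subset[OF F2(7)]\<close>)
      ultimately show ?thesis using impermeable by (simp add: f_def)
    qed
    have cv2: "continuous_on cell (\<lambda>z. - v2 (t, z))" by (intro continuous_intros c2)
    have "continuous_on cell (f t)"
      by (rule continuous_on_of_partials[OF cv2 cu dx dy])
    moreover have "f t (x, H) = 0" if "x \<in> {0..L}" for x
    proof -
      have "continuous_on {0..H} (\<lambda>s. v1 (t, x, s))"
        by (rule continuous_on_field_slice[OF F1(1)]) (auto intro!: continuous_intros)
      then have "f t (x, H) = integral {0..H} (\<lambda>s. v1 (t, x, s)) - integral {0..H} V"
        unfolding f_def u_def fst_conv snd_conv
        by (intro integral_diff integrable_continuous_real cV)
      moreover have "integral {0..H} V = (S H + \<kappa> * H) - (S 0 + \<kappa> * 0)"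
        by (rule integral_deriv_within) (use H_pos dS in \<open>auto intro!: derivative_eq_intros\<close>)
      ultimately show ?thesis using H_pos by (simp add: flux \<kappa>_def)
    qed
    moreover have "f t (0, y) = f t (L, y)" if "y \<in> {0..H}" for y
      unfolding f_def u_def fst_conv snd_conv
      by (rule integral_cong) (use that periodic(1) in auto)
    ultimately show ?thesis
      unfolding stream_def using dx dy cu cv2 by (auto simp: f_def)
  qed
  define E where "E t = cint (\<lambda>z. (- v2 (t, z))\<^sup>2) + cint (\<lambda>z. (u t z)\<^sup>2)" for t
  \<comment> \<open>\<open>w - wb\<close> is minus the Laplacian of \<open>f\<close>, and this is
    Green's identity without boundary terms.\<close>
  have ident: "E t = cint (\<lambda>z. f t z * (w (t, z) - wb z))" for t
  proof -
    have "cint (\<lambda>z. f t z * v2x (t, z)) = - cint (\<lambda>z. - v2 (t, z) * v2 (t, z))"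
      by (rule stream_by_parts_x[OF st c2 c2x])
         (use periodic(2) in \<open>auto intro!: has_field_derivative_at_within[OF F2(6)]\<close>)
    moreover have "cint (\<lambda>z. f t z * uy t z) = - cint (\<lambda>z. u t z * u t z)"
      by (rule stream_by_parts_y[OF st cu cuy duy])
    moreover have "cint (\<lambda>z. f t z * (w (t, z) - wb z)) = cint (\<lambda>z. f t z * v2x (t, z) - f t z * uy t z)"
    proof (rule cint_cong)
      fix z assume "z \<in> cell"
      then show "f t z * (w (t, z) - wb z) = f t z * v2x (t, z) - f t z * uy t z"
        by (cases z) (auto simp: mem_cell w_eq uy_def algebra_simps)
    qed
    moreover have "cint (\<lambda>z. f t z * v2x (t, z) - f t z * uy t z) = cint (\<lambda>z. f t z * v2x (t, z)) - cint (\<lambda>z. f t z * uy t z)"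
      by (intro cint_diff continuous_intros streamD(1)[OF st] c2x cuy)
    ultimately show ?thesis by (simp add: E_def power2_eq_square)
  qed
  \<comment> \<open>\<open>S 0 + c * y\<close> interpolates \<open>S\<close> at the walls, so
    \<open>Sd\<close> vanishes there; the pairing of this affine function with the vorticity is a
    combination of circulation and impulse.\<close>
  define c where "c = (S H - S 0) / H"
  define Sd where "Sd z = S (snd z) - S 0 - c * snd z" for z :: "real \<times> real"
  have cSd: "continuous_on cell Sd" unfolding Sd_def by (intro continuous_intros cSz)
  have stS: "stream Sd (\<lambda>_. 0) (\<lambda>z. V (snd z) - \<kappa> - c)"
    unfolding stream_def
    using H_pos cSd by (auto intro!: continuous_intros cVz derivative_eq_intros dS simp: Sd_def c_def)
  have energy: "cint (\<lambda>z. (v1 (t, z))\<^sup>2 + (v2 (t, z))\<^sup>2) = E t + 2 * cint (\<lambda>z. S (snd z) * w (t, z))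
      - 2 * (S 0 * cint (\<lambda>z. w (0, z)) + c * cint (\<lambda>z. snd z * w (0, z)) + cint (\<lambda>z. Sd z * wb z))
      + cint (\<lambda>z. (V (snd z))\<^sup>2)" for t
  proof -
    have u0: "cint (u t) = 0"
    proof -
      have "cint (u t) = integral {0..L} (\<lambda>x. integral {0..H} (\<lambda>y. u t (x, y)))"
        by (rule cint_iterated[OF cu])
      also have "\<dots> = integral {0..L} (\<lambda>x. f t (x, H))" by (simp add: f_def)
      also have "\<dots> = integral {0..L} (\<lambda>x. 0)" by (rule integral_cong) (rule streamD(7)[OF st])
      finally show ?thesis by simp
    qed
    \<comment> \<open>The cross term of the energy is moved from \<open>u\<close> to its derivative;
      the constant \<open>\<kappa> + c\<close> drops out because \<open>u\<close> has mean
      zero.\<close>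
    have "cint (\<lambda>z. Sd z * uy t z) = - cint (\<lambda>z. (V (snd z) - \<kappa> - c) * u t z)"
      by (rule stream_by_parts_y[OF stS cu cuy duy])
    also have "cint (\<lambda>z. (V (snd z) - \<kappa> - c) * u t z) = cint (\<lambda>z. V (snd z) * u t z - (\<kappa> + c) * u t z)"
      by (simp add: algebra_simps)
    also have "\<dots> = cint (\<lambda>z. V (snd z) * u t z) - (\<kappa> + c) * cint (u t)"
      unfolding integral_mult_right[symmetric] by (intro cint_diff continuous_intros cVz cu)
    finally have Vu: "cint (\<lambda>z. V (snd z) * u t z) = - cint (\<lambda>z. Sd z * uy t z)" using u0 by simp
    have "cint (\<lambda>z. Sd z * v2x (t, z)) = - cint (\<lambda>z. 0 * v2 (t, z))"
      by (rule stream_by_parts_x[OF stS c2 c2x])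
         (use periodic(2) in \<open>auto intro!: has_field_derivative_at_within[OF F2(6)]\<close>)
    then have Sv: "cint (\<lambda>z. Sd z * v2x (t, z)) = 0" by simp
    have "cint (\<lambda>z. Sd z * uy t z) = cint (\<lambda>z. Sd z * v2x (t, z) - (Sd z * w (t, z) - Sd z * wb z))"
    proof (rule cint_cong)
      fix z assume "z \<in> cell"
      then show "Sd z * uy t z = Sd z * v2x (t, z) - (Sd z * w (t, z) - Sd z * wb z)"
        by (cases z) (auto simp: mem_cell w_eq uy_def algebra_simps)
    qed
    also have "\<dots> = cint (\<lambda>z. Sd z * v2x (t, z)) - cint (\<lambda>z. Sd z * w (t, z) - Sd z * wb z)"
      by (intro cint_diff continuous_intros cSd c2x cw cwb)
    also have "cint (\<lambda>z. Sd z * w (t, z) - Sd z * wb z) = cint (\<lambda>z. Sd z * w (t, z)) - cint (\<lambda>z. Sd z * wb z)"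
      by (intro cint_diff continuous_intros cSd cw cwb)
    also have "cint (\<lambda>z. Sd z * w (t, z)) = cint (\<lambda>z. S (snd z) * w (t, z) - (S 0 * w (t, z) + c * (snd z * w (t, z))))"
      by (simp add: Sd_def algebra_simps)
    also have "\<dots> = cint (\<lambda>z. S (snd z) * w (t, z)) - cint (\<lambda>z. S 0 * w (t, z) + c * (snd z * w (t, z)))"
      by (intro cint_diff continuous_intros cSz cw)
    also have "cint (\<lambda>z. S 0 * w (t, z) + c * (snd z * w (t, z))) = cint (\<lambda>z. S 0 * w (t, z)) + cint (\<lambda>z. c * (snd z * w (t, z)))"
      by (intro cint_add continuous_intros cw)
    finally have Su: "- cint (\<lambda>z. Sd z * uy t z) = cint (\<lambda>z. S (snd z) * w (t, z))
       - (S 0 * cint (\<lambda>z. w (0, z)) + c * cint (\<lambda>z. snd z * w (0, z)) + cint (\<lambda>z. Sd z * wb z))"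
      using Sv vorticity_power_conserved[of t 1] impulse_conserved[of t] by simp
    have "cint (\<lambda>z. (v1 (t, z))\<^sup>2 + (v2 (t, z))\<^sup>2)
      = cint (\<lambda>z. ((- v2 (t, z))\<^sup>2 + (u t z)\<^sup>2) + (2 * (V (snd z) * u t z) + (V (snd z))\<^sup>2))"
      by (rule cint_cong) (simp add: u_def power2_eq_square algebra_simps)
    also have "\<dots> = cint (\<lambda>z. (- v2 (t, z))\<^sup>2 + (u t z)\<^sup>2) + cint (\<lambda>z. 2 * (V (snd z) * u t z) + (V (snd z))\<^sup>2)"
      by (intro cint_add continuous_intros c2 cu cVz)
    also have "cint (\<lambda>z. (- v2 (t, z))\<^sup>2 + (u t z)\<^sup>2) = E t"
      unfolding E_def by (intro cint_add continuous_intros c2 cu)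
    also have "cint (\<lambda>z. 2 * (V (snd z) * u t z) + (V (snd z))\<^sup>2) = cint (\<lambda>z. 2 * (V (snd z) * u t z)) + cint (\<lambda>z. (V (snd z))\<^sup>2)"
      by (intro cint_add continuous_intros cu cVz)
    finally show ?thesis using Vu Su by simp
  qed
  have "E t + 2 * cint (\<lambda>z. S (snd z) * w (t, z)) = E 0 + 2 * cint (\<lambda>z. S (snd z) * w (0, z))" for t
    using energy[of t] energy[of 0] energy_conserved[of t] by linarith
  then have "m\<^sup>2 * (E t + 2 * cint (\<lambda>z. S (snd z) * w (t, z))) = m\<^sup>2 * (E 0 + 2 * cint (\<lambda>z. S (snd z) * w (0, z)))" for t
    by (rule arg_cong[where f = "\<lambda>x. m\<^sup>2 * x"])
  \<comment> \<open>For a sine profile the vorticity is proportional to the stream function, with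
    factor \<open>m\<^sup>2\<close>; this is why the energy identity was multiplied by it.\<close>
  moreover have "cint (\<lambda>z. wb z * w (t, z)) = m\<^sup>2 * cint (\<lambda>z. S (snd z) * w (t, z))" for t
    unfolding integral_mult_right[symmetric] by (rule cint_cong) (simp add: wb_def S_def)
  ultimately have "m\<^sup>2 * E t + 2 * cint (\<lambda>z. wb z * w (t, z)) = m\<^sup>2 * E 0 + 2 * cint (\<lambda>z. wb z * w (0, z))" for t
    by (simp add: algebra_simps)
  note en = this
  show ?thesis
    by (intro exI[of _ f] exI[of _ "\<lambda>t z. - v2 (t, z)"] exI[of _ u] conjI allI;
        rule st ident[unfolded E_def] en[unfolded E_def])
qed

text \<open>Reduced to powers by Weierstrass on an interval containing the ranges of the vorticity
  at times 0 and \<open>t\<close>; both ranges are bounded because the cell is compact.\<close>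

lemma casimir_conserved:
  fixes F :: "real \<Rightarrow> real"
  assumes F: "continuous_on UNIV F"
  shows "cint (\<lambda>z. F (w (t, z))) = cint (\<lambda>z. F (w (0, z)))"
proof -
  have cw: "continuous_on cell (\<lambda>z. w (t, z))" for t
    by (intro continuous_on_cell C1_fieldD(1)[OF w])
  have cF: "continuous_on cell (\<lambda>z. F (w (t, z)))" for t
    by (rule continuous_on_compose2[OF F cw]) auto
  obtain M where M: "\<And>z. z \<in> cell \<Longrightarrow> \<bar>w (t, z)\<bar> \<le> M"
    by (rule continuous_on_cell_bounded[OF cw]) blast
  obtain N where N: "\<And>z. z \<in> cell \<Longrightarrow> \<bar>w (0, z)\<bar> \<le> N"
    by (rule continuous_on_cell_bounded[OF cw]) blast
  define R where "R = max M N"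
  have "\<bar>cint (\<lambda>z. F (w (t, z))) - cint (\<lambda>z. F (w (0, z)))\<bar> \<le> e" if e: "e > 0" for e
  proof -
    \<comment> \<open>Each of the two comparisons with the polynomial costs this times the area,
      that is \<open>e / 2\<close>.\<close>
    define \<epsilon> where "\<epsilon> = e / (2 * (L * H))"
    have \<epsilon>: "\<epsilon> > 0" "\<epsilon> * (L * H) = e / 2" using e L_pos H_pos by (auto simp: \<epsilon>_def)
    have "continuous_on {-R..R} F" by (rule continuous_on_subset[OF F]) simp
    then obtain g where g: "real_polynomial_function g" "\<And>x. x \<in> {-R..R} \<Longrightarrow> \<bar>F x - g x\<bar> < \<epsilon>"
      using Stone_Weierstrass_real_polynomial_function[OF compact_Icc _ \<epsilon>(1)] by blast
    obtain a n where a: "g = (\<lambda>x. \<Sum>i\<le>n. a i * x ^ i)"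
      using g(1) real_polynomial_function_iff_sum by metis
    have cg: "continuous_on cell (\<lambda>z. g (w (t, z)))" for t
      unfolding a by (intro continuous_intros cw)
    have gc: "cint (\<lambda>z. g (w (t, z))) = (\<Sum>i\<le>n. a i * cint (\<lambda>z. w (t, z) ^ i))" for t
      unfolding a integral_mult_right[symmetric]
      by (intro integral_sum integrable_continuous continuous_intros cw) auto
    have close: "\<bar>cint (\<lambda>z. F (w (s, z))) - cint (\<lambda>z. g (w (s, z)))\<bar> \<le> e / 2"
      if "\<And>z. z \<in> cell \<Longrightarrow> \<bar>w (s, z)\<bar> \<le> R" for s
    proof -
      have "\<bar>cint (\<lambda>z. F (w (s, z))) - cint (\<lambda>z. g (w (s, z)))\<bar> = \<bar>cint (\<lambda>z. F (w (s, z)) - g (w (s, z)))\<bar>"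
        by (subst cint_diff) (intro cF cg refl)+
      also have "\<dots> \<le> cint (\<lambda>z. \<bar>F (w (s, z)) - g (w (s, z))\<bar>)"
        by (intro cint_abs_le continuous_intros cF cg)
      also have "\<dots> \<le> cint (\<lambda>z. \<epsilon>)"
      proof (intro cint_mono continuous_intros cF cg)
        fix z assume "z \<in> cell"
        then have "w (s, z) \<in> {-R..R}" using that[of z] by auto
        then show "\<bar>F (w (s, z)) - g (w (s, z))\<bar> \<le> \<epsilon>" using g(2) by (intro less_imp_le)
      qed
      also have "\<dots> = e / 2" using cint_const[of \<epsilon>] \<epsilon> by simp
      finally show ?thesis .
    qed
    have "cint (\<lambda>z. g (w (t, z))) = cint (\<lambda>z. g (w (0, z)))"
      unfolding gc by (intro sum.cong refl) (simp only: vorticity_power_conserved[of t])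
    moreover have "\<bar>cint (\<lambda>z. F (w (t, z))) - cint (\<lambda>z. g (w (t, z)))\<bar> \<le> e / 2"
      by (rule close) (use M in \<open>simp add: R_def le_max_iff_disj\<close>)
    moreover have "\<bar>cint (\<lambda>z. F (w (0, z))) - cint (\<lambda>z. g (w (0, z)))\<bar> \<le> e / 2"
      by (rule close) (use N in \<open>simp add: R_def le_max_iff_disj\<close>)
    ultimately show ?thesis by linarith
  qed
  then have "\<bar>cint (\<lambda>z. F (w (t, z))) - cint (\<lambda>z. F (w (0, z)))\<bar> \<le> 0 + e" if "e > 0" for e
    using that by simp
  from field_le_epsilon[OF this] show ?thesis by simp
qed

end

subsection \<open>Estimates at a fixed time\<close>

definition clamp_to :: "real \<Rightarrow> real \<Rightarrow> real" where
  "clamp_to A s = max (- A) (min A s)"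

lemma abs_clamp_to: "0 \<le> A \<Longrightarrow> \<bar>clamp_to A s\<bar> \<le> A"
  by (auto simp: clamp_to_def)

lemma clamp_to_lipschitz: "\<bar>clamp_to A s - clamp_to A r\<bar> \<le> \<bar>s - r\<bar>"
  by (auto simp: clamp_to_def max_def min_def)

lemma clamp_to_id: "\<bar>r\<bar> \<le> A \<Longrightarrow> clamp_to A r = r"
  by (auto simp: clamp_to_def)

lemma clamp_to_nearest: "\<bar>r\<bar> \<le> A \<Longrightarrow> \<bar>s - clamp_to A s\<bar> \<le> \<bar>s - r\<bar>"
  by (auto simp: clamp_to_def max_def min_def)

lemma power2_sum_le: "(a + b)\<^sup>2 \<le> 2 * a\<^sup>2 + 2 * b\<^sup>2" for a b :: real
  using sum_squares_bound[of a b] by (simp add: power2_sum)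

lemma continuous_on_clamp_to [continuous_intros]:
  "continuous_on X f \<Longrightarrow> continuous_on X (\<lambda>x. clamp_to A (f x))"
  unfolding clamp_to_def by (intro continuous_intros)

lemma continuous_on_abs_powr:
  fixes f :: "'a::t2_space \<Rightarrow> real"
  shows "0 < p \<Longrightarrow> continuous_on X f \<Longrightarrow> continuous_on X (\<lambda>x. \<bar>f x\<bar> powr p)"
  by (rule continuous_on_powr') (auto intro!: continuous_intros)

context channel
begin

text \<open>A weak form of Hoelder's inequality: the pointwise bound
  \<open>s \<le> 1 + s powr p\<close> is used at scale \<open>d\<close>, and its two summands give
  the two terms of the constant.\<close>

lemma cint_abs_le_of_powr:
  assumes p: "1 < p" and d: "0 < d" and r: "continuous_on cell r"
    and rd: "cint (\<lambda>z. \<bar>r z\<bar> powr p) \<le> d powr p"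
  shows "cint (\<lambda>z. \<bar>r z\<bar>) \<le> (L * H + 1) * d"
proof -
  have cp: "continuous_on cell (\<lambda>z. \<bar>r z\<bar> powr p)"
    by (rule continuous_on_abs_powr) (use p r in auto)
  have "cint (\<lambda>z. \<bar>r z\<bar>) \<le> cint (\<lambda>z. d + d / d powr p * \<bar>r z\<bar> powr p)"
  proof (intro cint_mono continuous_on_add continuous_on_mult continuous_on_const continuous_on_rabs r cp)
    fix z
    have "\<bar>r z\<bar> / d \<le> 1 + (\<bar>r z\<bar> / d) powr p"
    proof (cases "\<bar>r z\<bar> / d \<le> 1")
      case False
      then have "(\<bar>r z\<bar> / d) powr 1 \<le> (\<bar>r z\<bar> / d) powr p"
        using p by (intro powr_mono) auto
      then show ?thesis using False d by simp
    qed (simp add: add_increasing2)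
    then have "d * (\<bar>r z\<bar> / d) \<le> d * (1 + (\<bar>r z\<bar> / d) powr p)"
      using d by (intro mult_left_mono) auto
    then show "\<bar>r z\<bar> \<le> d + d / d powr p * \<bar>r z\<bar> powr p"
      using d by (simp add: powr_divide distrib_left)
  qed
  also have "\<dots> = d * (L * H) + d / d powr p * cint (\<lambda>z. \<bar>r z\<bar> powr p)"
    unfolding cint_const[of d, symmetric] integral_mult_right[symmetric]
    by (intro cint_add continuous_on_mult continuous_on_const cp)
  also have "\<dots> \<le> d * (L * H) + d / d powr p * d powr p"
    using rd d by (intro add_left_mono mult_left_mono) auto
  also have "\<dots> = (L * H + 1) * d" using d by (simp add: algebra_simps)
  finally show ?thesis .
qed

lemma cint_abs_le_sqrt:
  assumes "continuous_on cell r"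
  shows "cint (\<lambda>z. \<bar>r z\<bar>) \<le> sqrt (L * H * cint (\<lambda>z. (r z)\<^sup>2))"
proof (rule real_le_rsqrt)
  have "(cint (\<lambda>z. \<bar>r z\<bar> * 1))\<^sup>2 \<le> cint (\<lambda>z. \<bar>r z\<bar>\<^sup>2) * cint (\<lambda>z. 1\<^sup>2)"
    by (intro cint_cauchy_schwarz continuous_intros assms)
  then show "(cint (\<lambda>z. \<bar>r z\<bar>))\<^sup>2 \<le> L * H * cint (\<lambda>z. (r z)\<^sup>2)"
    using cint_const[of 1] by (simp add: mult.commute)
qed

lemma cint_mult_bound:
  assumes "continuous_on cell g" "continuous_on cell r" and "\<And>z. z \<in> cell \<Longrightarrow> \<bar>g z\<bar> \<le> K"
  shows "\<bar>cint (\<lambda>z. g z * r z)\<bar> \<le> K * cint (\<lambda>z. \<bar>r z\<bar>)"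
proof -
  have "\<bar>cint (\<lambda>z. g z * r z)\<bar> \<le> cint (\<lambda>z. \<bar>g z * r z\<bar>)"
    by (intro cint_abs_le continuous_intros assms)
  also have "\<dots> \<le> cint (\<lambda>z. K * \<bar>r z\<bar>)"
    using assms(3) by (intro cint_mono continuous_intros assms) (auto simp: abs_mult intro!: mult_right_mono)
  finally show ?thesis by simp
qed

text \<open>Here \<open>w\<close> is the vorticity, \<open>\<theta>\<close> its truncation, \<open>wb\<close> the vorticity of the shear flow and \<open>f\<close> the
  stream function of \<open>w - wb\<close>; the inequalities are those that the conservation laws provide.\<close>

definition near_state where
  "near_state p A \<mu> f fx fy w \<theta> wb d \<longleftrightarrow> stream f fx fy \<and>
     continuous_on cell w \<and> continuous_on cell \<theta> \<and> continuous_on cell wb \<and> 0 < d \<and> d \<le> (1::real) \<and>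
     (\<forall>z\<in>cell. \<bar>\<theta> z\<bar> \<le> A \<and> \<bar>wb z\<bar> \<le> A) \<and> cint (\<lambda>z. \<bar>w z - \<theta> z\<bar> powr p) \<le> d powr p \<and>
     cint (\<lambda>z. (fx z)\<^sup>2) + cint (\<lambda>z. (fy z)\<^sup>2) = cint (\<lambda>z. f z * (w z - wb z)) \<and>
     2 * cint (\<lambda>z. wb z * (wb z - w z)) \<le> \<mu> * (cint (\<lambda>z. (fx z)\<^sup>2) + cint (\<lambda>z. (fy z)\<^sup>2)) + d \<and>
     cint (\<lambda>z. (\<theta> z)\<^sup>2) \<le> cint (\<lambda>z. (wb z)\<^sup>2) + d \<and> \<bar>cint \<theta> - cint wb\<bar> \<le> d"

text \<open>With \<open>\<eta> = \<theta> - wb\<close> and \<open>f'\<close> the mean-free part of \<open>f\<close>, the conservation laws give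
  \<open>\<parallel>\<eta>\<parallel>\<^sup>2 \<le> \<mu> E + O(d)\<close> and \<open>E = \<integral> f' \<eta> + O(d)\<close>; completing the square yields the claim.\<close>

lemma energy_casimir_estimate:
  fixes p A \<mu> :: real
  assumes p: "1 < p" and A: "0 \<le> A" and \<mu>: "0 \<le> \<mu>"
  shows "\<exists>C>0. \<forall>f fx fy w \<theta> wb d Q. near_state p A \<mu> f fx fy w \<theta> wb d \<longrightarrow>
     \<mu> * (cint (\<lambda>z. (f z)\<^sup>2) - (cint f)\<^sup>2 / (L * H)) + Q \<le> cint (\<lambda>z. (fx z)\<^sup>2) + cint (\<lambda>z. (fy z)\<^sup>2) \<longrightarrow>
     cint (\<lambda>z. (\<theta> z - wb z - \<mu> * (f z - cint f / (L * H)))\<^sup>2) + \<mu> * Q \<le> C * d"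
proof -
  obtain C1 where C1: "C1 > 0" and dual: "\<And>f fx fy \<rho> X d. stream f fx fy \<Longrightarrow> continuous_on cell \<rho> \<Longrightarrow> X > 0 \<Longrightarrow> d > 0 \<Longrightarrow>
     cint (\<lambda>z. (fx z)\<^sup>2) + cint (\<lambda>z. (fy z)\<^sup>2) \<le> X\<^sup>2 \<Longrightarrow> cint (\<lambda>z. \<bar>\<rho> z\<bar> powr p) \<le> d powr p \<Longrightarrow>
     cint (\<lambda>z. \<bar>f z * \<rho> z\<bar>) \<le> C1 * X * d"
    using stream_duality_bound[OF p] by blast
  \<comment> \<open>\<open>N\<close> dominates the \<open>L^p\<close> norm of the constant 1, so
    duality with \<open>\<rho> = 1\<close> bounds the integral of
    \<open>\<bar>f\<bar>\<close>.\<close>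
  define N where "N = L * H + 1"
  have LH: "L * H > 0" using L_pos H_pos by simp
  then have N: "N > 1" "L * H \<le> N powr p"
    using p powr_mono[of 1 p N] by (auto simp: N_def)
  define K where "K = 2 * A * N + 1"
  \<comment> \<open>Read off from the inequality \<open>Y * Y \<le> Y0 * Y\<close> derived below
    when \<open>Y > 1\<close>.\<close>
  define Y0 where "Y0 = 2 * C1 * K + 2"
  have K: "K \<ge> 1" using A N by (simp add: K_def)
  have Y0: "Y0 \<ge> 2" using C1 K by (simp add: Y0_def)
  define C4 where "C4 = C1 * Y0 * N / (L * H) + C1 * Y0"
  have C4: "C4 > 0" using C1 Y0 N LH by (simp add: C4_def add_pos_pos)
  define C where "C = 2 + 2 * A * N + 2 * \<mu> * C4"
  show ?thesis
  proof (intro exI[of _ C] conjI allI impI)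
    show "C > 0" using A N \<mu> C4 by (simp add: C_def add_pos_nonneg)
    fix f fx fy w \<theta> wb and d Q :: real
    assume ns: "near_state p A \<mu> f fx fy w \<theta> wb d"
      and gap: "\<mu> * (cint (\<lambda>z. (f z)\<^sup>2) - (cint f)\<^sup>2 / (L * H)) + Q \<le> cint (\<lambda>z. (fx z)\<^sup>2) + cint (\<lambda>z. (fy z)\<^sup>2)"
    from ns have st: "stream f fx fy" and cw: "continuous_on cell w" and ct: "continuous_on cell \<theta>"
      and cb: "continuous_on cell wb" and d: "0 < d" "d \<le> 1"
      and bnd: "\<forall>z\<in>cell. \<bar>\<theta> z\<bar> \<le> A \<and> \<bar>wb z\<bar> \<le> A" and rd: "cint (\<lambda>z. \<bar>w z - \<theta> z\<bar> powr p) \<le> d powr p"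
      and Eid: "cint (\<lambda>z. (fx z)\<^sup>2) + cint (\<lambda>z. (fy z)\<^sup>2) = cint (\<lambda>z. f z * (w z - wb z))"
      and H1: "2 * cint (\<lambda>z. wb z * (wb z - w z)) \<le> \<mu> * (cint (\<lambda>z. (fx z)\<^sup>2) + cint (\<lambda>z. (fy z)\<^sup>2)) + d"
      and H2: "cint (\<lambda>z. (\<theta> z)\<^sup>2) \<le> cint (\<lambda>z. (wb z)\<^sup>2) + d" and H3: "\<bar>cint \<theta> - cint wb\<bar> \<le> d"
      unfolding near_state_def by - (elim conjE, assumption)+
    note cf = streamD(1-3)[OF st]
    define E where "E = cint (\<lambda>z. (fx z)\<^sup>2) + cint (\<lambda>z. (fy z)\<^sup>2)"
    define \<rho> where "\<rho> z = w z - \<theta> z" for z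
    define \<eta> where "\<eta> z = \<theta> z - wb z" for z
    have cr: "continuous_on cell \<rho>" and ce: "continuous_on cell \<eta>"
      unfolding \<rho>_def \<eta>_def by (intro continuous_intros cw ct cb)+
    have E0: "0 \<le> E" unfolding E_def by (intro add_nonneg_nonneg cint_sq_nonneg cf)
    \<comment> \<open>The summand \<open>d\<close> keeps the scale positive when the energy
      vanishes.\<close>
    define Y where "Y = sqrt E + d"
    have Y: "Y > 0" "E \<le> Y\<^sup>2"
    proof -
      show "Y > 0" using E0 d by (simp add: Y_def add_nonneg_pos)
      have "(sqrt E)\<^sup>2 \<le> Y\<^sup>2" using E0 d by (intro power_mono) (auto simp: Y_def)
      then show "E \<le> Y\<^sup>2" using E0 by simp
    qed
    have fr: "cint (\<lambda>z. \<bar>f z * \<rho> z\<bar>) \<le> C1 * Y * d"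
      by (rule dual[OF st cr Y(1) d(1)]) (use Y(2) rd in \<open>simp_all add: E_def \<rho>_def\<close>)
    have f1: "cint (\<lambda>z. \<bar>f z\<bar>) \<le> C1 * Y * N"
      using dual[OF st continuous_on_const[of _ 1] Y(1), of N] Y(2) N cint_const[of 1] by (simp add: E_def)
    have fe: "\<bar>cint (\<lambda>z. \<eta> z * f z)\<bar> \<le> 2 * A * cint (\<lambda>z. \<bar>f z\<bar>)"
      by (rule cint_mult_bound[OF ce cf(1)]) (use bnd in \<open>force simp: \<eta>_def\<close>)
    have Esplit: "E = cint (\<lambda>z. \<eta> z * f z) + cint (\<lambda>z. f z * \<rho> z)"
    proof -
      have "E = cint (\<lambda>z. \<eta> z * f z + f z * \<rho> z)"
        unfolding E_def Eid by (simp add: \<eta>_def \<rho>_def algebra_simps)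
      also have "\<dots> = cint (\<lambda>z. \<eta> z * f z) + cint (\<lambda>z. f z * \<rho> z)"
        by (intro cint_add continuous_intros ce cr cf)
      finally show ?thesis .
    qed
    have fr': "\<bar>cint (\<lambda>z. f z * \<rho> z)\<bar> \<le> C1 * Y * d"
      using cint_abs_le[of "\<lambda>z. f z * \<rho> z"] fr cf cr by (force intro!: continuous_intros)
    \<comment> \<open>A priori bound: as \<open>\<eta>\<close> is bounded by \<open>2 * A\<close>,
      the energy grows at most linearly in its own root.\<close>
    have "Y \<le> Y0"
    proof (cases "Y \<le> 1")
      case False
      have "2 * A * cint (\<lambda>z. \<bar>f z\<bar>) \<le> 2 * A * (C1 * Y * N)"
        using f1 A by (intro mult_left_mono) auto
      moreover have "C1 * Y * d \<le> C1 * Y * 1" using C1 Y d by (intro mult_left_mono) auto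
      ultimately have EY: "E \<le> C1 * K * Y"
        using Esplit fe fr' by (simp add: K_def algebra_simps)
      have "Y\<^sup>2 \<le> 2 * E + 2 * d\<^sup>2"
        using sum_squares_bound[of "sqrt E" d] E0 by (simp add: Y_def power2_sum)
      also have "\<dots> \<le> 2 * (C1 * K * Y) + 2 * Y"
        using EY False d power_mono[of d 1 2] by (intro add_mono) auto
      finally have "Y * Y \<le> Y0 * Y" by (simp add: Y0_def power2_eq_square algebra_simps)
      then show ?thesis using Y(1) by simp
    qed (use Y0 in simp)
    then have f1': "cint (\<lambda>z. \<bar>f z\<bar>) \<le> C1 * Y0 * N" and fr'': "\<bar>cint (\<lambda>z. f z * \<rho> z)\<bar> \<le> C1 * Y0 * d"
      using f1 fr' C1 N d by (meson mult_left_mono mult_right_mono less_imp_le order_trans less_trans zero_less_one)+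
    define M where "M = cint f / (L * H)"
    define fm where "fm z = f z - M" for z
    have cfm: "continuous_on cell fm" unfolding fm_def by (intro continuous_intros cf)
    have Mb: "\<bar>M\<bar> \<le> C1 * Y0 * N / (L * H)"
      using cint_abs_le[OF cf(1)] f1' LH by (simp add: M_def abs_divide divide_right_mono)
    have e1: "\<bar>cint \<eta>\<bar> \<le> d"
      using H3 unfolding \<eta>_def by (subst cint_diff) (auto intro: ct cb)
    have fe2: "cint (\<lambda>z. \<eta> z * f z) = cint (\<lambda>z. fm z * \<eta> z) + M * cint \<eta>"
    proof -
      have "cint (\<lambda>z. \<eta> z * f z) = cint (\<lambda>z. fm z * \<eta> z + M * \<eta> z)"
        by (simp add: fm_def algebra_simps)
      also have "\<dots> = cint (\<lambda>z. fm z * \<eta> z) + cint (\<lambda>z. M * \<eta> z)"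
        by (intro cint_add continuous_intros ce cfm)
      finally show ?thesis by simp
    qed
    have "\<bar>M * cint \<eta>\<bar> \<le> C1 * Y0 * N / (L * H) * d"
      unfolding abs_mult using Mb e1 by (intro mult_mono) auto
    then have EC: "E \<le> cint (\<lambda>z. fm z * \<eta> z) + C4 * d"
      using Esplit fe2 fr'' by (simp add: C4_def algebra_simps)
    have fm2: "cint (\<lambda>z. (fm z)\<^sup>2) = cint (\<lambda>z. (f z)\<^sup>2) - (cint f)\<^sup>2 / (L * H)"
    proof -
      have "cint (\<lambda>z. (fm z)\<^sup>2) = cint (\<lambda>z. (f z)\<^sup>2 - (2 * M * f z - M\<^sup>2))"
        by (simp add: fm_def power2_diff algebra_simps)
      also have "\<dots> = cint (\<lambda>z. (f z)\<^sup>2) - cint (\<lambda>z. 2 * M * f z - M\<^sup>2)"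
        by (intro cint_diff continuous_intros cf)
      also have "cint (\<lambda>z. 2 * M * f z - M\<^sup>2) = cint (\<lambda>z. 2 * M * f z) - cint (\<lambda>z. M\<^sup>2)"
        by (intro cint_diff continuous_intros cf)
      also have "\<dots> = 2 * M * cint f - M\<^sup>2 * (L * H)" by (simp only: integral_mult_right cint_const)
      also have "\<dots> = (cint f)\<^sup>2 / (L * H)" using LH by (simp add: M_def power2_eq_square)
      finally show ?thesis .
    qed
    \<comment> \<open>\<open>\<eta>\<^sup>2\<close> is the difference of the quadratic moments plus
      the linear term controlled by the energy inequality; the truncation error enters through
      \<open>wb * \<rho>\<close> alone.\<close>
    have "cint (\<lambda>z. (\<eta> z)\<^sup>2) \<le> \<mu> * E + (2 + 2 * A * N) * d"
    proof -
      have "cint (\<lambda>z. (\<eta> z)\<^sup>2) = cint (\<lambda>z. ((\<theta> z)\<^sup>2 - (wb z)\<^sup>2) + (2 * (wb z * (wb z - w z)) + 2 * (wb z * \<rho> z)))"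
        by (simp add: \<eta>_def \<rho>_def power2_eq_square algebra_simps)
      also have "\<dots> = cint (\<lambda>z. (\<theta> z)\<^sup>2 - (wb z)\<^sup>2) + cint (\<lambda>z. 2 * (wb z * (wb z - w z)) + 2 * (wb z * \<rho> z))"
        by (intro cint_add continuous_intros ct cb cw cr)
      also have "cint (\<lambda>z. (\<theta> z)\<^sup>2 - (wb z)\<^sup>2) = cint (\<lambda>z. (\<theta> z)\<^sup>2) - cint (\<lambda>z. (wb z)\<^sup>2)"
        by (intro cint_diff continuous_intros ct cb)
      also have "cint (\<lambda>z. 2 * (wb z * (wb z - w z)) + 2 * (wb z * \<rho> z))
         = cint (\<lambda>z. 2 * (wb z * (wb z - w z))) + cint (\<lambda>z. 2 * (wb z * \<rho> z))"
        by (intro cint_add continuous_intros ct cb cw cr)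
      finally have eq: "cint (\<lambda>z. (\<eta> z)\<^sup>2) = cint (\<lambda>z. (\<theta> z)\<^sup>2) - cint (\<lambda>z. (wb z)\<^sup>2)
         + (2 * cint (\<lambda>z. wb z * (wb z - w z)) + 2 * cint (\<lambda>z. wb z * \<rho> z))"
        by (simp only: integral_mult_right)
      have "\<bar>cint (\<lambda>z. wb z * \<rho> z)\<bar> \<le> A * cint (\<lambda>z. \<bar>\<rho> z\<bar>)"
        by (rule cint_mult_bound[OF cb cr]) (use bnd in auto)
      also have "\<dots> \<le> A * (N * d)"
        using cint_abs_le_of_powr[OF p d(1) cr] rd A by (intro mult_left_mono) (auto simp: \<rho>_def N_def)
      finally show ?thesis using eq H1 H2 unfolding E_def[symmetric] by (simp add: algebra_simps)
    qed
    moreover have "cint (\<lambda>z. (\<eta> z - \<mu> * fm z)\<^sup>2)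
        = cint (\<lambda>z. (\<eta> z)\<^sup>2) - 2 * \<mu> * cint (\<lambda>z. fm z * \<eta> z) + \<mu>\<^sup>2 * cint (\<lambda>z. (fm z)\<^sup>2)"
    proof -
      have "cint (\<lambda>z. (\<eta> z - \<mu> * fm z)\<^sup>2) = cint (\<lambda>z. ((\<eta> z)\<^sup>2 - 2 * \<mu> * (fm z * \<eta> z)) + \<mu>\<^sup>2 * (fm z)\<^sup>2)"
        by (simp add: power2_eq_square algebra_simps)
      also have "\<dots> = cint (\<lambda>z. (\<eta> z)\<^sup>2 - 2 * \<mu> * (fm z * \<eta> z)) + cint (\<lambda>z. \<mu>\<^sup>2 * (fm z)\<^sup>2)"
        by (intro cint_add continuous_intros ce cfm)
      also have "cint (\<lambda>z. (\<eta> z)\<^sup>2 - 2 * \<mu> * (fm z * \<eta> z)) = cint (\<lambda>z. (\<eta> z)\<^sup>2) - cint (\<lambda>z. 2 * \<mu> * (fm z * \<eta> z))"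
        by (intro cint_diff continuous_intros ce cfm)
      finally show ?thesis by (simp only: integral_mult_right)
    qed
    moreover have "\<mu> * E \<le> \<mu> * (cint (\<lambda>z. fm z * \<eta> z) + C4 * d)"
      using EC \<mu> by (intro mult_left_mono)
    moreover have "\<mu> * (\<mu> * cint (\<lambda>z. (fm z)\<^sup>2) + Q) \<le> \<mu> * E"
      using gap \<mu> unfolding E_def fm2 by (intro mult_left_mono)
    \<comment> \<open>The energy occurs as \<open>\<mu> * E\<close> from the first bound, at most
      \<open>- 2 * \<mu> * E\<close> from the mixed term and at most
      \<open>\<mu> * E - \<mu> * Q\<close> from the gap, so it cancels up to multiples of
      \<open>d\<close>.\<close>
    ultimately have "cint (\<lambda>z. (\<eta> z - \<mu> * fm z)\<^sup>2) + \<mu> * Q \<le> C * d"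
      by (simp add: C_def power2_eq_square algebra_simps)
    then show "cint (\<lambda>z. (\<theta> z - wb z - \<mu> * (f z - cint f / (L * H)))\<^sup>2) + \<mu> * Q \<le> C * d"
      by (simp add: \<eta>_def fm_def M_def)
  qed
qed

section \<open>The lowest modes and projection onto them\<close>

definition mode :: "nat \<Rightarrow> real \<times> real \<Rightarrow> real" where
  "mode i = (if i = 0 then (\<lambda>_. 1) else if i = 1 then e1 else if i = 2 then e2 else if i = 3 then e3 else e4)"

definition mode_sq :: "nat \<Rightarrow> real" where
  "mode_sq i = (if i = 0 then L * H else if i \<le> 2 then L * H / 2 else L * H / 4)"

lemma mode_simps: "mode 0 = (\<lambda>_. 1)" "mode 1 = e1" "mode (Suc 0) = e1" "mode 2 = e2" "mode 3 = e3" "mode 4 = e4"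
  by (simp_all add: mode_def)

lemma mode_sq_simps: "mode_sq 0 = L * H" "mode_sq 1 = L * H / 2" "mode_sq (Suc 0) = L * H / 2"
  "mode_sq 2 = L * H / 2" "mode_sq 3 = L * H / 4" "mode_sq 4 = L * H / 4"
  by (simp_all add: mode_sq_def)

lemma mode_sq_pos: "0 < mode_sq i"
  using L_pos H_pos by (simp add: mode_sq_def)

lemma continuous_on_modes:
  "continuous_on X e1" "continuous_on X e2" "continuous_on X e3" "continuous_on X e4"
  using L_pos H_pos by (auto intro!: continuous_intros)

lemma continuous_on_mode: "continuous_on X (mode i)"
  using L_pos H_pos by (auto simp: mode_def intro!: continuous_intros)

lemma cint_product:
  assumes "continuous_on {0..L} f" "continuous_on {0..H} g"
  shows "cint (\<lambda>z. g (snd z) * f (fst z)) = integral {0..H} g * integral {0..L} f"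
proof -
  have "continuous_on cell (\<lambda>z. g (snd z) * f (fst z))"
    by (intro continuous_intros continuous_on_compose2[OF assms(1)] continuous_on_compose2[OF assms(2)])
       (auto simp: mem_cell)
  then show ?thesis by (subst cint_iterated_swap) auto
qed

lemma mode_orthogonal:
  assumes "i \<le> 4" "j \<le> 4"
  shows "cint (\<lambda>z. mode i z * mode j z) = (if i = j then mode_sq i else 0)"
proof -
  let ?\<nu> = "2 * pi / H" and ?k = "2 * pi / L" and ?r = "pi / H"
  define X :: "nat \<Rightarrow> real \<Rightarrow> real" where
    "X i = (if i \<le> 2 then (\<lambda>_. 1) else if i = 3 then (\<lambda>x. cos (?k * x)) else (\<lambda>x. sin (?k * x)))" for i
  define Y :: "nat \<Rightarrow> real \<Rightarrow> real" where
    "Y i = (if i = 0 then (\<lambda>_. 1) else if i = 1 then (\<lambda>y. cos (?\<nu> * y)) else if i = 2 then (\<lambda>y. sin (?\<nu> * y))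
       else (\<lambda>y. sin (?r * y)))" for i
  have mXY: "mode i = (\<lambda>z. Y i (snd z) * X i (fst z))" for i
    by (auto simp: mode_def X_def Y_def)
  have cX: "continuous_on S (X i)" and cY: "continuous_on S (Y i)" for S i
    unfolding X_def Y_def using L_pos H_pos by (auto intro!: continuous_intros)
  have "cint (\<lambda>z. mode i z * mode j z) = cint (\<lambda>z. (Y i (snd z) * Y j (snd z)) * (X i (fst z) * X j (fst z)))"
    unfolding mXY by (simp add: mult_ac)
  also have "\<dots> = integral {0..H} (\<lambda>y. Y i y * Y j y) * integral {0..L} (\<lambda>x. X i x * X j x)"
    by (rule cint_product) (intro continuous_intros cX cY)+
  finally have *: "cint (\<lambda>z. mode i z * mode j z)
      = integral {0..H} (\<lambda>y. Y i y * Y j y) * integral {0..L} (\<lambda>x. X i x * X j x)" .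
  note perL = cos_sin_full_period[OF L_pos] and perH = cos_sin_full_period[OF H_pos]
  have IX: "integral {0..L} (\<lambda>x. X i x * X j x) = (if i \<le> 2 \<and> j \<le> 2 then L else if i = j then L / 2 else 0)"
    if "i \<le> 4" "j \<le> 4" for i j
  proof -
    have "i \<le> 2 \<or> i = 3 \<or> i = 4" "j \<le> 2 \<or> j = 3 \<or> j = 4" using that by auto
    then show ?thesis
      using perL L_pos by (elim disjE) (simp_all add: X_def mult.commute[of "sin _" "cos _"])
  qed
  have IY: "integral {0..H} (\<lambda>y. Y i y * Y j y) = (if i = 0 \<and> j = 0 then H else if i = j then H / 2 else 0)"
    if "i \<le> 2" "j \<le> 2" for i j
  proof -
    have "i = 0 \<or> i = 1 \<or> i = 2" "j = 0 \<or> j = 1 \<or> j = 2" using that by auto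
    then show ?thesis
      using perH H_pos by (elim disjE) (simp_all add: Y_def mult.commute[of "sin _" "cos _"])
  qed
  have IY': "integral {0..H} (\<lambda>y. Y i y * Y i y) = H / 2" if "2 < i" for i
    using sin_mode_orthogonal[OF H_pos, of 1 1] that by (simp add: Y_def)
  show ?thesis
  \<comment> \<open>With a mixed mode involved, orthogonality has to come from the factor in
    \<open>x\<close>: \<open>sin (pi / H * y)\<close> is not orthogonal to the constant 1.\<close>
  proof (cases "i \<le> 2 \<and> j \<le> 2")
    case True
    then show ?thesis unfolding * using IX[OF assms] IY[of i j] by (auto simp: mode_sq_def)
  next
    case False
    then show ?thesis unfolding * using IX[OF assms] IY'[of i] by (auto simp: mode_sq_def)
  qed
qed

lemma mode_projection_defect:
  assumes F: "continuous_on cell F" and S: "S \<subseteq> {..4}"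
  shows "cint (\<lambda>z. (F z - (\<Sum>i\<in>S. k i * mode i z))\<^sup>2) = cint (\<lambda>z. (F z)\<^sup>2)
     - (\<Sum>i\<in>S. (cint (\<lambda>z. F z * mode i z))\<^sup>2 / mode_sq i)
     + (\<Sum>i\<in>S. mode_sq i * (k i - cint (\<lambda>z. F z * mode i z) / mode_sq i)\<^sup>2)"
proof (rule orthogonal_expansion_defect)
  show "finite S" using S by (rule finite_subset) simp
qed (use S in \<open>auto simp: mode_orthogonal subset_iff intro: F continuous_on_mode mode_sq_pos\<close>)

text \<open>The energy estimate puts \<open>\<theta> - wb\<close> near \<open>\<mu>\<close> times
  the mean-free part of \<open>f\<close>, and the surplus \<open>\<kappa>\<close> in the gap puts
  that part near the span of the modes in \<open>S\<close>. So \<open>\<mu>\<close> times the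
  Fourier coefficients of \<open>f\<close> serve as \<open>c\<close>.\<close>

lemma mode_estimate:
  fixes p A \<mu> \<kappa> :: real
  assumes p: "1 < p" and A: "0 \<le> A" and \<mu>: "0 \<le> \<mu>" and \<kappa>: "0 < \<kappa>" and S: "S \<subseteq> {1..4}"
    and gap: "\<And>f fx fy. stream f fx fy \<Longrightarrow>
      \<mu> * (cint (\<lambda>z. (f z)\<^sup>2) - (cint f)\<^sup>2 / (L * H))
      + \<kappa> * (cint (\<lambda>z. (f z)\<^sup>2) - (cint f)\<^sup>2 / (L * H) - (\<Sum>i\<in>S. (cint (\<lambda>z. f z * mode i z))\<^sup>2 / mode_sq i))
      \<le> cint (\<lambda>z. (fx z)\<^sup>2) + cint (\<lambda>z. (fy z)\<^sup>2)"
  shows "\<exists>C>0. \<forall>f fx fy w \<theta> wb d. near_state p A \<mu> f fx fy w \<theta> wb d \<longrightarrow>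
     (\<exists>c. cint (\<lambda>z. (\<theta> z - wb z - (\<Sum>i\<in>S. c i * mode i z))\<^sup>2) \<le> C * d)"
proof -
  obtain C where C: "C > 0" and est: "\<forall>f fx fy w \<theta> wb d Q. near_state p A \<mu> f fx fy w \<theta> wb d \<longrightarrow>
     \<mu> * (cint (\<lambda>z. (f z)\<^sup>2) - (cint f)\<^sup>2 / (L * H)) + Q \<le> cint (\<lambda>z. (fx z)\<^sup>2) + cint (\<lambda>z. (fy z)\<^sup>2) \<longrightarrow>
     cint (\<lambda>z. (\<theta> z - wb z - \<mu> * (f z - cint f / (L * H)))\<^sup>2) + \<mu> * Q \<le> C * d"
    using energy_casimir_estimate[OF p A \<mu>] by (elim exE conjE) (rule that)
  \<comment> \<open>The 2 comes from \<open>power2_sum_le\<close>; \<open>\<mu> / \<kappa>\<close>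
    converts the bound on \<open>\<mu> * (\<kappa> * Q)\<close> into one on
    \<open>\<mu>\<^sup>2 * Q\<close>.\<close>
  define C' where "C' = 2 * C * (1 + \<mu> / \<kappa>)"
  show ?thesis
  proof (intro exI[of _ C'] conjI allI impI)
    show "C' > 0" using C \<mu> \<kappa> by (simp add: C'_def add_pos_nonneg)
    fix f fx fy w \<theta> wb and d :: real
    assume ns: "near_state p A \<mu> f fx fy w \<theta> wb d"
    then have st: "stream f fx fy" and cw: "continuous_on cell w" and ct: "continuous_on cell \<theta>"
      and cb: "continuous_on cell wb" and d: "0 < d" "d \<le> 1"
      and bnd: "\<forall>z\<in>cell. \<bar>\<theta> z\<bar> \<le> A \<and> \<bar>wb z\<bar> \<le> A" and rd: "cint (\<lambda>z. \<bar>w z - \<theta> z\<bar> powr p) \<le> d powr p"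
      and Eid: "cint (\<lambda>z. (fx z)\<^sup>2) + cint (\<lambda>z. (fy z)\<^sup>2) = cint (\<lambda>z. f z * (w z - wb z))"
      and H1: "2 * cint (\<lambda>z. wb z * (wb z - w z)) \<le> \<mu> * (cint (\<lambda>z. (fx z)\<^sup>2) + cint (\<lambda>z. (fy z)\<^sup>2)) + d"
      and H2: "cint (\<lambda>z. (\<theta> z)\<^sup>2) \<le> cint (\<lambda>z. (wb z)\<^sup>2) + d" and H3: "\<bar>cint \<theta> - cint wb\<bar> \<le> d"
      unfolding near_state_def by - (elim conjE, assumption)+
    define P where "P i = cint (\<lambda>z. f z * mode i z) / mode_sq i" for i
    define Q where "Q = cint (\<lambda>z. (f z - (\<Sum>i\<in>insert 0 S. P i * mode i z))\<^sup>2)"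
    note cf = streamD(1)[OF st]
    have S0: "insert 0 S \<subseteq> {..4}" "0 \<notin> S" "finite S" using S by (auto intro: finite_subset)
    have "Q = cint (\<lambda>z. (f z)\<^sup>2) - (\<Sum>i\<in>insert 0 S. (cint (\<lambda>z. f z * mode i z))\<^sup>2 / mode_sq i)"
      unfolding Q_def mode_projection_defect[OF cf S0(1)] by (simp add: P_def)
    then have Q: "Q = cint (\<lambda>z. (f z)\<^sup>2) - (cint f)\<^sup>2 / (L * H) - (\<Sum>i\<in>S. (cint (\<lambda>z. f z * mode i z))\<^sup>2 / mode_sq i)"
      using S0 by (simp add: mode_simps mode_sq_simps)
    have Q0: "0 \<le> Q" unfolding Q_def by (intro cint_sq_nonneg continuous_intros cf continuous_on_mode)
    have main: "cint (\<lambda>z. (\<theta> z - wb z - \<mu> * (f z - cint f / (L * H)))\<^sup>2) + \<mu> * (\<kappa> * Q) \<le> C * d"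
      by (rule est[rule_format, OF ns]) (use gap[OF st] in \<open>simp add: Q\<close>)
    \<comment> \<open>The projection in the second bracket contains the constant mode, so the means
      of \<open>f\<close> in the two brackets cancel.\<close>
    have split: "(\<theta> z - wb z - (\<Sum>i\<in>S. (\<mu> * P i) * mode i z))
       = (\<theta> z - wb z - \<mu> * (f z - cint f / (L * H))) + \<mu> * (f z - (\<Sum>i\<in>insert 0 S. P i * mode i z))" for z
      using S0 by (simp add: P_def mode_simps mode_sq_simps sum_distrib_left algebra_simps)
    have cD: "continuous_on cell (\<lambda>z. \<theta> z - wb z - \<mu> * (f z - cint f / (L * H)))"
      by (intro continuous_on_diff continuous_on_mult continuous_on_const ct cb cf)
    have cQ: "continuous_on cell (\<lambda>z. f z - (\<Sum>i\<in>insert 0 S. P i * mode i z))"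
      by (intro continuous_intros cf continuous_on_mode)
    have "cint (\<lambda>z. (\<theta> z - wb z - (\<Sum>i\<in>S. (\<mu> * P i) * mode i z))\<^sup>2)
       \<le> cint (\<lambda>z. 2 * (\<theta> z - wb z - \<mu> * (f z - cint f / (L * H)))\<^sup>2
             + 2 * \<mu>\<^sup>2 * (f z - (\<Sum>i\<in>insert 0 S. P i * mode i z))\<^sup>2)"
    proof (intro cint_mono)
      fix z
      let ?a = "\<theta> z - wb z - \<mu> * (f z - cint f / (L * H))" and ?b = "\<mu> * (f z - (\<Sum>i\<in>insert 0 S. P i * mode i z))"
      show "(\<theta> z - wb z - (\<Sum>i\<in>S. (\<mu> * P i) * mode i z))\<^sup>2
        \<le> 2 * ?a\<^sup>2 + 2 * \<mu>\<^sup>2 * (f z - (\<Sum>i\<in>insert 0 S. P i * mode i z))\<^sup>2"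
      proof -
        have "(?a + ?b)\<^sup>2 \<le> 2 * ?a\<^sup>2 + 2 * ?b\<^sup>2" by (rule power2_sum_le)
        also have "2 * ?b\<^sup>2 = 2 * \<mu>\<^sup>2 * (f z - (\<Sum>i\<in>insert 0 S. P i * mode i z))\<^sup>2"
          by (simp only: power_mult_distrib mult.assoc)
        finally show ?thesis unfolding split .
      qed
    qed (intro continuous_on_power continuous_on_add continuous_on_mult continuous_on_const cD cQ
        continuous_on_diff continuous_on_sum ct cb continuous_on_mode)+
    also have "\<dots> = 2 * cint (\<lambda>z. (\<theta> z - wb z - \<mu> * (f z - cint f / (L * H)))\<^sup>2) + 2 * \<mu>\<^sup>2 * Q"
      unfolding Q_def integral_mult_right[symmetric]
      by (intro cint_add continuous_on_mult continuous_on_const continuous_on_power cD cQ)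
    also have "\<dots> \<le> C' * d"
    proof -
      have "\<mu> * (\<kappa> * Q) \<le> C * d"
        using main cint_sq_nonneg[OF cD] by linarith
      then have "\<mu> / \<kappa> * (\<mu> * (\<kappa> * Q)) \<le> \<mu> / \<kappa> * (C * d)"
        using \<mu> \<kappa> by (intro mult_left_mono) auto
      then have "\<mu>\<^sup>2 * Q \<le> \<mu> / \<kappa> * (C * d)" using \<kappa> by (simp add: power2_eq_square)
      moreover have "cint (\<lambda>z. (\<theta> z - wb z - \<mu> * (f z - cint f / (L * H)))\<^sup>2) \<le> C * d"
        using main mult_nonneg_nonneg[OF \<mu> mult_nonneg_nonneg[OF less_imp_le[OF \<kappa>] Q0]] by linarith
      ultimately have "2 * cint (\<lambda>z. (\<theta> z - wb z - \<mu> * (f z - cint f / (L * H)))\<^sup>2) + 2 * \<mu>\<^sup>2 * Q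
         \<le> 2 * (C * d) + 2 * (\<mu> / \<kappa> * (C * d))"
        by linarith
      also have "\<dots> = C' * d" by (simp add: C'_def algebra_simps)
      finally show ?thesis .
    qed
    finally show "\<exists>c. cint (\<lambda>z. (\<theta> z - wb z - (\<Sum>i\<in>S. c i * mode i z))\<^sup>2) \<le> C' * d"
      by (intro exI[of _ "\<lambda>i. \<mu> * P i"])
  qed
qed

end

section \<open>Moments of the lowest modes and the two fixed-time estimates\<close>

lemma first_harmonic_moments:
  fixes T p q :: real
  assumes T: "T > 0"
  defines "G \<equiv> \<lambda>x. p * cos (2 * pi / T * x) + q * sin (2 * pi / T * x)"
  shows "integral {0..T} G = 0"
    and "integral {0..T} (\<lambda>x. (G x)\<^sup>2) = T / 2 * (p\<^sup>2 + q\<^sup>2)"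
    and "integral {0..T} (\<lambda>x. (G x) ^ 3) = 0"
proof -
  let ?n = "2 * pi / T"
  \<comment> \<open>\<open>D\<close> is the harmonic in quadrature, with \<open>G' = n D\<close>,
    \<open>D' = - n G\<close> and \<open>D\<^sup>2 + G\<^sup>2\<close> constant for
    \<open>n = 2 * pi / T\<close>. The antiderivatives of the powers of \<open>G\<close> below are
    polynomials in \<open>G\<close>, \<open>D\<close> and \<open>x\<close>.\<close>
  define D where "D x = q * cos (?n * x) - p * sin (?n * x)" for x
  have n: "?n \<noteq> 0" using T by simp
  have per: "?n * T = 2 * pi" using T by simp
  have GT: "G T = G 0" "D T = D 0" unfolding G_def D_def per by simp_all
  have dG: "(G has_real_derivative ?n * D x) (at x within X)" for x X
    unfolding G_def D_def using T by (auto intro!: derivative_eq_intros simp: algebra_simps)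
  have dD: "(D has_real_derivative - ?n * G x) (at x within X)" for x X
    unfolding G_def D_def using T by (auto intro!: derivative_eq_intros simp: algebra_simps)
  have pyth: "(D x)\<^sup>2 = p\<^sup>2 + q\<^sup>2 - (G x)\<^sup>2" for x
  proof -
    have "(q * c - p * s)\<^sup>2 + (p * c + q * s)\<^sup>2 = (p\<^sup>2 + q\<^sup>2) * (s\<^sup>2 + c\<^sup>2)" for c s :: real
      by (simp add: power2_eq_square algebra_simps)
    then have "(D x)\<^sup>2 + (G x)\<^sup>2 = (p\<^sup>2 + q\<^sup>2) * ((sin (?n * x))\<^sup>2 + (cos (?n * x))\<^sup>2)"
      unfolding G_def D_def by blast
    then show ?thesis by (simp only: sin_cos_squared_add) simp
  qed
  have "integral {0..T} G = - D T / ?n - - D 0 / ?n"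
    using T by (intro integral_deriv_within DERIV_cong[OF DERIV_cdivide[OF DERIV_minus[OF dD]]]) auto
  then show "integral {0..T} G = 0" using GT by simp
  have "integral {0..T} (\<lambda>x. (G x)\<^sup>2) = ((p\<^sup>2 + q\<^sup>2) * T - G T * D T / ?n) / 2 - ((p\<^sup>2 + q\<^sup>2) * 0 - G 0 * D 0 / ?n) / 2"
  proof (intro integral_deriv_within)
    fix x
    have "((\<lambda>x. ((p\<^sup>2 + q\<^sup>2) * x - G x * D x / ?n) / 2) has_real_derivative
       ((p\<^sup>2 + q\<^sup>2) * 1 - (G x * (- ?n * G x) + ?n * D x * D x) / ?n) / 2) (at x within {0..T})"
      by (intro DERIV_cdivide DERIV_diff DERIV_cmult DERIV_mult' dG dD DERIV_ident)
    also have "((p\<^sup>2 + q\<^sup>2) * 1 - (G x * (- ?n * G x) + ?n * D x * D x) / ?n) / 2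
       = ((p\<^sup>2 + q\<^sup>2) - ((D x)\<^sup>2 - (G x)\<^sup>2)) / 2"
    proof -
      have "G x * (- ?n * G x) + ?n * D x * D x = ?n * ((D x)\<^sup>2 - (G x)\<^sup>2)"
        by (simp add: power2_eq_square algebra_simps)
      then show ?thesis by (simp only: nonzero_mult_div_cancel_left[OF n] mult_1_right)
    qed
    also have "\<dots> = (G x)\<^sup>2" unfolding pyth by simp
    finally show "((\<lambda>x. ((p\<^sup>2 + q\<^sup>2) * x - G x * D x / ?n) / 2) has_real_derivative (G x)\<^sup>2) (at x within {0..T})" .
  qed (use T in simp)
  then show "integral {0..T} (\<lambda>x. (G x)\<^sup>2) = T / 2 * (p\<^sup>2 + q\<^sup>2)"
    unfolding GT by (simp only: diff_divide_distrib) simp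
  have "integral {0..T} (\<lambda>x. (G x) ^ 3) = ((D T) ^ 3 / 3 - (p\<^sup>2 + q\<^sup>2) * D T) / ?n - ((D 0) ^ 3 / 3 - (p\<^sup>2 + q\<^sup>2) * D 0) / ?n"
  proof (intro integral_deriv_within)
    fix x
    have "((\<lambda>x. ((D x) ^ 3 / 3 - (p\<^sup>2 + q\<^sup>2) * D x) / ?n) has_real_derivative
       ((real 3 * (- ?n * G x * D x ^ (3 - Suc 0))) / 3 - (p\<^sup>2 + q\<^sup>2) * (- ?n * G x)) / ?n) (at x within {0..T})"
      by (intro DERIV_cdivide DERIV_diff DERIV_cmult DERIV_power dD)
    also have "((real 3 * (- ?n * G x * D x ^ (3 - Suc 0))) / 3 - (p\<^sup>2 + q\<^sup>2) * (- ?n * G x)) / ?n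
       = G x * (p\<^sup>2 + q\<^sup>2 - (D x)\<^sup>2)"
    proof -
      have "(real 3 * (- ?n * G x * D x ^ (3 - Suc 0))) / 3 - (p\<^sup>2 + q\<^sup>2) * (- ?n * G x)
          = ?n * (G x * (p\<^sup>2 + q\<^sup>2 - (D x)\<^sup>2))"
        by (simp add: numeral_2_eq_2 algebra_simps add_divide_distrib)
      then show ?thesis by (simp only: nonzero_mult_div_cancel_left[OF n])
    qed
    also have "\<dots> = (G x) ^ 3" unfolding pyth by (simp add: power3_eq_cube power2_eq_square)
    finally show "((\<lambda>x. ((D x) ^ 3 / 3 - (p\<^sup>2 + q\<^sup>2) * D x) / ?n) has_real_derivative (G x) ^ 3) (at x within {0..T})" .
  qed (use T in simp)
  then show "integral {0..T} (\<lambda>x. (G x) ^ 3) = 0" unfolding GT by simp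
qed

lemma abs_square_diff_le:
  fixes x y a b :: real
  assumes "\<bar>x\<bar> \<le> a" "\<bar>y\<bar> \<le> b"
  shows "\<bar>x\<^sup>2 - y\<^sup>2\<bar> \<le> (a + b) * \<bar>x - y\<bar>" "(x - y)\<^sup>2 \<le> (a + b) * \<bar>x - y\<bar>"
proof -
  have "\<bar>x\<^sup>2 - y\<^sup>2\<bar> = \<bar>x + y\<bar> * \<bar>x - y\<bar>"
    by (simp add: abs_mult[symmetric] power2_eq_square algebra_simps)
  also have "\<dots> \<le> (a + b) * \<bar>x - y\<bar>" using assms by (intro mult_right_mono) auto
  finally show "\<bar>x\<^sup>2 - y\<^sup>2\<bar> \<le> (a + b) * \<bar>x - y\<bar>" .
  have "(x - y)\<^sup>2 = \<bar>x - y\<bar> * \<bar>x - y\<bar>" by (simp add: power2_eq_square)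
  also have "\<dots> \<le> (a + b) * \<bar>x - y\<bar>" using assms by (intro mult_right_mono) auto
  finally show "(x - y)\<^sup>2 \<le> (a + b) * \<bar>x - y\<bar>" .
qed

context channel
begin

lemma cint_height_times_odd_mode_zero:
  assumes B: "continuous_on {0..H} B"
  shows "cint (\<lambda>z. B (snd z) * mode 3 z) = 0" "cint (\<lambda>z. B (snd z) * mode 4 z) = 0"
proof -
  have c: "continuous_on {0..L} (\<lambda>x. cos (2 * pi / L * x))" "continuous_on {0..L} (\<lambda>x. sin (2 * pi / L * x))"
      "continuous_on {0..H} (\<lambda>y. B y * sin (pi / H * y))"
    using L_pos H_pos by (auto intro!: continuous_intros B)
  show "cint (\<lambda>z. B (snd z) * mode 3 z) = 0"
    using cint_product[OF c(1,3)] unfolding cos_sin_full_period(1)[OF L_pos] mode_simps by (simp only: mult.assoc mult_zero_right)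
  show "cint (\<lambda>z. B (snd z) * mode 4 z) = 0"
    using cint_product[OF c(2,3)] unfolding cos_sin_full_period(2)[OF L_pos] mode_simps by (simp only: mult.assoc mult_zero_right)
qed

lemma near_stateD:
  assumes "near_state p A \<mu> f fx fy w \<theta> wb d"
  shows "continuous_on cell \<theta>" "continuous_on cell wb" "0 < d" "d \<le> 1"
    "\<And>z. z \<in> cell \<Longrightarrow> \<bar>\<theta> z\<bar> \<le> A" "\<And>z. z \<in> cell \<Longrightarrow> \<bar>wb z\<bar> \<le> A"
    "cint (\<lambda>z. (\<theta> z)\<^sup>2) \<le> cint (\<lambda>z. (wb z)\<^sup>2) + d"
  using assms unfolding near_state_def by - (elim conjE, blast)+

lemma le_sqrt_of_le_1: "0 < d \<Longrightarrow> d \<le> 1 \<Longrightarrow> d \<le> sqrt d" for d :: real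
  by (rule real_le_rsqrt) (simp add: power2_eq_square mult_left_le)

text \<open>The strict inequality lets the whole shear block count as surplus, so only the mixed
  modes survive. The reference vorticity depends on \<open>y\<close> alone and is orthogonal to
  them; equality of second moments then leaves no room for them, since a component orthogonal to
  \<open>wb\<close> would increase the squared norm.\<close>

lemma noncritical_estimate:
  fixes p A \<mu> :: real
  assumes p: "1 < p" and A: "0 \<le> A" and \<mu>: "0 \<le> \<mu>"
    and l1: "\<mu> < (2 * pi / H)\<^sup>2" and l2: "\<mu> \<le> (2 * pi / L)\<^sup>2 + (pi / H)\<^sup>2"
  shows "\<exists>C>0. \<forall>f fx fy w \<theta> B d. near_state p A \<mu> f fx fy w \<theta> (\<lambda>z. B (snd z)) d \<longrightarrow>
     continuous_on {0..H} B \<longrightarrow> cint (\<lambda>z. (\<theta> z - B (snd z))\<^sup>2) \<le> C * sqrt d"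
proof -
  define k' where "k' = min (3 * (pi / H)\<^sup>2) (3 * (2 * pi / L)\<^sup>2)"
  \<comment> \<open>The first entry makes all of \<open>F0\<close> surplus, the second is the
    surplus available beyond the mixed modes.\<close>
  define \<kappa> where "\<kappa> = min ((2 * pi / H)\<^sup>2 - \<mu>) k'"
  have \<kappa>: "0 < \<kappa>" using l1 L_pos H_pos by (simp add: \<kappa>_def k'_def)
  have gap: "\<mu> * (cint (\<lambda>z. (f z)\<^sup>2) - (cint f)\<^sup>2 / (L * H))
      + \<kappa> * (cint (\<lambda>z. (f z)\<^sup>2) - (cint f)\<^sup>2 / (L * H) - (\<Sum>i\<in>{3, 4}. (cint (\<lambda>z. f z * mode i z))\<^sup>2 / mode_sq i))
      \<le> cint (\<lambda>z. (fx z)\<^sup>2) + cint (\<lambda>z. (fy z)\<^sup>2)" if st: "stream f fx fy" for f fx fy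
  proof -
    define G1 where "G1 = 4 / (L * H) * ((cint (\<lambda>z. f z * e3 z))\<^sup>2 + (cint (\<lambda>z. f z * e4 z))\<^sup>2)"
    define F1 where "F1 = 2 / (L * H) * ((cint (\<lambda>z. f z * e1 z))\<^sup>2 + (cint (\<lambda>z. f z * e2 z))\<^sup>2)"
    obtain F0 G0 where FG: "F0 + G0 = cint (\<lambda>z. (f z)\<^sup>2) - (cint f)\<^sup>2 / (L * H)" "F1 \<le> F0" "G1 \<le> G0" "0 \<le> F0" "0 \<le> G0"
      "(2 * pi / H)\<^sup>2 * F0 + 3 * (2 * pi / H)\<^sup>2 * (F0 - F1) + ((pi / H)\<^sup>2 + (2 * pi / L)\<^sup>2) * G0 + k' * (G0 - G1)
       \<le> cint (\<lambda>z. (fx z)\<^sup>2) + cint (\<lambda>z. (fy z)\<^sup>2)"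
      using stream_spectral_gap[OF st] unfolding G1_def F1_def k'_def by blast
    have sum: "(\<Sum>i\<in>{3, 4}. (cint (\<lambda>z. f z * mode i z))\<^sup>2 / mode_sq i) = G1"
      unfolding G1_def by (simp add: mode_simps mode_sq_simps algebra_simps add_divide_distrib)
    have "(\<mu> + \<kappa>) * F0 \<le> (2 * pi / H)\<^sup>2 * F0" using FG(4) by (intro mult_right_mono) (simp_all add: \<kappa>_def)
    moreover have "0 \<le> 3 * (2 * pi / H)\<^sup>2 * (F0 - F1)" using FG(2) by (intro mult_nonneg_nonneg) auto
    moreover have "\<mu> * G0 \<le> ((pi / H)\<^sup>2 + (2 * pi / L)\<^sup>2) * G0" using FG(5) l2 by (intro mult_right_mono) auto
    moreover have "\<kappa> * (G0 - G1) \<le> k' * (G0 - G1)" using FG(3) by (intro mult_right_mono) (simp_all add: \<kappa>_def)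
    ultimately show ?thesis using FG(6) unfolding sum FG(1)[symmetric] by (simp add: algebra_simps)
  qed
  have "\<exists>C>0. \<forall>f fx fy w \<theta> wb d. near_state p A \<mu> f fx fy w \<theta> wb d \<longrightarrow>
     (\<exists>c. cint (\<lambda>z. (\<theta> z - wb z - (\<Sum>i\<in>{3, 4}. c i * mode i z))\<^sup>2) \<le> C * d)"
    by (rule mode_estimate[OF p A \<mu> \<kappa> _ gap]) auto
  then obtain C where C: "C > 0" and est: "\<forall>f fx fy w \<theta> wb d. near_state p A \<mu> f fx fy w \<theta> wb d \<longrightarrow>
     (\<exists>c. cint (\<lambda>z. (\<theta> z - wb z - (\<Sum>i\<in>{3, 4}. c i * mode i z))\<^sup>2) \<le> C * d)"
    by (elim exE conjE) (rule that)
  define K where "K = sqrt (L * H * C)"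
  have K: "K \<ge> 0" using C L_pos H_pos by (simp add: K_def)
  show ?thesis
  proof (intro exI[of _ "1 + 2 * A * K"] conjI allI impI)
    show "0 < 1 + 2 * A * K" using A K by (simp add: add_pos_nonneg)
    fix f fx fy w \<theta> B d
    assume ns: "near_state p A \<mu> f fx fy w \<theta> (\<lambda>z. B (snd z)) d" and B: "continuous_on {0..H} B"
    note D = near_stateD[OF ns]
    obtain c where c: "cint (\<lambda>z. (\<theta> z - B (snd z) - (\<Sum>i\<in>{3, 4}. c i * mode i z))\<^sup>2) \<le> C * d"
      using est[rule_format, OF ns] by blast
    define r where "r z = \<theta> z - B (snd z) - (\<Sum>i\<in>{3, 4}. c i * mode i z)" for z
    have cr: "continuous_on cell r" unfolding r_def by (intro continuous_intros D(1,2) continuous_on_mode)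
    \<comment> \<open>The squared norm of the error is of order \<open>d\<close>, its integral only
      of order \<open>sqrt d\<close>; this fixes the rate in the conclusion.\<close>
    have "cint (\<lambda>z. \<bar>r z\<bar>) \<le> sqrt (L * H * cint (\<lambda>z. (r z)\<^sup>2))" by (rule cint_abs_le_sqrt[OF cr])
    also have "\<dots> \<le> sqrt (L * H * (C * d))"
      using c L_pos H_pos unfolding r_def by (intro real_sqrt_le_mono mult_left_mono) auto
    also have "\<dots> = K * sqrt d" by (simp add: K_def real_sqrt_mult mult.assoc)
    finally have r1: "cint (\<lambda>z. \<bar>r z\<bar>) \<le> K * sqrt d" .
    have "\<bar>cint (\<lambda>z. B (snd z) * r z)\<bar> \<le> A * cint (\<lambda>z. \<bar>r z\<bar>)"
      by (rule cint_mult_bound[OF D(2) cr D(6)])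
    also have "\<dots> \<le> A * (K * sqrt d)" using r1 A by (intro mult_left_mono)
    finally have Br: "\<bar>cint (\<lambda>z. B (snd z) * r z)\<bar> \<le> A * K * sqrt d" by simp
    have cm: "continuous_on cell (\<lambda>z. B (snd z) * mode i z)" for i
      by (intro continuous_intros D(2) continuous_on_mode)
    \<comment> \<open>A square is a difference of squares minus twice the product with
      \<open>B\<close>, and in that product \<open>\<theta> - B\<close> is replaced by mixed modes
      plus \<open>r\<close>.\<close>
    have "cint (\<lambda>z. (\<theta> z - B (snd z))\<^sup>2) = cint (\<lambda>z. ((\<theta> z)\<^sup>2 - (B (snd z))\<^sup>2)
        - 2 * (c 3 * (B (snd z) * mode 3 z) + c 4 * (B (snd z) * mode 4 z) + B (snd z) * r z))"
      by (simp add: r_def power2_eq_square algebra_simps)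
    also have "\<dots> = cint (\<lambda>z. (\<theta> z)\<^sup>2 - (B (snd z))\<^sup>2)
        - cint (\<lambda>z. 2 * (c 3 * (B (snd z) * mode 3 z) + c 4 * (B (snd z) * mode 4 z) + B (snd z) * r z))"
      by (intro cint_diff continuous_intros D(1,2) continuous_on_mode cr)
    also have "cint (\<lambda>z. (\<theta> z)\<^sup>2 - (B (snd z))\<^sup>2) = cint (\<lambda>z. (\<theta> z)\<^sup>2) - cint (\<lambda>z. (B (snd z))\<^sup>2)"
      by (intro cint_diff continuous_intros D(1,2))
    also have "cint (\<lambda>z. 2 * (c 3 * (B (snd z) * mode 3 z) + c 4 * (B (snd z) * mode 4 z) + B (snd z) * r z))
       = 2 * (cint (\<lambda>z. c 3 * (B (snd z) * mode 3 z)) + cint (\<lambda>z. c 4 * (B (snd z) * mode 4 z)) + cint (\<lambda>z. B (snd z) * r z))"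
      unfolding integral_mult_right
      by (subst cint_add, (intro continuous_on_add continuous_on_mult continuous_on_const cm D(2) cr continuous_on_mode)+)+
         (simp only: integral_mult_right)
    finally have "cint (\<lambda>z. (\<theta> z - B (snd z))\<^sup>2) = cint (\<lambda>z. (\<theta> z)\<^sup>2) - cint (\<lambda>z. (B (snd z))\<^sup>2) - 2 * cint (\<lambda>z. B (snd z) * r z)"
      by (simp add: cint_height_times_odd_mode_zero[OF B])
    also have "\<dots> \<le> d + 2 * (A * K * sqrt d)" using D(7) Br by linarith
    also have "\<dots> \<le> (1 + 2 * A * K) * sqrt d" using le_sqrt_of_le_1[OF D(3,4)] by (simp add: algebra_simps)
    finally show "cint (\<lambda>z. (\<theta> z - B (snd z))\<^sup>2) \<le> (1 + 2 * A * K) * sqrt d" .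
  qed
qed

text \<open>The combination has the form \<open>G y + s y * X x\<close>. In the cube,
  \<open>G ^ 3\<close> and the odd powers of \<open>X\<close> integrate to zero, and only
  \<open>3 * G * s\<^sup>2 * X\<^sup>2\<close> survives.\<close>

lemma cint_cubed_modes:
  "cint (\<lambda>z. (k1 * e1 z + k2 * e2 z + k3 * e3 z + k4 * e4 z) ^ 3) = - (3 / 8) * (L * H) * k1 * (k3\<^sup>2 + k4\<^sup>2)"
proof -
  define G where "G y = k1 * cos (2 * pi / H * y) + k2 * sin (2 * pi / H * y)" for y
  define X where "X x = k3 * cos (2 * pi / L * x) + k4 * sin (2 * pi / L * x)" for x
  define s where "s y = sin (pi / H * y)" for y
  have cG: "continuous_on U G" and cX: "continuous_on U X" and cs: "continuous_on U s" for U
    unfolding G_def X_def s_def using L_pos H_pos by (auto intro!: continuous_intros)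
  have cGz: "continuous_on cell (\<lambda>z. G (snd z))" and cXz: "continuous_on cell (\<lambda>z. X (fst z))"
    and csz: "continuous_on cell (\<lambda>z. s (snd z))"
    unfolding G_def X_def s_def using L_pos H_pos by (auto intro!: continuous_intros)
  note mX = first_harmonic_moments[OF L_pos, of k3 k4, folded X_def]
  note mG = first_harmonic_moments[OF H_pos, of k1 k2, folded G_def]
  \<comment> \<open>\<open>(s y)\<^sup>2\<close> equals
    \<open>(1 - cos (2 * pi / H * y)) / 2\<close>, so it correlates with the cosine coefficient
    \<open>k1\<close> and not with \<open>k2\<close>.\<close>
  have Gs: "integral {0..H} (\<lambda>y. G y * (s y)\<^sup>2) = - (k1 * H / 4)"
  proof -
    note per = cos_sin_full_period[OF H_pos]
    let ?c = "\<lambda>y. cos (2 * pi / H * y)" and ?s = "\<lambda>y. sin (2 * pi / H * y)"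
    have tr: "?c integrable_on {0..H}" "?s integrable_on {0..H}" "(\<lambda>y. ?c y * ?c y) integrable_on {0..H}"
        "(\<lambda>y. ?c y * ?s y) integrable_on {0..H}"
      using H_pos by (auto intro!: integrable_continuous_real continuous_intros)
    have "((\<lambda>y. (1/2) * (k1 * ?c y + k2 * ?s y - (k1 * (?c y * ?c y) + k2 * (?c y * ?s y)))) has_integral
       (1/2) * (k1 * 0 + k2 * 0 - (k1 * (H / 2) + k2 * 0))) {0..H}"
      using integrable_integral[OF tr(1)] integrable_integral[OF tr(2)] integrable_integral[OF tr(3)] integrable_integral[OF tr(4)]
      unfolding per by (intro has_integral_mult_right has_integral_diff has_integral_add)
    moreover have "(1/2) * (k1 * ?c y + k2 * ?s y - (k1 * (?c y * ?c y) + k2 * (?c y * ?s y))) = G y * (s y)\<^sup>2" for y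
    proof -
      have "?c y = 1 - 2 * (s y)\<^sup>2" unfolding s_def using cos_double_sin[of "pi / H * y"] by (simp add: mult.assoc)
      then have "(s y)\<^sup>2 = (1 - ?c y) / 2" by simp
      then show ?thesis
        unfolding G_def by (simp only:) (simp add: algebra_simps add_divide_distrib diff_divide_distrib)
    qed
    ultimately show ?thesis by (simp add: integral_unique)
  qed
  have "cint (\<lambda>z. (k1 * e1 z + k2 * e2 z + k3 * e3 z + k4 * e4 z) ^ 3) =
     cint (\<lambda>z. (G (snd z) ^ 3 * 1 + (3 * (G (snd z))\<^sup>2 * s (snd z)) * X (fst z))
       + ((3 * (G (snd z) * (s (snd z))\<^sup>2)) * (X (fst z))\<^sup>2 + (s (snd z)) ^ 3 * (X (fst z)) ^ 3))"
  proof (rule cint_cong)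
    fix z
    have "k1 * e1 z + k2 * e2 z + k3 * e3 z + k4 * e4 z = G (snd z) + s (snd z) * X (fst z)"
      unfolding G_def X_def s_def by (simp add: algebra_simps)
    then show "(k1 * e1 z + k2 * e2 z + k3 * e3 z + k4 * e4 z) ^ 3 =
      (G (snd z) ^ 3 * 1 + (3 * (G (snd z))\<^sup>2 * s (snd z)) * X (fst z))
       + ((3 * (G (snd z) * (s (snd z))\<^sup>2)) * (X (fst z))\<^sup>2 + (s (snd z)) ^ 3 * (X (fst z)) ^ 3)"
      by (simp only:) (simp add: power2_eq_square power3_eq_cube algebra_simps)
  qed
  also have "\<dots> = cint (\<lambda>z. G (snd z) ^ 3 * 1 + (3 * (G (snd z))\<^sup>2 * s (snd z)) * X (fst z))
     + cint (\<lambda>z. (3 * (G (snd z) * (s (snd z))\<^sup>2)) * (X (fst z))\<^sup>2 + (s (snd z)) ^ 3 * (X (fst z)) ^ 3)"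
    by (intro cint_add continuous_intros cGz cXz csz)
  also have "cint (\<lambda>z. G (snd z) ^ 3 * 1 + (3 * (G (snd z))\<^sup>2 * s (snd z)) * X (fst z))
     = cint (\<lambda>z. G (snd z) ^ 3 * 1) + cint (\<lambda>z. (3 * (G (snd z))\<^sup>2 * s (snd z)) * X (fst z))"
    by (intro cint_add continuous_intros cGz cXz csz)
  also have "cint (\<lambda>z. (3 * (G (snd z) * (s (snd z))\<^sup>2)) * (X (fst z))\<^sup>2 + (s (snd z)) ^ 3 * (X (fst z)) ^ 3)
     = cint (\<lambda>z. (3 * (G (snd z) * (s (snd z))\<^sup>2)) * (X (fst z))\<^sup>2) + cint (\<lambda>z. (s (snd z)) ^ 3 * (X (fst z)) ^ 3)"
    by (intro cint_add continuous_intros cGz cXz csz)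
  also have "cint (\<lambda>z. G (snd z) ^ 3 * 1) = integral {0..H} (\<lambda>y. G y ^ 3) * integral {0..L} (\<lambda>x. 1)"
    by (rule cint_product[of "\<lambda>_. 1" "\<lambda>y. G y ^ 3"]) (intro continuous_intros cG)+
  also have "cint (\<lambda>z. (3 * (G (snd z))\<^sup>2 * s (snd z)) * X (fst z)) = integral {0..H} (\<lambda>y. 3 * (G y)\<^sup>2 * s y) * integral {0..L} X"
    by (rule cint_product[of X "\<lambda>y. 3 * (G y)\<^sup>2 * s y"]) (intro continuous_intros cG cX cs)+
  also have "cint (\<lambda>z. (3 * (G (snd z) * (s (snd z))\<^sup>2)) * (X (fst z))\<^sup>2)
     = integral {0..H} (\<lambda>y. 3 * (G y * (s y)\<^sup>2)) * integral {0..L} (\<lambda>x. (X x)\<^sup>2)"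
    by (rule cint_product[of "\<lambda>x. (X x)\<^sup>2" "\<lambda>y. 3 * (G y * (s y)\<^sup>2)"]) (intro continuous_intros cG cX cs)+
  also have "cint (\<lambda>z. (s (snd z)) ^ 3 * (X (fst z)) ^ 3) = integral {0..H} (\<lambda>y. s y ^ 3) * integral {0..L} (\<lambda>x. X x ^ 3)"
    by (rule cint_product[of "\<lambda>x. X x ^ 3" "\<lambda>y. s y ^ 3"]) (intro continuous_intros cG cX cs)+
  also have "integral {0..L} X = 0" using mX(1) unfolding X_def[abs_def] .
  also have "integral {0..H} (\<lambda>y. G y ^ 3) = 0" by (rule mG(3))
  also have "integral {0..L} (\<lambda>x. X x ^ 3) = 0" by (rule mX(3))
  also have "integral {0..L} (\<lambda>x. (X x)\<^sup>2) = L / 2 * (k3\<^sup>2 + k4\<^sup>2)" by (rule mX(2))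
  also have "integral {0..H} (\<lambda>y. 3 * (G y * (s y)\<^sup>2)) = 3 * (- (k1 * H / 4))" unfolding integral_mult_right Gs ..
  finally show ?thesis by (simp add: field_simps)
qed

text \<open>The impulse detects \<open>e2\<close> and is blind to \<open>e1\<close>; the coefficient
  of \<open>e1\<close> must be found by other means.\<close>

lemma cint_height_modes:
  "cint (\<lambda>z. snd z * e1 z) = 0" "cint (\<lambda>z. snd z * e2 z) = - (L * H\<^sup>2 / (2 * pi))"
proof -
  let ?n = "2 * pi / H"
  have n: "?n \<noteq> 0" "?n * H = 2 * pi" using H_pos by simp_all
  have c: "continuous_on {0..H} (\<lambda>y. y * cos (?n * y))" "continuous_on {0..H} (\<lambda>y. y * sin (?n * y))"
    using H_pos by (auto intro!: continuous_intros)
  have "integral {0..H} (\<lambda>y. y * cos (?n * y))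
      = (H * sin (?n * H) / ?n + cos (?n * H) / ?n\<^sup>2) - (0 * sin (?n * 0) / ?n + cos (?n * 0) / ?n\<^sup>2)"
    using H_pos by (intro integral_deriv_within) (auto intro!: derivative_eq_intros simp: power2_eq_square field_simps)
  then have i1: "integral {0..H} (\<lambda>y. y * cos (?n * y)) = 0" unfolding n(2) by simp
  have "integral {0..H} (\<lambda>y. y * sin (?n * y))
      = (- H * cos (?n * H) / ?n + sin (?n * H) / ?n\<^sup>2) - (- 0 * cos (?n * 0) / ?n + sin (?n * 0) / ?n\<^sup>2)"
    using H_pos by (intro integral_deriv_within) (auto intro!: derivative_eq_intros simp: power2_eq_square field_simps)
  then have i2: "integral {0..H} (\<lambda>y. y * sin (?n * y)) = - H / ?n" unfolding n(2) by simp
  show "cint (\<lambda>z. snd z * e1 z) = 0"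
    using cint_product[OF continuous_on_const[of _ 1] c(1)] unfolding i1 by simp
  show "cint (\<lambda>z. snd z * e2 z) = - (L * H\<^sup>2 / (2 * pi))"
    using cint_product[OF continuous_on_const[of _ 1] c(2)] L_pos unfolding i2
    by (simp add: power2_eq_square mult.commute)
qed

lemma sum_four_modes: "(\<Sum>i\<in>{1, 2, 3, 4}. k i * mode i z) = k 1 * e1 z + k 2 * e2 z + k 3 * e3 z + k 4 * e4 z"
  by (simp add: mode_simps)

text \<open>The impulse controls the coefficient of \<open>e2\<close>; the second and third moments then force the
  coefficient \<open>b\<close> of \<open>e1\<close> to be close to one of \<open>0\<close>, \<open>\<beta>\<close>, \<open>-\<beta>\<close>.\<close>

lemma critical_estimate:
  fixes p A \<mu> \<beta> \<gamma> :: real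
  assumes p: "1 < p" and A: "0 \<le> A" and \<mu>: "0 \<le> \<mu>"
    and l1: "\<mu> \<le> (2 * pi / H)\<^sup>2" and l2: "\<mu> \<le> (2 * pi / L)\<^sup>2 + (pi / H)\<^sup>2"
  defines "wb \<equiv> \<lambda>z. \<beta> * e1 z + \<gamma> * e2 z"
  shows "\<exists>C>0. \<forall>f fx fy w \<theta> d. near_state p A \<mu> f fx fy w \<theta> wb d \<longrightarrow>
     \<bar>cint (\<lambda>z. (\<theta> z)\<^sup>2) - cint (\<lambda>z. (wb z)\<^sup>2)\<bar> \<le> d \<longrightarrow> \<bar>cint (\<lambda>z. \<theta> z ^ 3)\<bar> \<le> d \<longrightarrow>
     \<bar>cint (\<lambda>z. snd z * (\<theta> z - wb z))\<bar> \<le> d \<longrightarrow>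
     \<bar>2 / (L * H) * cint (\<lambda>z. \<theta> z * e1 z) * (\<beta>\<^sup>2 - (2 / (L * H) * cint (\<lambda>z. \<theta> z * e1 z))\<^sup>2)\<bar> \<le> C * sqrt d \<and>
     cint (\<lambda>z. (\<theta> z - wb z)\<^sup>2) \<le> C * (\<bar>2 / (L * H) * cint (\<lambda>z. \<theta> z * e1 z) - \<beta>\<bar> + sqrt d)"
proof -
  define k' where "k' = min (3 * (pi / H)\<^sup>2) (3 * (2 * pi / L)\<^sup>2)"
  define \<kappa> where "\<kappa> = min (3 * (2 * pi / H)\<^sup>2) k'"
  have \<kappa>: "0 < \<kappa>" using L_pos H_pos by (simp add: \<kappa>_def k'_def)
  let ?S = "{1, 2, 3, 4} :: nat set"
  have LH: "0 < L * H" using L_pos H_pos by simp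
  have gap: "\<mu> * (cint (\<lambda>z. (f z)\<^sup>2) - (cint f)\<^sup>2 / (L * H))
      + \<kappa> * (cint (\<lambda>z. (f z)\<^sup>2) - (cint f)\<^sup>2 / (L * H) - (\<Sum>i\<in>?S. (cint (\<lambda>z. f z * mode i z))\<^sup>2 / mode_sq i))
      \<le> cint (\<lambda>z. (fx z)\<^sup>2) + cint (\<lambda>z. (fy z)\<^sup>2)" if st: "stream f fx fy" for f fx fy
  proof -
    define G1 where "G1 = 4 / (L * H) * ((cint (\<lambda>z. f z * e3 z))\<^sup>2 + (cint (\<lambda>z. f z * e4 z))\<^sup>2)"
    define F1 where "F1 = 2 / (L * H) * ((cint (\<lambda>z. f z * e1 z))\<^sup>2 + (cint (\<lambda>z. f z * e2 z))\<^sup>2)"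
    obtain F0 G0 where FG: "F0 + G0 = cint (\<lambda>z. (f z)\<^sup>2) - (cint f)\<^sup>2 / (L * H)" "F1 \<le> F0" "G1 \<le> G0" "0 \<le> F0" "0 \<le> G0"
      "(2 * pi / H)\<^sup>2 * F0 + 3 * (2 * pi / H)\<^sup>2 * (F0 - F1) + ((pi / H)\<^sup>2 + (2 * pi / L)\<^sup>2) * G0 + k' * (G0 - G1)
       \<le> cint (\<lambda>z. (fx z)\<^sup>2) + cint (\<lambda>z. (fy z)\<^sup>2)"
      using stream_spectral_gap[OF st] unfolding G1_def F1_def k'_def by blast
    have sum: "(\<Sum>i\<in>?S. (cint (\<lambda>z. f z * mode i z))\<^sup>2 / mode_sq i) = F1 + G1"
      unfolding G1_def F1_def by (simp add: mode_simps mode_sq_simps algebra_simps add_divide_distrib)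
    have "\<mu> * F0 \<le> (2 * pi / H)\<^sup>2 * F0" using FG(4) l1 by (intro mult_right_mono) auto
    moreover have "\<kappa> * (F0 - F1) \<le> 3 * (2 * pi / H)\<^sup>2 * (F0 - F1)"
      using FG(2) by (intro mult_right_mono) (simp_all add: \<kappa>_def)
    moreover have "\<mu> * G0 \<le> ((pi / H)\<^sup>2 + (2 * pi / L)\<^sup>2) * G0" using FG(5) l2 by (intro mult_right_mono) auto
    moreover have "\<kappa> * (G0 - G1) \<le> k' * (G0 - G1)" using FG(3) by (intro mult_right_mono) (simp_all add: \<kappa>_def)
    ultimately show ?thesis using FG(6) unfolding sum FG(1)[symmetric] by (simp add: algebra_simps)
  qed
  have "\<exists>C>0. \<forall>f fx fy w \<theta> wb d. near_state p A \<mu> f fx fy w \<theta> wb d \<longrightarrow>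
     (\<exists>c. cint (\<lambda>z. (\<theta> z - wb z - (\<Sum>i\<in>?S. c i * mode i z))\<^sup>2) \<le> C * d)"
    by (rule mode_estimate[OF p A \<mu> \<kappa> _ gap]) auto
  then obtain C0 where C0: "C0 > 0" and est: "\<forall>f fx fy w \<theta> wb d. near_state p A \<mu> f fx fy w \<theta> wb d \<longrightarrow>
     (\<exists>c. cint (\<lambda>z. (\<theta> z - wb z - (\<Sum>i\<in>?S. c i * mode i z))\<^sup>2) \<le> C0 * d)"
    by (elim exE conjE) (rule that)
  define K where "K = sqrt (L * H * C0)"
  define M where "M = 4 * A"
  \<comment> \<open>\<open>Ca\<close>, \<open>Cb\<close> and \<open>Cc\<close> bound, in units of
    \<open>sqrt d\<close>, the errors in the relations from the impulse, the second and the third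
    moment. \<open>Mc\<close> bounds the quotient of \<open>\<theta>\<^sup>3 - F\<^sup>3\<close> by
    \<open>\<theta> - F\<close>.\<close>
  define Ca where "Ca = (1 + H * K) * (2 * pi / (L * H\<^sup>2))"
  define Cb where "Cb = 2 / (L * H) * (1 + C0) + (M + \<bar>\<gamma>\<bar>) * Ca"
  define Mc where "Mc = A\<^sup>2 + A * (4 * M) + (4 * M)\<^sup>2"
  define Cc where "Cc = 8 / (3 * (L * H)) * (1 + Mc * K)"
  define Cd where "Cd = C0 + L * H / 2 * ((M + \<bar>\<gamma>\<bar>) * Ca) + L * H / 2 * Cb"
  define C where "C = (Cc / 2 + M * Cb) + L * H * (M + \<bar>\<beta>\<bar>) + Cd"
  have K: "K \<ge> 0" using C0 LH by (simp add: K_def)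
  have M: "M \<ge> 0" using A by (simp add: M_def)
  have Ca: "Ca \<ge> 0" using K L_pos H_pos by (simp add: Ca_def)
  have Cb: "Cb \<ge> 0" unfolding Cb_def using LH C0 M Ca by (intro add_nonneg_nonneg mult_nonneg_nonneg) auto
  have Mc: "Mc \<ge> 0" unfolding Mc_def using A M by (intro add_nonneg_nonneg mult_nonneg_nonneg) auto
  have Cc: "Cc \<ge> 0" unfolding Cc_def using LH Mc K by (intro mult_nonneg_nonneg add_nonneg_nonneg) auto
  have Cd: "Cd > 0" unfolding Cd_def using C0 LH M Ca Cb by (intro add_pos_nonneg mult_nonneg_nonneg) auto
  have nn: "0 \<le> Cc / 2 + M * Cb" "0 \<le> L * H * (M + \<bar>\<beta>\<bar>)"
    using Cc M Cb LH by (auto intro!: add_nonneg_nonneg mult_nonneg_nonneg)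
  show ?thesis
  proof (intro exI[of _ C] conjI allI impI)
    show "C > 0" unfolding C_def using nn Cd by linarith
    fix f fx fy w \<theta> d
    assume ns: "near_state p A \<mu> f fx fy w \<theta> wb d"
      and m2: "\<bar>cint (\<lambda>z. (\<theta> z)\<^sup>2) - cint (\<lambda>z. (wb z)\<^sup>2)\<bar> \<le> d" and m3: "\<bar>cint (\<lambda>z. \<theta> z ^ 3)\<bar> \<le> d"
      and imp: "\<bar>cint (\<lambda>z. snd z * (\<theta> z - wb z))\<bar> \<le> d"
    note D = near_stateD[OF ns]
    define s where "s = sqrt d"
    have s: "d \<le> s" "0 \<le> s" using le_sqrt_of_le_1[OF D(3,4)] D(3) by (simp_all add: s_def)
    define k where "k i = cint (\<lambda>z. \<theta> z * mode i z) / mode_sq i" for i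
    define k0 where "k0 i = (if i = 1 then \<beta> else if i = 2 then \<gamma> else 0)" for i :: nat
    define F where "F z = k 1 * e1 z + k 2 * e2 z + k 3 * e3 z + k 4 * e4 z" for z
    define r where "r z = \<theta> z - F z" for z
    note cmodes = continuous_on_modes
    have cF: "continuous_on cell F" unfolding F_def by (intro continuous_on_add continuous_on_mult continuous_on_const cmodes)
    have cr: "continuous_on cell r" unfolding r_def by (intro continuous_intros D(1) cF)
    have sumF: "(\<Sum>i\<in>?S. k i * mode i z) = F z" for z unfolding F_def by (rule sum_four_modes)
    have sum0: "(\<Sum>i\<in>?S. k0 i * mode i z) = wb z" for z unfolding wb_def sum_four_modes by (simp add: k0_def)
    have S4: "?S \<subseteq> {..4}" by auto
    have proj: "cint (\<lambda>z. (\<theta> z - (\<Sum>i\<in>?S. x i * mode i z))\<^sup>2)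
       = cint (\<lambda>z. (r z)\<^sup>2) + (\<Sum>i\<in>?S. mode_sq i * (x i - k i)\<^sup>2)" for x
    proof -
      have "cint (\<lambda>z. (r z)\<^sup>2) = cint (\<lambda>z. (\<theta> z)\<^sup>2) - (\<Sum>i\<in>?S. (cint (\<lambda>z. \<theta> z * mode i z))\<^sup>2 / mode_sq i)"
        using mode_projection_defect[OF D(1) S4, of k] unfolding sumF r_def by (simp add: k_def)
      then show ?thesis unfolding mode_projection_defect[OF D(1) S4] k_def by simp
    qed
    have r2: "0 \<le> cint (\<lambda>z. (r z)\<^sup>2)" "cint (\<lambda>z. (r z)\<^sup>2) \<le> C0 * d"
    proof -
      obtain c where c: "cint (\<lambda>z. (\<theta> z - wb z - (\<Sum>i\<in>?S. c i * mode i z))\<^sup>2) \<le> C0 * d"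
        using est[rule_format, OF ns] by blast
      \<comment> \<open>Adding the coefficients of \<open>wb\<close> to \<open>c\<close> yields a
        competitor for the best approximation of \<open>\<theta>\<close>; the projection
        \<open>F\<close> is at least as good.\<close>
      have "cint (\<lambda>z. (\<theta> z - wb z - (\<Sum>i\<in>?S. c i * mode i z))\<^sup>2) = cint (\<lambda>z. (\<theta> z - (\<Sum>i\<in>?S. (k0 i + c i) * mode i z))\<^sup>2)"
        unfolding sum0[symmetric] distrib_right sum.distrib by (simp only: diff_diff_eq)
      also have "\<dots> \<ge> cint (\<lambda>z. (r z)\<^sup>2)"
        unfolding proj by (simp only: le_add_same_cancel1) (intro sum_nonneg mult_nonneg_nonneg zero_le_power2 less_imp_le mode_sq_pos)
      finally show "cint (\<lambda>z. (r z)\<^sup>2) \<le> C0 * d" using c by linarith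
      show "0 \<le> cint (\<lambda>z. (r z)\<^sup>2)" by (rule cint_sq_nonneg[OF cr])
    qed
    have r1: "cint (\<lambda>z. \<bar>r z\<bar>) \<le> K * s"
    proof -
      have "cint (\<lambda>z. \<bar>r z\<bar>) \<le> sqrt (L * H * cint (\<lambda>z. (r z)\<^sup>2))" by (rule cint_abs_le_sqrt[OF cr])
      also have "\<dots> \<le> sqrt (L * H * (C0 * d))"
        using r2(2) LH by (intro real_sqrt_le_mono mult_left_mono) auto
      also have "\<dots> = K * s" by (simp add: K_def s_def real_sqrt_mult mult.assoc)
      finally show ?thesis .
    qed
    have mode1: "\<bar>mode i z\<bar> \<le> 1" for i z
      by (auto simp: mode_def abs_mult intro!: mult_le_one)
    have kM: "\<bar>k i\<bar> \<le> M" for i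
    proof -
      have "\<bar>cint (\<lambda>z. \<theta> z * mode i z)\<bar> \<le> cint (\<lambda>z. \<bar>\<theta> z * mode i z\<bar>)"
        by (intro cint_abs_le continuous_intros D(1) continuous_on_mode)
      also have "\<dots> \<le> cint (\<lambda>z. A)"
      proof (intro cint_mono continuous_intros D(1) continuous_on_mode)
        fix z assume "z \<in> cell"
        then have "\<bar>\<theta> z\<bar> * \<bar>mode i z\<bar> \<le> A * 1" using D(5) mode1 A by (intro mult_mono) auto
        then show "\<bar>\<theta> z * mode i z\<bar> \<le> A" by (simp add: abs_mult)
      qed
      also have "\<dots> = A * (L * H)" by (rule cint_const)
      \<comment> \<open>\<open>M = 4 * A\<close> because no mode has squared norm below a quarter of
        the area.\<close>
      also have "\<dots> \<le> M * mode_sq i" using A L_pos H_pos by (simp add: M_def mode_sq_def)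
      finally show ?thesis using mode_sq_pos[of i] by (simp add: k_def abs_divide pos_divide_le_eq)
    qed
    define b where "b = k 1"
    define g where "g = k 2"
    define R where "R = (k 3)\<^sup>2 + (k 4)\<^sup>2"
    have R0: "0 \<le> R" by (simp add: R_def)
    have bM: "\<bar>b\<bar> \<le> M" and gM: "\<bar>g\<bar> \<le> M" unfolding b_def g_def by (rule kM)+
    have b_eq: "2 / (L * H) * cint (\<lambda>z. \<theta> z * e1 z) = b" by (simp add: b_def k_def mode_simps mode_sq_simps)
    \<comment> \<open>Of the four modes only \<open>e2\<close> has nonzero impulse, so the impulse
      determines its coefficient up to the error \<open>r\<close>.\<close>
    have ga: "\<bar>g - \<gamma>\<bar> \<le> Ca * s"
    proof -
      have z34: "cint (\<lambda>z. snd z * e3 z) = 0" "cint (\<lambda>z. snd z * e4 z) = 0"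
        using cint_height_times_odd_mode_zero[of "\<lambda>y. y"] by (simp_all add: mode_simps continuous_on_id)
      have cy: "continuous_on cell (\<lambda>z. snd z * m z)" if "continuous_on cell m" for m
        by (intro continuous_intros that)
      have "cint (\<lambda>z. snd z * (\<theta> z - wb z)) = cint (\<lambda>z. ((b - \<beta>) * (snd z * e1 z) + (g - \<gamma>) * (snd z * e2 z))
          + (k 3 * (snd z * e3 z) + k 4 * (snd z * e4 z)) + snd z * r z)"
        by (rule cint_cong) (simp add: r_def F_def wb_def b_def g_def algebra_simps)
      also have "\<dots> = (b - \<beta>) * cint (\<lambda>z. snd z * e1 z) + (g - \<gamma>) * cint (\<lambda>z. snd z * e2 z)
          + (k 3 * cint (\<lambda>z. snd z * e3 z) + k 4 * cint (\<lambda>z. snd z * e4 z)) + cint (\<lambda>z. snd z * r z)"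
      proof -
        have c12: "continuous_on cell (\<lambda>z. (b - \<beta>) * (snd z * e1 z))" "continuous_on cell (\<lambda>z. (g - \<gamma>) * (snd z * e2 z))"
          "continuous_on cell (\<lambda>z. k 3 * (snd z * e3 z))" "continuous_on cell (\<lambda>z. k 4 * (snd z * e4 z))"
          by (intro continuous_on_mult[OF continuous_on_const] cy cmodes)+
        show ?thesis
          unfolding cint_add[OF continuous_on_add[OF continuous_on_add[OF c12(1,2)] continuous_on_add[OF c12(3,4)]] cy[OF cr]]
            cint_add[OF continuous_on_add[OF c12(1,2)] continuous_on_add[OF c12(3,4)]] cint_add[OF c12(1,2)] cint_add[OF c12(3,4)]
            integral_mult_right ..
      qed
      finally have eq: "(g - \<gamma>) * (L * H\<^sup>2 / (2 * pi)) = cint (\<lambda>z. snd z * r z) - cint (\<lambda>z. snd z * (\<theta> z - wb z))"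
        unfolding cint_height_modes z34 by simp
      have "\<bar>cint (\<lambda>z. snd z * r z)\<bar> \<le> H * cint (\<lambda>z. \<bar>r z\<bar>)"
        by (rule cint_mult_bound[OF _ cr]) (auto intro!: continuous_intros simp: cbox_Pair_eq)
      also have "\<dots> \<le> H * (K * s)" using r1 H_pos by (intro mult_left_mono) auto
      finally have "\<bar>(g - \<gamma>) * (L * H\<^sup>2 / (2 * pi))\<bar> \<le> (1 + H * K) * s"
        unfolding eq using imp s(1) by (simp add: algebra_simps)
      then have "\<bar>g - \<gamma>\<bar> * (L * H\<^sup>2 / (2 * pi)) \<le> (1 + H * K) * s"
        using L_pos by (simp add: abs_mult)
      moreover have "0 < L * H\<^sup>2 / (2 * pi)" using L_pos H_pos by simp
      ultimately have "\<bar>g - \<gamma>\<bar> \<le> (1 + H * K) * s / (L * H\<^sup>2 / (2 * pi))"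
        by (simp only: pos_le_divide_eq)
      then show ?thesis by (simp add: Ca_def mult_ac)
    qed
    have gg: "\<bar>g\<^sup>2 - \<gamma>\<^sup>2\<bar> \<le> (M + \<bar>\<gamma>\<bar>) * Ca * s" "(g - \<gamma>)\<^sup>2 \<le> (M + \<bar>\<gamma>\<bar>) * Ca * s"
    proof -
      have "(M + \<bar>\<gamma>\<bar>) * \<bar>g - \<gamma>\<bar> \<le> (M + \<bar>\<gamma>\<bar>) * (Ca * s)" using ga M by (intro mult_left_mono) auto
      then show "\<bar>g\<^sup>2 - \<gamma>\<^sup>2\<bar> \<le> (M + \<bar>\<gamma>\<bar>) * Ca * s" "(g - \<gamma>)\<^sup>2 \<le> (M + \<bar>\<gamma>\<bar>) * Ca * s"
        using abs_square_diff_le[OF gM order_refl[of "\<bar>\<gamma>\<bar>"]] by (simp_all add: mult.assoc)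
    qed
    \<comment> \<open>The second moment nearly fixes \<open>b\<^sup>2 + g\<^sup>2 + R / 2\<close>,
      and \<open>g\<close> is known already. The half reflects that mixed modes have half the
      squared norm of \<open>e1\<close> and \<open>e2\<close>.\<close>
    have quad: "\<bar>b\<^sup>2 + R / 2 - \<beta>\<^sup>2\<bar> \<le> Cb * s"
    proof -
      have t2: "cint (\<lambda>z. (\<theta> z)\<^sup>2) = cint (\<lambda>z. (r z)\<^sup>2) + (L * H / 2 * (b\<^sup>2 + g\<^sup>2) + L * H / 4 * R)"
        using proj[of "\<lambda>_. 0"] by (simp add: b_def g_def R_def mode_sq_simps algebra_simps)
      have "cint (\<lambda>z. (0 - (\<Sum>i\<in>?S. k0 i * mode i z))\<^sup>2) = L * H / 2 * (\<beta>\<^sup>2 + \<gamma>\<^sup>2)"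
        unfolding mode_projection_defect[OF continuous_on_const S4] by (simp add: k0_def mode_sq_simps algebra_simps)
      then have w2: "cint (\<lambda>z. (wb z)\<^sup>2) = L * H / 2 * (\<beta>\<^sup>2 + \<gamma>\<^sup>2)" unfolding sum0 by simp
      have "b\<^sup>2 + R / 2 - \<beta>\<^sup>2 = 2 / (L * H) * (L * H / 2 * (b\<^sup>2 + g\<^sup>2) + L * H / 4 * R - L * H / 2 * (\<beta>\<^sup>2 + \<gamma>\<^sup>2)) - (g\<^sup>2 - \<gamma>\<^sup>2)"
        using L_pos H_pos by (simp add: field_simps)
      also have "L * H / 2 * (b\<^sup>2 + g\<^sup>2) + L * H / 4 * R - L * H / 2 * (\<beta>\<^sup>2 + \<gamma>\<^sup>2)
         = (cint (\<lambda>z. (\<theta> z)\<^sup>2) - cint (\<lambda>z. (wb z)\<^sup>2)) - cint (\<lambda>z. (r z)\<^sup>2)"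
        using t2 w2 by linarith
      finally have eq: "b\<^sup>2 + R / 2 - \<beta>\<^sup>2 = 2 / (L * H) * ((cint (\<lambda>z. (\<theta> z)\<^sup>2) - cint (\<lambda>z. (wb z)\<^sup>2)) - cint (\<lambda>z. (r z)\<^sup>2)) - (g\<^sup>2 - \<gamma>\<^sup>2)" .
      have "C0 * d \<le> C0 * s" using C0 s by (intro mult_left_mono) auto
      then have "\<bar>(cint (\<lambda>z. (\<theta> z)\<^sup>2) - cint (\<lambda>z. (wb z)\<^sup>2)) - cint (\<lambda>z. (r z)\<^sup>2)\<bar> \<le> (1 + C0) * s"
        using m2 r2 s by (simp add: algebra_simps)
      then have "\<bar>2 / (L * H) * ((cint (\<lambda>z. (\<theta> z)\<^sup>2) - cint (\<lambda>z. (wb z)\<^sup>2)) - cint (\<lambda>z. (r z)\<^sup>2))\<bar> \<le> 2 / (L * H) * ((1 + C0) * s)"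
        unfolding abs_mult using LH by (intro mult_mono) auto
      then have "\<bar>b\<^sup>2 + R / 2 - \<beta>\<^sup>2\<bar> \<le> 2 / (L * H) * ((1 + C0) * s) + (M + \<bar>\<gamma>\<bar>) * Ca * s"
        unfolding eq using gg(1) by - (rule order_trans[OF abs_triangle_ineq4 add_mono]; assumption)
      also have "\<dots> = Cb * s" unfolding Cb_def by (simp only: distrib_right mult.assoc)
      finally show ?thesis .
    qed
    \<comment> \<open>The third moment of \<open>F\<close> is a multiple of \<open>b * R\<close>, so
      a nearly vanishing third moment of \<open>\<theta>\<close> prevents \<open>b\<close> and
      \<open>R\<close> from both being large.\<close>
    have cub: "\<bar>b * R\<bar> \<le> Cc * s"
    proof -
      have F3: "cint (\<lambda>z. F z ^ 3) = - (3 / 8) * (L * H) * b * R"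
        unfolding F_def cint_cubed_modes by (simp add: b_def R_def)
      have FM: "\<bar>F z\<bar> \<le> 4 * M" for z
      proof -
        have "\<bar>k i * mode i z\<bar> \<le> M" for i
          using mult_mono[OF kM[of i] mode1[of i z] M abs_ge_zero] by (simp add: abs_mult)
        then have "\<bar>\<Sum>i\<in>?S. k i * mode i z\<bar> \<le> (\<Sum>i\<in>?S. M)"
          by (intro order_trans[OF sum_abs] sum_mono)
        then show ?thesis unfolding sumF by simp
      qed
      have "cint (\<lambda>z. \<theta> z ^ 3 - F z ^ 3) = cint (\<lambda>z. ((\<theta> z)\<^sup>2 + \<theta> z * F z + (F z)\<^sup>2) * r z)"
        by (simp add: r_def power2_eq_square power3_eq_cube algebra_simps)
      also have "\<bar>\<dots>\<bar> \<le> Mc * cint (\<lambda>z. \<bar>r z\<bar>)"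
      proof (rule cint_mult_bound[OF _ cr])
        show "continuous_on cell (\<lambda>z. (\<theta> z)\<^sup>2 + \<theta> z * F z + (F z)\<^sup>2)" by (intro continuous_intros D(1) cF)
        fix z assume z: "z \<in> cell"
        have "(\<theta> z)\<^sup>2 \<le> A\<^sup>2" "(F z)\<^sup>2 \<le> (4 * M)\<^sup>2"
          using power_mono[OF D(5)[OF z] abs_ge_zero, of 2] power_mono[OF FM[of z] abs_ge_zero, of 2]
          by (simp_all only: power2_abs)
        moreover have "\<bar>\<theta> z * F z\<bar> \<le> A * (4 * M)"
          unfolding abs_mult using D(5)[OF z] FM[of z] A by (intro mult_mono) auto
        ultimately show "\<bar>(\<theta> z)\<^sup>2 + \<theta> z * F z + (F z)\<^sup>2\<bar> \<le> Mc"
          unfolding Mc_def using zero_le_power2[of "\<theta> z"] zero_le_power2[of "F z"] by linarith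
      qed
      also have "\<dots> \<le> Mc * (K * s)" using r1 Mc by (intro mult_left_mono)
      also have "cint (\<lambda>z. \<theta> z ^ 3 - F z ^ 3) = cint (\<lambda>z. \<theta> z ^ 3) - cint (\<lambda>z. F z ^ 3)"
        by (intro cint_diff continuous_intros D(1) cF)
      finally have "\<bar>3 / 8 * (L * H) * (b * R)\<bar> \<le> (1 + Mc * K) * s"
        using m3 s(1) unfolding F3 by (simp add: algebra_simps)
      then have "3 / 8 * (L * H) * \<bar>b * R\<bar> \<le> (1 + Mc * K) * s"
        using L_pos H_pos by (simp add: abs_mult)
      then have "8 / (3 * (L * H)) * (3 / 8 * (L * H) * \<bar>b * R\<bar>) \<le> 8 / (3 * (L * H)) * ((1 + Mc * K) * s)"
        using LH by (intro mult_left_mono) auto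
      moreover have "8 / (3 * (L * H)) * (3 / 8 * (L * H) * \<bar>b * R\<bar>) = \<bar>b * R\<bar>" using L_pos H_pos by simp
      moreover have "8 / (3 * (L * H)) * ((1 + Mc * K) * s) = Cc * s" by (simp only: Cc_def mult.assoc)
      ultimately show ?thesis by linarith
    qed
    show "\<bar>2 / (L * H) * cint (\<lambda>z. \<theta> z * e1 z) * (\<beta>\<^sup>2 - (2 / (L * H) * cint (\<lambda>z. \<theta> z * e1 z))\<^sup>2)\<bar> \<le> C * sqrt d"
    proof -
      \<comment> \<open>Eliminating \<open>R\<close> between the quadratic and the cubic relation
        leaves a polynomial in \<open>b\<close> with roots 0 and plus or minus
        \<open>\<beta>\<close>.\<close>
      have "b * (\<beta>\<^sup>2 - b\<^sup>2) = b * R / 2 - b * (b\<^sup>2 + R / 2 - \<beta>\<^sup>2)" by (simp add: algebra_simps)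
      moreover have "\<bar>b * (b\<^sup>2 + R / 2 - \<beta>\<^sup>2)\<bar> \<le> M * (Cb * s)"
        unfolding abs_mult using bM quad M by (intro mult_mono) auto
      moreover have "\<bar>b * R / 2\<bar> \<le> Cc / 2 * s" using cub by simp
      ultimately have "\<bar>b * (\<beta>\<^sup>2 - b\<^sup>2)\<bar> \<le> (Cc / 2 + M * Cb) * s" by (simp add: algebra_simps)
      also have "\<dots> \<le> C * s" using nn Cd s unfolding C_def by (intro mult_right_mono) auto
      finally show ?thesis unfolding b_eq s_def .
    qed
    \<comment> \<open>When \<open>b\<close> is close to \<open>\<beta>\<close> the second moment
      leaves no room for the mixed modes.\<close>
    have R: "R \<le> 2 * (M + \<bar>\<beta>\<bar>) * \<bar>b - \<beta>\<bar> + 2 * Cb * s"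
      using quad abs_square_diff_le(1)[OF bM order_refl[of "\<bar>\<beta>\<bar>"]]
      unfolding mult.assoc by linarith
    have "cint (\<lambda>z. (\<theta> z - wb z)\<^sup>2) = cint (\<lambda>z. (r z)\<^sup>2) + (L * H / 2 * ((b - \<beta>)\<^sup>2 + (g - \<gamma>)\<^sup>2) + L * H / 4 * R)"
      using proj[of k0] unfolding sum0
      by (simp add: b_def g_def R_def k0_def mode_sq_simps algebra_simps power2_commute)
    also have "\<dots> \<le> C0 * s + (L * H / 2 * ((M + \<bar>\<beta>\<bar>) * \<bar>b - \<beta>\<bar> + (M + \<bar>\<gamma>\<bar>) * Ca * s)
        + L * H / 4 * (2 * (M + \<bar>\<beta>\<bar>) * \<bar>b - \<beta>\<bar> + 2 * Cb * s))"
    proof (intro add_mono mult_left_mono gg(2) R abs_square_diff_le(2)[OF bM order_refl])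
      have "C0 * d \<le> C0 * s" using C0 s by (intro mult_left_mono) auto
      then show "cint (\<lambda>z. (r z)\<^sup>2) \<le> C0 * s" using r2(2) by linarith
    qed (use LH in auto)
    also have "\<dots> = L * H * (M + \<bar>\<beta>\<bar>) * \<bar>b - \<beta>\<bar> + Cd * s"
      unfolding Cd_def by (simp add: algebra_simps)
    also have "\<dots> \<le> C * \<bar>b - \<beta>\<bar> + C * s"
      using nn Cd s unfolding C_def by (intro add_mono mult_right_mono) auto
    finally show "cint (\<lambda>z. (\<theta> z - wb z)\<^sup>2) \<le> C * (\<bar>2 / (L * H) * cint (\<lambda>z. \<theta> z * e1 z) - \<beta>\<bar> + sqrt d)"
      unfolding b_eq s_def by (simp add: distrib_left)
  qed
qed

text \<open>The roots \<open>0\<close>, \<open>\<beta>\<close>, \<open>-\<beta>\<close> being separated, a continuous function cannot jump between them.\<close>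

lemma continuous_trapped_near_root:
  fixes \<beta> \<epsilon> :: real
  assumes \<epsilon>: "\<epsilon> > 0"
  shows "\<exists>e0>0. \<forall>e b. e < e0 \<longrightarrow> continuous_on UNIV b \<longrightarrow> \<bar>b (0::real) - \<beta>\<bar> \<le> e \<longrightarrow>
     (\<forall>t. \<bar>b t * (\<beta>\<^sup>2 - (b t)\<^sup>2)\<bar> \<le> e) \<longrightarrow> (\<forall>t. \<bar>b t - \<beta>\<bar> < \<epsilon>)"
proof (cases "\<beta> = 0")
  case True
  show ?thesis
  proof (intro exI[of _ "\<epsilon> ^ 3"] conjI allI impI)
    fix e :: real and b :: "real \<Rightarrow> real" and t assume e: "e < \<epsilon> ^ 3" and b: "\<forall>t. \<bar>b t * (\<beta>\<^sup>2 - (b t)\<^sup>2)\<bar> \<le> e"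
    have "\<bar>b t\<bar> ^ 3 \<le> e" using spec[OF b, of t] True by (simp add: abs_mult power3_eq_cube power2_eq_square)
    then have "\<bar>b t\<bar> ^ 3 < \<epsilon> ^ 3" using e by linarith
    then have "\<bar>b t\<bar> < \<epsilon>" by (rule power_less_imp_less_base) (use \<epsilon> in simp)
    then show "\<bar>b t - \<beta>\<bar> < \<epsilon>" using True by simp
  qed (use \<epsilon> in simp)
next
  case False
  define \<beta>' where "\<beta>' = \<bar>\<beta>\<bar>"
  have pos: "\<beta>' > 0" using False by (simp add: \<beta>'_def)
  \<comment> \<open>In turn: \<open>B\<close> starts above \<open>\<beta>' / 2\<close>; the value
    \<open>3 * \<beta>' ^ 3 / 8\<close> of the cubic at \<open>\<beta>' / 2\<close> exceeds
    \<open>e\<close>, which forbids a crossing; and beyond \<open>\<beta>' / 2\<close> the cubic is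
    at least \<open>\<beta>'\<^sup>2 / 2\<close> times the distance to the root.\<close>
  define e0 where "e0 = min (\<beta>' / 4) (min (3 * \<beta>' ^ 3 / 8) (\<epsilon> * \<beta>'\<^sup>2 / 2))"
  show ?thesis
  proof (intro exI[of _ e0] conjI allI impI)
    show "e0 > 0" using pos \<epsilon> by (simp add: e0_def)
    fix e :: real and b :: "real \<Rightarrow> real" and t
    assume e: "e < e0" and cb: "continuous_on UNIV b" and b0: "\<bar>b 0 - \<beta>\<bar> \<le> e"
      and b: "\<forall>t. \<bar>b t * (\<beta>\<^sup>2 - (b t)\<^sup>2)\<bar> \<le> e"
    have e': "e < \<beta>' / 4" "e < 3 * \<beta>' ^ 3 / 8" "e < \<epsilon> * \<beta>'\<^sup>2 / 2" using e by (simp_all add: e0_def)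
    \<comment> \<open>Multiplication by the sign of \<open>\<beta>\<close> moves the relevant root
      to the positive axis.\<close>
    define B where "B t = sgn \<beta> * b t" for t
    have sb: "sgn \<beta> * \<beta> = \<beta>'" "\<bar>sgn \<beta>\<bar> = 1" "(sgn \<beta>)\<^sup>2 = 1" using False by (auto simp: \<beta>'_def sgn_if)
    have cB: "continuous_on UNIV B" unfolding B_def by (intro continuous_intros cb)
    have diff: "\<bar>B t - \<beta>'\<bar> = \<bar>b t - \<beta>\<bar>" for t
    proof -
      have "B t - \<beta>' = sgn \<beta> * (b t - \<beta>)" unfolding B_def sb(1)[symmetric] by (simp add: algebra_simps)
      then show ?thesis using sb by (simp add: abs_mult)
    qed
    have poly: "\<bar>B t * (\<beta>'\<^sup>2 - (B t)\<^sup>2)\<bar> \<le> e" for t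
      using spec[OF b, of t] sb by (simp add: B_def \<beta>'_def abs_mult power_mult_distrib)
    have B0: "\<beta>' / 2 < B 0" using b0 diff[of 0] e'(1) pos by linarith
    have "\<beta>' / 2 < B t"
    proof (rule ccontr)
      assume "\<not> \<beta>' / 2 < B t"
      then have "B t \<le> \<beta>' / 2" by simp
      moreover have "connected (range B)"
        by (rule connected_continuous_image[OF cB connected_UNIV])
      ultimately have "\<beta>' / 2 \<in> range B"
        using B0 connectedD_interval[of "range B" "B t" "B 0" "\<beta>' / 2"] by auto
      then obtain r where Br: "B r = \<beta>' / 2" by auto
      have "B r * (\<beta>'\<^sup>2 - (B r)\<^sup>2) = 3 * \<beta>' ^ 3 / 8"
        unfolding Br by (simp add: power2_eq_square power3_eq_cube field_simps)
      then show False using poly[of r] e'(2) pos by simp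
    qed
    then have "\<beta>' / 2 * \<beta>' \<le> B t * (\<beta>' + B t)" using pos by (intro mult_mono) auto
    then have "\<beta>' / 2 * \<beta>' * \<bar>B t - \<beta>'\<bar> \<le> B t * (\<beta>' + B t) * \<bar>B t - \<beta>'\<bar>" by (intro mult_right_mono) auto
    also have "\<dots> = \<bar>B t * (\<beta>'\<^sup>2 - (B t)\<^sup>2)\<bar>"
    proof -
      have "\<bar>B t * (\<beta>'\<^sup>2 - (B t)\<^sup>2)\<bar> = \<bar>B t * (\<beta>' + B t) * (B t - \<beta>')\<bar>"
        by (subst abs_minus_cancel[symmetric]) (simp add: power2_eq_square algebra_simps)
      also have "\<dots> = B t * (\<beta>' + B t) * \<bar>B t - \<beta>'\<bar>"
        using \<open>\<beta>' / 2 < B t\<close> pos by (simp add: abs_mult)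
      finally show ?thesis by simp
    qed
    also have "\<dots> < \<beta>' / 2 * \<beta>' * \<epsilon>" using poly[of t] e'(3) by (simp add: power2_eq_square mult_ac)
    finally show "\<bar>b t - \<beta>\<bar> < \<epsilon>" using pos diff[of t] by simp
  qed
qed

end

subsection \<open>Stability\<close>

context euler_fields
begin

text \<open>Truncation is 1-Lipschitz and fixes \<open>wb\<close>, so it starts within the
  \<open>L^1\<close> distance \<open>(L * H + 1) * \<delta>\<close> of \<open>wb\<close>. The
  summands of \<open>d\<close> pay for the remainder, the mean, the second moment and the energy
  (\<open>2 * A\<close>), the third moment (\<open>3 * A\<^sup>2\<close>) and the impulse
  (\<open>2 * H\<close>).\<close>

lemma truncation_estimates:
  fixes a m \<alpha> p \<delta> :: real
  assumes p: "1 < p" and \<delta>: "0 < \<delta>"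
  defines "A \<equiv> \<bar>a\<bar> * m\<^sup>2" and "wb \<equiv> \<lambda>z::real \<times> real. a * m\<^sup>2 * sin (m * snd z + \<alpha>)"
  defines "d \<equiv> (1 + (L * H + 1) * (1 + 2 * A + 3 * A\<^sup>2 + 2 * H)) * \<delta>"
  assumes init: "cint (\<lambda>z. \<bar>w (0, z) - wb z\<bar> powr p) \<le> \<delta> powr p" and d1: "d \<le> 1"
  shows "\<exists>f fx fy. \<forall>t. near_state p A (m\<^sup>2) (f t) (fx t) (fy t) (\<lambda>z. w (t, z)) (\<lambda>z. clamp_to A (w (t, z))) wb d"
    and "\<bar>cint (\<lambda>z. (clamp_to A (w (t, z)))\<^sup>2) - cint (\<lambda>z. (wb z)\<^sup>2)\<bar> \<le> d"
    and "\<bar>cint (\<lambda>z. clamp_to A (w (t, z)) ^ 3) - cint (\<lambda>z. wb z ^ 3)\<bar> \<le> d"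
    and "\<bar>cint (\<lambda>z. snd z * (clamp_to A (w (t, z)) - wb z))\<bar> \<le> d"
    and "cint (\<lambda>z. \<bar>clamp_to A (w (0, z)) - wb z\<bar>) \<le> d"
    and "cint (\<lambda>z. \<bar>w (t, z) - clamp_to A (w (t, z))\<bar> powr p) \<le> \<delta> powr p"
proof -
  define N where "N = L * H + 1"
  define \<theta> where "\<theta> t z = clamp_to A (w (t, z))" for t z
  have A: "0 \<le> A" by (simp add: A_def)
  have N: "1 \<le> N" using L_pos H_pos by (simp add: N_def)
  have d_eq: "d = \<delta> + N * \<delta> + 2 * A * (N * \<delta>) + 3 * A\<^sup>2 * (N * \<delta>) + 2 * H * (N * \<delta>)"
    unfolding d_def N_def by (simp add: algebra_simps)
  have N\<delta>: "0 \<le> N * \<delta>" using N \<delta> by simp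
  have parts: "0 \<le> 2 * A * (N * \<delta>)" "0 \<le> 3 * A\<^sup>2 * (N * \<delta>)" "0 \<le> 2 * H * (N * \<delta>)"
    using A N\<delta> H_pos by auto
  have d: "0 < d" "\<delta> \<le> d" "N * \<delta> \<le> d" "2 * A * (N * \<delta>) \<le> d" "3 * A\<^sup>2 * (N * \<delta>) \<le> d" "2 * H * (N * \<delta>) \<le> d"
    using parts N\<delta> \<delta> unfolding d_eq by linarith+
  have cw: "continuous_on cell (\<lambda>z. w (t, z))" for t
    by (rule continuous_on_cell[OF C1_fieldD(1)[OF w]])
  have cb: "continuous_on cell wb" unfolding wb_def by (intro continuous_intros)
  have ct: "continuous_on cell (\<theta> t)" for t unfolding \<theta>_def by (intro continuous_intros cw)
  have wbA: "\<bar>wb z\<bar> \<le> A" for z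
    unfolding wb_def A_def by (simp add: abs_mult mult_left_le)
  have \<theta>A: "\<bar>\<theta> t z\<bar> \<le> A" for t z unfolding \<theta>_def by (rule abs_clamp_to[OF A])
  have w0: "cint (\<lambda>z. \<bar>w (0, z) - wb z\<bar>) \<le> N * \<delta>"
    using cint_abs_le_of_powr[OF p \<delta> _ init] cw cb by (simp add: N_def continuous_intros)
  have \<theta>0: "cint (\<lambda>z. \<bar>\<theta> 0 z - wb z\<bar>) \<le> N * \<delta>"
  proof -
    have "cint (\<lambda>z. \<bar>\<theta> 0 z - wb z\<bar>) \<le> cint (\<lambda>z. \<bar>w (0, z) - wb z\<bar>)"
    proof (intro cint_mono continuous_intros ct cb cw)
      show "\<bar>\<theta> 0 z - wb z\<bar> \<le> \<bar>w (0, z) - wb z\<bar>" for z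
        using clamp_to_lipschitz[of A "w (0, z)" "wb z"] clamp_to_id[OF wbA] by (simp add: \<theta>_def)
    qed
    then show ?thesis using w0 by linarith
  qed
  \<comment> \<open>Clamping gives the nearest point of the interval in which \<open>wb\<close>
    takes its values, so at time 0 the remainder is pointwise no larger than the
    perturbation.\<close>
  have rp: "cint (\<lambda>z. \<bar>w (t, z) - \<theta> t z\<bar> powr p) \<le> \<delta> powr p" for t
  proof -
    have "continuous_on UNIV (\<lambda>s. \<bar>s - clamp_to A s\<bar> powr p)"
      by (rule continuous_on_abs_powr) (use p in \<open>auto intro!: continuous_intros\<close>)
    then have "cint (\<lambda>z. \<bar>w (t, z) - \<theta> t z\<bar> powr p) = cint (\<lambda>z. \<bar>w (0, z) - \<theta> 0 z\<bar> powr p)"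
      unfolding \<theta>_def by (rule casimir_conserved)
    also have "\<dots> \<le> cint (\<lambda>z. \<bar>w (0, z) - wb z\<bar> powr p)"
    proof (intro cint_mono)
      show "\<bar>w (0, z) - \<theta> 0 z\<bar> powr p \<le> \<bar>w (0, z) - wb z\<bar> powr p" for z
        using clamp_to_nearest[OF wbA] p unfolding \<theta>_def by (intro powr_mono2) auto
    qed (rule continuous_on_abs_powr; use p in \<open>auto intro!: continuous_intros cw ct cb\<close>)+
    finally show ?thesis using init by linarith
  qed
  then show "cint (\<lambda>z. \<bar>w (t, z) - clamp_to A (w (t, z))\<bar> powr p) \<le> \<delta> powr p" for t
    unfolding \<theta>_def .
  have moment: "cint (\<lambda>z. \<theta> t z ^ k) = cint (\<lambda>z. \<theta> 0 z ^ k)" for t k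
    unfolding \<theta>_def by (rule casimir_conserved) (intro continuous_intros)
  have m1: "\<bar>cint (\<theta> t) - cint wb\<bar> \<le> d" for t
  proof -
    have "cint (\<theta> t) - cint wb = cint (\<lambda>z. \<theta> 0 z - wb z)"
      using moment[of t 1] by (simp add: cint_diff[OF ct cb])
    also have "\<bar>\<dots>\<bar> \<le> cint (\<lambda>z. \<bar>\<theta> 0 z - wb z\<bar>)" by (intro cint_abs_le continuous_intros ct cb)
    finally show ?thesis using \<theta>0 d(3) by linarith
  qed
  have m2: "\<bar>cint (\<lambda>z. (\<theta> t z)\<^sup>2) - cint (\<lambda>z. (wb z)\<^sup>2)\<bar> \<le> d" for t
  proof -
    have "cint (\<lambda>z. (\<theta> t z)\<^sup>2) - cint (\<lambda>z. (wb z)\<^sup>2) = cint (\<lambda>z. (\<theta> 0 z)\<^sup>2 - (wb z)\<^sup>2)"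
      unfolding moment[of t 2] by (rule cint_diff[symmetric]) (intro continuous_intros ct cb)+
    also have "\<dots> = cint (\<lambda>z. (\<theta> 0 z + wb z) * (\<theta> 0 z - wb z))"
      by (simp add: power2_eq_square algebra_simps)
    also have "\<bar>\<dots>\<bar> \<le> 2 * A * cint (\<lambda>z. \<bar>\<theta> 0 z - wb z\<bar>)"
    proof (intro cint_mult_bound continuous_intros ct cb)
      show "\<bar>\<theta> 0 z + wb z\<bar> \<le> 2 * A" for z using \<theta>A[of 0 z] wbA[of z] by linarith
    qed
    also have "\<dots> \<le> 2 * A * (N * \<delta>)" using \<theta>0 A by (intro mult_left_mono) auto
    finally show ?thesis using d(4) by linarith
  qed
  then show "\<bar>cint (\<lambda>z. (clamp_to A (w (t, z)))\<^sup>2) - cint (\<lambda>z. (wb z)\<^sup>2)\<bar> \<le> d"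
    unfolding \<theta>_def .
  have m3: "\<bar>cint (\<lambda>z. \<theta> t z ^ 3) - cint (\<lambda>z. wb z ^ 3)\<bar> \<le> d" for t
  proof -
    have "cint (\<lambda>z. \<theta> t z ^ 3) - cint (\<lambda>z. wb z ^ 3) = cint (\<lambda>z. \<theta> 0 z ^ 3 - wb z ^ 3)"
      unfolding moment[of t 3] by (rule cint_diff[symmetric]) (intro continuous_intros ct cb)+
    also have "\<dots> = cint (\<lambda>z. ((\<theta> 0 z)\<^sup>2 + \<theta> 0 z * wb z + (wb z)\<^sup>2) * (\<theta> 0 z - wb z))"
      by (simp add: power2_eq_square power3_eq_cube algebra_simps)
    also have "\<bar>\<dots>\<bar> \<le> 3 * A\<^sup>2 * cint (\<lambda>z. \<bar>\<theta> 0 z - wb z\<bar>)"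
    proof (intro cint_mult_bound continuous_intros ct cb)
      fix z
      have "(\<theta> 0 z)\<^sup>2 \<le> A\<^sup>2" "(wb z)\<^sup>2 \<le> A\<^sup>2"
        using power_mono[OF \<theta>A[of 0 z] abs_ge_zero, of 2] power_mono[OF wbA[of z] abs_ge_zero, of 2]
        by (simp_all only: power2_abs)
      moreover have "\<bar>\<theta> 0 z * wb z\<bar> \<le> A * A"
        unfolding abs_mult using \<theta>A[of 0 z] wbA[of z] A by (intro mult_mono) auto
      ultimately show "\<bar>(\<theta> 0 z)\<^sup>2 + \<theta> 0 z * wb z + (wb z)\<^sup>2\<bar> \<le> 3 * A\<^sup>2"
        using zero_le_power2[of "\<theta> 0 z"] zero_le_power2[of "wb z"] unfolding power2_eq_square[of A] by linarith
    qed
    also have "\<dots> \<le> 3 * A\<^sup>2 * (N * \<delta>)" using \<theta>0 A by (intro mult_left_mono) auto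
    finally show ?thesis using d(5) by linarith
  qed
  then show "\<bar>cint (\<lambda>z. clamp_to A (w (t, z)) ^ 3) - cint (\<lambda>z. wb z ^ 3)\<bar> \<le> d"
    unfolding \<theta>_def .
  show "cint (\<lambda>z. \<bar>clamp_to A (w (0, z)) - wb z\<bar>) \<le> d"
    using \<theta>0 d(3) unfolding \<theta>_def by linarith
  \<comment> \<open>Impulse is conserved for \<open>w\<close>, not for its truncation: the
    perturbation at time 0 and the remainder at time \<open>t\<close> are both paid for.\<close>
  have imp: "\<bar>cint (\<lambda>z. snd z * (\<theta> t z - wb z))\<bar> \<le> d" for t
  proof -
    have cy: "continuous_on cell (\<lambda>z. snd z)" by (intro continuous_intros)
    have yH: "\<bar>snd z\<bar> \<le> H" if "z \<in> cell" for z using that by (cases z) (auto simp: mem_cell)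
    have "cint (\<lambda>z. snd z * (\<theta> t z - wb z)) = cint (\<lambda>z. (snd z * w (t, z) - snd z * wb z) - snd z * (w (t, z) - \<theta> t z))"
      by (simp add: algebra_simps)
    also have "\<dots> = cint (\<lambda>z. snd z * w (t, z) - snd z * wb z) - cint (\<lambda>z. snd z * (w (t, z) - \<theta> t z))"
      by (intro cint_diff continuous_intros cw cb ct)
    also have "cint (\<lambda>z. snd z * w (t, z) - snd z * wb z) = cint (\<lambda>z. snd z * w (0, z)) - cint (\<lambda>z. snd z * wb z)"
      unfolding impulse_conserved[of t, symmetric] by (intro cint_diff continuous_intros cw cb)
    also have "\<dots> = cint (\<lambda>z. snd z * w (0, z) - snd z * wb z)"
      by (rule cint_diff[symmetric]) (intro continuous_intros cw cb)+
    also have "\<dots> = cint (\<lambda>z. snd z * (w (0, z) - wb z))" by (simp add: algebra_simps)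
    finally have eq: "cint (\<lambda>z. snd z * (\<theta> t z - wb z))
       = cint (\<lambda>z. snd z * (w (0, z) - wb z)) - cint (\<lambda>z. snd z * (w (t, z) - \<theta> t z))" .
    have "\<bar>cint (\<lambda>z. snd z * (w (0, z) - wb z))\<bar> \<le> H * cint (\<lambda>z. \<bar>w (0, z) - wb z\<bar>)"
      by (rule cint_mult_bound[OF cy _ yH]) (intro continuous_intros cw cb)
    moreover have "H * cint (\<lambda>z. \<bar>w (0, z) - wb z\<bar>) \<le> H * (N * \<delta>)" using w0 H_pos by (intro mult_left_mono) auto
    moreover have "\<bar>cint (\<lambda>z. snd z * (w (t, z) - \<theta> t z))\<bar> \<le> H * cint (\<lambda>z. \<bar>w (t, z) - \<theta> t z\<bar>)"
      by (rule cint_mult_bound[OF cy _ yH]) (intro continuous_intros cw ct)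
    moreover have "cint (\<lambda>z. \<bar>w (t, z) - \<theta> t z\<bar>) \<le> N * \<delta>"
      using cint_abs_le_of_powr[OF p \<delta> _ rp[of t]] cw ct by (simp add: N_def continuous_intros)
    then have "H * cint (\<lambda>z. \<bar>w (t, z) - \<theta> t z\<bar>) \<le> H * (N * \<delta>)" using H_pos by (intro mult_left_mono) auto
    ultimately show ?thesis using d(6) unfolding eq by linarith
  qed
  then show "\<bar>cint (\<lambda>z. snd z * (clamp_to A (w (t, z)) - wb z))\<bar> \<le> d"
    unfolding \<theta>_def .
  obtain f fx fy where st: "\<And>t. stream (f t) (fx t) (fy t)"
    and id: "\<And>t. cint (\<lambda>z. (fx t z)\<^sup>2) + cint (\<lambda>z. (fy t z)\<^sup>2) = cint (\<lambda>z. f t z * (w (t, z) - wb z))"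
    and en: "\<And>t. m\<^sup>2 * (cint (\<lambda>z. (fx t z)\<^sup>2) + cint (\<lambda>z. (fy t z)\<^sup>2)) + 2 * cint (\<lambda>z. wb z * w (t, z)) =
         m\<^sup>2 * (cint (\<lambda>z. (fx 0 z)\<^sup>2) + cint (\<lambda>z. (fy 0 z)\<^sup>2)) + 2 * cint (\<lambda>z. wb z * w (0, z))"
  proof -
    have "\<exists>f fx fy. (\<forall>t. stream (f t) (fx t) (fy t)) \<and>
    (\<forall>t. cint (\<lambda>z. (fx t z)\<^sup>2) + cint (\<lambda>z. (fy t z)\<^sup>2) = cint (\<lambda>z. f t z * (w (t, z) - wb z))) \<and>
    (\<forall>t. m\<^sup>2 * (cint (\<lambda>z. (fx t z)\<^sup>2) + cint (\<lambda>z. (fy t z)\<^sup>2)) + 2 * cint (\<lambda>z. wb z * w (t, z)) =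
         m\<^sup>2 * (cint (\<lambda>z. (fx 0 z)\<^sup>2) + cint (\<lambda>z. (fy 0 z)\<^sup>2)) + 2 * cint (\<lambda>z. wb z * w (0, z)))"
      unfolding wb_def by (rule perturbation_stream)
    then show thesis by (elim exE conjE) (rule that, (erule spec)+)
  qed
  \<comment> \<open>The perturbation energy at time 0 has the favourable sign and is dropped; the
    rest at time 0 is linear in the perturbation.\<close>
  have energy: "2 * cint (\<lambda>z. wb z * (wb z - w (t, z))) \<le> m\<^sup>2 * (cint (\<lambda>z. (fx t z)\<^sup>2) + cint (\<lambda>z. (fy t z)\<^sup>2)) + d" for t
  proof -
    have split: "cint (\<lambda>z. wb z * (wb z - w (t, z))) = cint (\<lambda>z. wb z * wb z) - cint (\<lambda>z. wb z * w (t, z))" for t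
      unfolding right_diff_distrib by (intro cint_diff continuous_intros cb cw)
    have "\<bar>cint (\<lambda>z. wb z * (w (0, z) - wb z))\<bar> \<le> A * cint (\<lambda>z. \<bar>w (0, z) - wb z\<bar>)"
      by (intro cint_mult_bound continuous_intros cb cw wbA)
    also have "\<dots> \<le> A * (N * \<delta>)" using w0 A by (intro mult_left_mono)
    also have "cint (\<lambda>z. wb z * (w (0, z) - wb z)) = - cint (\<lambda>z. wb z * (wb z - w (0, z)))"
      unfolding integral_neg[symmetric] by (simp add: algebra_simps)
    finally have 1: "2 * cint (\<lambda>z. wb z * (wb z - w (0, z))) \<le> d" using d(4) by linarith
    have "0 \<le> m\<^sup>2 * (cint (\<lambda>z. (fx 0 z)\<^sup>2) + cint (\<lambda>z. (fy 0 z)\<^sup>2))"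
      using streamD(2,3)[OF st] by (intro mult_nonneg_nonneg add_nonneg_nonneg cint_sq_nonneg) auto
    then show ?thesis using en[of t] 1 split[of t] split[of 0] by linarith
  qed
  have "near_state p A (m\<^sup>2) (f t) (fx t) (fy t) (\<lambda>z. w (t, z)) (\<theta> t) wb d" for t
    unfolding near_state_def
  proof (intro conjI ballI st cw ct cb d(1) d1 \<theta>A wbA id energy m1)
    have "\<delta> powr p \<le> d powr p" using \<delta> d p by (intro powr_mono2) auto
    then show "cint (\<lambda>z. \<bar>w (t, z) - \<theta> t z\<bar> powr p) \<le> d powr p" using rp[of t] by linarith
    show "cint (\<lambda>z. (\<theta> t z)\<^sup>2) \<le> cint (\<lambda>z. (wb z)\<^sup>2) + d" using m2[of t] by linarith
  qed
  then show "\<exists>f fx fy. \<forall>t. near_state p A (m\<^sup>2) (f t) (fx t) (fy t) (\<lambda>z. w (t, z)) (\<lambda>z. clamp_to A (w (t, z))) wb d"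
    unfolding \<theta>_def by blast
qed

end

section \<open>Stability with constants uniform over all flows\<close>

context channel
begin

text \<open>Recombines the truncated part, bounded and small in mean square, with the remainder,
  unbounded and small in \<open>L^p\<close>. For a bounded function the \<open>L^p\<close> integral
  is controlled by the mean square, whether \<open>p\<close> is below or above 2.\<close>

lemma powr_small_of_square_small:
  fixes p A \<epsilon> :: real
  assumes p: "1 < p" and A: "0 \<le> A" and \<epsilon>: "0 < \<epsilon>"
  shows "\<exists>\<epsilon>1>0. \<exists>\<delta>1>0. \<forall>\<eta> \<rho> \<delta>. continuous_on cell \<eta> \<longrightarrow> continuous_on cell \<rho> \<longrightarrow> (\<forall>z\<in>cell. \<bar>\<eta> z\<bar> \<le> A) \<longrightarrow>
     cint (\<lambda>z. (\<eta> z)\<^sup>2) \<le> \<epsilon>1 \<longrightarrow> 0 < \<delta> \<longrightarrow> \<delta> \<le> \<delta>1 \<longrightarrow> cint (\<lambda>z. \<bar>\<rho> z\<bar> powr p) \<le> \<delta> powr p \<longrightarrow>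
     cint (\<lambda>z. \<bar>\<eta> z + \<rho> z\<bar> powr p) < \<epsilon> powr p"
proof -
  have LH: "0 < L * H" using L_pos H_pos by simp
  \<comment> \<open>Three contributions of size \<open>e\<close>, multiplied by
    \<open>2 powr p\<close>, make up three quarters of \<open>\<epsilon> powr p\<close>.\<close>
  define e where "e = \<epsilon> powr p / (4 * 2 powr p)"
  have e: "0 < e" using \<epsilon> by (simp add: e_def)
  define c where "c = e / (L * H)"
  have c: "0 < c" using e LH by (simp add: c_def)
  \<comment> \<open>Where \<open>\<bar>s\<bar> powr p\<close> exceeds \<open>c\<close>,
    \<open>s\<^sup>2\<close> is at least \<open>c powr (2 / p)\<close>; this ratio then lifts
    \<open>C * s\<^sup>2\<close> to at least \<open>A powr p\<close>.\<close>
  define C where "C = A powr p / c powr (2 / p)"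
  have C: "0 \<le> C" by (simp add: C_def)
  have cLH: "c * (L * H) = e" using L_pos H_pos by (simp add: c_def)
  have pt: "\<bar>s\<bar> powr p \<le> c + C * s\<^sup>2" if s: "\<bar>s\<bar> \<le> A" for s
  proof (cases "\<bar>s\<bar> powr p \<le> c")
    case True
    then show ?thesis using C by (simp add: add_increasing2)
  next
    case False
    then have s0: "s \<noteq> 0" using c p by auto
    have "c powr (2 / p) \<le> (\<bar>s\<bar> powr p) powr (2 / p)"
      using False c p by (intro powr_mono2) auto
    also have "\<dots> = \<bar>s\<bar> powr real 2" using p by (simp add: powr_powr)
    also have "\<dots> = s\<^sup>2" using s0 by (subst powr_realpow) auto
    finally have "C * c powr (2 / p) \<le> C * s\<^sup>2" using C by (intro mult_left_mono)
    moreover have "C * c powr (2 / p) = A powr p" using c by (simp add: C_def)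
    moreover have "\<bar>s\<bar> powr p \<le> A powr p" using s p by (intro powr_mono2) auto
    ultimately show ?thesis using c by linarith
  qed
  show ?thesis
  proof (rule exI[of _ "e / (C + 1)"], rule conjI[OF _ exI[of _ "e powr (1 / p)"]]; (intro conjI allI impI)?)
    show "0 < e / (C + 1)" "0 < e powr (1 / p)" using e C by simp_all
    fix \<eta> \<rho> and \<delta> :: real
    assume ce: "continuous_on cell \<eta>" and cr: "continuous_on cell \<rho>" and bnd: "\<forall>z\<in>cell. \<bar>\<eta> z\<bar> \<le> A"
      and e2: "cint (\<lambda>z. (\<eta> z)\<^sup>2) \<le> e / (C + 1)" and \<delta>: "0 < \<delta>" "\<delta> \<le> e powr (1 / p)"
      and rp: "cint (\<lambda>z. \<bar>\<rho> z\<bar> powr p) \<le> \<delta> powr p"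
    have cpr: "continuous_on cell (\<lambda>z. \<bar>\<rho> z\<bar> powr p)" by (rule continuous_on_abs_powr) (use p cr in auto)
    have cs: "continuous_on cell (\<lambda>z. c + C * (\<eta> z)\<^sup>2)" by (intro continuous_intros ce)
    have "cint (\<lambda>z. \<bar>\<eta> z + \<rho> z\<bar> powr p) \<le> cint (\<lambda>z. 2 powr p * ((c + C * (\<eta> z)\<^sup>2) + \<bar>\<rho> z\<bar> powr p))"
    proof (rule cint_mono)
      show "continuous_on cell (\<lambda>z. \<bar>\<eta> z + \<rho> z\<bar> powr p)"
        by (rule continuous_on_abs_powr) (use p ce cr in \<open>auto intro!: continuous_intros\<close>)
      show "continuous_on cell (\<lambda>z. 2 powr p * ((c + C * (\<eta> z)\<^sup>2) + \<bar>\<rho> z\<bar> powr p))"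
        by (intro continuous_on_mult continuous_on_add continuous_on_const cs cpr continuous_on_power ce)
      fix z assume z: "z \<in> cell"
      have "\<bar>\<eta> z + \<rho> z\<bar> powr p \<le> (2 * max \<bar>\<eta> z\<bar> \<bar>\<rho> z\<bar>) powr p"
        using p by (intro powr_mono2) auto
      also have "\<dots> = 2 powr p * max \<bar>\<eta> z\<bar> \<bar>\<rho> z\<bar> powr p" by (rule powr_mult)
      also have "max \<bar>\<eta> z\<bar> \<bar>\<rho> z\<bar> powr p \<le> \<bar>\<eta> z\<bar> powr p + \<bar>\<rho> z\<bar> powr p" by (simp add: max_def)
      also have "\<dots> \<le> (c + C * (\<eta> z)\<^sup>2) + \<bar>\<rho> z\<bar> powr p" using pt bnd z by (intro add_right_mono) auto
      finally show "\<bar>\<eta> z + \<rho> z\<bar> powr p \<le> 2 powr p * ((c + C * (\<eta> z)\<^sup>2) + \<bar>\<rho> z\<bar> powr p)" by simp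
    qed
    also have "\<dots> = 2 powr p * (cint (\<lambda>z. c + C * (\<eta> z)\<^sup>2) + cint (\<lambda>z. \<bar>\<rho> z\<bar> powr p))"
      unfolding integral_mult_right by (subst cint_add[OF cs cpr]) simp
    also have "cint (\<lambda>z. c + C * (\<eta> z)\<^sup>2) = c * (L * H) + C * cint (\<lambda>z. (\<eta> z)\<^sup>2)"
      unfolding cint_const[of c, symmetric] integral_mult_right[symmetric] by (intro cint_add continuous_intros ce)
    also have "2 powr p * (c * (L * H) + C * cint (\<lambda>z. (\<eta> z)\<^sup>2) + cint (\<lambda>z. \<bar>\<rho> z\<bar> powr p)) \<le> 2 powr p * (e + e + e)"
    proof (intro mult_left_mono add_mono)
      have "C * cint (\<lambda>z. (\<eta> z)\<^sup>2) \<le> C * (e / (C + 1))" using e2 C by (intro mult_left_mono)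
      also have "\<dots> \<le> e" using e C by (simp add: pos_divide_le_eq algebra_simps)
      finally show "C * cint (\<lambda>z. (\<eta> z)\<^sup>2) \<le> e" .
      have "\<delta> powr p \<le> (e powr (1 / p)) powr p" using \<delta> p by (intro powr_mono2) auto
      also have "\<dots> = e" using p e by (simp add: powr_powr)
      finally show "cint (\<lambda>z. \<bar>\<rho> z\<bar> powr p) \<le> e" using rp by linarith
    qed (simp_all add: cLH)
    also have "\<dots> < \<epsilon> powr p" using \<epsilon> by (simp add: e_def)
    finally show "cint (\<lambda>z. \<bar>\<eta> z + \<rho> z\<bar> powr p) < \<epsilon> powr p" .
  qed
qed

text \<open>\<open>\<delta>0\<close> is fixed before the flow, which is possible because the
  constants of the fixed-time estimates depend on the channel, the profile and \<open>p\<close>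
  alone. Time enters only in the critical case, through the continuity of one coefficient.\<close>

lemma truncated_vorticity_stability:
  fixes a m \<alpha> p \<epsilon> :: real
  assumes p: "1 < p" and \<epsilon>: "0 < \<epsilon>"
    and l1: "m\<^sup>2 \<le> (2 * pi / H)\<^sup>2" and l2: "m\<^sup>2 \<le> (2 * pi / L)\<^sup>2 + (pi / H)\<^sup>2"
  defines "A \<equiv> \<bar>a\<bar> * m\<^sup>2" and "wb \<equiv> \<lambda>z::real \<times> real. a * m\<^sup>2 * sin (m * snd z + \<alpha>)"
  shows "\<exists>\<delta>0>0. \<forall>v1 v1t v1x v1y v2 v2t v2x v2y q qt qx qy w wt wx wy \<delta>.
    euler_fields L H v1 v1t v1x v1y v2 v2t v2x v2y q qt qx qy w wt wx wy \<longrightarrow> 0 < \<delta> \<longrightarrow> \<delta> \<le> \<delta>0 \<longrightarrow>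
    cint (\<lambda>z. \<bar>w (0, z) - wb z\<bar> powr p) \<le> \<delta> powr p \<longrightarrow>
    (\<forall>t. cint (\<lambda>z. (clamp_to A (w (t, z)) - wb z)\<^sup>2) \<le> \<epsilon>)"
proof -
  define K where "K = 1 + (L * H + 1) * (1 + 2 * A + 3 * A\<^sup>2 + 2 * H)"
  have A: "0 \<le> A" by (simp add: A_def)
  have LH: "0 < L * H" using L_pos H_pos by simp
  have K: "0 < K" unfolding K_def using A L_pos H_pos by (intro add_pos_nonneg mult_nonneg_nonneg add_nonneg_nonneg) auto
  have small: "\<exists>\<delta>0>0. \<forall>\<delta>. 0 < \<delta> \<longrightarrow> \<delta> \<le> \<delta>0 \<longrightarrow> K * \<delta> \<le> 1 \<and> sqrt (K * \<delta>) \<le> s" if "s > 0" for s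
  proof (intro exI[of _ "min 1 (s\<^sup>2) / K"] conjI allI impI)
    fix \<delta> assume "0 < \<delta>" and "\<delta> \<le> min 1 (s\<^sup>2) / K"
    then have "K * \<delta> \<le> min 1 (s\<^sup>2)" using K by (simp add: pos_le_divide_eq mult.commute)
    then show "K * \<delta> \<le> 1" "sqrt (K * \<delta>) \<le> s" using that by (auto intro: real_le_lsqrt)
  qed (use K that in simp)
  show ?thesis
  proof (cases "m\<^sup>2 < (2 * pi / H)\<^sup>2")
    case True
    obtain C where C: "C > 0" and est: "\<forall>f fx fy w \<theta> B d. near_state p A (m\<^sup>2) f fx fy w \<theta> (\<lambda>z. B (snd z)) d \<longrightarrow>
     continuous_on {0..H} B \<longrightarrow> cint (\<lambda>z. (\<theta> z - B (snd z))\<^sup>2) \<le> C * sqrt d"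
      using noncritical_estimate[OF p A zero_le_power2 True l2] by (elim exE conjE) (rule that)
    obtain \<delta>0 where \<delta>0: "\<delta>0 > 0" "\<forall>\<delta>. 0 < \<delta> \<longrightarrow> \<delta> \<le> \<delta>0 \<longrightarrow> K * \<delta> \<le> 1 \<and> sqrt (K * \<delta>) \<le> \<epsilon> / C"
      using small[of "\<epsilon> / C"] \<epsilon> C by auto
    show ?thesis
    proof (intro exI[of _ \<delta>0] conjI \<delta>0(1) allI impI)
      fix v1 v1t v1x v1y v2 v2t v2x v2y q qt qx qy w wt wx wy and \<delta> t :: real
      assume ef: "euler_fields L H v1 v1t v1x v1y v2 v2t v2x v2y q qt qx qy w wt wx wy"
        and \<delta>: "0 < \<delta>" "\<delta> \<le> \<delta>0" and init: "cint (\<lambda>z. \<bar>w (0, z) - wb z\<bar> powr p) \<le> \<delta> powr p"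
      interpret euler_fields L H v1 v1t v1x v1y v2 v2t v2x v2y q qt qx qy w wt wx wy by (rule ef)
      have d: "K * \<delta> \<le> 1" "sqrt (K * \<delta>) \<le> \<epsilon> / C" using \<delta>0(2) \<delta> by blast+
      obtain f fx fy where ns: "\<forall>t. near_state p A (m\<^sup>2) (f t) (fx t) (fy t) (\<lambda>z. w (t, z)) (\<lambda>z. clamp_to A (w (t, z))) wb (K * \<delta>)"
        using truncation_estimates(1)[OF p \<delta>(1) init[unfolded wb_def] d(1)[unfolded K_def A_def]]
        unfolding wb_def K_def A_def by blast
      have "cint (\<lambda>z. (clamp_to A (w (t, z)) - wb z)\<^sup>2) \<le> C * sqrt (K * \<delta>)"
        using est[rule_format, of "f t" "fx t" "fy t" "\<lambda>z. w (t, z)" "\<lambda>z. clamp_to A (w (t, z))" "\<lambda>y. a * m\<^sup>2 * sin (m * y + \<alpha>)" "K * \<delta>"] ns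
        unfolding wb_def by (simp add: continuous_intros)
      also have "\<dots> \<le> C * (\<epsilon> / C)" using d(2) C by (intro mult_left_mono) auto
      finally show "cint (\<lambda>z. (clamp_to A (w (t, z)) - wb z)\<^sup>2) \<le> \<epsilon>" using C by simp
    qed
  next
    case False
    then have "m\<^sup>2 = (2 * pi / H)\<^sup>2" using l1 by simp
    then have m: "m = 2 * pi / H \<or> m = - (2 * pi / H)" by (simp only: power2_eq_iff)
    \<comment> \<open>Addition theorem for \<open>sin (m * y + \<alpha>)\<close>; a negative
      \<open>m\<close> changes the sign of the sine part only.\<close>
    define \<beta> where "\<beta> = a * m\<^sup>2 * sin \<alpha>"
    define \<gamma> where "\<gamma> = (if m = 2 * pi / H then 1 else - 1) * (a * m\<^sup>2 * cos \<alpha>)"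
    have wb: "wb = (\<lambda>z. \<beta> * e1 z + \<gamma> * e2 z)"
    proof
      fix z
      have "cos (m * snd z) = e1 z" using m by auto
      moreover have "sin (m * snd z) = (if m = 2 * pi / H then 1 else - 1) * e2 z" using m by auto
      ultimately show "wb z = \<beta> * e1 z + \<gamma> * e2 z"
        unfolding wb_def \<beta>_def \<gamma>_def sin_add by (simp only: algebra_simps)
    qed
    obtain C where C: "C > 0" and est: "\<forall>f fx fy w \<theta> d. near_state p A (m\<^sup>2) f fx fy w \<theta> (\<lambda>z. \<beta> * e1 z + \<gamma> * e2 z) d \<longrightarrow>
     \<bar>cint (\<lambda>z. (\<theta> z)\<^sup>2) - cint (\<lambda>z. (\<beta> * e1 z + \<gamma> * e2 z)\<^sup>2)\<bar> \<le> d \<longrightarrow> \<bar>cint (\<lambda>z. \<theta> z ^ 3)\<bar> \<le> d \<longrightarrow>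
     \<bar>cint (\<lambda>z. snd z * (\<theta> z - (\<beta> * e1 z + \<gamma> * e2 z)))\<bar> \<le> d \<longrightarrow>
     \<bar>2 / (L * H) * cint (\<lambda>z. \<theta> z * e1 z) * (\<beta>\<^sup>2 - (2 / (L * H) * cint (\<lambda>z. \<theta> z * e1 z))\<^sup>2)\<bar> \<le> C * sqrt d \<and>
     cint (\<lambda>z. (\<theta> z - (\<beta> * e1 z + \<gamma> * e2 z))\<^sup>2) \<le> C * (\<bar>2 / (L * H) * cint (\<lambda>z. \<theta> z * e1 z) - \<beta>\<bar> + sqrt d)"
      using critical_estimate[OF p A zero_le_power2 l1 l2, of \<beta> \<gamma>] by (elim exE conjE) (rule that)
    have "\<epsilon> / (2 * C) > 0" using \<epsilon> C by simp
    from continuous_trapped_near_root[OF this, of \<beta>]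
    obtain e0 where e0: "e0 > 0" and trap: "\<forall>e b. e < e0 \<longrightarrow> continuous_on UNIV b \<longrightarrow> \<bar>b (0::real) - \<beta>\<bar> \<le> e \<longrightarrow>
     (\<forall>t. \<bar>b t * (\<beta>\<^sup>2 - (b t)\<^sup>2)\<bar> \<le> e) \<longrightarrow> (\<forall>t. \<bar>b t - \<beta>\<bar> < \<epsilon> / (2 * C))"
      by (elim exE conjE) (rule that)
    \<comment> \<open>The trapping argument uses one bound \<open>e\<close> both for the cubic
      relation, with constant \<open>C\<close>, and for the initial coefficient, with constant
      \<open>2 / (L * H)\<close>.\<close>
    define C2 where "C2 = C + 2 / (L * H)"
    have C2: "C2 > 0" using C LH by (simp add: C2_def add_pos_pos)
    \<comment> \<open>One half of \<open>\<epsilon>\<close> is reserved for \<open>sqrt d\<close>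
      and one half for the trapped coefficient; the second entry keeps \<open>e\<close> below
      \<open>e0\<close>.\<close>
    define s where "s = min (\<epsilon> / (2 * C)) (e0 / (2 * C2))"
    have s: "s > 0" using \<epsilon> C C2 e0 by (simp add: s_def)
    obtain \<delta>0 where \<delta>0: "\<delta>0 > 0" "\<forall>\<delta>. 0 < \<delta> \<longrightarrow> \<delta> \<le> \<delta>0 \<longrightarrow> K * \<delta> \<le> 1 \<and> sqrt (K * \<delta>) \<le> s"
      using small[OF s] by auto
    show ?thesis
    proof (intro exI[of _ \<delta>0] conjI \<delta>0(1) allI impI)
      fix v1 v1t v1x v1y v2 v2t v2x v2y q qt qx qy w wt wx wy and \<delta> t :: real
      assume ef: "euler_fields L H v1 v1t v1x v1y v2 v2t v2x v2y q qt qx qy w wt wx wy"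
        and \<delta>: "0 < \<delta>" "\<delta> \<le> \<delta>0" and init: "cint (\<lambda>z. \<bar>w (0, z) - wb z\<bar> powr p) \<le> \<delta> powr p"
      interpret euler_fields L H v1 v1t v1x v1y v2 v2t v2x v2y q qt qx qy w wt wx wy by (rule ef)
      define d where "d = K * \<delta>"
      have d: "d \<le> 1" "sqrt d \<le> s" unfolding d_def using \<delta>0(2) \<delta> by blast+
      have dpos: "0 < d" using K \<delta> by (simp add: d_def)
      note tr = truncation_estimates[OF p \<delta>(1) init[unfolded wb_def] d(1)[unfolded d_def K_def A_def]]
      have te: "\<exists>f fx fy. \<forall>t. near_state p A (m\<^sup>2) (f t) (fx t) (fy t) (\<lambda>z. w (t, z)) (\<lambda>z. clamp_to A (w (t, z))) wb d"
        "\<And>t. \<bar>cint (\<lambda>z. (clamp_to A (w (t, z)))\<^sup>2) - cint (\<lambda>z. (wb z)\<^sup>2)\<bar> \<le> d"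
        "\<And>t. \<bar>cint (\<lambda>z. clamp_to A (w (t, z)) ^ 3) - cint (\<lambda>z. wb z ^ 3)\<bar> \<le> d"
        "\<And>t. \<bar>cint (\<lambda>z. snd z * (clamp_to A (w (t, z)) - wb z))\<bar> \<le> d"
        "cint (\<lambda>z. \<bar>clamp_to A (w (0, z)) - wb z\<bar>) \<le> d"
        unfolding wb_def d_def K_def A_def by (rule tr)+
      obtain f fx fy where ns: "\<forall>t. near_state p A (m\<^sup>2) (f t) (fx t) (fy t) (\<lambda>z. w (t, z)) (\<lambda>z. clamp_to A (w (t, z))) wb d"
        using te(1) by blast
      \<comment> \<open>The coefficient of \<open>e1\<close> in the truncated vorticity, normalised
        by its squared norm. As an integral over a compact cell it is continuous in time, and at
        time 0 it is close to \<open>\<beta>\<close>.\<close>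
      define b where "b t = 2 / (L * H) * cint (\<lambda>z. clamp_to A (w (t, z)) * e1 z)" for t
      have wb3: "cint (\<lambda>z. wb z ^ 3) = 0" using cint_cubed_modes[of \<beta> \<gamma> 0 0] by (simp add: wb)
      have est': "\<bar>b t * (\<beta>\<^sup>2 - (b t)\<^sup>2)\<bar> \<le> C * sqrt d \<and> cint (\<lambda>z. (clamp_to A (w (t, z)) - wb z)\<^sup>2) \<le> C * (\<bar>b t - \<beta>\<bar> + sqrt d)" for t
        unfolding b_def wb
        by (rule est[rule_format, OF ns[rule_format, unfolded wb]])
           (use te(2-4)[of t] wb3 in \<open>simp_all only: wb diff_0_right\<close>)
      have cb: "continuous_on UNIV b"
      proof -
        have cw: "continuous_on (UNIV \<times> cell) (\<lambda>p. w p)"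
          by (rule continuous_on_subset[OF C1_fieldD(1)[OF w]]) (use cell_subset_strip in auto)
        have "continuous_on (UNIV \<times> cell) (\<lambda>p. clamp_to A (w p) * e1 (snd p))"
          using H_pos by (intro continuous_on_mult continuous_on_clamp_to cw) (auto intro!: continuous_intros)
        then have "continuous_on (UNIV \<times> cell) (\<lambda>(t, z). clamp_to A (w (t, z)) * e1 z)"
          by (simp add: case_prod_beta)
        then show ?thesis
          unfolding b_def by (intro continuous_on_mult continuous_on_const integral_continuous_on_param)
      qed
      have cbw: "continuous_on cell wb" unfolding wb by (intro continuous_on_add continuous_on_mult continuous_on_const continuous_on_modes)
      have ct: "continuous_on cell (\<lambda>z. clamp_to A (w (0, z)))"
        by (intro continuous_on_clamp_to continuous_on_cell C1_fieldD(1)[OF w])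
      have b0: "\<bar>b 0 - \<beta>\<bar> \<le> 2 / (L * H) * d"
      proof -
        have "cint (\<lambda>z. wb z * e1 z) = cint (\<lambda>z. \<beta> * (mode 1 z * mode 1 z) + \<gamma> * (mode 2 z * mode 1 z))"
          unfolding wb mode_simps by (rule cint_cong) (simp only: algebra_simps)
        also have "\<dots> = \<beta> * cint (\<lambda>z. mode 1 z * mode 1 z) + \<gamma> * cint (\<lambda>z. mode 2 z * mode 1 z)"
          unfolding integral_mult_right[symmetric] by (intro cint_add continuous_on_mult continuous_on_const continuous_on_mode)
        also have "\<dots> = \<beta> * (L * H / 2)"
          by (subst mode_orthogonal, simp, simp)+ (simp add: mode_sq_simps)
        finally have \<beta>: "\<beta> = 2 / (L * H) * cint (\<lambda>z. wb z * e1 z)" using L_pos H_pos by (simp only:) simp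
        have ce: "continuous_on cell e1" by (rule continuous_on_modes)
        have "b 0 - \<beta> = 2 / (L * H) * (cint (\<lambda>z. clamp_to A (w (0, z)) * e1 z) - cint (\<lambda>z. wb z * e1 z))"
          by (subst \<beta>) (simp only: b_def right_diff_distrib)
        also have "cint (\<lambda>z. clamp_to A (w (0, z)) * e1 z) - cint (\<lambda>z. wb z * e1 z)
           = cint (\<lambda>z. clamp_to A (w (0, z)) * e1 z - wb z * e1 z)"
          by (rule cint_diff[symmetric]) (intro continuous_on_mult ct cbw ce)+
        also have "\<dots> = cint (\<lambda>z. e1 z * (clamp_to A (w (0, z)) - wb z))"
          by (rule cint_cong) (simp add: algebra_simps)
        finally have "\<bar>b 0 - \<beta>\<bar> = 2 / (L * H) * \<bar>cint (\<lambda>z. e1 z * (clamp_to A (w (0, z)) - wb z))\<bar>"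
          using L_pos H_pos by (simp add: abs_mult)
        also have "\<dots> \<le> 2 / (L * H) * (1 * cint (\<lambda>z. \<bar>clamp_to A (w (0, z)) - wb z\<bar>))"
          using LH by (intro mult_left_mono cint_mult_bound ce continuous_on_diff ct cbw) auto
        also have "\<dots> \<le> 2 / (L * H) * d" using te(5) LH by (intro mult_left_mono) auto
        finally show ?thesis .
      qed
      have dd: "d \<le> sqrt d" using le_sqrt_of_le_1[OF dpos d(1)] .
      define e where "e = C2 * sqrt d"
      have "e \<le> C2 * (e0 / (2 * C2))" unfolding e_def using d(2) C2 by (intro mult_left_mono) (auto simp: s_def)
      also have "\<dots> < e0" using C2 e0 by simp
      finally have e: "e < e0" .
      have b0e: "\<bar>b 0 - \<beta>\<bar> \<le> e"
      proof -
        have "2 / (L * H) * d \<le> 2 / (L * H) * sqrt d" using dd LH by (intro mult_left_mono) auto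
        also have "\<dots> \<le> e" unfolding e_def C2_def using C dpos by (intro mult_right_mono) auto
        finally show ?thesis using b0 by linarith
      qed
      have bte: "\<bar>b t * (\<beta>\<^sup>2 - (b t)\<^sup>2)\<bar> \<le> e" for t
      proof -
        have "C * sqrt d \<le> e" unfolding e_def C2_def using LH dpos by (intro mult_right_mono) auto
        then show ?thesis using est'[of t] by linarith
      qed
      have "\<bar>b t - \<beta>\<bar> < \<epsilon> / (2 * C)" using trap e cb b0e bte by blast
      then have "C * (\<bar>b t - \<beta>\<bar> + sqrt d) \<le> C * (\<epsilon> / (2 * C) + \<epsilon> / (2 * C))"
        using d(2) C by (intro mult_left_mono add_mono) (auto simp: s_def)
      also have "\<dots> = \<epsilon>" using C by simp
      finally show "cint (\<lambda>z. (clamp_to A (w (t, z)) - wb z)\<^sup>2) \<le> \<epsilon>" using est'[of t] by linarith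
    qed
  qed
qed

lemma Lp_norm_vorticity:
  assumes p: "1 < p" and g: "continuous_on cell g" and fg: "\<And>z. z \<in> period_cell L H \<Longrightarrow> f z = g z"
  shows "Lp_norm L H p f = (cint (\<lambda>z. \<bar>g z\<bar> powr p)) powr (1 / p)"
  unfolding Lp_norm_def
  by (subst set_integral_period_cell[where g = "\<lambda>z. \<bar>g z\<bar> powr p"])
     (use p g fg in \<open>auto intro!: continuous_on_abs_powr\<close>)

end

lemma laplacian_shear_stream:
  "- laplacian (shear_stream a b c m \<alpha>) z = a * m\<^sup>2 * sin (m * snd z + \<alpha>)"
proof -
  have "pd1 (shear_stream a b c m \<alpha>) = (\<lambda>z. 0)"
    by (auto simp: pd1_def shear_stream_def fun_eq_iff)
  moreover have "pd2 (shear_stream a b c m \<alpha>) = (\<lambda>z. a * (m * cos (m * snd z + \<alpha>)) + b)"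
    by (auto simp: pd2_def shear_stream_def fun_eq_iff intro!: DERIV_imp_deriv derivative_eq_intros)
  moreover have "pd2 (\<lambda>z. a * (m * cos (m * snd z + \<alpha>)) + b) z = - (a * m\<^sup>2 * sin (m * snd z + \<alpha>))"
    by (auto simp: pd2_def power2_eq_square intro!: DERIV_imp_deriv derivative_eq_intros)
  moreover have "pd1 (\<lambda>z. 0) z = 0" by (simp add: pd1_def)
  ultimately show ?thesis unfolding laplacian_def by simp
qed

theorem corollary1p8:
  fixes L H p a b c m \<alpha> :: real
    and \<omega>bar :: "real \<times> real \<Rightarrow> real"
  assumes "L > 0" and "H > 0" and "1 < p"
    and "\<omega>bar = (\<lambda>x. - laplacian (shear_stream a b c m \<alpha>) x)"
    and "m\<^sup>2 \<le> first_eigenvalue L H"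
  shows "\<forall>\<epsilon>>0. \<exists>\<delta>>0. \<forall>v P. euler_flow L H v P \<longrightarrow>
           Lp_norm L H p (\<lambda>x. vorticity (v 0) x - \<omega>bar x) < \<delta> \<longrightarrow>
           (\<forall>t. Lp_norm L H p (\<lambda>x. vorticity (v t) x - \<omega>bar x) < \<epsilon>)"
proof (intro allI impI)
  fix \<epsilon> :: real assume \<epsilon>: "\<epsilon> > 0"
  interpret channel L H by unfold_locales (use assms in auto)
  define A where "A = \<bar>a\<bar> * m\<^sup>2"
  define wb where "wb = (\<lambda>z::real \<times> real. a * m\<^sup>2 * sin (m * snd z + \<alpha>))"
  have bar: "\<omega>bar = wb" unfolding assms(4) wb_def laplacian_shear_stream ..
  have A: "0 \<le> A" by (simp add: A_def)
  have wbA: "\<bar>wb z\<bar> \<le> A" for z unfolding wb_def A_def by (simp add: abs_mult mult_left_le)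
  have cwb: "continuous_on cell wb" unfolding wb_def by (intro continuous_intros)
  \<comment> \<open>Both the truncated vorticity and \<open>wb\<close> are bounded by
    \<open>A\<close>, hence their difference by \<open>2 * A\<close>.\<close>
  have "0 \<le> 2 * A" using A by simp
  from powr_small_of_square_small[OF assms(3) this \<epsilon>]
  obtain \<epsilon>1 \<delta>1 where \<epsilon>1: "\<epsilon>1 > 0" and \<delta>1: "\<delta>1 > 0"
    and small: "\<forall>\<eta> \<rho> \<delta>. continuous_on cell \<eta> \<longrightarrow> continuous_on cell \<rho> \<longrightarrow> (\<forall>z\<in>cell. \<bar>\<eta> z\<bar> \<le> 2 * A) \<longrightarrow>
     cint (\<lambda>z. (\<eta> z)\<^sup>2) \<le> \<epsilon>1 \<longrightarrow> 0 < \<delta> \<longrightarrow> \<delta> \<le> \<delta>1 \<longrightarrow> cint (\<lambda>z. \<bar>\<rho> z\<bar> powr p) \<le> \<delta> powr p \<longrightarrow>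
     cint (\<lambda>z. \<bar>\<eta> z + \<rho> z\<bar> powr p) < \<epsilon> powr p"
    by (elim exE conjE) (rule that)
  have l: "m\<^sup>2 \<le> (2 * pi / H)\<^sup>2" "m\<^sup>2 \<le> (2 * pi / L)\<^sup>2 + (pi / H)\<^sup>2"
    using first_eigenvalue_le assms(5) by linarith+
  obtain \<delta>0 where \<delta>0: "\<delta>0 > 0" and stab: "\<forall>v1 v1t v1x v1y v2 v2t v2x v2y q qt qx qy w wt wx wy \<delta>.
    euler_fields L H v1 v1t v1x v1y v2 v2t v2x v2y q qt qx qy w wt wx wy \<longrightarrow> 0 < \<delta> \<longrightarrow> \<delta> \<le> \<delta>0 \<longrightarrow>
    cint (\<lambda>z. \<bar>w (0, z) - wb z\<bar> powr p) \<le> \<delta> powr p \<longrightarrow>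
    (\<forall>t. cint (\<lambda>z. (clamp_to A (w (t, z)) - wb z)\<^sup>2) \<le> \<epsilon>1)"
  proof -
    have "\<exists>\<delta>0>0. \<forall>v1 v1t v1x v1y v2 v2t v2x v2y q qt qx qy w wt wx wy \<delta>.
    euler_fields L H v1 v1t v1x v1y v2 v2t v2x v2y q qt qx qy w wt wx wy \<longrightarrow> 0 < \<delta> \<longrightarrow> \<delta> \<le> \<delta>0 \<longrightarrow>
    cint (\<lambda>z. \<bar>w (0, z) - wb z\<bar> powr p) \<le> \<delta> powr p \<longrightarrow>
    (\<forall>t. cint (\<lambda>z. (clamp_to A (w (t, z)) - wb z)\<^sup>2) \<le> \<epsilon>1)"
      unfolding A_def wb_def by (rule truncated_vorticity_stability[OF assms(3) \<epsilon>1 l])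
    then show thesis by (elim exE conjE) (rule that)
  qed
  define K where "K = 1 + (L * H + 1) * (1 + 2 * A + 3 * A\<^sup>2 + 2 * H)"
  have K: "0 < K" unfolding K_def using A L_pos H_pos by (intro add_pos_nonneg mult_nonneg_nonneg add_nonneg_nonneg) auto
  \<comment> \<open>The bounds serve, in order, the truncation estimates, mean-square stability and
    the return to \<open>L^p\<close>.\<close>
  define \<delta> where "\<delta> = min (1 / K) (min \<delta>0 \<delta>1)"
  have \<delta>: "0 < \<delta>" "\<delta> \<le> \<delta>0" "\<delta> \<le> \<delta>1" "\<delta> \<le> 1 / K" using K \<delta>0 \<delta>1 by (auto simp: \<delta>_def)
  have K\<delta>: "K * \<delta> \<le> 1" using \<delta>(4) K by (simp add: pos_le_divide_eq mult.commute)
  show "\<exists>\<delta>>0. \<forall>v P. euler_flow L H v P \<longrightarrow>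
           Lp_norm L H p (\<lambda>x. vorticity (v 0) x - \<omega>bar x) < \<delta> \<longrightarrow>
           (\<forall>t. Lp_norm L H p (\<lambda>x. vorticity (v t) x - \<omega>bar x) < \<epsilon>)"
  proof (intro exI[of _ \<delta>] conjI \<delta>(1) allI impI)
    fix v P t
    assume ef: "euler_flow L H v P" and init: "Lp_norm L H p (\<lambda>x. vorticity (v 0) x - \<omega>bar x) < \<delta>"
    obtain v1 v1t v1x v1y v2 v2t v2x v2y q qt qx qy w wt wx wy
      where F: "euler_fields L H v1 v1t v1x v1y v2 v2t v2x v2y q qt qx qy w wt wx wy"
        and vort: "\<forall>t x y. y \<in> {0<..<H} \<longrightarrow> vorticity (v t) (x, y) = w (t, x, y)"
      using euler_flow_fields[OF ef] by (elim exE conjE) (rule that)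
    interpret euler_fields L H v1 v1t v1x v1y v2 v2t v2x v2y q qt qx qy w wt wx wy by (rule F)
    have cw: "continuous_on cell (\<lambda>z. w (t, z))" for t
      by (rule continuous_on_cell[OF C1_fieldD(1)[OF w]])
    have Lp: "Lp_norm L H p (\<lambda>x. vorticity (v t) x - \<omega>bar x) = (cint (\<lambda>z. \<bar>w (t, z) - wb z\<bar> powr p)) powr (1 / p)" for t
    proof (rule Lp_norm_vorticity[OF assms(3)])
      show "continuous_on cell (\<lambda>z. w (t, z) - wb z)" by (intro continuous_intros cw cwb)
      show "vorticity (v t) z - \<omega>bar z = w (t, z) - wb z" if "z \<in> period_cell L H" for z
        using vort that by (auto simp: period_cell_def bar)
    qed
    have nn: "0 \<le> cint (\<lambda>z. \<bar>w (t, z) - wb z\<bar> powr p)" for t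
      by (rule cint_nonneg[OF continuous_on_abs_powr]) (use assms(3) in \<open>auto intro!: continuous_intros cw cwb\<close>)
    have root: "(x powr (1 / p)) powr p = x" if "0 \<le> x" for x using that assms(3) by (simp add: powr_powr)
    have "((cint (\<lambda>z. \<bar>w (0, z) - wb z\<bar> powr p)) powr (1 / p)) powr p \<le> \<delta> powr p"
      using init assms(3) unfolding Lp by (intro powr_mono2) auto
    then have i0: "cint (\<lambda>z. \<bar>w (0, z) - wb z\<bar> powr p) \<le> \<delta> powr p" unfolding root[OF nn] .
    have "cint (\<lambda>z. (clamp_to A (w (t, z)) - wb z)\<^sup>2) \<le> \<epsilon>1"
      using stab F \<delta>(1,2) i0 by blast
    moreover have "cint (\<lambda>z. \<bar>w (t, z) - clamp_to A (w (t, z))\<bar> powr p) \<le> \<delta> powr p"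
      using truncation_estimates(6)[OF assms(3) \<delta>(1) i0[unfolded wb_def] K\<delta>[unfolded K_def A_def], of t]
      unfolding A_def .
    moreover have "\<bar>clamp_to A (w (t, z)) - wb z\<bar> \<le> 2 * A" for z
      using abs_clamp_to[OF A, of "w (t, z)"] wbA[of z] by linarith
    \<comment> \<open>The perturbation is split at the truncation: the first bracket is small in
      mean square, the second in \<open>L^p\<close>.\<close>
    ultimately have "cint (\<lambda>z. \<bar>(clamp_to A (w (t, z)) - wb z) + (w (t, z) - clamp_to A (w (t, z)))\<bar> powr p) < \<epsilon> powr p"
      using \<delta>(1,3) by (intro small[rule_format]) (auto intro!: continuous_intros cw cwb)
    then have "cint (\<lambda>z. \<bar>w (t, z) - wb z\<bar> powr p) < \<epsilon> powr p" by (simp add: algebra_simps)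
    then have "(cint (\<lambda>z. \<bar>w (t, z) - wb z\<bar> powr p)) powr (1 / p) < (\<epsilon> powr p) powr (1 / p)"
      using nn assms(3) by (intro powr_less_mono2) auto
    then show "Lp_norm L H p (\<lambda>x. vorticity (v t) x - \<omega>bar x) < \<epsilon>"
      unfolding Lp using assms(3) \<epsilon> by (simp add: powr_powr)
  qed
qed

end
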